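(* Let $A$ be an Artin algebra, $n\ge 2$ an integer, and $\mathcal X$ a full subcategory of $A\text{-mod}$. Then $\mathcal S_n(\mathcal X)$ is a resolving contravariantly finite subcategory in $T_n(A)\text{-mod}$ with $\widehat{\mathcal S_n(\mathcal X)}=T_n(A)\text{-mod}$ if and only if $\mathcal X$ is a resolving contravariantly finite subcategory in $A\text{-mod}$ with $\widehat{\mathcal X}=A\text{-mod}$.
   Context: For an Artin algebra $B$, $B\text{-mod}$ is the category of finitely generated left $B$-modules. A full subcategory $\mathcal Y$ of $B\text{-mod}$ is resolving if it contains all projective $B$-modules and is closed under extensions, kernels of epimorphisms, and direct summands. A right approximation of $M$ in $\mathcal Y$ is a morphism $f:Y\to M$ with $Y\in\mathcal Y$ such that $\operatorname{Hom}(Y',Y)\to\operatorname{Hom}(Y',M)$ is surjective for each $Y'\in\mathcal Y$; it is a right minimal approximation if moreover every endomorphism $g$ of $Y$ with $fg=f$ is an isomorphism. $\mathcal Y$ is contravariantly finite in $B\text{-mod}$ if every object of $B\text{-mod}$ admits a right minimal approximation in $\mathcal Y$. $\widehat{\mathcal Y}$ is the full subcategory of all $M\in B\text{-mod}$ for which there is an exact sequence $0\to Y_m\to\cdots\to Y_0\to M\to 0$ (for some $m\ge 0$) with all $Y_i\in\mathcal Y$. $T_n(A)$ is the algebra of upper triangular $n\times n$ matrices over $A$. $\operatorname{Mor}_n(A)$ is the category whose objects $X_{(\phi_i)}$ are sequences $X_n\xrightarrow{\phi_{n-1}}X_{n-1}\to\cdots\xrightarrow{\phi_1}X_1$ of $A$-maps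 in $A\text{-mod}$, and whose morphisms are $n$-tuples $(f_1,\dots,f_n)$ of $A$-maps commuting with the structure maps. It is identified with $T_n(A)\text{-mod}$: $X_{(\phi_i)}$ corresponds to $\bigoplus_i X_i$, where $(a_{ij})$ sends $(x_i)_i$ to the column with $i$-th entry $a_{ii}x_i+\sum_{j>i}a_{ij}\phi_i\cdots\phi_{j-1}(x_j)$. $\mathcal S_n(\mathcal X)$ is the full subcategory of $\operatorname{Mor}_n(A)$ of objects $X_{(\phi_i)}$ with all $X_i\in\mathcal X$, all $\phi_i$ monomorphisms, and all $\operatorname{Coker}\phi_i\in\mathcal X$ ($1\le i\le n-1$). *)

theory Defs
  imports "HOL-Algebra.Module" "HOL-Algebra.RingHom"
begin

section \<open>Left modules over a not necessarily commutative ring\<close>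

text \<open>The locale \<^locale>\<open>module\<close> of the library requires a commutative ring of scalars. We reuse its
  record type, whose fields for a multiplication and a unit of the module are irrelevant here.\<close>

locale left_module = B?: ring B + M?: abelian_group M
  for B :: "('b, 'c) ring_scheme" (structure) and M :: "('b, 'm, 'd) module_scheme" (structure) +
  assumes smult_closed: "a \<in> carrier B \<Longrightarrow> x \<in> carrier M \<Longrightarrow> a \<odot>\<^bsub>M\<^esub> x \<in> carrier M"
    and smult_l_distr: "a \<in> carrier B \<Longrightarrow> b \<in> carrier B \<Longrightarrow> x \<in> carrier M \<Longrightarrow>
      (a \<oplus>\<^bsub>B\<^esub> b) \<odot>\<^bsub>M\<^esub> x = a \<odot>\<^bsub>M\<^esub> x \<oplus>\<^bsub>M\<^esub> b \<odot>\<^bsub>M\<^esub> x"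
    and smult_r_distr: "a \<in> carrier B \<Longrightarrow> x \<in> carrier M \<Longrightarrow> y \<in> carrier M \<Longrightarrow>
      a \<odot>\<^bsub>M\<^esub> (x \<oplus>\<^bsub>M\<^esub> y) = a \<odot>\<^bsub>M\<^esub> x \<oplus>\<^bsub>M\<^esub> a \<odot>\<^bsub>M\<^esub> y"
    and smult_assoc: "a \<in> carrier B \<Longrightarrow> b \<in> carrier B \<Longrightarrow> x \<in> carrier M \<Longrightarrow>
      (a \<otimes>\<^bsub>B\<^esub> b) \<odot>\<^bsub>M\<^esub> x = a \<odot>\<^bsub>M\<^esub> (b \<odot>\<^bsub>M\<^esub> x)"
    and smult_one: "x \<in> carrier M \<Longrightarrow> \<one>\<^bsub>B\<^esub> \<odot>\<^bsub>M\<^esub> x = x"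

definition fg_left_module :: "('b, 'c) ring_scheme \<Rightarrow> ('b, 'm, 'd) module_scheme \<Rightarrow> bool" where
  "fg_left_module B M \<longleftrightarrow> left_module B M \<and>
     (\<exists>S. finite S \<and> S \<subseteq> carrier M \<and>
       (\<forall>x\<in>carrier M. \<exists>c\<in>S \<rightarrow> carrier B. x = (\<Oplus>\<^bsub>M\<^esub>s\<in>S. c s \<odot>\<^bsub>M\<^esub> s)))"

text \<open>Homomorphisms are represented by functions that matter only on the carrier of the domain; all
  equations between them below are accordingly stated on that carrier.\<close>

definition mod_hom ::
  "('b, 'c) ring_scheme \<Rightarrow> ('b, 'm) module \<Rightarrow> ('b, 'n) module \<Rightarrow> ('m \<Rightarrow> 'n) set" where
  "mod_hom B M N = {f \<in> carrier M \<rightarrow> carrier N.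
     (\<forall>x\<in>carrier M. \<forall>y\<in>carrier M. f (x \<oplus>\<^bsub>M\<^esub> y) = f x \<oplus>\<^bsub>N\<^esub> f y) \<and>
     (\<forall>a\<in>carrier B. \<forall>x\<in>carrier M. f (a \<odot>\<^bsub>M\<^esub> x) = a \<odot>\<^bsub>N\<^esub> f x)}"

definition mod_mono where
  "mod_mono B M N f \<longleftrightarrow> f \<in> mod_hom B M N \<and> inj_on f (carrier M)"

definition mod_epi where
  "mod_epi B M N f \<longleftrightarrow> f \<in> mod_hom B M N \<and> f ` carrier M = carrier N"

definition mod_iso where
  "mod_iso B M N f \<longleftrightarrow> f \<in> mod_hom B M N \<and> bij_betw f (carrier M) (carrier N)"

definition isomorphic_mods ::
  "('b, 'c) ring_scheme \<Rightarrow> ('b, 'm) module \<Rightarrow> ('b, 'n) module \<Rightarrow> bool" where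
  "isomorphic_mods B M N \<longleftrightarrow> (\<exists>f. mod_iso B M N f)"

definition short_exact where
  "short_exact B K L M f g \<longleftrightarrow>
     mod_mono B K L f \<and> mod_epi B L M g \<and> f ` carrier K = a_kernel L M g"

definition mod_sum :: "('b, 'm) module \<Rightarrow> ('b, 'n) module \<Rightarrow> ('b, 'm \<times> 'n) module" where
  "mod_sum M N = \<lparr>carrier = carrier M \<times> carrier N, mult = undefined, one = undefined,
     zero = (\<zero>\<^bsub>M\<^esub>, \<zero>\<^bsub>N\<^esub>),
     add = (\<lambda>(x, y) (x', y'). (x \<oplus>\<^bsub>M\<^esub> x', y \<oplus>\<^bsub>N\<^esub> y')),
     smult = (\<lambda>a (x, y). (a \<odot>\<^bsub>M\<^esub> x, a \<odot>\<^bsub>N\<^esub> y))\<rparr>"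

definition quot_module :: "('b, 'm) module \<Rightarrow> 'm set \<Rightarrow> ('b, 'm set) module" where
  "quot_module M U = \<lparr>carrier = a_rcosets\<^bsub>M\<^esub> U, mult = undefined, one = undefined,
     zero = U, add = set_add M,
     smult = (\<lambda>a V. \<Union>v\<in>V. U +>\<^bsub>M\<^esub> (a \<odot>\<^bsub>M\<^esub> v))\<rparr>"

definition coker_module :: "('b, 'm) module \<Rightarrow> ('b, 'n) module \<Rightarrow> ('m \<Rightarrow> 'n) \<Rightarrow> ('b, 'n set) module" where
  "coker_module M N f = quot_module N (f ` carrier M)"


section \<open>Artin algebras\<close>

definition artinian_cring :: "('r, 'c) ring_scheme \<Rightarrow> bool" where
  "artinian_cring R \<longleftrightarrow> cring R \<and>
     (\<forall>I :: nat \<Rightarrow> 'r set. (\<forall>k. ideal (I k) R) \<and> (\<forall>k. I (Suc k) \<subseteq> I k) \<longrightarrow>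
       (\<exists>m. \<forall>k\<ge>m. I k = I m))"

text \<open>\<open>\<iota>\<close> is the structure map of the \<open>R\<close>-algebra \<open>A\<close>; the record below is \<open>A\<close> regarded as
  an \<open>R\<close>-module through \<open>\<iota>\<close>.\<close>

definition artin_algebra ::
  "('r, 'c) ring_scheme \<Rightarrow> ('a, 'd) ring_scheme \<Rightarrow> ('r \<Rightarrow> 'a) \<Rightarrow> bool" where
  "artin_algebra R A \<iota> \<longleftrightarrow> artinian_cring R \<and> ring A \<and> \<iota> \<in> ring_hom R A \<and>
     (\<forall>r\<in>carrier R. \<forall>a\<in>carrier A. \<iota> r \<otimes>\<^bsub>A\<^esub> a = a \<otimes>\<^bsub>A\<^esub> \<iota> r) \<and>
     fg_left_module R \<lparr>carrier = carrier A, mult = mult A, one = one A, zero = zero A, add = add A,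
       smult = (\<lambda>r a. \<iota> r \<otimes>\<^bsub>A\<^esub> a)\<rparr>"


section \<open>The category of finitely generated modules and its full subcategories\<close>

text \<open>The objects of \<open>B\<close>-mod are taken with carriers inside the fixed type \<open>(nat \<Rightarrow> 'b) set\<close>, where
  \<open>'b\<close> is the type of the elements of \<open>B\<close>. This loses nothing: a finitely generated module is
  isomorphic to a quotient of some \<open>B\<^sup>k\<close>, and the elements of the quotient are sets of \<open>k\<close>-tuples;
  see \<open>fg_left_module_representative\<close> below.\<close>

type_synonym 'b fgmod = "('b, (nat \<Rightarrow> 'b) set) module"

definition fg_mods :: "('b, 'c) ring_scheme \<Rightarrow> 'b fgmod set" where
  "fg_mods B = {M. fg_left_module B M}"

lemma fg_left_module_representative:
  fixes B :: "('b, 'c) ring_scheme" and M :: "('b, 'm) module"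
  assumes M: "fg_left_module B M"
  shows "\<exists>N\<in>fg_mods B. isomorphic_mods B M N"
proof -
  interpret left_module B M using M by (simp add: fg_left_module_def)
  obtain S where S: "finite S" "S \<subseteq> carrier M"
    and gen: "\<And>x. x \<in> carrier M \<Longrightarrow> \<exists>c\<in>S \<rightarrow> carrier B. x = (\<Oplus>\<^bsub>M\<^esub>s\<in>S. c s \<odot>\<^bsub>M\<^esub> s)"
    using M unfolding fg_left_module_def by blast
  obtain e :: "'m \<Rightarrow> nat" where e: "inj_on e S"
    using finite_imp_inj_to_nat_seg[OF S(1)] by blast
  define h :: "'m \<Rightarrow> (nat \<Rightarrow> 'b) set" where
    "h x = {c. c \<circ> e \<in> S \<rightarrow> carrier B \<and> x = (\<Oplus>\<^bsub>M\<^esub>s\<in>S. c (e s) \<odot>\<^bsub>M\<^esub> s)}" for x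
  have ne: "\<exists>c. c \<in> h x" if x: "x \<in> carrier M" for x
  proof -
    obtain c where c: "c \<in> S \<rightarrow> carrier B" "x = (\<Oplus>\<^bsub>M\<^esub>s\<in>S. c s \<odot>\<^bsub>M\<^esub> s)"
      using gen[OF x] by blast
    have "(\<Oplus>\<^bsub>M\<^esub>s\<in>S. (c \<circ> inv_into S e) (e s) \<odot>\<^bsub>M\<^esub> s) = (\<Oplus>\<^bsub>M\<^esub>s\<in>S. c s \<odot>\<^bsub>M\<^esub> s)"
      using c S e by (intro M.finsum_cong') (auto intro!: smult_closed simp: Pi_iff subset_iff)
    moreover have "(c \<circ> inv_into S e) \<circ> e \<in> S \<rightarrow> carrier B" using c e by auto
    ultimately have "c \<circ> inv_into S e \<in> h x" using c(2) unfolding h_def by simp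
    then show "\<exists>c. c \<in> h x" by blast
  qed
  have inj: "inj_on h (carrier M)"
  proof (rule inj_onI)
    fix x y assume "x \<in> carrier M" "y \<in> carrier M" "h x = h y"
    then obtain c where "c \<in> h x" "c \<in> h y" using ne by metis
    then show "x = y" unfolding h_def by simp
  qed
  define k where "k = inv_into (carrier M) h"
  have kh [simp]: "k (h x) = x" if "x \<in> carrier M" for x
    using that inj by (simp add: k_def)
  define N :: "'b fgmod" where "N = \<lparr>carrier = h ` carrier M, mult = undefined, one = undefined,
     zero = h \<zero>\<^bsub>M\<^esub>, add = (\<lambda>x y. h (k x \<oplus>\<^bsub>M\<^esub> k y)), smult = (\<lambda>a x. h (a \<odot>\<^bsub>M\<^esub> k x))\<rparr>"
  have "abelian_group N"
  proof (rule abelian_groupI)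
    fix x assume "x \<in> carrier N"
    then obtain x' where x': "x' \<in> carrier M" "x = h x'" by (auto simp: N_def)
    then have "h (\<ominus>\<^bsub>M\<^esub> x') \<in> carrier N" "h (\<ominus>\<^bsub>M\<^esub> x') \<oplus>\<^bsub>N\<^esub> x = \<zero>\<^bsub>N\<^esub>"
      by (auto simp: N_def M.l_neg)
    then show "\<exists>y\<in>carrier N. y \<oplus>\<^bsub>N\<^esub> x = \<zero>\<^bsub>N\<^esub>" by blast
  qed (auto simp: N_def M.a_ac)
  then have N: "left_module B N"
    by (intro left_module.intro left_module_axioms.intro B.ring_axioms)
      (auto simp: N_def smult_closed smult_l_distr smult_r_distr smult_assoc smult_one)
  interpret N: left_module B N by (rule N)
  have sum: "h (\<Oplus>\<^bsub>M\<^esub>s\<in>T. f s) = (\<Oplus>\<^bsub>N\<^esub>s\<in>T. h (f s))" if "finite T" "f \<in> T \<rightarrow> carrier M"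
    for T :: "'m set" and f
    using that
  proof induction
    case empty
    have "h \<zero>\<^bsub>M\<^esub> = \<zero>\<^bsub>N\<^esub>" by (simp add: N_def)
    then show ?case by simp
  next
    case (insert s T)
    then have "f \<in> T \<rightarrow> carrier M" "f s \<in> carrier M" by auto
    moreover from this have "(\<lambda>s. h (f s)) \<in> T \<rightarrow> carrier N" "h (f s) \<in> carrier N"
      by (auto simp: N_def)
    moreover have "h (x \<oplus>\<^bsub>M\<^esub> y) = h x \<oplus>\<^bsub>N\<^esub> h y" if "x \<in> carrier M" "y \<in> carrier M" for x y
      using that by (simp add: N_def)
    ultimately show ?case using insert by simp
  qed
  have "\<exists>c\<in>h ` S \<rightarrow> carrier B. x = (\<Oplus>\<^bsub>N\<^esub>t\<in>h ` S. c t \<odot>\<^bsub>N\<^esub> t)" if x: "x \<in> carrier N" for x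
  proof -
    obtain x' where x': "x' \<in> carrier M" "x = h x'" using x by (auto simp: N_def)
    obtain c where c: "c \<in> S \<rightarrow> carrier B" "x' = (\<Oplus>\<^bsub>M\<^esub>s\<in>S. c s \<odot>\<^bsub>M\<^esub> s)"
      using gen[OF x'(1)] by blast
    have cs: "(\<lambda>s. c s \<odot>\<^bsub>M\<^esub> s) \<in> S \<rightarrow> carrier M" using c S by (auto intro!: smult_closed)
    have kS: "k (h s) = s" if "s \<in> S" for s using that S by auto
    have hS: "c s \<in> carrier B" "h s \<in> carrier N" if "s \<in> S" for s
      using that S c by (auto simp: N_def)
    have "x = (\<Oplus>\<^bsub>N\<^esub>s\<in>S. h (c s \<odot>\<^bsub>M\<^esub> s))"
      using x'(2) c(2) sum[OF S(1) cs] by simp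
    also have "\<dots> = (\<Oplus>\<^bsub>N\<^esub>s\<in>S. (c \<circ> k) (h s) \<odot>\<^bsub>N\<^esub> h s)"
      using cs kS hS by (intro N.finsum_cong') (auto simp: Pi_iff intro!: N.smult_closed, auto simp: N_def)
    also have "\<dots> = (\<Oplus>\<^bsub>N\<^esub>t\<in>h ` S. (c \<circ> k) t \<odot>\<^bsub>N\<^esub> t)"
      using inj S kS hS by (subst N.finsum_reindex) (auto intro!: N.smult_closed intro: inj_on_subset)
    finally show ?thesis using c kS by (intro bexI[of _ "c \<circ> k"]) auto
  qed
  moreover have "finite (h ` S)" "h ` S \<subseteq> carrier N" using S by (auto simp: N_def)
  ultimately have "N \<in> fg_mods B" using N unfolding fg_mods_def fg_left_module_def by blast
  moreover have "mod_iso B M N h"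
    using inj by (auto simp: mod_iso_def mod_hom_def bij_betw_def N_def)
  ultimately show ?thesis unfolding isomorphic_mods_def by blast
qed

text \<open>Full subcategories are closed under isomorphisms, as is usual in representation theory.\<close>

definition full_subcategory :: "('b, 'c) ring_scheme \<Rightarrow> 'b fgmod set \<Rightarrow> bool" where
  "full_subcategory B \<Y> \<longleftrightarrow> \<Y> \<subseteq> fg_mods B \<and>
     (\<forall>M\<in>\<Y>. \<forall>N\<in>fg_mods B. isomorphic_mods B M N \<longrightarrow> N \<in> \<Y>)"

definition projective :: "('b, 'c) ring_scheme \<Rightarrow> 'b fgmod \<Rightarrow> bool" where
  "projective B P \<longleftrightarrow> P \<in> fg_mods B \<and>
     (\<forall>M\<in>fg_mods B. \<forall>N\<in>fg_mods B. \<forall>g h. mod_epi B M N g \<and> h \<in> mod_hom B P N \<longrightarrow>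
       (\<exists>h'\<in>mod_hom B P M. \<forall>x\<in>carrier P. g (h' x) = h x))"

definition resolving :: "('b, 'c) ring_scheme \<Rightarrow> 'b fgmod set \<Rightarrow> bool" where
  "resolving B \<Y> \<longleftrightarrow> full_subcategory B \<Y> \<and>
     (\<forall>P. projective B P \<longrightarrow> P \<in> \<Y>) \<and>
     (\<forall>K\<in>\<Y>. \<forall>L\<in>fg_mods B. \<forall>M\<in>\<Y>. \<forall>f g. short_exact B K L M f g \<longrightarrow> L \<in> \<Y>) \<and>
     (\<forall>K\<in>fg_mods B. \<forall>L\<in>\<Y>. \<forall>M\<in>\<Y>. \<forall>f g. short_exact B K L M f g \<longrightarrow> K \<in> \<Y>) \<and>
     (\<forall>K\<in>fg_mods B. \<forall>N\<in>fg_mods B. \<forall>L\<in>\<Y>. isomorphic_mods B L (mod_sum K N) \<longrightarrow> K \<in> \<Y>)"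

definition right_approximation ::
  "('b, 'c) ring_scheme \<Rightarrow> 'b fgmod set \<Rightarrow> 'b fgmod \<Rightarrow> 'b fgmod \<Rightarrow>
    ((nat \<Rightarrow> 'b) set \<Rightarrow> (nat \<Rightarrow> 'b) set) \<Rightarrow> bool" where
  "right_approximation B \<Y> Y M f \<longleftrightarrow> Y \<in> \<Y> \<and> f \<in> mod_hom B Y M \<and>
     (\<forall>Y'\<in>\<Y>. \<forall>h\<in>mod_hom B Y' M. \<exists>h'\<in>mod_hom B Y' Y. \<forall>x\<in>carrier Y'. f (h' x) = h x)"

definition right_minimal_approximation ::
  "('b, 'c) ring_scheme \<Rightarrow> 'b fgmod set \<Rightarrow> 'b fgmod \<Rightarrow> 'b fgmod \<Rightarrow>
    ((nat \<Rightarrow> 'b) set \<Rightarrow> (nat \<Rightarrow> 'b) set) \<Rightarrow> bool" where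
  "right_minimal_approximation B \<Y> Y M f \<longleftrightarrow> right_approximation B \<Y> Y M f \<and>
     (\<forall>g\<in>mod_hom B Y Y. (\<forall>x\<in>carrier Y. f (g x) = f x) \<longrightarrow> mod_iso B Y Y g)"

definition contravariantly_finite :: "('b, 'c) ring_scheme \<Rightarrow> 'b fgmod set \<Rightarrow> bool" where
  "contravariantly_finite B \<Y> \<longleftrightarrow>
     (\<forall>M\<in>fg_mods B. \<exists>Y f. right_minimal_approximation B \<Y> Y M f)"

text \<open>The exact sequence has the maps \<open>d 0 : Y 0 \<rightarrow> M\<close> and \<open>d (Suc i) : Y (Suc i) \<rightarrow> Y i\<close> for
  \<open>i < m\<close>.\<close>

definition resolution_hat :: "('b, 'c) ring_scheme \<Rightarrow> 'b fgmod set \<Rightarrow> 'b fgmod set" where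
  "resolution_hat B \<Y> = {M \<in> fg_mods B. \<exists>m Y d.
     (\<forall>i\<le>m. Y i \<in> \<Y>) \<and>
     mod_epi B (Y 0) M (d 0) \<and>
     (\<forall>i<m. d (Suc i) \<in> mod_hom B (Y (Suc i)) (Y i)) \<and>
     (\<forall>i<m. d (Suc i) ` carrier (Y (Suc i)) =
        a_kernel (Y i) (case i of 0 \<Rightarrow> M | Suc j \<Rightarrow> Y j) (d i)) \<and>
     inj_on (d m) (carrier (Y m))}"


section \<open>Upper triangular matrices\<close>

text \<open>Rows and columns are indexed by \<open>1, \<dots>, n\<close>; all other entries are \<open>0\<close>.\<close>

definition upper_tri :: "nat \<Rightarrow> ('a, 'c) ring_scheme \<Rightarrow> (nat \<Rightarrow> nat \<Rightarrow> 'a) ring" where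
  "upper_tri n A =
     \<lparr>carrier = {a. (\<forall>i j. a i j \<in> carrier A) \<and>
        (\<forall>i j. \<not> (1 \<le> i \<and> i \<le> j \<and> j \<le> n) \<longrightarrow> a i j = \<zero>\<^bsub>A\<^esub>)},
      mult = (\<lambda>a b i j. \<Oplus>\<^bsub>A\<^esub>k\<in>{1..n}. a i k \<otimes>\<^bsub>A\<^esub> b k j),
      one = (\<lambda>i j. if i = j \<and> 1 \<le> i \<and> i \<le> n then \<one>\<^bsub>A\<^esub> else \<zero>\<^bsub>A\<^esub>),
      zero = (\<lambda>i j. \<zero>\<^bsub>A\<^esub>),
      add = (\<lambda>a b i j. a i j \<oplus>\<^bsub>A\<^esub> b i j)\<rparr>"


section \<open>Sequences of modules and monic representations\<close>

definition Mor_objects ::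
  "nat \<Rightarrow> ('a, 'c) ring_scheme \<Rightarrow>
    ((nat \<Rightarrow> 'a fgmod) \<times> (nat \<Rightarrow> (nat \<Rightarrow> 'a) set \<Rightarrow> (nat \<Rightarrow> 'a) set)) set" where
  "Mor_objects n A = {(X, \<phi>). (\<forall>i\<in>{1..n}. X i \<in> fg_mods A) \<and>
     (\<forall>i\<in>{1..<n}. \<phi> i \<in> mod_hom A (X (Suc i)) (X i))}"

text \<open>The module over the upper triangular matrices corresponding to an object of \<open>Mor\<^sub>n(A)\<close>. Note
  that \<open>foldr \<phi> [i..<j]\<close> is the composite \<open>\<phi> i \<circ> \<dots> \<circ> \<phi> (j - 1)\<close> from \<open>X j\<close> to \<open>X i\<close>.\<close>

definition tri_module ::
  "nat \<Rightarrow> (nat \<Rightarrow> ('a, 'm) module) \<Rightarrow> (nat \<Rightarrow> 'm \<Rightarrow> 'm) \<Rightarrow> (nat \<Rightarrow> nat \<Rightarrow> 'a, nat \<Rightarrow> 'm) module" where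
  "tri_module n X \<phi> =
     \<lparr>carrier = (\<Pi>\<^sub>E i\<in>{1..n}. carrier (X i)), mult = undefined, one = undefined,
      zero = (\<lambda>i\<in>{1..n}. \<zero>\<^bsub>X i\<^esub>),
      add = (\<lambda>x y. \<lambda>i\<in>{1..n}. x i \<oplus>\<^bsub>X i\<^esub> y i),
      smult = (\<lambda>a x. \<lambda>i\<in>{1..n}. a i i \<odot>\<^bsub>X i\<^esub> x i \<oplus>\<^bsub>X i\<^esub>
        (\<Oplus>\<^bsub>X i\<^esub>j\<in>{i<..n}. a i j \<odot>\<^bsub>X i\<^esub> foldr \<phi> [i..<j] (x j)))\<rparr>"

text \<open>A cokernel is a module of cosets, so that for it to lie in \<open>\<X>\<close> means to be isomorphic to an
  object of \<open>\<X>\<close>.\<close>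

definition mono_rep_objects ::
  "nat \<Rightarrow> ('a, 'c) ring_scheme \<Rightarrow> 'a fgmod set \<Rightarrow>
    ((nat \<Rightarrow> 'a fgmod) \<times> (nat \<Rightarrow> (nat \<Rightarrow> 'a) set \<Rightarrow> (nat \<Rightarrow> 'a) set)) set" where
  "mono_rep_objects n A \<X> = {(X, \<phi>) \<in> Mor_objects n A.
     (\<forall>i\<in>{1..n}. X i \<in> \<X>) \<and>
     (\<forall>i\<in>{1..<n}. mod_mono A (X (Suc i)) (X i) (\<phi> i)) \<and>
     (\<forall>i\<in>{1..<n}. \<exists>C\<in>\<X>. isomorphic_mods A C (coker_module (X (Suc i)) (X i) (\<phi> i)))}"

text \<open>\<open>S\<^sub>n(\<X>)\<close> as a full subcategory of the modules over the upper triangular matrices, under the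
  identification of these modules with \<open>Mor\<^sub>n(A)\<close>.\<close>

definition mono_rep_cat ::
  "nat \<Rightarrow> ('a, 'c) ring_scheme \<Rightarrow> 'a fgmod set \<Rightarrow> (nat \<Rightarrow> nat \<Rightarrow> 'a) fgmod set" where
  "mono_rep_cat n A \<X> = {M \<in> fg_mods (upper_tri n A).
     \<exists>(X, \<phi>)\<in>mono_rep_objects n A \<X>. isomorphic_mods (upper_tri n A) M (tri_module n X \<phi>)}"

end

(* A module over an Artin algebra is finitely generated iff it satisfies the descending chain condition.
   This gives length arguments, enough injectives, and Fitting's lemma, by which a right approximation in
   a resolving subcategory can be made minimal.  If it is resolving, a representation X lies in S_n iff every composite
   X_i -> X_1 is monic and, for every k, the cokernel C_k of X_(k+1) -> X_1 lies in the subcategory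
   (C_n = X_1).  To approximate M, first make the composites monic, by pullbacks along embeddings of the
   components into injective modules; then replace C_1, ..., C_n in turn by approximations, by pullbacks
   along the right adjoints of the C_k.  Dimension shifting bounds the resolution dimension of a
   representation in terms of those of its components and cokernels.  Conversely, A-mod embeds as the
   representations concentrated in the first component.  The embedding is exact, preserves and reflects
   membership, is right adjoint to C_1, and has X -> X_1 as its right adjoint. *)
theory Submission
  imports Defs
begin

text \<open>Membership in a subcategory is declared only for modules with carriers in one fixed
  type, whereas kernels, pullbacks, components and \<open>F M\<close> have other carriers; so every
  closure property is restated for \<open>in_cat\<close>, membership up to isomorphism. Modules over
  \<open>T\<close> are handled without unpacking them into sequences: the Peirce pieces
  \<open>comp i M\<close> are the components and the matrix units \<open>u i j\<close> act as the
  structure maps. The cokernels over X_1 replace those of consecutive maps because each has a simple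
  right adjoint, the columns with k equal rows, along which one pullback repairs one cokernel. The
  order of the repairs is forced. The cokernel functors are exact only on sequences whose quotient
  has monic composites, and repairing C_k preserves these and the earlier cokernels, but changes the
  later ones. The approximation uses no closure property of S_n. It therefore comes first, and a
  projective lies in S_n as a retract of its approximation. The kernel of an approximation has monic
  composites even if the module does not, so the dimension count starts there. Finiteness over
  \<open>A\<close> and over \<open>T\<close> is compared through chain conditions over
  \<open>R\<close>.\<close>

context left_module begin

section \<open>Elementary rules for left modules\<close>

lemma smult_r_null [simp]: "a \<in> carrier B \<Longrightarrow> a \<odot>\<^bsub>M\<^esub> \<zero>\<^bsub>M\<^esub> = \<zero>\<^bsub>M\<^esub>"
  by (metis M.add.r_cancel_one' M.r_zero M.zero_closed smult_closed smult_r_distr)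

lemma smult_l_null [simp]: "x \<in> carrier M \<Longrightarrow> \<zero>\<^bsub>B\<^esub> \<odot>\<^bsub>M\<^esub> x = \<zero>\<^bsub>M\<^esub>"
  by (metis B.r_zero B.zero_closed M.add.r_cancel_one' smult_closed smult_l_distr)

lemma smult_minus_one: "x \<in> carrier M \<Longrightarrow> (\<ominus>\<^bsub>B\<^esub> \<one>\<^bsub>B\<^esub>) \<odot>\<^bsub>M\<^esub> x = \<ominus>\<^bsub>M\<^esub> x"
  by (metis B.l_neg B.one_closed B.a_inv_closed M.minus_equality smult_closed smult_l_distr
      smult_l_null smult_one)

lemma smult_r_minus: "a \<in> carrier B \<Longrightarrow> x \<in> carrier M \<Longrightarrow> a \<odot>\<^bsub>M\<^esub> (\<ominus>\<^bsub>M\<^esub> x) = \<ominus>\<^bsub>M\<^esub> (a \<odot>\<^bsub>M\<^esub> x)"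
  by (metis M.l_neg M.a_inv_closed M.minus_equality smult_closed smult_r_distr smult_r_null)

end

lemma left_moduleI:
  assumes "ring B" "abelian_group M"
    and "\<And>a x. a \<in> carrier B \<Longrightarrow> x \<in> carrier M \<Longrightarrow> a \<odot>\<^bsub>M\<^esub> x \<in> carrier M"
    and "\<And>a b x. a \<in> carrier B \<Longrightarrow> b \<in> carrier B \<Longrightarrow> x \<in> carrier M \<Longrightarrow>
      (a \<oplus>\<^bsub>B\<^esub> b) \<odot>\<^bsub>M\<^esub> x = a \<odot>\<^bsub>M\<^esub> x \<oplus>\<^bsub>M\<^esub> b \<odot>\<^bsub>M\<^esub> x"
    and "\<And>a x y. a \<in> carrier B \<Longrightarrow> x \<in> carrier M \<Longrightarrow> y \<in> carrier M \<Longrightarrow>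
      a \<odot>\<^bsub>M\<^esub> (x \<oplus>\<^bsub>M\<^esub> y) = a \<odot>\<^bsub>M\<^esub> x \<oplus>\<^bsub>M\<^esub> a \<odot>\<^bsub>M\<^esub> y"
    and "\<And>a b x. a \<in> carrier B \<Longrightarrow> b \<in> carrier B \<Longrightarrow> x \<in> carrier M \<Longrightarrow>
      (a \<otimes>\<^bsub>B\<^esub> b) \<odot>\<^bsub>M\<^esub> x = a \<odot>\<^bsub>M\<^esub> (b \<odot>\<^bsub>M\<^esub> x)"
    and "\<And>x. x \<in> carrier M \<Longrightarrow> \<one>\<^bsub>B\<^esub> \<odot>\<^bsub>M\<^esub> x = x"
  shows "left_module B M"
  using assms by (intro left_module.intro left_module_axioms.intro)

lemma fg_modsD [dest]: "M \<in> fg_mods B \<Longrightarrow> fg_left_module B M"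
  by (simp add: fg_mods_def)

lemma fg_left_moduleD [dest]: "fg_left_module B M \<Longrightarrow> left_module B M"
  by (simp add: fg_left_module_def)

lemma fg_mods_left_module: "M \<in> fg_mods B \<Longrightarrow> left_module B M"
  by auto

section \<open>Homomorphisms\<close>

lemma mod_homI:
  assumes "\<And>x. x \<in> carrier M \<Longrightarrow> f x \<in> carrier N"
    and "\<And>x y. x \<in> carrier M \<Longrightarrow> y \<in> carrier M \<Longrightarrow> f (x \<oplus>\<^bsub>M\<^esub> y) = f x \<oplus>\<^bsub>N\<^esub> f y"
    and "\<And>a x. a \<in> carrier B \<Longrightarrow> x \<in> carrier M \<Longrightarrow> f (a \<odot>\<^bsub>M\<^esub> x) = a \<odot>\<^bsub>N\<^esub> f x"
  shows "f \<in> mod_hom B M N"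
  using assms unfolding mod_hom_def by auto

lemma hom_closed: "f \<in> mod_hom B M N \<Longrightarrow> x \<in> carrier M \<Longrightarrow> f x \<in> carrier N"
  and hom_add: "f \<in> mod_hom B M N \<Longrightarrow> x \<in> carrier M \<Longrightarrow> y \<in> carrier M \<Longrightarrow>
    f (x \<oplus>\<^bsub>M\<^esub> y) = f x \<oplus>\<^bsub>N\<^esub> f y"
  and hom_smult: "f \<in> mod_hom B M N \<Longrightarrow> a \<in> carrier B \<Longrightarrow> x \<in> carrier M \<Longrightarrow>
    f (a \<odot>\<^bsub>M\<^esub> x) = a \<odot>\<^bsub>N\<^esub> f x"
  by (auto simp: mod_hom_def)

text \<open>Preservation of zero is no part of \<open>mod_hom\<close>; it comes from scaling by the
  zero of the ring.\<close>

lemma hom_zero: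
  assumes "f \<in> mod_hom B M N" "left_module B M" "left_module B N"
  shows "f \<zero>\<^bsub>M\<^esub> = \<zero>\<^bsub>N\<^esub>"
proof -
  interpret M: left_module B M by fact
  interpret N: left_module B N by fact
  have "f (\<zero>\<^bsub>B\<^esub> \<odot>\<^bsub>M\<^esub> \<zero>\<^bsub>M\<^esub>) = \<zero>\<^bsub>B\<^esub> \<odot>\<^bsub>N\<^esub> f \<zero>\<^bsub>M\<^esub>"
    using assms(1) by (intro hom_smult) auto
  then show ?thesis using hom_closed[OF assms(1), of "\<zero>\<^bsub>M\<^esub>"] by simp
qed

lemma hom_minus:
  assumes "f \<in> mod_hom B M N" "left_module B M" "left_module B N" "x \<in> carrier M"
  shows "f (\<ominus>\<^bsub>M\<^esub> x) = \<ominus>\<^bsub>N\<^esub> f x"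
proof -
  interpret M: left_module B M by fact
  interpret N: left_module B N by fact
  have "f ((\<ominus>\<^bsub>B\<^esub> \<one>\<^bsub>B\<^esub>) \<odot>\<^bsub>M\<^esub> x) = (\<ominus>\<^bsub>B\<^esub> \<one>\<^bsub>B\<^esub>) \<odot>\<^bsub>N\<^esub> f x"
    using assms by (intro hom_smult) auto
  then show ?thesis using hom_closed[OF assms(1)] assms(4) by (simp add: M.smult_minus_one N.smult_minus_one)
qed

lemma hom_diff:
  assumes "f \<in> mod_hom B M N" "left_module B M" "left_module B N" "x \<in> carrier M" "y \<in> carrier M"
  shows "f (x \<ominus>\<^bsub>M\<^esub> y) = f x \<ominus>\<^bsub>N\<^esub> f y"
proof -
  interpret M: left_module B M by fact
  show ?thesis using assms by (simp add: a_minus_def hom_add[OF assms(1)] hom_minus[OF assms(1-3)])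
qed

lemma (in abelian_group) diff_zero_iff:
  "x \<in> carrier G \<Longrightarrow> y \<in> carrier G \<Longrightarrow> x \<ominus> y = \<zero> \<longleftrightarrow> x = y"
  by (metis a_minus_def add.inv_closed add.inv_equality minus_equality minus_minus r_neg)

lemma (in abelian_group) add_diff_cancel_left:
  "x \<in> carrier G \<Longrightarrow> y \<in> carrier G \<Longrightarrow> (x \<oplus> y) \<ominus> x = y"
  by (metis a_closed a_comm a_inv_closed a_minus_def r_neg1)

lemma hom_eq_iff_diff:
  assumes "f \<in> mod_hom B M N" "left_module B M" "left_module B N" "x \<in> carrier M" "y \<in> carrier M"
  shows "f x = f y \<longleftrightarrow> f (x \<ominus>\<^bsub>M\<^esub> y) = \<zero>\<^bsub>N\<^esub>"
proof -
  interpret N: left_module B N by fact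
  show ?thesis using hom_diff[OF assms] hom_closed[OF assms(1)] assms(4,5) N.diff_zero_iff by metis
qed

lemma hom_inj_iff:
  assumes "f \<in> mod_hom B M N" "left_module B M" "left_module B N"
  shows "inj_on f (carrier M) \<longleftrightarrow> (\<forall>x\<in>carrier M. f x = \<zero>\<^bsub>N\<^esub> \<longrightarrow> x = \<zero>\<^bsub>M\<^esub>)"
proof -
  interpret M: left_module B M by fact
  show ?thesis
  proof
    assume "inj_on f (carrier M)"
    then show "\<forall>x\<in>carrier M. f x = \<zero>\<^bsub>N\<^esub> \<longrightarrow> x = \<zero>\<^bsub>M\<^esub>"
      using hom_zero[OF assms] by (metis M.zero_closed inj_onD)
  next
    assume *: "\<forall>x\<in>carrier M. f x = \<zero>\<^bsub>N\<^esub> \<longrightarrow> x = \<zero>\<^bsub>M\<^esub>"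
    show "inj_on f (carrier M)"
    proof (rule inj_onI)
      fix x y assume xy: "x \<in> carrier M" "y \<in> carrier M" "f x = f y"
      then have "x \<ominus>\<^bsub>M\<^esub> y = \<zero>\<^bsub>M\<^esub>" using * hom_eq_iff_diff[OF assms] by simp
      then show "x = y" using xy M.diff_zero_iff by simp
    qed
  qed
qed

lemma hom_comp:
  "f \<in> mod_hom B M N \<Longrightarrow> g \<in> mod_hom B N P \<Longrightarrow> (\<lambda>x. g (f x)) \<in> mod_hom B M P"
  by (auto simp: mod_hom_def Pi_iff)

lemma hom_id: "(\<lambda>x. x) \<in> mod_hom B M M"
  by (auto simp: mod_hom_def)

lemma hom_pow: "f \<in> mod_hom B M M \<Longrightarrow> f ^^ k \<in> mod_hom B M M"
proof (induction k)
  case 0 then show ?case using hom_id by (simp add: id_def)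
next
  case (Suc k) then show ?case using hom_comp[OF Suc(1)[OF Suc(2)] Suc(2)] by (simp add: comp_def)
qed

lemma zero_hom:
  assumes "left_module B N" shows "(\<lambda>x. \<zero>\<^bsub>N\<^esub>) \<in> mod_hom B M N"
proof -
  interpret N: left_module B N by fact
  show ?thesis by (rule mod_homI) auto
qed

lemma diff_hom:
  assumes "f \<in> mod_hom B M N" "g \<in> mod_hom B M N" "left_module B M" "left_module B N"
  shows "(\<lambda>x. f x \<ominus>\<^bsub>N\<^esub> g x) \<in> mod_hom B M N"
proof -
  interpret M: left_module B M by fact
  interpret N: left_module B N by fact
  note c = hom_closed[OF assms(1)] hom_closed[OF assms(2)]
  show ?thesis
    by (rule mod_homI) (auto simp: c hom_add[OF assms(1)] hom_add[OF assms(2)] hom_smult[OF assms(1)]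
        hom_smult[OF assms(2)] N.smult_r_distr N.smult_r_minus a_minus_def N.a_ac N.minus_add)
qed

lemma mod_isoD:
  assumes "mod_iso B M N f"
  shows "f \<in> mod_hom B M N" "inj_on f (carrier M)" "f ` carrier M = carrier N"
  using assms by (auto simp: mod_iso_def bij_betw_def)

lemma mod_isoI:
  "f \<in> mod_hom B M N \<Longrightarrow> inj_on f (carrier M) \<Longrightarrow> carrier N \<subseteq> f ` carrier M \<Longrightarrow> mod_iso B M N f"
  by (auto simp: mod_iso_def bij_betw_def dest: hom_closed)

lemma mod_monoI: "f \<in> mod_hom B M N \<Longrightarrow> left_module B M \<Longrightarrow> left_module B N \<Longrightarrow>
   (\<And>x. x \<in> carrier M \<Longrightarrow> f x = \<zero>\<^bsub>N\<^esub> \<Longrightarrow> x = \<zero>\<^bsub>M\<^esub>) \<Longrightarrow> mod_mono B M N f"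
  using hom_inj_iff by (metis mod_mono_def)

lemma mod_monoD: "mod_mono B M N f \<Longrightarrow> f \<in> mod_hom B M N" "mod_mono B M N f \<Longrightarrow> inj_on f (carrier M)"
  by (auto simp: mod_mono_def)

lemma mod_epiI: "f \<in> mod_hom B M N \<Longrightarrow> (\<And>y. y \<in> carrier N \<Longrightarrow> \<exists>x\<in>carrier M. y = f x) \<Longrightarrow> mod_epi B M N f"
  by (auto simp: mod_epi_def dest: hom_closed)

lemma mod_epiD: "mod_epi B M N f \<Longrightarrow> f \<in> mod_hom B M N" "mod_epi B M N f \<Longrightarrow> f ` carrier M = carrier N"
  by (auto simp: mod_epi_def)

lemma mod_epi_surj: "mod_epi B M N f \<Longrightarrow> y \<in> carrier N \<Longrightarrow> \<exists>x\<in>carrier M. f x = y"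
  unfolding mod_epi_def by (metis imageE)

lemma mod_epi_comp: "mod_epi B M N f \<Longrightarrow> mod_epi B N P g \<Longrightarrow> mod_epi B M P (\<lambda>x. g (f x))"
  unfolding mod_epi_def using hom_comp by (metis (mono_tags, lifting) image_image)

lemma mod_iso_epi: "mod_iso B M N f \<Longrightarrow> mod_epi B M N f"
  by (auto simp: mod_epi_def mod_iso_def bij_betw_def)

lemma mod_iso_mono: "mod_iso B M N f \<Longrightarrow> mod_mono B M N f"
  by (auto simp: mod_mono_def mod_iso_def bij_betw_def)

lemma mod_iso_inv:
  assumes f: "mod_iso B M N f" and M: "left_module B M"
  shows "\<exists>g. mod_iso B N M g \<and> (\<forall>x\<in>carrier M. g (f x) = x) \<and> (\<forall>y\<in>carrier N. f (g y) = y)"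
proof -
  interpret M: left_module B M by fact
  note f' = mod_isoD[OF f]
  let ?g = "inv_into (carrier M) f"
  have gf: "?g (f x) = x" if "x \<in> carrier M" for x using that f'(2) by simp
  have fg: "f (?g y) = y" if "y \<in> carrier N" for y using that f'(3) by (metis f_inv_into_f)
  have gc: "?g y \<in> carrier M" if "y \<in> carrier N" for y using that f'(3) by (metis inv_into_into)
  have "?g \<in> mod_hom B N M"
  proof (rule mod_homI)
    show "?g (x \<oplus>\<^bsub>N\<^esub> y) = ?g x \<oplus>\<^bsub>M\<^esub> ?g y" if "x \<in> carrier N" "y \<in> carrier N" for x y
      using hom_add[OF f'(1), of "?g x" "?g y"] that fg gc gf by (metis M.a_closed)
    show "?g (a \<odot>\<^bsub>N\<^esub> x) = a \<odot>\<^bsub>M\<^esub> ?g x" if "a \<in> carrier B" "x \<in> carrier N" for a x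
      using hom_smult[OF f'(1), of a "?g x"] that fg gc gf by (metis M.smult_closed)
  qed (use gc in auto)
  moreover have "inj_on ?g (carrier N)" using fg by (metis inj_onI)
  moreover have "carrier M \<subseteq> ?g ` carrier N" using gf f'(3) by force
  ultimately show ?thesis using mod_isoI gf fg by blast
qed

lemma isomorphic_mods_sym:
  "isomorphic_mods B M N \<Longrightarrow> left_module B M \<Longrightarrow> isomorphic_mods B N M"
  unfolding isomorphic_mods_def using mod_iso_inv by blast

lemma mod_iso_comp: "mod_iso B M N f \<Longrightarrow> mod_iso B N P g \<Longrightarrow> mod_iso B M P (\<lambda>x. g (f x))"
  unfolding mod_iso_def using hom_comp bij_betw_trans by (fastforce simp: comp_def)

lemma isomorphic_mods_trans:
  "isomorphic_mods B M N \<Longrightarrow> isomorphic_mods B N P \<Longrightarrow> isomorphic_mods B M P"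
  unfolding isomorphic_mods_def using mod_iso_comp by blast

lemma isomorphic_mods_refl: "isomorphic_mods B M M"
  unfolding isomorphic_mods_def mod_iso_def using hom_id by (intro exI[of _ "\<lambda>x. x"]) (auto simp: bij_betw_def)

text \<open>A surjective image of a module is a module; the zero of the image has to be assumed to be
  the image of zero, since homomorphisms do not see the zero of the record.\<close>

lemma left_module_image:
  assumes M: "left_module B M" and h: "h \<in> mod_hom B M N" and s: "h ` carrier M = carrier N"
    and z: "h \<zero>\<^bsub>M\<^esub> = \<zero>\<^bsub>N\<^esub>"
  shows "left_module B N"
proof -
  interpret M: left_module B M by fact
  note H = hom_add[OF h, symmetric] hom_smult[OF h, symmetric]
  have c: "\<exists>x'\<in>carrier M. x = h x'" if "x \<in> carrier N" for x using that s by auto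
  have *: "abelian_group N"
  proof (rule abelian_groupI)
    fix x y z assume "x \<in> carrier N" "y \<in> carrier N" "z \<in> carrier N"
    then obtain x' y' z' where "x' \<in> carrier M" "x = h x'" "y' \<in> carrier M" "y = h y'" "z' \<in> carrier M" "z = h z'"
      using c by meson
    then show "x \<oplus>\<^bsub>N\<^esub> y \<oplus>\<^bsub>N\<^esub> z = x \<oplus>\<^bsub>N\<^esub> (y \<oplus>\<^bsub>N\<^esub> z)"
      by (simp add: H M.a_assoc)
  next
    fix x assume "x \<in> carrier N"
    then obtain x' where x: "x' \<in> carrier M" "x = h x'" using c by meson
    have "h (\<ominus>\<^bsub>M\<^esub> x') \<oplus>\<^bsub>N\<^esub> x = \<zero>\<^bsub>N\<^esub>" using x z by (simp add: H M.l_neg)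
    then show "\<exists>y\<in>carrier N. y \<oplus>\<^bsub>N\<^esub> x = \<zero>\<^bsub>N\<^esub>" using x hom_closed[OF h] by blast
  next
    fix x assume "x \<in> carrier N"
    then obtain x' where x: "x' \<in> carrier M" "x = h x'" using c by meson
    then show "\<zero>\<^bsub>N\<^esub> \<oplus>\<^bsub>N\<^esub> x = x" by (simp add: H z[symmetric])
  next
    show "\<zero>\<^bsub>N\<^esub> \<in> carrier N" using hom_closed[OF h] z by (metis M.zero_closed)
  next
    fix x y assume "x \<in> carrier N" "y \<in> carrier N"
    then obtain x' y' where xy: "x' \<in> carrier M" "x = h x'" "y' \<in> carrier M" "y = h y'"
      using c by meson
    show "x \<oplus>\<^bsub>N\<^esub> y \<in> carrier N" using xy hom_closed[OF h] by (simp add: H)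
    show "x \<oplus>\<^bsub>N\<^esub> y = y \<oplus>\<^bsub>N\<^esub> x" using xy by (simp add: H M.a_comm)
  qed
  show ?thesis
  proof (rule left_moduleI[OF M.B.ring_axioms *])
    fix a x assume a: "a \<in> carrier B" and "x \<in> carrier N"
    then obtain x' where x: "x' \<in> carrier M" "x = h x'" using c by meson
    show "a \<odot>\<^bsub>N\<^esub> x \<in> carrier N" using a x hom_closed[OF h] M.smult_closed by (simp add: H)
  next
    fix a b x assume a: "a \<in> carrier B" "b \<in> carrier B" and "x \<in> carrier N"
    then obtain x' where x: "x' \<in> carrier M" "x = h x'" using c by meson
    show "(a \<oplus>\<^bsub>B\<^esub> b) \<odot>\<^bsub>N\<^esub> x = a \<odot>\<^bsub>N\<^esub> x \<oplus>\<^bsub>N\<^esub> b \<odot>\<^bsub>N\<^esub> x"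
      "(a \<otimes>\<^bsub>B\<^esub> b) \<odot>\<^bsub>N\<^esub> x = a \<odot>\<^bsub>N\<^esub> (b \<odot>\<^bsub>N\<^esub> x)"
      using a x by (simp_all add: H M.smult_l_distr M.smult_assoc M.smult_closed)
  next
    fix a x y assume a: "a \<in> carrier B" and "x \<in> carrier N" "y \<in> carrier N"
    then obtain x' y' where "x' \<in> carrier M" "x = h x'" "y' \<in> carrier M" "y = h y'" using c by meson
    then show "a \<odot>\<^bsub>N\<^esub> (x \<oplus>\<^bsub>N\<^esub> y) = a \<odot>\<^bsub>N\<^esub> x \<oplus>\<^bsub>N\<^esub> a \<odot>\<^bsub>N\<^esub> y"
      using a by (simp add: H M.smult_r_distr M.smult_closed)
  next
    fix x assume "x \<in> carrier N"
    then obtain x' where x: "x' \<in> carrier M" "x = h x'" using c by meson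
    then show "\<one>\<^bsub>B\<^esub> \<odot>\<^bsub>N\<^esub> x = x" by (simp add: H M.smult_one)
  qed
qed

section \<open>Submodules\<close>

text \<open>Negatives come from scaling by minus one, see \<open>submod_minus\<close>.\<close>

definition submod :: "('b, 'c) ring_scheme \<Rightarrow> ('b, 'm) module \<Rightarrow> 'm set \<Rightarrow> bool" where
  "submod B M U \<longleftrightarrow> U \<subseteq> carrier M \<and> \<zero>\<^bsub>M\<^esub> \<in> U \<and> (\<forall>x\<in>U. \<forall>y\<in>U. x \<oplus>\<^bsub>M\<^esub> y \<in> U) \<and>
     (\<forall>a\<in>carrier B. \<forall>x\<in>U. a \<odot>\<^bsub>M\<^esub> x \<in> U)"

text \<open>Only the carrier of the record changes, so inclusions are identity functions and
  homomorphisms restrict without being rewritten.\<close>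

abbreviation sub_module :: "('b, 'm) module \<Rightarrow> 'm set \<Rightarrow> ('b, 'm) module" where
  "sub_module M U \<equiv> M\<lparr>carrier := U\<rparr>"

lemma submodI:
  assumes "\<And>x. x \<in> U \<Longrightarrow> x \<in> carrier M" "\<zero>\<^bsub>M\<^esub> \<in> U" "\<And>x y. x \<in> U \<Longrightarrow> y \<in> U \<Longrightarrow> x \<oplus>\<^bsub>M\<^esub> y \<in> U"
    "\<And>a x. a \<in> carrier B \<Longrightarrow> x \<in> U \<Longrightarrow> a \<odot>\<^bsub>M\<^esub> x \<in> U"
  shows "submod B M U"
  using assms by (auto simp: submod_def)

lemma submodD:
  assumes "submod B M U"
  shows "x \<in> U \<Longrightarrow> x \<in> carrier M" "\<zero>\<^bsub>M\<^esub> \<in> U" "x \<in> U \<Longrightarrow> y \<in> U \<Longrightarrow> x \<oplus>\<^bsub>M\<^esub> y \<in> U"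
    "a \<in> carrier B \<Longrightarrow> x \<in> U \<Longrightarrow> a \<odot>\<^bsub>M\<^esub> x \<in> U"
  using assms by (auto simp: submod_def)

lemma submod_minus:
  assumes "submod B M U" "left_module B M" "x \<in> U" shows "\<ominus>\<^bsub>M\<^esub> x \<in> U"
proof -
  interpret M: left_module B M by fact
  have "(\<ominus>\<^bsub>B\<^esub> \<one>\<^bsub>B\<^esub>) \<odot>\<^bsub>M\<^esub> x \<in> U" using submodD(4)[OF assms(1) _ assms(3)] by simp
  then show ?thesis using M.smult_minus_one submodD(1)[OF assms(1,3)] by simp
qed

lemma submod_diff:
  assumes "submod B M U" "left_module B M" "x \<in> U" "y \<in> U" shows "x \<ominus>\<^bsub>M\<^esub> y \<in> U"
  using assms submod_minus submodD(3) by (metis a_minus_def)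

lemma left_module_sub:
  assumes U: "submod B M U" and M: "left_module B M"
  shows "left_module B (sub_module M U)"
proof -
  interpret M: left_module B M by fact
  note d = submodD[OF U]
  have *: "abelian_group (sub_module M U)"
  proof (rule abelian_groupI)
    fix x assume "x \<in> carrier (sub_module M U)"
    then show "\<exists>y\<in>carrier (sub_module M U). y \<oplus>\<^bsub>sub_module M U\<^esub> x = \<zero>\<^bsub>sub_module M U\<^esub>"
      using submod_minus[OF U M] d(1) by (intro bexI[of _ "\<ominus>\<^bsub>M\<^esub> x"]) (auto simp: M.l_neg)
  qed (auto simp: d M.a_ac)
  show ?thesis
    by (rule left_moduleI[OF M.B.ring_axioms *])
      (auto simp: d M.smult_l_distr M.smult_r_distr M.smult_assoc M.smult_one)
qed

lemma sub_incl: "U \<subseteq> carrier M \<Longrightarrow> (\<lambda>x. x) \<in> mod_hom B (sub_module M U) M"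
  by (rule mod_homI) auto

lemma sub_incl_mono: "U \<subseteq> carrier M \<Longrightarrow> mod_mono B (sub_module M U) M (\<lambda>x. x)"
  by (auto simp: mod_mono_def sub_incl)

lemma submod_carrier: "left_module B M \<Longrightarrow> submod B M (carrier M)"
proof -
  assume "left_module B M" then interpret M: left_module B M .
  show ?thesis by (rule submodI) (auto simp: M.smult_closed)
qed

lemma submod_zero: "left_module B M \<Longrightarrow> submod B M {\<zero>\<^bsub>M\<^esub>}"
proof -
  assume "left_module B M" then interpret M: left_module B M .
  show ?thesis by (rule submodI) (auto simp: M.smult_closed)
qed

lemma submod_Int: "submod B M U \<Longrightarrow> submod B M V \<Longrightarrow> submod B M (U \<inter> V)"
  by (auto simp: submod_def)

lemma submod_image:
  assumes "f \<in> mod_hom B M N" "left_module B M" "left_module B N" "submod B M U"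
  shows "submod B N (f ` U)"
proof -
  note d = submodD[OF assms(4)] and h = hom_add[OF assms(1), symmetric] hom_smult[OF assms(1), symmetric]
  show ?thesis
    by (rule submodI) (use d hom_zero[OF assms(1-3)] in \<open>force simp: h intro: hom_closed[OF assms(1)]\<close>)+
qed

lemma submod_vimage:
  assumes "f \<in> mod_hom B M N" "left_module B M" "left_module B N" "submod B N V"
  shows "submod B M {x \<in> carrier M. f x \<in> V}"
proof -
  interpret M: left_module B M by fact
  show ?thesis
    by (rule submodI) (auto simp: hom_add[OF assms(1)] hom_smult[OF assms(1)] hom_zero[OF assms(1-3)]
        submodD[OF assms(4)] M.smult_closed)
qed

lemma submod_kernel:
  assumes "f \<in> mod_hom B M N" "left_module B M" "left_module B N"
  shows "submod B M {x \<in> carrier M. f x = \<zero>\<^bsub>N\<^esub>}"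
  using submod_vimage[OF assms submod_zero[OF assms(3)]] by simp

lemma a_kernel_eq: "a_kernel M N f = {x \<in> carrier M. f x = \<zero>\<^bsub>N\<^esub>}"
  by (simp add: a_kernel_def kernel_def)

lemma submod_Union_chain:
  assumes "\<And>k::nat. submod B M (V k)" "\<And>k. V k \<subseteq> V (Suc k)"
  shows "submod B M (\<Union>k. V k)"
proof -
  have m: "V i \<subseteq> V j" if "i \<le> j" for i j using that assms(2) by (rule lift_Suc_mono_le[rotated])
  show ?thesis
  proof (rule submodI)
    fix x y assume "x \<in> (\<Union>k. V k)" "y \<in> (\<Union>k. V k)"
    then obtain i j where "x \<in> V i" "y \<in> V j" by auto
    then have "x \<in> V (max i j)" "y \<in> V (max i j)" using m[of i "max i j"] m[of j "max i j"] by auto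
    then show "x \<oplus>\<^bsub>M\<^esub> y \<in> (\<Union>k. V k)" using submodD(3)[OF assms(1)] by blast
  next
    show "x \<in> carrier M" if "x \<in> (\<Union>k. V k)" for x using that submodD(1)[OF assms(1)] by auto
    show "\<zero>\<^bsub>M\<^esub> \<in> (\<Union>k. V k)" using submodD(2)[OF assms(1)] by auto
    show "a \<odot>\<^bsub>M\<^esub> x \<in> (\<Union>k. V k)" if "a \<in> carrier B" "x \<in> (\<Union>k. V k)" for a x
      using that submodD(4)[OF assms(1)] by auto
  qed
qed

definition submod_sum :: "('b, 'm) module \<Rightarrow> 'm set \<Rightarrow> 'm set \<Rightarrow> 'm set" where
  "submod_sum M U V = {x \<oplus>\<^bsub>M\<^esub> y | x y. x \<in> U \<and> y \<in> V}"

lemma submod_submod_sum: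
  assumes M: "left_module B M" and U: "submod B M U" and V: "submod B M V"
  shows "submod B M (submod_sum M U V)"
proof -
  interpret M: left_module B M by fact
  note u = submodD[OF U] and v = submodD[OF V]
  show ?thesis
  proof (rule submodI)
    fix x y assume "x \<in> submod_sum M U V" "y \<in> submod_sum M U V"
    then obtain a b c d where "x = a \<oplus>\<^bsub>M\<^esub> b" "y = c \<oplus>\<^bsub>M\<^esub> d" "a \<in> U" "b \<in> V" "c \<in> U" "d \<in> V"
      by (auto simp: submod_sum_def)
    moreover from this have "x \<oplus>\<^bsub>M\<^esub> y = (a \<oplus>\<^bsub>M\<^esub> c) \<oplus>\<^bsub>M\<^esub> (b \<oplus>\<^bsub>M\<^esub> d)" using u(1) v(1) by (simp add: M.a_ac)
    ultimately show "x \<oplus>\<^bsub>M\<^esub> y \<in> submod_sum M U V" using u(3) v(3) unfolding submod_sum_def by blast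
  next
    fix a x assume a: "a \<in> carrier B" and "x \<in> submod_sum M U V"
    then obtain y z where yz: "x = y \<oplus>\<^bsub>M\<^esub> z" "y \<in> U" "z \<in> V" by (auto simp: submod_sum_def)
    then have "a \<odot>\<^bsub>M\<^esub> x = a \<odot>\<^bsub>M\<^esub> y \<oplus>\<^bsub>M\<^esub> a \<odot>\<^bsub>M\<^esub> z" using a u(1) v(1) by (simp add: M.smult_r_distr)
    then show "a \<odot>\<^bsub>M\<^esub> x \<in> submod_sum M U V"
      using u(4)[OF a yz(2)] v(4)[OF a yz(3)] unfolding submod_sum_def by blast
  next
    show "\<zero>\<^bsub>M\<^esub> \<in> submod_sum M U V" using u(2) v(2) unfolding submod_sum_def by force
  qed (use u v in \<open>auto simp: submod_sum_def\<close>)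
qed

lemma submod_sum_upper:
  assumes "left_module B M" "submod B M U" "submod B M V"
  shows "U \<subseteq> submod_sum M U V" "V \<subseteq> submod_sum M U V"
proof -
  interpret M: left_module B M by fact
  note u = submodD[OF assms(2)] and v = submodD[OF assms(3)]
  show "U \<subseteq> submod_sum M U V" using u v(2) M.r_zero unfolding submod_sum_def by force
  show "V \<subseteq> submod_sum M U V" using v u(2) M.l_zero unfolding submod_sum_def by force
qed

definition cyclic :: "('b, 'c) ring_scheme \<Rightarrow> ('b, 'm) module \<Rightarrow> 'm \<Rightarrow> 'm set" where
  "cyclic B M x = (\<lambda>a. a \<odot>\<^bsub>M\<^esub> x) ` carrier B"

lemma submod_cyclic:
  assumes "left_module B M" "x \<in> carrier M"
  shows "submod B M (cyclic B M x)" "x \<in> cyclic B M x"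
proof -
  interpret M: left_module B M by fact
  show "submod B M (cyclic B M x)"
    using assms(2) M.smult_l_null[OF assms(2), symmetric] unfolding cyclic_def
    by (intro submodI)
      (auto simp: M.smult_closed M.smult_l_distr[symmetric] M.smult_assoc[symmetric]
        simp del: M.smult_l_null)
  show "x \<in> cyclic B M x" using M.smult_one[OF assms(2)] unfolding cyclic_def by force
qed

text \<open>The span of \<open>S\<close> is the least submodule containing \<open>S\<close>. This
  form of finite generation has no sums in it and passes through homomorphisms by taking preimages
  of submodules.\<close>

lemma fg_iff:
  "fg_left_module B M \<longleftrightarrow> left_module B M \<and>
     (\<exists>S. finite S \<and> S \<subseteq> carrier M \<and> (\<forall>U. submod B M U \<and> S \<subseteq> U \<longrightarrow> U = carrier M))"
    (is "_ \<longleftrightarrow> _ \<and> ?R")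
proof (cases "left_module B M")
  case True
  then interpret M: left_module B M .
  have in_sub: "(\<Oplus>\<^bsub>M\<^esub>s\<in>S. c s \<odot>\<^bsub>M\<^esub> s) \<in> U"
    if "finite S" "c \<in> S \<rightarrow> carrier B" "S \<subseteq> U" "submod B M U" for S c U
    using that
  proof (induction S)
    case (insert s S)
    then have "(\<lambda>s. c s \<odot>\<^bsub>M\<^esub> s) \<in> S \<rightarrow> carrier M" "c s \<odot>\<^bsub>M\<^esub> s \<in> U"
      using submodD[OF insert.prems(3)] by (auto simp: Pi_iff intro!: M.smult_closed)
    then show ?case using insert submodD[OF insert.prems(3)] by simp
  qed (simp add: submodD)
  have span: "submod B M {(\<Oplus>\<^bsub>M\<^esub>s\<in>S. c s \<odot>\<^bsub>M\<^esub> s) | c. c \<in> S \<rightarrow> carrier B}" (is "submod B M ?V")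
    and span': "S \<subseteq> {(\<Oplus>\<^bsub>M\<^esub>s\<in>S. c s \<odot>\<^bsub>M\<^esub> s) | c. c \<in> S \<rightarrow> carrier B}"
    if S: "finite S" "S \<subseteq> carrier M" for S
  proof -
    have cl: "(\<lambda>s. c s \<odot>\<^bsub>M\<^esub> s) \<in> S \<rightarrow> carrier M" if "c \<in> S \<rightarrow> carrier B" for c
      using that S by (auto simp: Pi_iff intro!: M.smult_closed)
    show "submod B M ?V"
    proof (rule submodI)
      show "\<zero>\<^bsub>M\<^esub> \<in> ?V"
        using S by (auto intro!: exI[of _ "\<lambda>_. \<zero>\<^bsub>B\<^esub>"] M.add.finprod_one_eqI[symmetric])
    next
      fix x y assume "x \<in> ?V" "y \<in> ?V"
      then obtain c d where cd: "c \<in> S \<rightarrow> carrier B" "d \<in> S \<rightarrow> carrier B"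
        "x = (\<Oplus>\<^bsub>M\<^esub>s\<in>S. c s \<odot>\<^bsub>M\<^esub> s)" "y = (\<Oplus>\<^bsub>M\<^esub>s\<in>S. d s \<odot>\<^bsub>M\<^esub> s)" by blast
      have "x \<oplus>\<^bsub>M\<^esub> y = (\<Oplus>\<^bsub>M\<^esub>s\<in>S. c s \<odot>\<^bsub>M\<^esub> s \<oplus>\<^bsub>M\<^esub> d s \<odot>\<^bsub>M\<^esub> s)"
        unfolding cd using M.finsum_addf[OF cl[OF cd(1)] cl[OF cd(2)]] by simp
      also have "\<dots> = (\<Oplus>\<^bsub>M\<^esub>s\<in>S. (c s \<oplus>\<^bsub>B\<^esub> d s) \<odot>\<^bsub>M\<^esub> s)"
        using cd S by (intro M.finsum_cong') (auto simp: Pi_iff M.smult_l_distr subset_iff intro!: M.smult_closed)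
      finally show "x \<oplus>\<^bsub>M\<^esub> y \<in> ?V" using cd by (auto intro!: exI[of _ "\<lambda>s. c s \<oplus>\<^bsub>B\<^esub> d s"])
    next
      fix a x assume a: "a \<in> carrier B" and "x \<in> ?V"
      then obtain c where c: "c \<in> S \<rightarrow> carrier B" "x = (\<Oplus>\<^bsub>M\<^esub>s\<in>S. c s \<odot>\<^bsub>M\<^esub> s)" by blast
      have "a \<odot>\<^bsub>M\<^esub> (\<Oplus>\<^bsub>M\<^esub>s\<in>T. c s \<odot>\<^bsub>M\<^esub> s) = (\<Oplus>\<^bsub>M\<^esub>s\<in>T. (a \<otimes>\<^bsub>B\<^esub> c s) \<odot>\<^bsub>M\<^esub> s)" if "finite T" "T \<subseteq> S" for T
        using that
      proof (induction T)
        case (insert t T)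
        then have "t \<in> carrier M" "c t \<in> carrier B" "(\<lambda>s. c s \<odot>\<^bsub>M\<^esub> s) \<in> T \<rightarrow> carrier M"
          "(\<lambda>s. (a \<otimes>\<^bsub>B\<^esub> c s) \<odot>\<^bsub>M\<^esub> s) \<in> T \<rightarrow> carrier M"
          using S c a by (auto simp: Pi_iff subset_iff intro!: M.smult_closed)
        with insert a show ?case by (simp add: M.smult_r_distr M.smult_assoc M.smult_closed)
      qed (use a in simp)
      then have "a \<odot>\<^bsub>M\<^esub> x = (\<Oplus>\<^bsub>M\<^esub>s\<in>S. (a \<otimes>\<^bsub>B\<^esub> c s) \<odot>\<^bsub>M\<^esub> s)" using c S by blast
      then show "a \<odot>\<^bsub>M\<^esub> x \<in> ?V" using a c by (auto intro!: exI[of _ "\<lambda>s. a \<otimes>\<^bsub>B\<^esub> c s"])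
    qed (use cl in \<open>auto intro!: M.finsum_closed\<close>)
    show "S \<subseteq> ?V"
    proof
      fix t assume t: "t \<in> S"
      define c where "c s = (if s = t then \<one>\<^bsub>B\<^esub> else \<zero>\<^bsub>B\<^esub>)" for s
      have "(\<Oplus>\<^bsub>M\<^esub>s\<in>S. c s \<odot>\<^bsub>M\<^esub> s) = (\<Oplus>\<^bsub>M\<^esub>s\<in>S. if t = s then s else \<zero>\<^bsub>M\<^esub>)"
        using S t by (intro M.finsum_cong') (auto simp: c_def M.smult_one)
      also have "\<dots> = t" using M.finsum_singleton[OF t S(1), of "\<lambda>s. s"] S by auto
      finally show "t \<in> ?V" by (auto simp: c_def intro!: exI[of _ c])
    qed
  qed
  have "fg_left_module B M \<longleftrightarrow> ?R"
  proof
    assume "fg_left_module B M"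
    then obtain S where S: "finite S" "S \<subseteq> carrier M"
      and gen: "\<And>x. x \<in> carrier M \<Longrightarrow> \<exists>c\<in>S \<rightarrow> carrier B. x = (\<Oplus>\<^bsub>M\<^esub>s\<in>S. c s \<odot>\<^bsub>M\<^esub> s)"
      unfolding fg_left_module_def by blast
    have "U = carrier M" if U: "submod B M U" "S \<subseteq> U" for U
    proof
      show "carrier M \<subseteq> U"
      proof
        fix x assume "x \<in> carrier M"
        then obtain c where "c \<in> S \<rightarrow> carrier B" "x = (\<Oplus>\<^bsub>M\<^esub>s\<in>S. c s \<odot>\<^bsub>M\<^esub> s)" using gen by blast
        then show "x \<in> U" using in_sub[OF S(1) _ U(2,1)] by simp
      qed
    qed (use submodD(1)[OF U(1)] in auto)
    with S show ?R by blast
  next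
    assume ?R
    then obtain S where "finite S \<and> S \<subseteq> carrier M \<and> (\<forall>U. submod B M U \<and> S \<subseteq> U \<longrightarrow> U = carrier M)" ..
    then have S: "finite S" "S \<subseteq> carrier M" "\<And>U. submod B M U \<Longrightarrow> S \<subseteq> U \<Longrightarrow> U = carrier M"
      by auto
    have e: "{(\<Oplus>\<^bsub>M\<^esub>s\<in>S. c s \<odot>\<^bsub>M\<^esub> s) | c. c \<in> S \<rightarrow> carrier B} = carrier M"
      using S(3)[OF span[OF S(1,2)] span'[OF S(1,2)]] .
    have "\<exists>c\<in>S \<rightarrow> carrier B. x = (\<Oplus>\<^bsub>M\<^esub>s\<in>S. c s \<odot>\<^bsub>M\<^esub> s)" if "x \<in> carrier M" for x
      using that unfolding e[symmetric] by blast
    then show "fg_left_module B M" using S True unfolding fg_left_module_def by blast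
  qed
  then show ?thesis using True by simp
qed auto

text \<open>Compose \<open>f\<close> with any set-theoretic section of \<open>q\<close>: the result
  does not depend on the section, because two preimages differ by an element of the kernel of
  \<open>q\<close>, which \<open>f\<close> kills. It serves as the universal property of quotients
  and cokernels.\<close>

lemma epi_factor:
  assumes q: "mod_epi B M N q" and f: "f \<in> mod_hom B M P"
    and M: "left_module B M" and N: "left_module B N" and P: "left_module B P"
    and k: "\<And>x. x \<in> carrier M \<Longrightarrow> q x = \<zero>\<^bsub>N\<^esub> \<Longrightarrow> f x = \<zero>\<^bsub>P\<^esub>"
  shows "\<exists>f'\<in>mod_hom B N P. \<forall>x\<in>carrier M. f' (q x) = f x"
proof -
  interpret M: left_module B M by fact
  note q' = mod_epiD[OF q]
  define s where "s = inv_into (carrier M) q"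
  have s: "s y \<in> carrier M" "q (s y) = y" if "y \<in> carrier N" for y
    using that q'(2) by (auto simp: s_def inv_into_into f_inv_into_f)
  have wd: "f x = f y" if "x \<in> carrier M" "y \<in> carrier M" "q x = q y" for x y
    using that k[of "x \<ominus>\<^bsub>M\<^esub> y"] hom_eq_iff_diff[OF q'(1) M N] hom_eq_iff_diff[OF f M P] by simp
  have e: "f (s (q x)) = f x" if "x \<in> carrier M" for x
    using that s hom_closed[OF q'(1)] by (intro wd) auto
  have "(\<lambda>y. f (s y)) \<in> mod_hom B N P"
  proof (rule mod_homI)
    show "f (s (x \<oplus>\<^bsub>N\<^esub> y)) = f (s x) \<oplus>\<^bsub>P\<^esub> f (s y)" if "x \<in> carrier N" "y \<in> carrier N" for x y
      using e[of "s x \<oplus>\<^bsub>M\<^esub> s y"] s that by (simp add: hom_add[OF q'(1)] hom_add[OF f])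
    show "f (s (a \<odot>\<^bsub>N\<^esub> x)) = a \<odot>\<^bsub>P\<^esub> f (s x)" if "a \<in> carrier B" "x \<in> carrier N" for a x
      using e[of "a \<odot>\<^bsub>M\<^esub> s x"] s that by (simp add: hom_smult[OF q'(1)] hom_smult[OF f] M.smult_closed)
  qed (use s hom_closed[OF f] in auto)
  then show ?thesis using e by (intro bexI[of _ "\<lambda>y. f (s y)"]) auto
qed

section \<open>Chain conditions\<close>

definition dcc :: "('b, 'c) ring_scheme \<Rightarrow> ('b, 'm) module \<Rightarrow> bool" where
  "dcc B M \<longleftrightarrow> (\<forall>V :: nat \<Rightarrow> 'm set. (\<forall>k. submod B M (V k)) \<and> (\<forall>k. V (Suc k) \<subseteq> V k) \<longrightarrow>
     (\<exists>m. \<forall>k\<ge>m. V k = V m))"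

definition acc :: "('b, 'c) ring_scheme \<Rightarrow> ('b, 'm) module \<Rightarrow> bool" where
  "acc B M \<longleftrightarrow> (\<forall>V :: nat \<Rightarrow> 'm set. (\<forall>k. submod B M (V k)) \<and> (\<forall>k. V k \<subseteq> V (Suc k)) \<longrightarrow>
     (\<exists>m. \<forall>k\<ge>m. V k = V m))"

lemma dccD:
  assumes "dcc B M" "\<And>k. submod B M (V k)" "\<And>k. V (Suc k) \<subseteq> V k"
  shows "\<exists>m. \<forall>k\<ge>m. V k = V m"
  using assms unfolding dcc_def by blast

lemma accD:
  assumes "acc B M" "\<And>k. submod B M (V k)" "\<And>k. V k \<subseteq> V (Suc k)"
  shows "\<exists>m. \<forall>k\<ge>m. V k = V m"
  using assms unfolding acc_def by blast

text \<open>A family without minimal member yields a strictly descending sequence by repeated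
  choice.\<close>

lemma dcc_minimal:
  assumes d: "dcc B M" and ne: "\<C> \<noteq> {}" and s: "\<And>U. U \<in> \<C> \<Longrightarrow> submod B M U"
  shows "\<exists>U\<in>\<C>. \<forall>V\<in>\<C>. V \<subseteq> U \<longrightarrow> V = U"
proof (rule ccontr)
  assume n: "\<not> ?thesis"
  define nx where "nx U = (SOME V. V \<in> \<C> \<and> V \<subset> U)" for U
  have nx: "nx U \<in> \<C> \<and> nx U \<subset> U" if U: "U \<in> \<C>" for U
  proof -
    have "\<exists>V. V \<in> \<C> \<and> V \<subset> U" using n U by blast
    then show ?thesis unfolding nx_def by (rule someI_ex)
  qed
  obtain U0 where U0: "U0 \<in> \<C>" using ne by auto
  define V where "V k = (nx ^^ k) U0" for k
  have V: "V k \<in> \<C>" for k by (induction k) (use U0 nx in \<open>auto simp: V_def\<close>)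
  have "V (Suc k) \<subset> V k" for k using nx[OF V[of k]] by (simp add: V_def)
  moreover from this obtain m where "\<forall>k\<ge>m. V k = V m"
    using dccD[OF d, of V] s[OF V] by (metis psubset_imp_subset)
  ultimately show False by (metis le_Suc_eq order_refl psubset_eq)
qed

lemma acc_maximal:
  assumes d: "acc B M" and ne: "\<C> \<noteq> {}" and s: "\<And>U. U \<in> \<C> \<Longrightarrow> submod B M U"
  shows "\<exists>U\<in>\<C>. \<forall>V\<in>\<C>. U \<subseteq> V \<longrightarrow> V = U"
proof (rule ccontr)
  assume n: "\<not> ?thesis"
  define nx where "nx U = (SOME V. V \<in> \<C> \<and> U \<subset> V)" for U
  have nx: "nx U \<in> \<C> \<and> U \<subset> nx U" if U: "U \<in> \<C>" for U
  proof -
    have "\<exists>V. V \<in> \<C> \<and> U \<subset> V" using n U by blast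
    then show ?thesis unfolding nx_def by (rule someI_ex)
  qed
  obtain U0 where U0: "U0 \<in> \<C>" using ne by auto
  define V where "V k = (nx ^^ k) U0" for k
  have V: "V k \<in> \<C>" for k by (induction k) (use U0 nx in \<open>auto simp: V_def\<close>)
  have "V k \<subset> V (Suc k)" for k using nx[OF V[of k]] by (simp add: V_def)
  moreover from this obtain m where "\<forall>k\<ge>m. V k = V m"
    using accD[OF d, of V] s[OF V] by (metis psubset_imp_subset)
  ultimately show False by (metis le_Suc_eq order_refl psubset_eq)
qed

text \<open>Induction on the number of maps. A descending chain is controlled by its image under one
  map and its intersection with the kernel of that map, on which the remaining maps still separate
  points. Submodules, columns and matrix rings are all instances.\<close>

lemma dcc_joint:
  assumes I: "finite I" and M: "left_module B M"
    and f: "\<And>i. i \<in> I \<Longrightarrow> left_module B (N i) \<and> dcc B (N i) \<and> f i \<in> mod_hom B M (N i)"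
    and inj: "\<And>x. x \<in> carrier M \<Longrightarrow> (\<And>i. i \<in> I \<Longrightarrow> f i x = \<zero>\<^bsub>N i\<^esub>) \<Longrightarrow> x = \<zero>\<^bsub>M\<^esub>"
  shows "dcc B M"
proof -
  interpret M: left_module B M by fact
  have "\<exists>m. \<forall>k\<ge>m. V k = V m"
    if "finite J" "J \<subseteq> I" "\<And>k. submod B M (V k)" "\<And>k. V (Suc k) \<subseteq> V k"
      "\<And>x. x \<in> V 0 \<Longrightarrow> (\<And>i. i \<in> J \<Longrightarrow> f i x = \<zero>\<^bsub>N i\<^esub>) \<Longrightarrow> x = \<zero>\<^bsub>M\<^esub>"
    for J and V :: "nat \<Rightarrow> _"
    using that
  proof (induction J arbitrary: V)
    case empty
    have "V k \<subseteq> V 0" for k using empty(3) lift_Suc_antimono_le[of V 0 k] by simp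
    then have "V k = {\<zero>\<^bsub>M\<^esub>}" for k using empty(4) submodD(2)[OF empty(2)] by fastforce
    then show ?case by simp
  next
    case (insert i J)
    note V = insert.prems(2,3)
    have anti: "V k \<subseteq> V m" if "m \<le> k" for m k using V(2) that lift_Suc_antimono_le[of V m k] by simp
    have Ni: "left_module B (N i)" "dcc B (N i)" "f i \<in> mod_hom B M (N i)"
      using f[of i] insert.prems(1) by auto
    let ?K = "{x \<in> carrier M. f i x = \<zero>\<^bsub>N i\<^esub>}"
    have K: "submod B M ?K" using submod_kernel[OF Ni(3) M Ni(1)] .
    have "\<exists>m. \<forall>k\<ge>m. V k \<inter> ?K = V m \<inter> ?K"
    proof (rule insert.IH)
      show "J \<subseteq> I" using insert.prems by auto
      show "submod B M (V k \<inter> ?K)" for k using submod_Int[OF V(1) K] .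
      show "V (Suc k) \<inter> ?K \<subseteq> V k \<inter> ?K" for k using V(2) by blast
      show "x = \<zero>\<^bsub>M\<^esub>" if "x \<in> V 0 \<inter> ?K" "\<And>j. j \<in> J \<Longrightarrow> f j x = \<zero>\<^bsub>N j\<^esub>" for x
        using that by (intro insert.prems(4)) auto
    qed
    then obtain m1 where m1: "\<And>k. k \<ge> m1 \<Longrightarrow> V k \<inter> ?K = V m1 \<inter> ?K" by auto
    have "\<exists>m. \<forall>k\<ge>m. f i ` V k = f i ` V m"
      by (rule dccD[OF Ni(2)]) (use submod_image[OF Ni(3) M Ni(1) V(1)] V(2) in auto)
    then obtain m2 where m2: "\<And>k. k \<ge> m2 \<Longrightarrow> f i ` V k = f i ` V m2" by auto
    define m where "m = max m1 m2"
    \<comment> \<open>An element of the larger term and one of the smaller term with the same image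
      differ by an element of the kernel, where the two terms already agree.\<close>
    have "V m \<subseteq> V k" if k: "k \<ge> m" for k
    proof
      fix x assume x: "x \<in> V m"
      have "f i x \<in> f i ` V k" using m2[of m] m2[of k] k x by (auto simp: m_def)
      then obtain y where y: "y \<in> V k" "f i x = f i y" by auto
      note c = submodD(1)[OF V(1)]
      have "x \<ominus>\<^bsub>M\<^esub> y \<in> V m \<inter> ?K"
        using submod_diff[OF V(1) M x] y anti[OF k] hom_eq_iff_diff[OF Ni(3) M Ni(1) c[OF x] c[OF y(1)]] c[OF x] c[OF y(1)]
        by auto
      also have "\<dots> = V k \<inter> ?K" using m1[of m] m1[of k] k by (auto simp: m_def)
      finally have "(x \<ominus>\<^bsub>M\<^esub> y) \<oplus>\<^bsub>M\<^esub> y \<in> V k" using submodD(3)[OF V(1) _ y(1)] by auto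
      then show "x \<in> V k" using c[OF x] c[OF y(1)] by (simp add: a_minus_def M.a_assoc M.l_neg)
    qed
    then have "V k = V m" if "k \<ge> m" for k using anti[OF that] that by auto
    then show ?case by blast
  qed
  from this[OF I] inj submodD(1) show ?thesis unfolding dcc_def by (metis subset_refl)
qed

lemma dcc_mono:
  assumes "mod_mono B M N f" "left_module B M" "left_module B N" "dcc B N"
  shows "dcc B M"
proof (rule dcc_joint[of "{()}" B M "\<lambda>_. N" "\<lambda>_. f"])
  show "x = \<zero>\<^bsub>M\<^esub>" if "x \<in> carrier M" "\<And>i. i \<in> {()} \<Longrightarrow> f x = \<zero>\<^bsub>N\<^esub>" for x
    using that hom_inj_iff[OF mod_monoD(1)[OF assms(1)] assms(2,3)] mod_monoD(2)[OF assms(1)] by auto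
qed (use assms mod_monoD in auto)

lemma dcc_epi:
  assumes f: "mod_epi B M N f" and M: "left_module B M" and N: "left_module B N" and d: "dcc B M"
  shows "dcc B N"
  unfolding dcc_def
proof (intro allI impI, elim conjE)
  fix V assume V: "\<forall>k. submod B N (V k)" "\<forall>k. V (Suc k) \<subseteq> V k"
  note f' = mod_epiD[OF f]
  let ?W = "\<lambda>k. {x \<in> carrier M. f x \<in> V k}"
  have "\<exists>m. \<forall>k\<ge>m. ?W k = ?W m"
  proof (rule dccD[OF d])
    show "submod B M (?W k)" for k using submod_vimage[OF f'(1) M N] V(1) by blast
    show "?W (Suc k) \<subseteq> ?W k" for k using V(2) by auto
  qed
  then obtain m where m: "\<And>k. k \<ge> m \<Longrightarrow> ?W k = ?W m" by auto
  have e: "V k = f ` ?W k" for k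
  proof
    show "V k \<subseteq> f ` ?W k"
    proof
      fix y assume y: "y \<in> V k"
      then obtain x where "x \<in> carrier M" "f x = y"
        using mod_epi_surj[OF f submodD(1)[OF V(1)[rule_format]]] by metis
      then show "y \<in> f ` ?W k" using y by auto
    qed
  qed auto
  have "V k = V m" if "k \<ge> m" for k
    by (subst e, subst e, subst m[OF that]) (rule refl)
  then show "\<exists>m. \<forall>k\<ge>m. V k = V m" by blast
qed

text \<open>A module over a commutative artinian ring with descending chain condition has the ascending one:
  on a minimal submodule \<open>C\<close> without it every scalar acts as zero or onto, hence the scalars act
  through a field, and over a field the two conditions agree.\<close>

definition reg_module :: "('b, 'c) ring_scheme \<Rightarrow> ('b, 'b) module" where
  "reg_module B = \<lparr>carrier = carrier B, mult = mult B, one = one B, zero = zero B, add = add B, smult = mult B\<rparr>"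

lemma reg_simps [simp]: "carrier (reg_module B) = carrier B" "zero (reg_module B) = zero B"
  "add (reg_module B) = add B" "smult (reg_module B) = mult B"
  by (auto simp: reg_module_def)

lemma reg_left_module: "ring B \<Longrightarrow> left_module B (reg_module B)"
proof -
  assume "ring B" then interpret ring B .
  have "abelian_group (reg_module B)"
    by (rule abelian_groupI) (auto simp: a_ac intro: l_neg)
  then show ?thesis by (rule left_moduleI[OF ring_axioms]) (auto simp: l_distr r_distr m_assoc)
qed

lemma dcc_imp_acc_comm:
  assumes R: "cring R" and dR: "dcc R (reg_module R)" and L: "left_module R L" and dL: "dcc R L"
  shows "acc R L"
proof (rule ccontr)
  assume nacc: "\<not> acc R L"
  interpret R: cring R by fact
  interpret L: left_module R L by fact
  \<comment> \<open>The ascending chain condition for submodules inside \<open>C\<close>; a least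
    \<open>C\<close> violating it exists by the descending condition.\<close>
  define Nt where "Nt C \<longleftrightarrow> (\<forall>V :: nat \<Rightarrow> _. (\<forall>k. submod R L (V k)) \<and> (\<forall>k. V k \<subseteq> V (Suc k)) \<and> (\<forall>k. V k \<subseteq> C) \<longrightarrow>
     (\<exists>m. \<forall>k\<ge>m. V k = V m))" for C
  have NtD: "\<exists>m. \<forall>k\<ge>m. V k = V m" if "Nt C" "\<And>k. submod R L (V k)" "\<And>k. V k \<subseteq> V (Suc k)" "\<And>k. V k \<subseteq> C" for C V
    using that unfolding Nt_def by blast
  have "\<exists>C\<in>{C. submod R L C \<and> \<not> Nt C}. \<forall>D\<in>{C. submod R L C \<and> \<not> Nt C}. D \<subseteq> C \<longrightarrow> D = C"
  proof (rule dcc_minimal[OF dL])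
    have "\<not> Nt (carrier L)"
    proof
      assume "Nt (carrier L)"
      then have "acc R L" unfolding acc_def Nt_def using submodD(1)[of R L] by (metis subsetI)
      with nacc show False ..
    qed
    then show "{C. submod R L C \<and> \<not> Nt C} \<noteq> {}" using submod_carrier[OF L] by auto
  qed auto
  then obtain C where C: "submod R L C" "\<not> Nt C" and minC: "\<And>D. submod R L D \<Longrightarrow> D \<subset> C \<Longrightarrow> Nt D" by blast
  note Cc = submodD[OF C(1)]
  define mu where "mu a = (\<lambda>x. a \<odot>\<^bsub>L\<^esub> x)" for a
  have mu: "mu a \<in> mod_hom R L L" if "a \<in> carrier R" for a
    using that unfolding mu_def by (intro mod_homI)
      (auto simp: L.smult_closed L.smult_r_distr L.smult_assoc[symmetric] R.m_comm)
  \<comment> \<open>Otherwise the kernel of \<open>mu a\<close> inside \<open>C\<close> and the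
    image of \<open>C\<close> are both proper, hence satisfy the ascending condition by minimality
    of \<open>C\<close>, and then so does \<open>C\<close>.\<close>
  have alt: "mu a ` C = C \<or> (\<forall>x\<in>C. mu a x = \<zero>\<^bsub>L\<^esub>)" if a: "a \<in> carrier R" for a
  proof (rule ccontr)
    assume n: "\<not> ?thesis"
    let ?K = "{x \<in> carrier L. mu a x = \<zero>\<^bsub>L\<^esub>}"
    have K: "submod R L ?K" using submod_kernel[OF mu[OF a] L L] .
    have NK: "Nt (C \<inter> ?K)" using n by (intro minC submod_Int C K) auto
    have "mu a ` C \<subseteq> C" using Cc(4)[OF a] by (auto simp: mu_def)
    then have NI: "Nt (mu a ` C)" using n by (intro minC submod_image[OF mu[OF a] L L C(1)]) auto
    have "Nt C" unfolding Nt_def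
    proof (intro allI impI, elim conjE)
      fix V assume V: "\<forall>k. submod R L (V k)" "\<forall>k. V k \<subseteq> V (Suc k)" "\<forall>k. V k \<subseteq> C"
      have mono: "V m \<subseteq> V k" if "m \<le> k" for m k using V(2) that lift_Suc_mono_le[of V m k] by simp
      have c: "x \<in> carrier L" if "x \<in> V k" for x k using V(3) that Cc(1) by auto
      have "\<exists>m. \<forall>k\<ge>m. V k \<inter> ?K = V m \<inter> ?K"
        by (rule NtD[OF NK]) (use V submod_Int[OF _ K] in auto)
      then obtain m1 where m1: "\<And>k. k \<ge> m1 \<Longrightarrow> V k \<inter> ?K = V m1 \<inter> ?K" by auto
      have "\<exists>m. \<forall>k\<ge>m. mu a ` V k = mu a ` V m"
        by (rule NtD[OF NI]) (use V submod_image[OF mu[OF a] L L] in blast)+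
      then obtain m2 where m2: "\<And>k. k \<ge> m2 \<Longrightarrow> mu a ` V k = mu a ` V m2" by auto
      define m where "m = max m1 m2"
      have "V k \<subseteq> V m" if k: "k \<ge> m" for k
      proof
        fix x assume x: "x \<in> V k"
        have "mu a x \<in> mu a ` V m" using m2[of m] m2[of k] k x by (auto simp: m_def)
        then obtain y where y: "y \<in> V m" "mu a x = mu a y" by auto
        have y': "y \<in> V k" using y(1) mono[OF k] by auto
        have "x \<ominus>\<^bsub>L\<^esub> y \<in> V k \<inter> ?K"
          using submod_diff[OF V(1)[rule_format] L x y'] hom_eq_iff_diff[OF mu[OF a] L L c[OF x] c[OF y(1)]] y(2)
            c[OF x] c[OF y(1)] by auto
        also have "\<dots> = V m \<inter> ?K" using m1[of m] m1[of k] k by (auto simp: m_def)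
        finally have "(x \<ominus>\<^bsub>L\<^esub> y) \<oplus>\<^bsub>L\<^esub> y \<in> V m" using submodD(3)[OF V(1)[rule_format] _ y(1)] by auto
        then show "x \<in> V m" using c[OF x] c[OF y(1)] by (simp add: a_minus_def L.a_assoc L.l_neg)
      qed
      then have "V k = V m" if "k \<ge> m" for k using mono[OF that] that by auto
      then show "\<exists>m. \<forall>k\<ge>m. V k = V m" by blast
    qed
    with C(2) show False ..
  qed
  \<comment> \<open>The ideals generated by the powers of \<open>a\<close> stabilise in
    \<open>R\<close>, so some power satisfies a^m = r a^(m+1). As \<open>a\<close> maps
    \<open>C\<close> onto itself, every element of \<open>C\<close> is divisible by a^m, and
    \<open>r\<close> undoes \<open>a\<close> there.\<close>
  have invert: "\<exists>r\<in>carrier R. \<forall>x\<in>C. r \<odot>\<^bsub>L\<^esub> (a \<odot>\<^bsub>L\<^esub> x) = x" if a: "a \<in> carrier R" and onto: "mu a ` C = C" for a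
  proof -
    define V where "V k = cyclic R (reg_module R) (a [^]\<^bsub>R\<^esub> (k::nat))" for k
    have "submod R (reg_module R) (V k)" for k
      unfolding V_def using a by (intro submod_cyclic reg_left_module R.ring_axioms) auto
    moreover have "V (Suc k) \<subseteq> V k" for k
      using a unfolding V_def cyclic_def by (auto simp: R.m_assoc[symmetric] R.m_comm[of _ a]
        intro!: image_eqI[of _ _ "a \<otimes>\<^bsub>R\<^esub> _"])
    ultimately obtain m where "V (Suc m) = V m" using dccD[OF dR, of V] by (metis le_Suc_eq order_refl)
    then have "a [^]\<^bsub>R\<^esub> m \<in> V (Suc m)"
      using submod_cyclic(2)[OF reg_left_module[OF R.ring_axioms], of "a [^]\<^bsub>R\<^esub> m"] a by (simp add: V_def)
    then obtain r where r: "r \<in> carrier R" "a [^]\<^bsub>R\<^esub> m = r \<otimes>\<^bsub>R\<^esub> (a [^]\<^bsub>R\<^esub> Suc m)" by (auto simp: V_def cyclic_def)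
    have pw: "\<exists>y\<in>C. x = (a [^]\<^bsub>R\<^esub> (k::nat)) \<odot>\<^bsub>L\<^esub> y" if "x \<in> C" for x k
      using that
    proof (induction k arbitrary: x)
      case 0 then show ?case using L.smult_one Cc(1) by auto
    next
      case (Suc k)
      then obtain z where z: "z \<in> C" "x = a \<odot>\<^bsub>L\<^esub> z" using onto by (auto simp: mu_def)
      then obtain y where y: "y \<in> C" "z = (a [^]\<^bsub>R\<^esub> k) \<odot>\<^bsub>L\<^esub> y" using Suc.IH by auto
      have "x = (a [^]\<^bsub>R\<^esub> Suc k) \<odot>\<^bsub>L\<^esub> y"
        using a y z Cc(1) by (simp add: L.smult_assoc[symmetric] R.m_comm)
      then show ?case using y by auto
    qed
    have "r \<odot>\<^bsub>L\<^esub> (a \<odot>\<^bsub>L\<^esub> x) = x" if x: "x \<in> C" for x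
    proof -
      obtain y where y: "y \<in> C" "x = (a [^]\<^bsub>R\<^esub> m) \<odot>\<^bsub>L\<^esub> y" using pw[OF x] by auto
      have "r \<odot>\<^bsub>L\<^esub> (a \<odot>\<^bsub>L\<^esub> x) = (r \<otimes>\<^bsub>R\<^esub> (a [^]\<^bsub>R\<^esub> Suc m)) \<odot>\<^bsub>L\<^esub> y"
      proof -
        have "a \<otimes>\<^bsub>R\<^esub> (a [^]\<^bsub>R\<^esub> m) = a [^]\<^bsub>R\<^esub> Suc m" using a by (simp add: R.m_comm)
        then show ?thesis using a r(1) y Cc(1)[OF y(1)] by (metis L.smult_assoc L.smult_closed R.m_closed R.nat_pow_closed)
      qed
      then show ?thesis using r(2) y(2) by metis
    qed
    then show ?thesis using r(1) by auto
  qed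
  obtain V where V: "\<And>k::nat. submod R L (V k)" "\<And>k. V k \<subseteq> V (Suc k)" "\<And>k. V k \<subseteq> C" "\<And>m. \<exists>k\<ge>m. V k \<noteq> V m"
    using C(2) unfolding Nt_def by auto
  have mono: "V m \<subseteq> V k" if "m \<le> k" for m k using V(2) that lift_Suc_mono_le[of V m k] by simp
  have "\<exists>k y. k > m \<and> y \<in> V k \<and> y \<notin> V m" for m
  proof -
    obtain k where k: "k \<ge> m" "V k \<noteq> V m" using V(4) by blast
    then have "\<not> V k \<subseteq> V m" using mono[OF k(1)] by blast
    moreover have "k \<noteq> m" using k(2) by blast
    then have "k > m" using k(1) by simp
    ultimately show ?thesis by blast
  qed
  then obtain s y where sy: "\<And>m. s m > m" "\<And>m. y m \<in> V (s m)" "\<And>m. y m \<notin> V m" by metis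
  \<comment> \<open>A subsequence makes the chain strict, with \<open>x k\<close> a witness that
    lies in \<open>W (Suc k)\<close> but not in \<open>W k\<close>.\<close>
  define t where "t k = (s ^^ k) 0" for k
  define W where "W k = V (t k)" for k
  define x where "x k = y (t k)" for k
  have x: "x k \<in> W (Suc k)" "x k \<notin> W k" for k using sy[of "t k"] by (auto simp: W_def x_def t_def)
  have W: "submod R L (W k)" "W k \<subseteq> C" for k using V(1,3) by (auto simp: W_def)
  have Wm: "W k \<subseteq> W (Suc k)" for k using mono[of "t k" "t (Suc k)"] sy(1)[of "t k"] by (simp add: W_def t_def)
  have Wmono: "W m \<subseteq> W k" if "m \<le> k" for m k using Wm that lift_Suc_mono_le[of W m k] by simp
  have xC: "x k \<in> C" for k using x W by blast
  \<comment> \<open>\<open>S k p\<close> is the span of the \<open>p\<close> vectors from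
    \<open>x k\<close> on. Its union over \<open>p\<close>, called \<open>D k\<close> below,
    descends with \<open>k\<close>, so the descending condition forces some \<open>x k\<close> into
    the span of later vectors.\<close>
  define S where "S k p = rec_nat {\<zero>\<^bsub>L\<^esub>} (\<lambda>p U. submod_sum L U (cyclic R L (x (k + p)))) p" for k p
  have S0: "S k 0 = {\<zero>\<^bsub>L\<^esub>}" and SS: "S k (Suc p) = submod_sum L (S k p) (cyclic R L (x (k + p)))" for k p
    by (auto simp: S_def)
  have cy: "submod R L (cyclic R L (x k))" for k using submod_cyclic[OF L] Cc(1)[OF xC] by blast
  have Ssub: "submod R L (S k p)" for k p
    by (induction p) (auto simp: S0 SS submod_zero[OF L] submod_submod_sum[OF L _ cy])
  have SW: "S k p \<subseteq> W (k + p)" for k p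
  proof (induction p)
    case (Suc p)
    have "S k p \<subseteq> W (Suc (k + p))" using Suc Wm by blast
    moreover have "cyclic R L (x (k + p)) \<subseteq> W (Suc (k + p))"
      using x(1) submodD(4)[OF W(1)] by (auto simp: cyclic_def)
    ultimately show ?case using submodD(3)[OF W(1), of _ "Suc (k + p)"] by (auto simp: SS submod_sum_def)
  qed (use submodD(2)[OF W(1)] in \<open>auto simp: S0\<close>)
  have SSm: "S k p \<subseteq> S k (Suc p)" for k p using submod_sum_upper[OF L Ssub cy] SS by simp
  have shift: "S (Suc k) p \<subseteq> S k (Suc p)" for k p
  proof (induction p)
    case 0 then show ?case using submodD(2)[OF Ssub] by (auto simp: S0)
  next
    case (Suc p)
    then show ?case unfolding SS[of "Suc k"] SS[of k "Suc p"] submod_sum_def by auto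
  qed
  define D where "D k = (\<Union>p. S k p)" for k
  have "submod R L (D k)" for k unfolding D_def using submod_Union_chain[of R L "S k"] Ssub SSm by blast
  moreover have "D (Suc k) \<subseteq> D k" for k using shift by (auto simp: D_def)
  ultimately obtain k where "D (Suc k) = D k" using dccD[OF dL, of D] by (metis le_Suc_eq order_refl)
  moreover have "x k \<in> S k (Suc 0)"
    using submod_sum_upper(2)[OF L Ssub[of k 0] cy[of k]] submod_cyclic(2)[OF L Cc(1)[OF xC[of k]]] SS[of k 0] by auto
  then have "x k \<in> D k" by (auto simp: D_def)
  ultimately have ex: "\<exists>p. x k \<in> S (Suc k) p" by (auto simp: D_def)
  \<comment> \<open>With the fewest later vectors the last coefficient cannot act as zero on
    \<open>C\<close>. It is then invertible on \<open>C\<close>, and solving for the last vector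
    puts it into a term of the chain that it was chosen to avoid.\<close>
  define p where "p = (LEAST p. x k \<in> S (Suc k) p)"
  have p: "x k \<in> S (Suc k) p" "\<And>q. q < p \<Longrightarrow> x k \<notin> S (Suc k) q"
    using LeastI_ex[OF ex] not_less_Least by (auto simp: p_def)
  have "p \<noteq> 0" using p(1) x(2)[of k] submodD(2)[OF W(1)] by (auto simp: S0 intro: Nat.gr0I)
  then obtain q where q: "p = Suc q" by (cases p) auto
  then obtain u r where ur: "u \<in> S (Suc k) q" "r \<in> carrier R" "x k = u \<oplus>\<^bsub>L\<^esub> r \<odot>\<^bsub>L\<^esub> x (Suc k + q)"
    using p(1) by (auto simp: SS submod_sum_def cyclic_def)
  let ?j = "Suc k + q"
  have uc: "u \<in> carrier L" using submodD(1)[OF Ssub ur(1)] .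
  have xc: "x i \<in> carrier L" for i using Cc(1)[OF xC] .
  show False using alt[OF ur(2)]
  proof
    assume "\<forall>x\<in>C. mu r x = \<zero>\<^bsub>L\<^esub>"
    then have "x k = u" using ur(3) uc xC by (simp add: mu_def)
    then show False using p(2)[of q] q ur(1) by auto
  next
    assume "mu r ` C = C"
    then obtain r' where r': "r' \<in> carrier R" "\<And>x. x \<in> C \<Longrightarrow> r' \<odot>\<^bsub>L\<^esub> (r \<odot>\<^bsub>L\<^esub> x) = x"
      using invert[OF ur(2)] by blast
    have "r \<odot>\<^bsub>L\<^esub> x ?j = x k \<ominus>\<^bsub>L\<^esub> u"
      unfolding ur(3) using uc xc ur(2) by (simp add: L.add_diff_cancel_left L.smult_closed)
    also have "\<dots> \<in> W ?j"
    proof (rule submod_diff[OF W(1) L])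
      show "x k \<in> W ?j" using x(1)[of k] Wmono[of "Suc k" ?j] by auto
      show "u \<in> W ?j" using ur(1) SW[of "Suc k" q] by blast
    qed
    finally have "r' \<odot>\<^bsub>L\<^esub> (r \<odot>\<^bsub>L\<^esub> x ?j) \<in> W ?j" using submodD(4)[OF W(1) r'(1)] by blast
    then show False using r'(2)[OF xC] x(2) by simp
  qed
qed

section \<open>Finite algebras over artinian rings\<close>

definition res_scalars :: "('r \<Rightarrow> 'b) \<Rightarrow> ('b, 'm) module \<Rightarrow> ('r, 'm) module" where
  "res_scalars \<iota> M = \<lparr>carrier = carrier M, mult = mult M, one = one M, zero = zero M, add = add M,
     smult = (\<lambda>r x. \<iota> r \<odot>\<^bsub>M\<^esub> x)\<rparr>"

lemma res_simps [simp]: "carrier (res_scalars \<iota> M) = carrier M" "zero (res_scalars \<iota> M) = zero M"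
  "add (res_scalars \<iota> M) = add M" "smult (res_scalars \<iota> M) r x = \<iota> r \<odot>\<^bsub>M\<^esub> x"
  by (auto simp: res_scalars_def)

lemma res_minus: "x \<ominus>\<^bsub>res_scalars \<iota> M\<^esub> y = x \<ominus>\<^bsub>M\<^esub> y"
  by (simp add: a_minus_def a_inv_def m_inv_def)

lemma res_left_module:
  assumes "ring R" "\<iota> \<in> ring_hom R B" "left_module B M"
  shows "left_module R (res_scalars \<iota> M)"
proof -
  interpret R: ring R by fact
  interpret M: left_module B M by fact
  note h = ring_hom_closed[OF assms(2)] ring_hom_add[OF assms(2)] ring_hom_mult[OF assms(2)] ring_hom_one[OF assms(2)]
  have "abelian_group (res_scalars \<iota> M)"
    by (rule abelian_groupI) (auto simp: M.a_ac intro: M.l_neg)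
  then show ?thesis
    by (rule left_moduleI[OF R.ring_axioms])
      (auto simp: h M.smult_closed M.smult_l_distr M.smult_r_distr M.smult_assoc M.smult_one)
qed

lemma res_submod: "\<iota> \<in> ring_hom R B \<Longrightarrow> submod B M U \<Longrightarrow> submod R (res_scalars \<iota> M) U"
  by (auto simp: submod_def ring_hom_closed)

lemma res_hom: "\<iota> \<in> ring_hom R B \<Longrightarrow> f \<in> mod_hom B M N \<Longrightarrow> f \<in> mod_hom R (res_scalars \<iota> M) (res_scalars \<iota> N)"
  by (auto simp: mod_hom_def ring_hom_closed)

text \<open>Generators are adjoined one at a time; \<open>st W\<close> says that descending chains
  of \<open>R\<close>-submodules become stationary inside \<open>W\<close>. For a further generator
  \<open>s\<close>, the ring elements \<open>b\<close> with \<open>b s\<close> in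
  \<open>V k + W\<close> form a descending chain of \<open>R\<close>-submodules of \<open>B\<close>.
  Once this chain and the intersections with \<open>W\<close> are constant, so are the intersections
  with \<open>W + B s\<close>.\<close>

lemma dcc_fg:
  assumes R: "ring R" and i: "\<iota> \<in> ring_hom R B" and M: "fg_left_module B M"
    and d: "dcc R (res_scalars \<iota> (reg_module B))"
  shows "dcc R (res_scalars \<iota> M)"
proof -
  obtain S where S: "finite S" "S \<subseteq> carrier M" "\<And>U. submod B M U \<Longrightarrow> S \<subseteq> U \<Longrightarrow> U = carrier M"
    using M unfolding fg_iff by auto
  have lM: "left_module B M" using M by auto
  interpret R: ring R by fact
  interpret M: left_module B M by fact
  let ?M = "res_scalars \<iota> M"
  have RM: "left_module R ?M" using res_left_module[OF R i lM] .
  note ic = ring_hom_closed[OF i]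
  define st where "st W \<longleftrightarrow> (\<forall>V :: nat \<Rightarrow> _. (\<forall>k. submod R ?M (V k)) \<and> (\<forall>k. V (Suc k) \<subseteq> V k) \<longrightarrow>
     (\<exists>m. \<forall>k\<ge>m. V k \<inter> W = V m \<inter> W))" for W
  have "\<exists>W. submod B M W \<and> T \<subseteq> W \<and> st W" if "finite T" "T \<subseteq> carrier M" for T
    using that
  proof induction
    case empty
    have "V \<inter> {\<zero>\<^bsub>M\<^esub>} = {\<zero>\<^bsub>M\<^esub>}" if "submod R ?M V" for V
      using submodD(2)[OF that] by auto
    then have "st {\<zero>\<^bsub>M\<^esub>}" unfolding st_def by auto
    then show ?case using submod_zero[OF lM] by blast
  next
    case (insert s T)
    then obtain W where W: "submod B M W" "T \<subseteq> W" "st W" by auto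
    have s: "s \<in> carrier M" using insert by auto
    note w = submodD[OF W(1)]
    let ?W = "submod_sum M W (cyclic B M s)"
    have "st ?W" unfolding st_def
    proof (intro allI impI, elim conjE)
      fix V assume V: "\<forall>k. submod R ?M (V k)" "\<forall>k. V (Suc k) \<subseteq> V k"
      have v: "x \<in> V k \<Longrightarrow> x \<in> carrier M" "\<zero>\<^bsub>M\<^esub> \<in> V k" "x \<in> V k \<Longrightarrow> y \<in> V k \<Longrightarrow> x \<oplus>\<^bsub>M\<^esub> y \<in> V k"
        "r \<in> carrier R \<Longrightarrow> x \<in> V k \<Longrightarrow> \<iota> r \<odot>\<^bsub>M\<^esub> x \<in> V k" for x y k r
        using V(1) unfolding submod_def by auto
      have anti: "V k \<subseteq> V m" if "m \<le> k" for m k using V(2) that lift_Suc_antimono_le[of V m k] by simp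
      define C where "C k = {b \<in> carrier B. \<exists>x\<in>V k. \<exists>w\<in>W. b \<odot>\<^bsub>M\<^esub> s = x \<oplus>\<^bsub>M\<^esub> w}" for k
      have "submod R (res_scalars \<iota> (reg_module B)) (C k)" for k
      proof (rule submodI)
        have "\<zero>\<^bsub>B\<^esub> \<odot>\<^bsub>M\<^esub> s = \<zero>\<^bsub>M\<^esub> \<oplus>\<^bsub>M\<^esub> \<zero>\<^bsub>M\<^esub>" using s by simp
        then show "\<zero>\<^bsub>res_scalars \<iota> (reg_module B)\<^esub> \<in> C k"
          using v(2)[of k] w(2) M.B.zero_closed unfolding C_def reg_simps res_simps by blast
      next
        fix b c assume "b \<in> C k" "c \<in> C k"
        then obtain x y w' z where xy: "b \<in> carrier B" "c \<in> carrier B" "x \<in> V k" "y \<in> V k" "w' \<in> W" "z \<in> W"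
          "b \<odot>\<^bsub>M\<^esub> s = x \<oplus>\<^bsub>M\<^esub> w'" "c \<odot>\<^bsub>M\<^esub> s = y \<oplus>\<^bsub>M\<^esub> z" by (auto simp: C_def)
        then have "(b \<oplus>\<^bsub>B\<^esub> c) \<odot>\<^bsub>M\<^esub> s = (x \<oplus>\<^bsub>M\<^esub> y) \<oplus>\<^bsub>M\<^esub> (w' \<oplus>\<^bsub>M\<^esub> z)"
          using v(1) w(1) s by (simp add: M.smult_l_distr M.a_ac)
        then show "b \<oplus>\<^bsub>res_scalars \<iota> (reg_module B)\<^esub> c \<in> C k"
          using xy(1,2) v(3)[OF xy(3,4)] w(3)[OF xy(5,6)] M.B.a_closed unfolding C_def reg_simps res_simps
          by blast
      next
        fix r b assume r: "r \<in> carrier R" and "b \<in> C k"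
        then obtain x z where xz: "b \<in> carrier B" "x \<in> V k" "z \<in> W" "b \<odot>\<^bsub>M\<^esub> s = x \<oplus>\<^bsub>M\<^esub> z" by (auto simp: C_def)
        then have "(\<iota> r \<otimes>\<^bsub>B\<^esub> b) \<odot>\<^bsub>M\<^esub> s = \<iota> r \<odot>\<^bsub>M\<^esub> x \<oplus>\<^bsub>M\<^esub> \<iota> r \<odot>\<^bsub>M\<^esub> z"
          using v(1)[OF xz(2)] w(1)[OF xz(3)] s ic[OF r] by (simp add: M.smult_assoc M.smult_r_distr)
        then show "r \<odot>\<^bsub>res_scalars \<iota> (reg_module B)\<^esub> b \<in> C k"
          using v(4)[OF r xz(2)] w(4)[OF ic[OF r] xz(3)] ic[OF r] xz(1) unfolding C_def by auto
      qed (auto simp: C_def)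
      moreover have "C (Suc k) \<subseteq> C k" for k using V(2) unfolding C_def by blast
      ultimately obtain m1 where m1: "\<And>k. k \<ge> m1 \<Longrightarrow> C k = C m1" using dccD[OF d, of C] by auto
      obtain m2 where m2: "\<And>k. k \<ge> m2 \<Longrightarrow> V k \<inter> W = V m2 \<inter> W" using W(3) V unfolding st_def by blast
      define m where "m = max m1 m2"
      have "V m \<inter> ?W \<subseteq> V k" if k: "k \<ge> m" for k
      proof
        fix x assume "x \<in> V m \<inter> ?W"
        then obtain z b where x: "x \<in> V m" "z \<in> W" "b \<in> carrier B" "x = z \<oplus>\<^bsub>M\<^esub> b \<odot>\<^bsub>M\<^esub> s"
          by (auto simp: submod_sum_def cyclic_def)
        have zc: "z \<in> carrier M" "b \<odot>\<^bsub>M\<^esub> s \<in> carrier M" using x w(1) s M.smult_closed by auto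
        have "b \<odot>\<^bsub>M\<^esub> s = x \<oplus>\<^bsub>M\<^esub> (\<ominus>\<^bsub>M\<^esub> z)"
          unfolding x(4) using zc by (metis M.a_inv_closed M.a_lcomm M.a_comm M.a_closed M.r_neg M.r_zero)
        then have "b \<in> C m" using x submod_minus[OF W(1) lM x(2)] unfolding C_def by blast
        then have "b \<in> C k" using m1[of m] m1[of k] k by (auto simp: m_def)
        then obtain v' z' where v': "v' \<in> V k" "z' \<in> W" "b \<odot>\<^bsub>M\<^esub> s = v' \<oplus>\<^bsub>M\<^esub> z'" by (auto simp: C_def)
        have c: "v' \<in> carrier M" "z' \<in> carrier M" "x \<in> carrier M" using v' v(1) w(1) x(1) by auto
        have "x = (z \<oplus>\<^bsub>M\<^esub> z') \<oplus>\<^bsub>M\<^esub> v'" unfolding x(4) v'(3) using c zc by (simp add: M.a_ac)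
        then have xv: "x \<ominus>\<^bsub>M\<^esub> v' = z \<oplus>\<^bsub>M\<^esub> z'" using c zc by (simp add: a_minus_def M.a_assoc M.r_neg)
        have "v' \<in> V m" using v'(1) anti[OF k] by auto
        then have "x \<ominus>\<^bsub>M\<^esub> v' \<in> V m"
          using submod_diff[OF V(1)[rule_format] RM x(1)] by (simp add: res_minus)
        then have "x \<ominus>\<^bsub>M\<^esub> v' \<in> V m \<inter> W" using xv w(3)[OF x(2) v'(2)] by auto
        also have "\<dots> = V k \<inter> W" using m2[of m] m2[of k] k by (auto simp: m_def)
        finally have "(x \<ominus>\<^bsub>M\<^esub> v') \<oplus>\<^bsub>M\<^esub> v' \<in> V k" using v(3) v'(1) by auto
        then show "x \<in> V k" using c by (simp add: a_minus_def M.a_assoc M.l_neg)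
      qed
      then have "V k \<inter> ?W = V m \<inter> ?W" if "k \<ge> m" for k using anti[OF that] that by auto
      then show "\<exists>m. \<forall>k\<ge>m. V k \<inter> ?W = V m \<inter> ?W" by blast
    qed
    moreover have "submod B M ?W" "insert s T \<subseteq> ?W"
      using submod_submod_sum[OF lM W(1)] submod_cyclic[OF lM s] submod_sum_upper[OF lM W(1)] W(2) by blast+
    ultimately show ?case by blast
  qed
  from this[OF S(1,2)] obtain W where W: "submod B M W" "S \<subseteq> W" "st W" by auto
  then have "W = carrier M" using S(3) by auto
  then have "V k \<inter> W = V k" if "submod R ?M (V k)" for V k using submodD(1)[OF that] by auto
  then show ?thesis using W(3) unfolding dcc_def st_def by metis
qed

text \<open>Artin algebras in the form in which they are used: finite generation over
  \<open>R\<close> is replaced by the descending chain condition, which is easily checked for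
  \<open>A\<close> and for the triangular ring alike.\<close>

locale fin_alg = R: cring R + B: ring B for R :: "('r, 'c) ring_scheme" and B :: "('b, 'd) ring_scheme" and \<iota> +
  assumes artinian: "dcc R (reg_module R)" and hom: "\<iota> \<in> ring_hom R B"
    and dcc_reg: "dcc R (res_scalars \<iota> (reg_module B))"
    and central: "\<And>r b. r \<in> carrier R \<Longrightarrow> b \<in> carrier B \<Longrightarrow> \<iota> r \<otimes>\<^bsub>B\<^esub> b = b \<otimes>\<^bsub>B\<^esub> \<iota> r"
begin

lemma res_lm: "left_module B M \<Longrightarrow> left_module R (res_scalars \<iota> M)"
  using res_left_module[OF R.ring_axioms hom] .

text \<open>Among the submodules generated by finite sets there is a maximal one, and adjoining a
  further element does not enlarge it. \<open>H S\<close> is the submodule generated by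
  \<open>S\<close>.\<close>

lemma acc_imp_fg:
  assumes M: "left_module B M" and a: "acc R (res_scalars \<iota> M)"
  shows "fg_left_module B M"
proof -
  define H where "H S = \<Inter>{U. submod B M U \<and> S \<subseteq> U}" for S
  have H: "submod B M (H S)" "S \<subseteq> H S" if "S \<subseteq> carrier M" for S
  proof -
    have "carrier M \<in> {U. submod B M U \<and> S \<subseteq> U}" using that submod_carrier[OF M] by auto
    then show "submod B M (H S)" unfolding H_def
      by (intro submodI) (auto simp: submod_def)
    show "S \<subseteq> H S" by (auto simp: H_def)
  qed
  have "\<exists>U\<in>{H S | S. finite S \<and> S \<subseteq> carrier M}. \<forall>V\<in>{H S | S. finite S \<and> S \<subseteq> carrier M}. U \<subseteq> V \<longrightarrow> V = U"
  proof (rule acc_maximal[OF a])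
    show "submod R (res_scalars \<iota> M) U" if "U \<in> {H S | S. finite S \<and> S \<subseteq> carrier M}" for U
      using that H(1) res_submod[OF hom] by auto
  qed blast
  then obtain U where "U \<in> {H S | S. finite S \<and> S \<subseteq> carrier M}"
    and mU: "\<forall>V\<in>{H S | S. finite S \<and> S \<subseteq> carrier M}. U \<subseteq> V \<longrightarrow> V = U" ..
  then obtain S where S: "finite S" "S \<subseteq> carrier M" "U = H S" by auto
  have mx: "H T = H S" if "finite T" "T \<subseteq> carrier M" "H S \<subseteq> H T" for T
    using mU that unfolding S(3) by auto
  have "U = carrier M" if U: "submod B M U" "S \<subseteq> U" for U
  proof
    show "carrier M \<subseteq> U"
    proof
      fix x assume x: "x \<in> carrier M"
      have "H S \<subseteq> H (insert x S)" unfolding H_def by auto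
      then have "H (insert x S) = H S" using mx[of "insert x S"] S x by auto
      then have "x \<in> H S" using H(2)[of "insert x S"] S x by auto
      then show "x \<in> U" using U by (auto simp: H_def)
    qed
  qed (use submodD(1)[OF U(1)] in auto)
  then show ?thesis using S M unfolding fg_iff by auto
qed

text \<open>Over \<open>R\<close> the descending condition implies the ascending one. Finite
  generation thus passes to submodules, and it becomes comparable for modules over different
  algebras.\<close>

lemma fg_iff_dcc: "fg_left_module B M \<longleftrightarrow> left_module B M \<and> dcc R (res_scalars \<iota> M)"
  using acc_imp_fg dcc_imp_acc_comm[OF R.is_cring artinian res_lm] dcc_fg[OF R.ring_axioms hom _ dcc_reg]
  by blast

lemma fg_acc: "fg_left_module B M \<Longrightarrow> acc R (res_scalars \<iota> M)"
  using fg_iff_dcc dcc_imp_acc_comm[OF R.is_cring artinian res_lm] by blast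

lemma fg_mono:
  "mod_mono B M N f \<Longrightarrow> left_module B M \<Longrightarrow> fg_left_module B N \<Longrightarrow> fg_left_module B M"
  using dcc_mono[of R "res_scalars \<iota> M" "res_scalars \<iota> N" f] res_hom[OF hom, of f M N]
    res_lm[of M] res_lm[of N] unfolding fg_iff_dcc mod_mono_def by auto

lemma fg_epi:
  "mod_epi B M N f \<Longrightarrow> fg_left_module B M \<Longrightarrow> left_module B N \<Longrightarrow> fg_left_module B N"
  using dcc_epi[of R "res_scalars \<iota> M" "res_scalars \<iota> N" f] res_hom[OF hom, of f M N]
    res_lm[of M] res_lm[of N] unfolding fg_iff_dcc mod_epi_def by auto

lemma fg_sub: "fg_left_module B M \<Longrightarrow> submod B M U \<Longrightarrow> fg_left_module B (sub_module M U)"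
  using fg_mono[OF sub_incl_mono] left_module_sub by (metis fg_left_moduleD submod_def)

lemma submod_acc_maximal:
  assumes "fg_left_module B M" "\<C> \<noteq> {}" "\<And>U. U \<in> \<C> \<Longrightarrow> submod B M U"
  shows "\<exists>U\<in>\<C>. \<forall>V\<in>\<C>. U \<subseteq> V \<longrightarrow> V = U"
  using acc_maximal[OF fg_acc[OF assms(1)] assms(2)] res_submod[OF hom] assms(3) by blast

lemma submod_dcc_minimal:
  assumes "fg_left_module B M" "\<C> \<noteq> {}" "\<And>U. U \<in> \<C> \<Longrightarrow> submod B M U"
  shows "\<exists>U\<in>\<C>. \<forall>V\<in>\<C>. V \<subseteq> U \<longrightarrow> V = U"
proof (rule dcc_minimal[OF _ assms(2)])
  show "dcc R (res_scalars \<iota> M)" using assms(1) fg_iff_dcc by auto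
  show "submod R (res_scalars \<iota> M) U" if "U \<in> \<C>" for U using assms(3)[OF that] res_submod[OF hom] by blast
qed

end

lemma fin_algI:
  assumes "artin_algebra R A \<iota>" shows "fin_alg R A \<iota>"
proof -
  interpret R: cring R using assms by (auto simp: artin_algebra_def artinian_cring_def)
  interpret A: ring A using assms by (auto simp: artin_algebra_def)
  have i: "\<iota> \<in> ring_hom R A" using assms by (auto simp: artin_algebra_def)
  have dR: "dcc R (reg_module R)" unfolding dcc_def
  proof (intro allI impI, elim conjE)
    fix V assume V: "\<forall>k. submod R (reg_module R) (V k)" "\<forall>k. V (Suc k) \<subseteq> V k"
    have "ideal (V k) R" for k
    proof (rule idealI[OF R.ring_axioms])
      note v = submodD[OF V(1)[rule_format, of k]]
      show "subgroup (V k) (add_monoid R)"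
      proof (rule R.add.subgroupI)
        show "\<ominus>\<^bsub>R\<^esub> a \<in> V k" if "a \<in> V k" for a
          using v(4)[of "\<ominus>\<^bsub>R\<^esub> \<one>\<^bsub>R\<^esub>" a] v(1)[OF that] that by (simp add: R.l_minus)
      qed (use v in auto)
      show "x \<otimes>\<^bsub>R\<^esub> a \<in> V k" "a \<otimes>\<^bsub>R\<^esub> x \<in> V k" if "a \<in> V k" "x \<in> carrier R" for a x
        using that v(1)[OF that(1)] v(4)[OF that(2,1)] by (auto simp: R.m_comm)
    qed
    then show "\<exists>m. \<forall>k\<ge>m. V k = V m"
      using assms V(2) unfolding artin_algebra_def artinian_cring_def by blast
  qed
  \<comment> \<open>To get the chain condition for \<open>A\<close>, the ring \<open>R\<close> is
    regarded as an algebra over itself and \<open>A\<close> as one of its finitely generated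
    modules.\<close>
  have id: "(\<lambda>x. x) \<in> ring_hom R R" by (auto simp: ring_hom_def)
  have rr: "res_scalars (\<lambda>x. x) M = M" for M :: "('x, 'y) module" by (simp add: res_scalars_def)
  have "fg_left_module R (res_scalars \<iota> (reg_module A))"
    using assms unfolding artin_algebra_def by (simp add: res_scalars_def reg_module_def)
  from dcc_fg[OF R.ring_axioms id this] dR have "dcc R (res_scalars \<iota> (reg_module A))"
    by (simp add: rr)
  then show ?thesis using dR i assms unfolding artin_algebra_def
    by (intro fin_alg.intro fin_alg_axioms.intro R.is_cring A.ring_axioms) auto
qed

section \<open>Quotients and closure under isomorphism\<close>

lemma quot_module_hom:
  assumes M: "left_module B M" and U: "submod B M U"
  shows "(\<lambda>x. U +>\<^bsub>M\<^esub> x) \<in> mod_hom B M (quot_module M U)"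
    and "(\<lambda>x. U +>\<^bsub>M\<^esub> x) ` carrier M = carrier (quot_module M U)"
    and "left_module B (quot_module M U)"
    and "\<And>x. x \<in> carrier M \<Longrightarrow> U +>\<^bsub>M\<^esub> x = \<zero>\<^bsub>quot_module M U\<^esub> \<longleftrightarrow> x \<in> U"
proof -
  interpret M: left_module B M by fact
  note u = submodD[OF U]
  have sg: "subgroup U (add_monoid M)"
    by (rule M.add.subgroupI) (use u submod_minus[OF U M] in auto)
  then interpret U: abelian_subgroup U M
    by (intro abelian_subgroupI3 additive_subgroup.intro M.abelian_group_axioms)
  \<comment> \<open>The scalar action on cosets is a union over representatives; every member of the
    union is the same coset.\<close>
  have sm: "(\<Union>v\<in>U +>\<^bsub>M\<^esub> x. U +>\<^bsub>M\<^esub> (a \<odot>\<^bsub>M\<^esub> v)) = U +>\<^bsub>M\<^esub> (a \<odot>\<^bsub>M\<^esub> x)"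
    if a: "a \<in> carrier B" and x: "x \<in> carrier M" for a x
  proof -
    have "U +>\<^bsub>M\<^esub> (a \<odot>\<^bsub>M\<^esub> v) = U +>\<^bsub>M\<^esub> (a \<odot>\<^bsub>M\<^esub> x)" if v: "v \<in> U +>\<^bsub>M\<^esub> x" for v
    proof -
      obtain w where w: "w \<in> U" "v = w \<oplus>\<^bsub>M\<^esub> x" using v by (auto simp: a_r_coset_def')
      then have "a \<odot>\<^bsub>M\<^esub> v \<in> U +>\<^bsub>M\<^esub> (a \<odot>\<^bsub>M\<^esub> x)"
        using u(1)[OF w(1)] u(4)[OF a w(1)] a x by (auto simp: a_r_coset_def' M.smult_r_distr)
      then show ?thesis using M.a_repr_independence[OF _ M.smult_closed[OF a x] sg] by simp
    qed
    moreover have "x \<in> U +>\<^bsub>M\<^esub> x" using U.a_rcos_self[OF x] .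
    ultimately show ?thesis by blast
  qed
  show h: "(\<lambda>x. U +>\<^bsub>M\<^esub> x) \<in> mod_hom B M (quot_module M U)"
    by (rule mod_homI) (auto simp: quot_module_def U.a_rcos_sum sm u(1) intro!: M.a_rcosetsI)
  show s: "(\<lambda>x. U +>\<^bsub>M\<^esub> x) ` carrier M = carrier (quot_module M U)"
    by (auto simp: quot_module_def A_RCOSETS_def')
  show z: "U +>\<^bsub>M\<^esub> x = \<zero>\<^bsub>quot_module M U\<^esub> \<longleftrightarrow> x \<in> U" if x: "x \<in> carrier M" for x
    using M.a_coset_join1[OF _ x sg] M.a_coset_join2[OF x sg] by (auto simp: quot_module_def)
  show "left_module B (quot_module M U)"
    using left_module_image[OF M h s] z[of "\<zero>\<^bsub>M\<^esub>"] u(2) by simp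
qed

lemma epi_same_kernel_iso:
  assumes q: "mod_epi B M N q" and q': "mod_epi B M N' q'"
    and M: "left_module B M" and N: "left_module B N" and N': "left_module B N'"
    and k: "\<And>x. x \<in> carrier M \<Longrightarrow> q x = \<zero>\<^bsub>N\<^esub> \<longleftrightarrow> q' x = \<zero>\<^bsub>N'\<^esub>"
  shows "isomorphic_mods B N N'"
proof -
  obtain f where f: "f \<in> mod_hom B N N'" "\<And>x. x \<in> carrier M \<Longrightarrow> f (q x) = q' x"
    using epi_factor[OF q mod_epiD(1)[OF q'] M N N'] k by auto
  have "inj_on f (carrier N)"
    unfolding hom_inj_iff[OF f(1) N N'] using mod_epi_surj[OF q] f(2) k by metis
  moreover have "carrier N' \<subseteq> f ` carrier N"
  proof
    fix y assume "y \<in> carrier N'"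
    then obtain x where "x \<in> carrier M" "q' x = y" using mod_epi_surj[OF q'] by blast
    then show "y \<in> f ` carrier N" using f(2) hom_closed[OF mod_epiD(1)[OF q]] by (metis imageI)
  qed
  ultimately have "mod_iso B N N' f" using f(1) mod_isoI by blast
  then show ?thesis unfolding isomorphic_mods_def by blast
qed

text \<open>From here on a cokernel is an epimorphism with prescribed kernel, and cosets disappear
  from the arguments.\<close>

lemma isomorphic_coker_iff:
  assumes M: "left_module B M" and N: "left_module B N" and C: "left_module B C" and f: "f \<in> mod_hom B M N"
  shows "isomorphic_mods B C (coker_module M N f) \<longleftrightarrow>
    (\<exists>q. mod_epi B N C q \<and> (\<forall>x\<in>carrier N. q x = \<zero>\<^bsub>C\<^esub> \<longleftrightarrow> x \<in> f ` carrier M))"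
proof -
  let ?U = "f ` carrier M" and ?Q = "coker_module M N f"
  have U: "submod B N ?U" using submod_image[OF f M N submod_carrier[OF M]] .
  note Q = quot_module_hom[OF N U, folded coker_module_def]
  have p: "mod_epi B N ?Q (\<lambda>x. ?U +>\<^bsub>N\<^esub> x)" using Q(1,2) by (simp add: mod_epi_def)
  show ?thesis
  proof
    assume "isomorphic_mods B C ?Q"
    then obtain h where h: "mod_iso B ?Q C h" using isomorphic_mods_sym[OF _ C] by (auto simp: isomorphic_mods_def)
    let ?q = "\<lambda>x. h (?U +>\<^bsub>N\<^esub> x)"
    have "mod_epi B N C ?q" using mod_epi_comp[OF p mod_iso_epi[OF h]] .
    moreover have "?q x = \<zero>\<^bsub>C\<^esub> \<longleftrightarrow> x \<in> ?U" if "x \<in> carrier N" for x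
    proof -
      have "(h (?U +>\<^bsub>N\<^esub> x) = \<zero>\<^bsub>C\<^esub>) = (?U +>\<^bsub>N\<^esub> x = \<zero>\<^bsub>?Q\<^esub>)"
        using mod_isoD(1,2)[OF h] hom_inj_iff[OF mod_isoD(1)[OF h] Q(3) C] hom_zero[OF mod_isoD(1)[OF h] Q(3) C]
          hom_closed[OF Q(1) that] by auto
      then show ?thesis using Q(4)[OF that] by simp
    qed
    ultimately show "\<exists>q. mod_epi B N C q \<and> (\<forall>x\<in>carrier N. q x = \<zero>\<^bsub>C\<^esub> \<longleftrightarrow> x \<in> ?U)" by blast
  next
    assume "\<exists>q. mod_epi B N C q \<and> (\<forall>x\<in>carrier N. q x = \<zero>\<^bsub>C\<^esub> \<longleftrightarrow> x \<in> ?U)"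
    then obtain q where q: "mod_epi B N C q" "\<forall>x\<in>carrier N. q x = \<zero>\<^bsub>C\<^esub> \<longleftrightarrow> x \<in> ?U" by blast
    show "isomorphic_mods B C ?Q" by (rule epi_same_kernel_iso[OF q(1) p N C Q(3)]) (simp add: Q(4) q(2))
  qed
qed

lemma fg_rep:
  assumes "fg_left_module B M"
  shows "\<exists>N f. N \<in> fg_mods B \<and> mod_iso B M N f"
  using fg_left_module_representative[OF assms] by (auto simp: isomorphic_mods_def)

lemma fg_iso:
  assumes M: "fg_left_module B M" and f: "mod_iso B M N f" and N: "left_module B N"
  shows "fg_left_module B N"
proof -
  have lM: "left_module B M" using M by auto
  obtain S where S: "finite S" "S \<subseteq> carrier M" "\<And>U. submod B M U \<Longrightarrow> S \<subseteq> U \<Longrightarrow> U = carrier M"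
    using M unfolding fg_iff by auto
  note f' = mod_isoD[OF f]
  have "V = carrier N" if V: "submod B N V" "f ` S \<subseteq> V" for V
  proof -
    have "{x \<in> carrier M. f x \<in> V} = carrier M"
      using S(2) V(2) by (intro S(3) submod_vimage[OF f'(1) lM N V(1)]) auto
    then have "carrier N \<subseteq> V" unfolding f'(3)[symmetric] by auto
    then show ?thesis using submodD(1)[OF V(1)] by auto
  qed
  moreover have "finite (f ` S)" "f ` S \<subseteq> carrier N" using S f' by auto
  ultimately show ?thesis using N unfolding fg_iff by blast
qed

section \<open>Membership up to isomorphism, for arbitrary carriers\<close>

text \<open>Extends membership to modules whose carriers have another type; on finitely generated
  modules of the fixed type it is plain membership, see \<open>in_cat_mem\<close>. The module axioms
  are listed separately because \<open>mod_iso\<close> does not constrain the zero of the target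
  record.\<close>

definition in_cat :: "('b, 'c) ring_scheme \<Rightarrow> 'b fgmod set \<Rightarrow> ('b, 'm) module \<Rightarrow> bool" where
  "in_cat B \<Y> M \<longleftrightarrow> left_module B M \<and> (\<exists>N\<in>\<Y>. isomorphic_mods B N M)"

lemma in_cat_self: "full_subcategory B \<Y> \<Longrightarrow> M \<in> \<Y> \<Longrightarrow> in_cat B \<Y> M"
  unfolding in_cat_def full_subcategory_def using isomorphic_mods_refl[of B M] by blast

lemma in_cat_mem: "full_subcategory B \<Y> \<Longrightarrow> M \<in> fg_mods B \<Longrightarrow> in_cat B \<Y> M \<longleftrightarrow> M \<in> \<Y>"
  using in_cat_self by (auto simp: in_cat_def full_subcategory_def)

lemma in_cat_fg: "full_subcategory B \<Y> \<Longrightarrow> in_cat B \<Y> M \<Longrightarrow> fg_left_module B M"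
  unfolding in_cat_def full_subcategory_def isomorphic_mods_def using fg_iso by blast

lemma in_cat_iso:
  "in_cat B \<Y> M \<Longrightarrow> mod_iso B M N f \<Longrightarrow> left_module B N \<Longrightarrow> in_cat B \<Y> N"
  unfolding in_cat_def isomorphic_mods_def using mod_iso_comp by blast

lemma in_cat_iso':
  assumes "in_cat B \<Y> N" "mod_iso B M N f" "left_module B M"
  shows "in_cat B \<Y> M"
  using mod_iso_inv[OF assms(2,3)] in_cat_iso[OF assms(1) _ assms(3)] by blast

lemma in_cat_rep:
  assumes "full_subcategory B \<Y>" "in_cat B \<Y> M"
  shows "\<exists>N f. N \<in> \<Y> \<and> left_module B N \<and> mod_iso B M N f"
proof -
  obtain N g where N: "N \<in> \<Y>" "mod_iso B N M g" using assms(2) by (auto simp: in_cat_def isomorphic_mods_def)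
  then have "left_module B N" using assms(1) by (auto simp: full_subcategory_def)
  then show ?thesis using mod_iso_inv[OF N(2)] N(1) by blast
qed

lemma short_exactI:
  assumes "mod_mono B K L f" "mod_epi B L M g"
    and "\<And>y. y \<in> carrier L \<Longrightarrow> g y = \<zero>\<^bsub>M\<^esub> \<Longrightarrow> \<exists>x\<in>carrier K. y = f x"
    and "\<And>x. x \<in> carrier K \<Longrightarrow> g (f x) = \<zero>\<^bsub>M\<^esub>"
  shows "short_exact B K L M f g"
  using assms hom_closed[OF mod_monoD(1)[OF assms(1)]]
  unfolding short_exact_def a_kernel_eq by auto

lemma short_exactD:
  assumes "short_exact B K L M f g"
  shows "mod_mono B K L f" "mod_epi B L M g" "f \<in> mod_hom B K L" "g \<in> mod_hom B L M"
    and "y \<in> carrier L \<Longrightarrow> g y = \<zero>\<^bsub>M\<^esub> \<Longrightarrow> \<exists>x\<in>carrier K. y = f x"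
    and "x \<in> carrier K \<Longrightarrow> g (f x) = \<zero>\<^bsub>M\<^esub>"
  using assms unfolding short_exact_def a_kernel_eq mod_mono_def mod_epi_def by auto

lemma short_exact_transport:
  assumes e: "short_exact B K L M f g"
    and k: "mod_iso B K K' k" and l: "mod_iso B L L' l" and m: "mod_iso B M M' m"
    and K: "left_module B K" and L: "left_module B L" and M: "left_module B M" and M': "left_module B M'"
  shows "\<exists>f' g'. short_exact B K' L' M' f' g'"
proof -
  note e' = short_exactD[OF e]
  obtain k' where k': "mod_iso B K' K k'" "\<And>x. x \<in> carrier K \<Longrightarrow> k' (k x) = x" "\<And>x. x \<in> carrier K' \<Longrightarrow> k (k' x) = x"
    using mod_iso_inv[OF k K] by blast
  obtain l' where l': "mod_iso B L' L l'" "\<And>x. x \<in> carrier L \<Longrightarrow> l' (l x) = x" "\<And>x. x \<in> carrier L' \<Longrightarrow> l (l' x) = x"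
    using mod_iso_inv[OF l L] by blast
  note kc = hom_closed[OF mod_isoD(1)[OF k]] hom_closed[OF mod_isoD(1)[OF k'(1)]]
    and lc = hom_closed[OF mod_isoD(1)[OF l]] hom_closed[OF mod_isoD(1)[OF l'(1)]]
    and fc = hom_closed[OF e'(3)] and gc = hom_closed[OF e'(4)]
  have mz: "m \<zero>\<^bsub>M\<^esub> = \<zero>\<^bsub>M'\<^esub>" using hom_zero[OF mod_isoD(1)[OF m] M M'] .
  have mi: "x = \<zero>\<^bsub>M\<^esub>" if "x \<in> carrier M" "m x = \<zero>\<^bsub>M'\<^esub>" for x
    using that mod_isoD(2)[OF m] hom_inj_iff[OF mod_isoD(1)[OF m] M M'] by auto
  have "short_exact B K' L' M' (\<lambda>x. l (f (k' x))) (\<lambda>x. m (g (l' x)))"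
  proof (rule short_exactI)
    have "inj_on f (carrier K)" using mod_monoD(2)[OF e'(1)] .
    then have "inj_on (\<lambda>x. l (f (k' x))) (carrier K')"
      using mod_isoD(2)[OF l] mod_isoD(2)[OF k'(1)] kc fc by (simp add: inj_on_def)
    then show "mod_mono B K' L' (\<lambda>x. l (f (k' x)))"
      using hom_comp[OF hom_comp[OF mod_isoD(1)[OF k'(1)] e'(3)] mod_isoD(1)[OF l]] by (simp add: mod_mono_def)
    show "mod_epi B L' M' (\<lambda>x. m (g (l' x)))"
      using mod_epi_comp[OF mod_epi_comp[OF mod_iso_epi[OF l'(1)] e'(2)] mod_iso_epi[OF m]] .
  next
    fix y assume y: "y \<in> carrier L'" "m (g (l' y)) = \<zero>\<^bsub>M'\<^esub>"
    then have "g (l' y) = \<zero>\<^bsub>M\<^esub>" using mi lc gc by auto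
    then obtain x where x: "x \<in> carrier K" "l' y = f x" using e'(5) lc(2)[OF y(1)] by blast
    then have "y = l (f (k' (k x)))" using l'(3)[OF y(1)] k'(2)[OF x(1)] by simp
    then show "\<exists>x\<in>carrier K'. y = l (f (k' x))" using kc(1)[OF x(1)] by auto
  next
    fix x assume "x \<in> carrier K'"
    then show "m (g (l' (l (f (k' x))))) = \<zero>\<^bsub>M'\<^esub>" using l'(2) kc fc e'(6) mz by simp
  qed
  then show ?thesis by blast
qed

lemma resolving_full: "resolving B \<Y> \<Longrightarrow> full_subcategory B \<Y>"
  by (simp add: resolving_def)

text \<open>The sequence is moved to representatives with carriers of the fixed type, where the
  definition of \<open>resolving\<close> applies.\<close>

lemma resolving_ext:
  assumes Y: "resolving B \<Y>" and e: "short_exact B K L M f g" and L: "fg_left_module B L"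
    and K: "in_cat B \<Y> K" and M: "in_cat B \<Y> M"
  shows "in_cat B \<Y> L"
proof -
  note full = resolving_full[OF Y]
  obtain K' k where K': "K' \<in> \<Y>" "left_module B K'" "mod_iso B K K' k" using in_cat_rep[OF full K] by blast
  obtain M' m where M': "M' \<in> \<Y>" "left_module B M'" "mod_iso B M M' m" using in_cat_rep[OF full M] by blast
  obtain L' l where L': "L' \<in> fg_mods B" "mod_iso B L L' l" using fg_rep[OF L] by blast
  have lm: "left_module B K" "left_module B L" "left_module B M" using K L M by (auto simp: in_cat_def)
  obtain f' g' where "short_exact B K' L' M' f' g'"
    using short_exact_transport[OF e K'(3) L'(2) M'(3) lm M'(2)] by blast
  then have "L' \<in> \<Y>" using Y K'(1) M'(1) L'(1) unfolding resolving_def by blast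
  then show ?thesis using in_cat_iso'[OF in_cat_self[OF full] L'(2) lm(2)] by blast
qed

lemma resolving_ker:
  assumes Y: "resolving B \<Y>" and e: "short_exact B K L M f g" and K: "fg_left_module B K"
    and L: "in_cat B \<Y> L" and M: "in_cat B \<Y> M"
  shows "in_cat B \<Y> K"
proof -
  note full = resolving_full[OF Y]
  obtain L' l where L': "L' \<in> \<Y>" "left_module B L'" "mod_iso B L L' l" using in_cat_rep[OF full L] by blast
  obtain M' m where M': "M' \<in> \<Y>" "left_module B M'" "mod_iso B M M' m" using in_cat_rep[OF full M] by blast
  obtain K' k where K': "K' \<in> fg_mods B" "mod_iso B K K' k" using fg_rep[OF K] by blast
  have lm: "left_module B K" "left_module B L" "left_module B M" using K L M by (auto simp: in_cat_def)
  obtain f' g' where "short_exact B K' L' M' f' g'"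
    using short_exact_transport[OF e K'(2) L'(3) M'(3) lm M'(2)] by blast
  then have "K' \<in> \<Y>" using Y L'(1) M'(1) K'(1) unfolding resolving_def by blast
  then show ?thesis using in_cat_iso'[OF in_cat_self[OF full] K'(2) lm(1)] by blast
qed

lemma kernel_short_exact:
  assumes g: "mod_epi B L M g" and L: "left_module B L" and M: "left_module B M"
  shows "short_exact B (sub_module L {x \<in> carrier L. g x = \<zero>\<^bsub>M\<^esub>}) L M (\<lambda>x. x) g"
  by (rule short_exactI[OF sub_incl_mono g]) auto

lemma mod_sum_simps [simp]: "carrier (mod_sum M N) = carrier M \<times> carrier N"
  "\<zero>\<^bsub>mod_sum M N\<^esub> = (\<zero>\<^bsub>M\<^esub>, \<zero>\<^bsub>N\<^esub>)"
  "(x, y) \<oplus>\<^bsub>mod_sum M N\<^esub> (x', y') = (x \<oplus>\<^bsub>M\<^esub> x', y \<oplus>\<^bsub>N\<^esub> y')"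
  "a \<odot>\<^bsub>mod_sum M N\<^esub> (x, y) = (a \<odot>\<^bsub>M\<^esub> x, a \<odot>\<^bsub>N\<^esub> y)"
  by (auto simp: mod_sum_def)

lemma left_module_mod_sum:
  assumes "left_module B M" "left_module B N" shows "left_module B (mod_sum M N)"
proof -
  interpret M: left_module B M by fact
  interpret N: left_module B N by fact
  have "abelian_group (mod_sum M N)"
  proof (rule abelian_groupI)
    fix x assume "x \<in> carrier (mod_sum M N)"
    then show "\<exists>y\<in>carrier (mod_sum M N). y \<oplus>\<^bsub>mod_sum M N\<^esub> x = \<zero>\<^bsub>mod_sum M N\<^esub>"
      by (intro bexI[of _ "(\<ominus>\<^bsub>M\<^esub> fst x, \<ominus>\<^bsub>N\<^esub> snd x)"]) (auto simp: M.l_neg N.l_neg)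
  qed (auto simp: M.a_ac N.a_ac)
  then show ?thesis
    by (rule left_moduleI[OF M.B.ring_axioms])
      (auto simp: M.smult_closed N.smult_closed M.smult_l_distr N.smult_l_distr M.smult_r_distr N.smult_r_distr
        M.smult_assoc N.smult_assoc M.smult_one N.smult_one)
qed

lemma fst_hom: "fst \<in> mod_hom B (mod_sum M N) M"
  and snd_hom: "snd \<in> mod_hom B (mod_sum M N) N"
  by (auto intro!: mod_homI)

lemma fg_mod_sum:
  assumes fM: "fg_left_module B M" and fN: "fg_left_module B N" shows "fg_left_module B (mod_sum M N)"
proof -
  have lm: "left_module B M" "left_module B N" using assms by auto
  interpret M: left_module B M by fact
  interpret N: left_module B N by fact
  note s = left_module_mod_sum[OF lm]
  obtain S where S: "finite S" "S \<subseteq> carrier M" "\<And>U. submod B M U \<Longrightarrow> S \<subseteq> U \<Longrightarrow> U = carrier M"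
    using fM unfolding fg_iff by auto
  obtain T where T: "finite T" "T \<subseteq> carrier N" "\<And>U. submod B N U \<Longrightarrow> T \<subseteq> U \<Longrightarrow> U = carrier N"
    using fN unfolding fg_iff by auto
  have l: "(\<lambda>x. (x, \<zero>\<^bsub>N\<^esub>)) \<in> mod_hom B M (mod_sum M N)" and r: "(\<lambda>y. (\<zero>\<^bsub>M\<^esub>, y)) \<in> mod_hom B N (mod_sum M N)"
    by (auto intro!: mod_homI)
  let ?G = "(\<lambda>x. (x, \<zero>\<^bsub>N\<^esub>)) ` S \<union> (\<lambda>y. (\<zero>\<^bsub>M\<^esub>, y)) ` T"
  have "U = carrier (mod_sum M N)" if U: "submod B (mod_sum M N) U" "?G \<subseteq> U" for U
  proof -
    have 1: "{x \<in> carrier M. (x, \<zero>\<^bsub>N\<^esub>) \<in> U} = carrier M"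
      using U(2) S(2) by (intro S(3) submod_vimage[OF l lm(1) s U(1)]) auto
    have 2: "{y \<in> carrier N. (\<zero>\<^bsub>M\<^esub>, y) \<in> U} = carrier N"
      using U(2) T(2) by (intro T(3) submod_vimage[OF r lm(2) s U(1)]) auto
    have "(x, y) \<in> U" if "x \<in> carrier M" "y \<in> carrier N" for x y
    proof -
      have "(x, \<zero>\<^bsub>N\<^esub>) \<in> U" "(\<zero>\<^bsub>M\<^esub>, y) \<in> U" using 1 2 that by auto
      from submodD(3)[OF U(1) this] show ?thesis using that by simp
    qed
    then show ?thesis using submodD(1)[OF U(1)] by auto
  qed
  moreover have "finite ?G" "?G \<subseteq> carrier (mod_sum M N)" using S T by auto
  ultimately show ?thesis using s unfolding fg_iff by (intro conjI exI[of _ ?G]) blast+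
qed

text \<open>\<open>projective\<close> tests only modules of the fixed carrier type; epimorphisms
  between other modules are conjugated with isomorphisms to representatives. The same device gives
  \<open>approx_lift\<close> and \<open>inj_ext\<close>.\<close>

lemma proj_lift:
  assumes P: "projective B P" and g: "mod_epi B M N g" and M: "fg_left_module B M" and N: "fg_left_module B N"
    and h: "h \<in> mod_hom B P N"
  shows "\<exists>h'\<in>mod_hom B P M. \<forall>x\<in>carrier P. g (h' x) = h x"
proof -
  have lm: "left_module B M" "left_module B N" using M N by auto
  obtain M' m where M': "M' \<in> fg_mods B" "mod_iso B M M' m" using fg_rep[OF M] by blast
  obtain N' n where N': "N' \<in> fg_mods B" "mod_iso B N N' n" using fg_rep[OF N] by blast
  obtain m' where m': "mod_iso B M' M m'" "\<And>y. y \<in> carrier M' \<Longrightarrow> m (m' y) = y"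
    using mod_iso_inv[OF M'(2) lm(1)] by metis
  have g': "mod_epi B M' N' (\<lambda>x. n (g (m' x)))"
    using mod_epi_comp[OF mod_epi_comp[OF mod_iso_epi[OF m'(1)] g] mod_iso_epi[OF N'(2)]] .
  have nh: "(\<lambda>x. n (h x)) \<in> mod_hom B P N'" using hom_comp[OF h mod_isoD(1)[OF N'(2)]] .
  have "\<forall>M\<in>fg_mods B. \<forall>N\<in>fg_mods B. \<forall>g h. mod_epi B M N g \<and> h \<in> mod_hom B P N \<longrightarrow>
       (\<exists>h'\<in>mod_hom B P M. \<forall>x\<in>carrier P. g (h' x) = h x)" using P by (simp add: projective_def)
  from this[rule_format, OF M'(1) N'(1) conjI[OF g' nh]]
  obtain k where k: "k \<in> mod_hom B P M'" "\<And>x. x \<in> carrier P \<Longrightarrow> n (g (m' (k x))) = n (h x)" by auto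
  have "g (m' (k x)) = h x" if x: "x \<in> carrier P" for x
  proof (rule inj_onD[OF mod_isoD(2)[OF N'(2)] k(2)[OF x]])
    show "g (m' (k x)) \<in> carrier N"
      using hom_closed[OF mod_epiD(1)[OF g]] hom_closed[OF mod_isoD(1)[OF m'(1)]] hom_closed[OF k(1) x] by blast
    show "h x \<in> carrier N" using hom_closed[OF h x] .
  qed
  then show ?thesis by (intro bexI[OF _ hom_comp[OF k(1) mod_isoD(1)[OF m'(1)]]]) auto
qed

lemma approx_lift:
  assumes full: "full_subcategory B \<Y>" and a: "right_approximation B \<Y> Y M f"
    and Z: "in_cat B \<Y> Z" and h: "h \<in> mod_hom B Z M"
  shows "\<exists>h'\<in>mod_hom B Z Y. \<forall>x\<in>carrier Z. f (h' x) = h x"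
proof -
  obtain Z' z where Z': "Z' \<in> \<Y>" "left_module B Z'" "mod_iso B Z Z' z" using in_cat_rep[OF full Z] by blast
  have lZ: "left_module B Z" using Z by (simp add: in_cat_def)
  obtain z' where z': "mod_iso B Z' Z z'" "\<And>x. x \<in> carrier Z \<Longrightarrow> z' (z x) = x"
    using mod_iso_inv[OF Z'(3) lZ] by blast
  have hz: "(\<lambda>x. h (z' x)) \<in> mod_hom B Z' M" using hom_comp[OF mod_isoD(1)[OF z'(1)] h] .
  have "\<forall>Y'\<in>\<Y>. \<forall>h\<in>mod_hom B Y' M. \<exists>h'\<in>mod_hom B Y' Y. \<forall>x\<in>carrier Y'. f (h' x) = h x"
    using a by (simp add: right_approximation_def)
  from this[rule_format, OF Z'(1) hz]
  obtain k where k: "k \<in> mod_hom B Z' Y" "\<forall>x\<in>carrier Z'. f (k x) = h (z' x)" by (rule bexE)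
  have "f (k (z x)) = h x" if "x \<in> carrier Z" for x
    using k(2) z'(2)[OF that] hom_closed[OF mod_isoD(1)[OF Z'(3)] that] by simp
  then show ?thesis by (intro bexI[OF _ hom_comp[OF mod_isoD(1)[OF Z'(3)] k(1)]]) auto
qed

section \<open>Retracts and minimal approximations\<close>

context fin_alg begin

text \<open>A representative replaces the module of cosets; only the projection and its kernel are
  remembered.\<close>

lemma quot_exists:
  assumes M: "fg_left_module B M" and U: "submod B M U"
  shows "\<exists>N q. N \<in> fg_mods B \<and> mod_epi B M N q \<and> (\<forall>x\<in>carrier M. q x = \<zero>\<^bsub>N\<^esub> \<longleftrightarrow> x \<in> U)"
proof -
  have lM: "left_module B M" using M by auto
  note Q = quot_module_hom[OF lM U]
  let ?Q = "quot_module M U"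
  have p: "mod_epi B M ?Q (\<lambda>x. U +>\<^bsub>M\<^esub> x)" using Q(1,2) by (simp add: mod_epi_def)
  have "fg_left_module B ?Q" using fg_epi[OF p M Q(3)] .
  then obtain N n where N: "N \<in> fg_mods B" "mod_iso B ?Q N n" using fg_rep by blast
  have lN: "left_module B N" using N by auto
  have "n (U +>\<^bsub>M\<^esub> x) = \<zero>\<^bsub>N\<^esub> \<longleftrightarrow> x \<in> U" if "x \<in> carrier M" for x
    using hom_inj_iff[OF mod_isoD(1)[OF N(2)] Q(3) lN] mod_isoD(2)[OF N(2)]
      hom_zero[OF mod_isoD(1)[OF N(2)] Q(3) lN] hom_closed[OF Q(1) that] Q(4)[OF that] by auto
  then show ?thesis using mod_epi_comp[OF p mod_iso_epi[OF N(2)]] N(1) by blast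
qed

text \<open>The idempotent \<open>i p\<close> splits \<open>L\<close> into a copy of
  \<open>K\<close> and the kernel of \<open>p\<close>. The definition of \<open>resolving\<close>
  needs the complement as a finitely generated module, which it is as a submodule of
  \<open>L\<close>.\<close>

lemma resolving_retract:
  assumes Y: "resolving B \<Y>" and L: "in_cat B \<Y> L" and K: "left_module B K"
    and i: "i \<in> mod_hom B K L" and p: "p \<in> mod_hom B L K" and pi: "\<And>x. x \<in> carrier K \<Longrightarrow> p (i x) = x"
  shows "in_cat B \<Y> K"
proof -
  note full = resolving_full[OF Y]
  have fL: "fg_left_module B L" using in_cat_fg[OF full L] .
  have lL: "left_module B L" using fL by auto
  interpret L: left_module B L by fact
  interpret K: left_module B K by fact
  let ?N = "sub_module L {x \<in> carrier L. p x = \<zero>\<^bsub>K\<^esub>}"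
  have N: "submod B L {x \<in> carrier L. p x = \<zero>\<^bsub>K\<^esub>}" using submod_kernel[OF p lL K] .
  have lN: "left_module B ?N" using left_module_sub[OF N lL] .
  have "mod_mono B K L i" using i pi by (auto simp: mod_mono_def intro: inj_on_inverseI)
  then have fK: "fg_left_module B K" using fg_mono K fL by blast
  note ic = hom_closed[OF i] and pc = hom_closed[OF p]
  note pd = hom_diff[OF p lL K] and pa = hom_add[OF p]
  \<comment> \<open>The inverse of the map that sends a pair \<open>(k, n)\<close> to
    \<open>n\<close> plus \<open>i k\<close>.\<close>
  define s where "s x = (p x, x \<ominus>\<^bsub>L\<^esub> i (p x))" for x
  have ip: "(\<lambda>x. i (p x)) \<in> mod_hom B L L" using hom_comp[OF p i] .
  have d: "(\<lambda>x. x \<ominus>\<^bsub>L\<^esub> i (p x)) \<in> mod_hom B L L" using diff_hom[OF hom_id ip lL lL] .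
  have z: "p (x \<ominus>\<^bsub>L\<^esub> i (p x)) = \<zero>\<^bsub>K\<^esub>" if "x \<in> carrier L" for x
    using that pd[OF that ic[OF pc[OF that]]] pi[OF pc[OF that]] pc[OF that] K.diff_zero_iff by simp
  have dc: "x \<ominus>\<^bsub>L\<^esub> i (p x) \<in> carrier L" if "x \<in> carrier L" for x using hom_closed[OF d that] .
  have sh: "s \<in> mod_hom B L (mod_sum K ?N)"
    unfolding s_def by (rule mod_homI)
      (simp_all add: z dc pc hom_add[OF p, symmetric] hom_smult[OF p, symmetric]
        hom_add[OF d, symmetric] hom_smult[OF d, symmetric])
  have "mod_iso B L (mod_sum K ?N) s"
  proof (rule mod_isoI[OF sh])
    have "x = \<zero>\<^bsub>L\<^esub>" if x: "x \<in> carrier L" "s x = \<zero>\<^bsub>mod_sum K ?N\<^esub>" for x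
    proof -
      have "p x = \<zero>\<^bsub>K\<^esub>" "x \<ominus>\<^bsub>L\<^esub> i (p x) = \<zero>\<^bsub>L\<^esub>" using x(2) by (auto simp: s_def)
      then show ?thesis using x(1) hom_zero[OF i K lL] by (simp add: L.diff_zero_iff)
    qed
    then show "inj_on s (carrier L)"
      using hom_inj_iff[OF sh lL left_module_mod_sum[OF K lN]] by blast
    show "carrier (mod_sum K ?N) \<subseteq> s ` carrier L"
    proof
      fix y assume "y \<in> carrier (mod_sum K ?N)"
      then obtain k n where y: "y = (k, n)" "k \<in> carrier K" "n \<in> carrier L" "p n = \<zero>\<^bsub>K\<^esub>" by auto
      let ?x = "n \<oplus>\<^bsub>L\<^esub> i k"
      have "p ?x = k" using y ic pi by (simp add: pa)
      moreover from this have "?x \<ominus>\<^bsub>L\<^esub> i (p ?x) = n"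
        using y ic[OF y(2)] by (simp add: a_minus_def L.a_assoc L.r_neg)
      ultimately have "s ?x = y" by (simp add: s_def y(1))
      then show "y \<in> s ` carrier L" using y ic by (metis L.a_closed imageI)
    qed
  qed
  note s' = this
  obtain L' l where L': "L' \<in> \<Y>" "left_module B L'" "mod_iso B L L' l" using in_cat_rep[OF full L] by blast
  obtain l' where l': "mod_iso B L' L l'" using mod_iso_inv[OF L'(3) lL] by blast
  obtain K' k where K': "K' \<in> fg_mods B" "mod_iso B K K' k" using fg_rep[OF fK] by blast
  obtain N' n where N': "N' \<in> fg_mods B" "mod_iso B ?N N' n" using fg_rep[OF fg_sub[OF fL N]] by blast
  have kn: "mod_iso B (mod_sum K ?N) (mod_sum K' N') (\<lambda>(x, y). (k x, n y))"
  proof (rule mod_isoI)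
    note h = mod_isoD(1)[OF K'(2)] mod_isoD(1)[OF N'(2)]
    note a = hom_add[OF h(2), simplified] hom_smult[OF h(2), simplified] hom_closed[OF h(2), simplified]
    show "(\<lambda>(x, y). (k x, n y)) \<in> mod_hom B (mod_sum K ?N) (mod_sum K' N')"
      by (rule mod_homI) (auto simp: hom_closed[OF h(1)] hom_add[OF h(1)] hom_smult[OF h(1)] a)
    show "inj_on (\<lambda>(x, y). (k x, n y)) (carrier (mod_sum K ?N))"
      using mod_isoD(2)[OF K'(2)] mod_isoD(2)[OF N'(2)] unfolding inj_on_def by auto
    show "carrier (mod_sum K' N') \<subseteq> (\<lambda>(x, y). (k x, n y)) ` carrier (mod_sum K ?N)"
      unfolding mod_sum_simps mod_isoD(3)[OF K'(2), symmetric] mod_isoD(3)[OF N'(2), symmetric] by force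
  qed
  have "isomorphic_mods B L' (mod_sum K' N')"
    using mod_iso_comp[OF mod_iso_comp[OF l' s'] kn] unfolding isomorphic_mods_def by blast
  then have "K' \<in> \<Y>" using Y K'(1) N'(1) L'(1) unfolding resolving_def by blast
  then show ?thesis using in_cat_iso'[OF in_cat_self[OF full] K'(2) K] by blast
qed

text \<open>Fitting: a power \<open>a\<close> of a suitable endomorphism splits the approximating module into image and kernel
  of \<open>a\<close>; minimality of the image of the idempotent \<open>e\<close> makes the image of \<open>a\<close> all of \<open>e Y\<close>.\<close>

lemma minimal_approximation:
  assumes Y\<Y>: "resolving B \<Y>" and a: "right_approximation B \<Y> Y M f" and fM: "M \<in> fg_mods B"
  shows "\<exists>Y' f'. right_minimal_approximation B \<Y> Y' M f'"
proof -
  note full = resolving_full[OF Y\<Y>]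
  have Yin: "Y \<in> \<Y>" and f: "f \<in> mod_hom B Y M" using a by (auto simp: right_approximation_def)
  have fY: "fg_left_module B Y" using Yin full by (auto simp: full_subcategory_def)
  have lY: "left_module B Y" and lM: "left_module B M" using fY fM by auto
  interpret Y: left_module B Y by fact
  \<comment> \<open>Idempotent endomorphisms of \<open>Y\<close> over \<open>M\<close>. One whose
    image is minimal among such images exists by the descending condition, and its image carries the
    minimal approximation.\<close>
  define I where "I = {e \<in> mod_hom B Y Y. (\<forall>x\<in>carrier Y. e (e x) = e x) \<and> (\<forall>x\<in>carrier Y. f (e x) = f x)}"
  have "\<exists>U\<in>(\<lambda>e. e ` carrier Y) ` I. \<forall>V\<in>(\<lambda>e. e ` carrier Y) ` I. V \<subseteq> U \<longrightarrow> V = U"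
  proof (rule submod_dcc_minimal[OF fY])
    have "(\<lambda>x. x) \<in> I" using hom_id by (auto simp: I_def)
    then show "(\<lambda>e. e ` carrier Y) ` I \<noteq> {}" by blast
    show "submod B Y U" if "U \<in> (\<lambda>e. e ` carrier Y) ` I" for U
      using that submod_image[OF _ lY lY submod_carrier[OF lY]] by (auto simp: I_def)
  qed
  then obtain e where e: "e \<in> I" and mn': "\<forall>V\<in>(\<lambda>e. e ` carrier Y) ` I. V \<subseteq> e ` carrier Y \<longrightarrow> V = e ` carrier Y"
    by (elim bexE imageE) simp
  have mn: "e' ` carrier Y = e ` carrier Y" if "e' \<in> I" "e' ` carrier Y \<subseteq> e ` carrier Y" for e'
    using mn' that by simp
  define U where "U = e ` carrier Y"
  have eh: "e \<in> mod_hom B Y Y" and ee: "\<And>x. x \<in> carrier Y \<Longrightarrow> e (e x) = e x" and fe: "\<And>x. x \<in> carrier Y \<Longrightarrow> f (e x) = f x"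
    using e by (auto simp: I_def)
  have U: "submod B Y U" unfolding U_def using submod_image[OF eh lY lY submod_carrier[OF lY]] .
  have Uc: "x \<in> carrier Y" if "x \<in> U" for x using submodD(1)[OF U that] .
  have eU: "e x = x" if "x \<in> U" for x using that ee by (auto simp: U_def)
  have eUc: "e x \<in> U" if "x \<in> carrier Y" for x using that by (auto simp: U_def)
  let ?U = "sub_module Y U"
  have lU: "left_module B ?U" using left_module_sub[OF U lY] .
  have min: "mod_iso B ?U ?U g"
    if g: "g \<in> mod_hom B ?U ?U" and fg: "\<And>x. x \<in> U \<Longrightarrow> f (g x) = f x" for g
  proof -
    note gc = hom_closed[OF g, simplified]
    \<comment> \<open>Precomposed with the idempotent \<open>e\<close>, the endomorphism
      \<open>g\<close> of \<open>U\<close> becomes an endomorphism of all of \<open>Y\<close> over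
      \<open>M\<close> with image in \<open>U\<close>.\<close>
    define g' where "g' x = g (e x)" for x
    have "e \<in> mod_hom B Y ?U" using eh eUc by (auto simp: mod_hom_def)
    from hom_comp[OF hom_comp[OF this g] sub_incl] have g': "g' \<in> mod_hom B Y Y"
      unfolding g'_def using Uc by auto
    have g'c: "g' x \<in> carrier Y" "g' x \<in> U" if "x \<in> carrier Y" for x
      using hom_closed[OF g' that] gc[OF eUc[OF that]] by (auto simp: g'_def)
    have pw: "g' ^^ k \<in> mod_hom B Y Y" for k using hom_pow[OF g'] .
    note pwc = hom_closed[OF pw]
    have fpw: "f ((g' ^^ k) x) = f x" if "x \<in> carrier Y" for k x
    proof (induction k)
      case (Suc k)
      have "f (g' ((g' ^^ k) x)) = f ((g' ^^ k) x)"
        using fg[OF eUc] fe pwc[OF that] by (simp add: g'_def)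
      then show ?case using Suc by simp
    qed simp
    have "\<exists>V\<in>range (\<lambda>k. (g' ^^ k) ` carrier Y). \<forall>W\<in>range (\<lambda>k. (g' ^^ k) ` carrier Y). W \<subseteq> V \<longrightarrow> W = V"
      by (rule submod_dcc_minimal[OF fY]) (use submod_image[OF pw lY lY submod_carrier[OF lY]] in auto)
    then obtain m1 where m1: "\<And>k. (g' ^^ k) ` carrier Y \<subseteq> (g' ^^ m1) ` carrier Y \<Longrightarrow>
       (g' ^^ k) ` carrier Y = (g' ^^ m1) ` carrier Y" by auto
    let ?K = "\<lambda>k. {x \<in> carrier Y. (g' ^^ k) x = \<zero>\<^bsub>Y\<^esub>}"
    have "\<exists>V\<in>range ?K. \<forall>W\<in>range ?K. V \<subseteq> W \<longrightarrow> W = V"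
      by (rule submod_acc_maximal[OF fY]) (use submod_kernel[OF pw lY lY] in auto)
    then obtain m2 where m2: "\<And>k. ?K m2 \<subseteq> ?K k \<Longrightarrow> ?K k = ?K m2" by auto
    have im: "(g' ^^ (i + j)) ` carrier Y \<subseteq> (g' ^^ i) ` carrier Y" for i j
      using pwc by (auto simp: funpow_add)
    have ker: "?K i \<subseteq> ?K (j + i)" for i j
      using hom_zero[OF pw lY lY] by (auto simp: funpow_add)
    \<comment> \<open>Large enough for images and kernels of the powers of \<open>g'\<close> to be
      constant, and positive, so that the image of \<open>h\<close> lies in
      \<open>U\<close>.\<close>
    define k where "k = Suc (m1 + m2)"
    have kim: "(g' ^^ (k + k)) ` carrier Y = (g' ^^ k) ` carrier Y"
    proof -
      have "k + k = m1 + (Suc m2 + k)" "k = m1 + Suc m2" by (auto simp: k_def)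
      then show ?thesis using m1[OF im[of m1 "Suc m2 + k"]] m1[OF im[of m1 "Suc m2"]] by metis
    qed
    have kker: "?K (k + k) = ?K k"
    proof -
      have "k + k = (k + Suc m1) + m2" "k = Suc m1 + m2" by (auto simp: k_def)
      then show ?thesis using m2[OF ker[of m2 "k + Suc m1"]] m2[OF ker[of m2 "Suc m1"]] by (simp only:)
    qed
    define h where "h = g' ^^ k"
    have h: "h \<in> mod_hom B Y Y" using pw by (simp add: h_def)
    note hc = hom_closed[OF h] and hd = hom_diff[OF h lY lY] and hz = hom_zero[OF h lY lY]
    have hh: "(g' ^^ (k + k)) x = h (h x)" for x by (simp add: h_def funpow_add)
    have h1: "\<exists>z. z \<in> h ` carrier Y \<and> h z = h y" if "y \<in> carrier Y" for y
    proof -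
      have "h y \<in> (g' ^^ (k + k)) ` carrier Y" using kim that by (simp add: h_def)
      then obtain w where "w \<in> carrier Y" "h y = h (h w)" using hh by auto
      then show ?thesis by (intro exI[of _ "h w"]) auto
    qed
    have h2: "x = \<zero>\<^bsub>Y\<^esub>" if x: "x \<in> h ` carrier Y" "h x = \<zero>\<^bsub>Y\<^esub>" for x
    proof -
      obtain w where w: "w \<in> carrier Y" "x = h w" using x(1) by auto
      then have "w \<in> ?K (k + k)" using x hh by simp
      then show ?thesis using kker w by (simp add: h_def)
    qed
    have hs: "submod B Y (h ` carrier Y)" using submod_image[OF h lY lY submod_carrier[OF lY]] .
    have h3: "x = y" if "x \<in> h ` carrier Y" "y \<in> h ` carrier Y" "h x = h y" for x y
    proof -
      have c: "x \<in> carrier Y" "y \<in> carrier Y" using that submodD(1)[OF hs] by auto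
      have "x \<ominus>\<^bsub>Y\<^esub> y = \<zero>\<^bsub>Y\<^esub>"
      proof (rule h2)
        show "x \<ominus>\<^bsub>Y\<^esub> y \<in> h ` carrier Y" using submod_diff[OF hs lY that(1,2)] .
        show "h (x \<ominus>\<^bsub>Y\<^esub> y) = \<zero>\<^bsub>Y\<^esub>" using that(3) c hc by (simp add: hd Y.diff_zero_iff)
      qed
      then show ?thesis using Y.diff_zero_iff c by simp
    qed
    \<comment> \<open>The projection onto the image of \<open>h\<close> along its kernel: the unique
      element of the image with the same value under \<open>h\<close>. It exists because
      \<open>h\<close> and its square have the same image, and it is unique because they have the
      same kernel.\<close>
    define e' where "e' y = (SOME z. z \<in> h ` carrier Y \<and> h z = h y)" for y
    have e': "e' y \<in> h ` carrier Y \<and> h (e' y) = h y" if "y \<in> carrier Y" for y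
      unfolding e'_def using someI_ex[OF h1[OF that]] .
    have e'c: "e' y \<in> carrier Y" if "y \<in> carrier Y" for y using e'[OF that] submodD(1)[OF hs] by blast
    have e'h: "e' \<in> mod_hom B Y Y"
    proof (rule mod_homI)
      fix x y assume xy: "x \<in> carrier Y" "y \<in> carrier Y"
      show "e' (x \<oplus>\<^bsub>Y\<^esub> y) = e' x \<oplus>\<^bsub>Y\<^esub> e' y"
      proof (rule h3)
        show "e' x \<oplus>\<^bsub>Y\<^esub> e' y \<in> h ` carrier Y" using submodD(3)[OF hs conjunct1[OF e'[OF xy(1)]] conjunct1[OF e'[OF xy(2)]]] .
        show "h (e' (x \<oplus>\<^bsub>Y\<^esub> y)) = h (e' x \<oplus>\<^bsub>Y\<^esub> e' y)" using xy e' e'c by (simp add: hom_add[OF h])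
      qed (use e' xy in auto)
    next
      fix b x assume bx: "b \<in> carrier B" "x \<in> carrier Y"
      show "e' (b \<odot>\<^bsub>Y\<^esub> x) = b \<odot>\<^bsub>Y\<^esub> e' x"
      proof (rule h3)
        show "b \<odot>\<^bsub>Y\<^esub> e' x \<in> h ` carrier Y" using submodD(4)[OF hs bx(1) conjunct1[OF e'[OF bx(2)]]] .
        show "h (e' (b \<odot>\<^bsub>Y\<^esub> x)) = h (b \<odot>\<^bsub>Y\<^esub> e' x)"
          using bx e' e'c Y.smult_closed by (simp add: hom_smult[OF h])
      qed (use e' bx Y.smult_closed in auto)
    qed (use e'c in auto)
    have e'i: "e' x = x" if "x \<in> h ` carrier Y" for x
      using that e'[OF submodD(1)[OF hs that]] by (rule_tac h3) auto
    have "e' \<in> I"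
      unfolding I_def
    proof (intro CollectI conjI ballI)
      show "e' (e' x) = e' x" if "x \<in> carrier Y" for x using e'i e'[OF that] by blast
      \<comment> \<open>\<open>f\<close> is invariant under every power of \<open>g'\<close>, in
        particular under \<open>h\<close>, and \<open>h\<close> takes the same value on
        \<open>e' x\<close> and on \<open>x\<close>.\<close>
      show "f (e' x) = f x" if "x \<in> carrier Y" for x
        using e'[OF that] fpw[OF that, of k] fpw[OF e'c[OF that], of k] by (simp add: h_def)
    qed (rule e'h)
    moreover have im': "e' ` carrier Y = h ` carrier Y"
    proof
      show "h ` carrier Y \<subseteq> e' ` carrier Y"
      proof
        fix x assume x: "x \<in> h ` carrier Y"
        then have "e' x \<in> e' ` carrier Y" using submodD(1)[OF hs x] by blast
        then show "x \<in> e' ` carrier Y" by (simp add: e'i[OF x])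
      qed
    qed (use e' in auto)
    moreover have hg: "h x = g' ((g' ^^ (m1 + m2)) x)" for x by (simp add: h_def k_def)
    have "h ` carrier Y \<subseteq> U" using g'c(2)[OF pwc] hg by auto
    ultimately have hU: "h ` carrier Y = U" using mn[of e'] by (simp add: U_def)
    show ?thesis
    proof (rule mod_isoI[OF g])
      have "x = \<zero>\<^bsub>Y\<^esub>" if x: "x \<in> U" "g x = \<zero>\<^bsub>Y\<^esub>" for x
      proof (rule h2)
        have "g' x = \<zero>\<^bsub>Y\<^esub>" using x eU by (simp add: g'_def)
        moreover have "h x = (g' ^^ (m1 + m2)) (g' x)" unfolding h_def k_def by (metis comp_apply funpow_Suc_right)
        ultimately show "h x = \<zero>\<^bsub>Y\<^esub>" using hom_zero[OF pw lY lY] by simp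
      qed (use x hU in auto)
      then show "inj_on g (carrier ?U)" using hom_inj_iff[OF g lU lU] by simp
      show "carrier ?U \<subseteq> g ` carrier ?U"
      proof
        fix u assume "u \<in> carrier ?U"
        then obtain y where y: "y \<in> carrier Y" "u = h y" using hU by auto
        then have "u = g (e ((g' ^^ (m1 + m2)) y))" using hg[of y] by (simp only: g'_def)
        then show "u \<in> g ` carrier ?U" using eUc[OF pwc[OF y(1)]] by auto
      qed
    qed
  qed
  have "in_cat B \<Y> ?U"
  proof (rule resolving_retract[OF Y\<Y> in_cat_self[OF full Yin] lU, where i = "\<lambda>x. x" and p = e])
    show "(\<lambda>x. x) \<in> mod_hom B ?U Y" using sub_incl Uc by (metis subsetI)
    show "e \<in> mod_hom B Y ?U" using eh eUc by (auto simp: mod_hom_def)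
  qed (use eU in auto)
  then obtain Y' r where Y': "Y' \<in> \<Y>" "left_module B Y'" "mod_iso B ?U Y' r" using in_cat_rep[OF full] by metis
  obtain r' where r': "mod_iso B Y' ?U r'" "\<And>x. x \<in> carrier ?U \<Longrightarrow> r' (r x) = x" "\<And>x. x \<in> carrier Y' \<Longrightarrow> r (r' x) = x"
    using mod_iso_inv[OF Y'(3) lU] by metis
  note rh = mod_isoD(1)[OF Y'(3)] and rh' = mod_isoD(1)[OF r'(1)]
  have rc: "r x \<in> carrier Y'" if "x \<in> U" for x using hom_closed[OF rh] that by simp
  have rc': "r' x \<in> U" if "x \<in> carrier Y'" for x using hom_closed[OF rh' that] by simp
  define f' where "f' x = f (r' x)" for x
  have fU: "f \<in> mod_hom B ?U M" using f Uc by (auto simp: mod_hom_def)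
  have eU': "e \<in> mod_hom B Y ?U" using eh eUc by (auto simp: mod_hom_def)
  have "right_approximation B \<Y> Y' M f'"
    unfolding right_approximation_def
  proof (intro conjI ballI)
    show "f' \<in> mod_hom B Y' M" unfolding f'_def using hom_comp[OF rh' fU] .
    fix Z h assume Z: "Z \<in> \<Y>" "h \<in> mod_hom B Z M"
    have "\<forall>Y'\<in>\<Y>. \<forall>h\<in>mod_hom B Y' M. \<exists>h'\<in>mod_hom B Y' Y. \<forall>x\<in>carrier Y'. f (h' x) = h x"
      using a by (simp add: right_approximation_def)
    from this[rule_format, OF Z]
    obtain h' where h': "h' \<in> mod_hom B Z Y" "\<forall>x\<in>carrier Z. f (h' x) = h x" by (rule bexE)
    have "(\<lambda>x. r (e (h' x))) \<in> mod_hom B Z Y'" using hom_comp[OF hom_comp[OF h'(1) eU'] rh] .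
    moreover have "f' (r (e (h' x))) = h x" if "x \<in> carrier Z" for x
      using h'(2) that r'(2) eUc fe hom_closed[OF h'(1) that] by (simp add: f'_def)
    ultimately show "\<exists>h'\<in>mod_hom B Z Y'. \<forall>x\<in>carrier Z. f' (h' x) = h x" by (intro bexI[of _ "\<lambda>x. r (e (h' x))"]) auto
  qed (rule Y'(1))
  moreover have "mod_iso B Y' Y' g" if g: "g \<in> mod_hom B Y' Y'" "\<forall>x\<in>carrier Y'. f' (g x) = f' x" for g
  proof -
    have "mod_iso B ?U ?U (\<lambda>x. r' (g (r x)))"
    proof (rule min)
      show "(\<lambda>x. r' (g (r x))) \<in> mod_hom B ?U ?U" using hom_comp[OF hom_comp[OF rh g(1)] rh'] .
      show "f (r' (g (r x))) = f x" if "x \<in> U" for x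
        using g(2) rc[OF that] r'(2) that by (simp add: f'_def)
    qed
    from mod_iso_comp[OF mod_iso_comp[OF r'(1) this] Y'(3)]
    have *: "mod_iso B Y' Y' (\<lambda>x. r (r' (g (r (r' x)))))" .
    have "r (r' (g (r (r' x)))) = g x" if "x \<in> carrier Y'" for x
      using that r'(3) hom_closed[OF g(1)] by simp
    then have "bij_betw g (carrier Y') (carrier Y')"
      using * bij_betw_cong[of "carrier Y'" "\<lambda>x. r (r' (g (r (r' x))))" g] by (simp add: mod_iso_def)
    then show ?thesis using g(1) by (simp add: mod_iso_def)
  qed
  ultimately show ?thesis unfolding right_minimal_approximation_def by blast
qed

end

section \<open>Enough injectives and projectives\<close>

text \<open>Injectivity inside the category of finitely generated modules; \<open>inj_ext\<close>
  lifts the restriction on carriers.\<close>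

definition inj_mod :: "('b, 'c) ring_scheme \<Rightarrow> 'b fgmod \<Rightarrow> bool" where
  "inj_mod B J \<longleftrightarrow> J \<in> fg_mods B \<and>
     (\<forall>U\<in>fg_mods B. \<forall>V\<in>fg_mods B. \<forall>i g. mod_mono B U V i \<and> g \<in> mod_hom B U J \<longrightarrow>
       (\<exists>h\<in>mod_hom B V J. \<forall>x\<in>carrier U. h (i x) = g x))"

lemma inj_ext:
  assumes J: "inj_mod B J" and i: "mod_mono B U V i" and U: "fg_left_module B U" and V: "fg_left_module B V"
    and g: "g \<in> mod_hom B U J"
  shows "\<exists>h\<in>mod_hom B V J. \<forall>x\<in>carrier U. h (i x) = g x"
proof -
  have lm: "left_module B U" "left_module B V" using U V by auto
  obtain U' u where U': "U' \<in> fg_mods B" "mod_iso B U U' u" using fg_rep[OF U] by blast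
  obtain V' v where V': "V' \<in> fg_mods B" "mod_iso B V V' v" using fg_rep[OF V] by blast
  obtain u' where u': "mod_iso B U' U u'" "\<And>x. x \<in> carrier U \<Longrightarrow> u' (u x) = x"
    using mod_iso_inv[OF U'(2) lm(1)] by metis
  note uh = mod_isoD(1)[OF U'(2)] and uh' = mod_isoD(1)[OF u'(1)] and vh = mod_isoD(1)[OF V'(2)]
  have "(\<lambda>x. v (i (u' x))) \<in> mod_hom B U' V'" using hom_comp[OF hom_comp[OF uh' mod_monoD(1)[OF i]] vh] .
  moreover have "inj_on (\<lambda>x. v (i (u' x))) (carrier U')"
    using mod_isoD(2)[OF V'(2)] mod_isoD(2)[OF u'(1)] mod_monoD(2)[OF i]
      hom_closed[OF uh'] hom_closed[OF mod_monoD(1)[OF i]] by (simp add: inj_on_def)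
  ultimately have m: "mod_mono B U' V' (\<lambda>x. v (i (u' x)))" by (simp add: mod_mono_def)
  have g': "(\<lambda>x. g (u' x)) \<in> mod_hom B U' J" using hom_comp[OF uh' g] .
  have "\<forall>U\<in>fg_mods B. \<forall>V\<in>fg_mods B. \<forall>i g. mod_mono B U V i \<and> g \<in> mod_hom B U J \<longrightarrow>
       (\<exists>h\<in>mod_hom B V J. \<forall>x\<in>carrier U. h (i x) = g x)" using J by (simp add: inj_mod_def)
  from this[rule_format, OF U'(1) V'(1) conjI[OF m g']]
  obtain h where h: "h \<in> mod_hom B V' J" "\<And>x. x \<in> carrier U' \<Longrightarrow> h (v (i (u' x))) = g (u' x)" by auto
  have "h (v (i x)) = g x" if "x \<in> carrier U" for x
    using h(2)[OF hom_closed[OF uh that]] u'(2)[OF that] by simp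
  then show ?thesis by (intro bexI[OF _ hom_comp[OF vh h(1)]]) auto
qed

section \<open>Essential extensions and embeddings into injectives\<close>

context fin_alg begin

lemma fg_reg: "fg_left_module B (reg_module B)"
proof -
  have "U = carrier (reg_module B)" if "submod B (reg_module B) U" "{\<one>\<^bsub>B\<^esub>} \<subseteq> U" for U
  proof
    show "carrier (reg_module B) \<subseteq> U" using submodD(4)[OF that(1), of _ "\<one>\<^bsub>B\<^esub>"] that(2) by auto
  qed (use submodD(1)[OF that(1)] in auto)
  then show ?thesis using reg_left_module[OF B.ring_axioms] unfolding fg_iff
    by (intro conjI exI[of _ "{\<one>\<^bsub>B\<^esub>}"]) auto
qed

definition essential :: "'b fgmod \<Rightarrow> 'b fgmod \<Rightarrow> ((nat \<Rightarrow> 'b) set \<Rightarrow> (nat \<Rightarrow> 'b) set) \<Rightarrow> bool" where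
  "essential M N j \<longleftrightarrow> N \<in> fg_mods B \<and> mod_mono B M N j \<and>
     (\<forall>W. submod B N W \<and> W \<noteq> {\<zero>\<^bsub>N\<^esub>} \<longrightarrow> (\<exists>x\<in>carrier M. j x \<in> W \<and> x \<noteq> \<zero>\<^bsub>M\<^esub>))"

text \<open>Write \<open>N[a]\<close> for the elements of \<open>N\<close> annihilated by a left ideal \<open>a\<close>. If \<open>a\<close> covers \<open>b\<close>, say
  \<open>a = b + B a0\<close>, then multiplication by \<open>a0\<close> maps \<open>N[b]\<close> to elements generating simple modules, so into \<open>M\<close>
  by essentiality, and its kernel is \<open>N[a]\<close>. Hence the sequences \<open>N j[a]\<close> stabilize for smaller and
  smaller \<open>a\<close>, finally for \<open>a = 0\<close>.\<close>

lemma essential_chain_stops: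
  fixes N :: "nat \<Rightarrow> 'b fgmod" and e j
  assumes M: "M \<in> fg_mods B" and ess: "\<And>i. essential M (N i) (j i)"
    and e: "\<And>i. mod_mono B (N i) (N (Suc i)) (e i)" and ej: "\<And>i x. x \<in> carrier M \<Longrightarrow> e i (j i x) = j (Suc i) x"
  shows "\<exists>i. e i ` carrier (N i) = carrier (N (Suc i))"
proof -
  have lM: "left_module B M" and lN: "left_module B (N i)" for i
    using M ess[of i] by (auto simp: essential_def)
  interpret M: left_module B M by (rule lM)
  have jh: "j i \<in> mod_hom B M (N i)" and jm: "mod_mono B M (N i) (j i)" for i
    using ess[of i] by (auto simp: essential_def mod_mono_def)
  have eh: "e i \<in> mod_hom B (N i) (N (Suc i))" for i using e[of i] by (simp add: mod_mono_def)
  let ?Reg = "reg_module B"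
  have lR: "left_module B ?Reg" using reg_left_module[OF B.ring_axioms] .
  define Ann where "Ann i a = {x \<in> carrier (N i). \<forall>c\<in>a. c \<odot>\<^bsub>N i\<^esub> x = \<zero>\<^bsub>N i\<^esub>}" for i and a :: "'b set"
  \<comment> \<open>From some stage on, whatever \<open>a\<close> kills comes from the preceding
    stage. For the zero ideal this is the claim; for the whole ring it is trivial, since one kills
    only zero.\<close>
  define St where "St a \<longleftrightarrow> (\<exists>m. \<forall>i\<ge>m. \<forall>y\<in>Ann (Suc i) a. \<exists>x\<in>carrier (N i). y = e i x)" for a
  have Annc: "x \<in> carrier (N i)" if "x \<in> Ann i a" for x i a using that by (simp add: Ann_def)
  have AnnD: "c \<odot>\<^bsub>N i\<^esub> x = \<zero>\<^bsub>N i\<^esub>" if "x \<in> Ann i a" "c \<in> a" for x i a c using that by (simp add: Ann_def)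
  have "\<exists>a\<in>{a. submod B ?Reg a \<and> St a}. \<forall>b\<in>{a. submod B ?Reg a \<and> St a}. b \<subseteq> a \<longrightarrow> b = a"
  proof (rule submod_dcc_minimal[OF fg_reg])
    have "St (carrier B)" unfolding St_def
    proof (intro exI[of _ 0] allI impI ballI)
      fix i y assume y: "y \<in> Ann (Suc i) (carrier B)"
      interpret N: left_module B "N i" by (rule lN)
      interpret N': left_module B "N (Suc i)" by (rule lN)
      have "y = \<zero>\<^bsub>N (Suc i)\<^esub>" using AnnD[OF y B.one_closed] N'.smult_one[OF Annc[OF y]] by simp
      then show "\<exists>x\<in>carrier (N i). y = e i x"
        using hom_zero[OF eh lN lN] by (intro bexI[of _ "\<zero>\<^bsub>N i\<^esub>"]) auto
    qed
    then show "{a. submod B ?Reg a \<and> St a} \<noteq> {}" using submod_carrier[OF lR] by auto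
  qed auto
  then obtain a where a: "submod B ?Reg a" "St a" and mina: "\<And>b. submod B ?Reg b \<Longrightarrow> St b \<Longrightarrow> b \<subseteq> a \<Longrightarrow> b = a"
    by auto
  show ?thesis
  proof (cases "a = {\<zero>\<^bsub>B\<^esub>}")
    case True
    obtain m where m: "\<And>y. y \<in> Ann (Suc m) a \<Longrightarrow> \<exists>x\<in>carrier (N m). y = e m x" using a(2) unfolding St_def by auto
    have "Ann (Suc m) a = carrier (N (Suc m))"
      using left_module.smult_l_null[OF lN] unfolding Ann_def True by auto
    then have "carrier (N (Suc m)) \<subseteq> e m ` carrier (N m)" using m by auto
    moreover have "e m ` carrier (N m) \<subseteq> carrier (N (Suc m))" using hom_closed[OF eh] by auto
    ultimately show ?thesis by blast
  next
    case False
    have "\<exists>b\<in>{b. submod B ?Reg b \<and> b \<subset> a}. \<forall>c\<in>{b. submod B ?Reg b \<and> b \<subset> a}. b \<subseteq> c \<longrightarrow> c = b"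
    proof (rule submod_acc_maximal[OF fg_reg])
      have "{\<zero>\<^bsub>B\<^esub>} \<subset> a" using False submodD(2)[OF a(1)] by auto
      then show "{b. submod B ?Reg b \<and> b \<subset> a} \<noteq> {}" using submod_zero[OF lR] by auto
    qed auto
    then obtain b where b: "submod B ?Reg b" "b \<subset> a" and maxb: "\<And>c. submod B ?Reg c \<Longrightarrow> c \<subset> a \<Longrightarrow> b \<subseteq> c \<Longrightarrow> c = b"
      by auto
    have ac: "c \<in> carrier B" if "c \<in> a" for c using submodD(1)[OF a(1) that] by simp
    have cover: "\<exists>z\<in>b. \<exists>r\<in>carrier B. d = z \<oplus>\<^bsub>B\<^esub> r \<otimes>\<^bsub>B\<^esub> c" if c: "c \<in> a" "c \<notin> b" and d: "d \<in> a" for c d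
    proof -
      have cc: "c \<in> carrier ?Reg" using ac[OF c(1)] by simp
      note cy = submod_cyclic[OF lR cc]
      let ?s = "submod_sum ?Reg b (cyclic B ?Reg c)"
      note up = submod_sum_upper[OF lR b(1) cy(1)]
      have "cyclic B ?Reg c \<subseteq> a" using submodD(4)[OF a(1) _ c(1)] by (auto simp: cyclic_def)
      then have "?s \<subseteq> a" using b(2) submodD(3)[OF a(1)] unfolding submod_sum_def by blast
      moreover have "c \<in> ?s" using up(2) cy(2) by blast
      then have "?s \<noteq> b" using c(2) by blast
      ultimately have "?s = a" using maxb[OF submod_submod_sum[OF lR b(1) cy(1)] _ up(1)] by blast
      then show ?thesis using d unfolding submod_sum_def cyclic_def by auto
    qed
    obtain c where c: "c \<in> a" "c \<notin> b" using b(2) by blast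
    have cc: "c \<in> carrier B" using ac[OF c(1)] .
    \<comment> \<open>If \<open>c x\<close> is nonzero, essentiality puts some \<open>r c x\<close>
      into the image of \<open>M\<close>. Since \<open>b\<close> kills \<open>x\<close>, the element
      \<open>r c\<close> is not in \<open>b\<close>, so it generates \<open>a\<close> together with
      \<open>b\<close>; thus \<open>c x\<close> is a multiple of \<open>r c x\<close> and lies in
      the image as well.\<close>
    have into: "\<exists>m\<in>carrier M. j i m = c \<odot>\<^bsub>N i\<^esub> x" if x: "x \<in> Ann i b" for i x
    proof (cases "c \<odot>\<^bsub>N i\<^esub> x = \<zero>\<^bsub>N i\<^esub>")
      case True then show ?thesis using hom_zero[OF jh lM lN] by (intro bexI[of _ "\<zero>\<^bsub>M\<^esub>"]) auto
    next
      case False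
      interpret N: left_module B "N i" by (rule lN)
      have cx: "c \<odot>\<^bsub>N i\<^esub> x \<in> carrier (N i)" using cc Annc[OF x] N.smult_closed by blast
      note cy = submod_cyclic[OF lN cx]
      have "cyclic B (N i) (c \<odot>\<^bsub>N i\<^esub> x) \<noteq> {\<zero>\<^bsub>N i\<^esub>}" using cy(2) False by auto
      then obtain m where m: "m \<in> carrier M" "j i m \<in> cyclic B (N i) (c \<odot>\<^bsub>N i\<^esub> x)" "m \<noteq> \<zero>\<^bsub>M\<^esub>"
        using ess[of i] cy(1) unfolding essential_def by metis
      then obtain r where r: "r \<in> carrier B" "j i m = r \<odot>\<^bsub>N i\<^esub> (c \<odot>\<^bsub>N i\<^esub> x)" by (auto simp: cyclic_def)
      then have rm: "j i m = (r \<otimes>\<^bsub>B\<^esub> c) \<odot>\<^bsub>N i\<^esub> x" using N.smult_assoc cc Annc[OF x] by simp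
      have rc: "r \<otimes>\<^bsub>B\<^esub> c \<in> a" using submodD(4)[OF a(1) r(1) c(1)] by simp
      have "j i m \<noteq> \<zero>\<^bsub>N i\<^esub>" using m(1,3) mod_monoD(2)[OF jm] hom_inj_iff[OF jh lM lN] by blast
      then have "r \<otimes>\<^bsub>B\<^esub> c \<notin> b" using rm AnnD[OF x] by auto
      from cover[OF rc this c(1)] obtain z s where zs: "z \<in> b" "s \<in> carrier B" "c = z \<oplus>\<^bsub>B\<^esub> s \<otimes>\<^bsub>B\<^esub> (r \<otimes>\<^bsub>B\<^esub> c)" by blast
      have zc: "z \<in> carrier B" "r \<otimes>\<^bsub>B\<^esub> c \<in> carrier B" using zs(1) b(2) ac rc by auto
      have "c \<odot>\<^bsub>N i\<^esub> x = (z \<oplus>\<^bsub>B\<^esub> s \<otimes>\<^bsub>B\<^esub> (r \<otimes>\<^bsub>B\<^esub> c)) \<odot>\<^bsub>N i\<^esub> x" using zs(3) by simp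
      also have "\<dots> = \<zero>\<^bsub>N i\<^esub> \<oplus>\<^bsub>N i\<^esub> s \<odot>\<^bsub>N i\<^esub> j i m"
        using zc zs(2) Annc[OF x] AnnD[OF x zs(1)] rm by (simp add: N.smult_l_distr N.smult_assoc)
      also have "\<dots> = j i (s \<odot>\<^bsub>M\<^esub> m)"
        using hom_smult[OF jh zs(2) m(1)] hom_closed[OF jh m(1)] zs(2) N.smult_closed by simp
      finally show ?thesis using M.smult_closed zs(2) m(1) by (intro bexI[of _ "s \<odot>\<^bsub>M\<^esub> m"]) auto
    qed
    \<comment> \<open>Only an \<open>R\<close>-submodule of \<open>M\<close>, because
      \<open>c\<close> need not commute with \<open>B\<close>. This is enough, as the ascending
      chain condition holds over \<open>R\<close>.\<close>
    define V where "V i = {m \<in> carrier M. \<exists>x\<in>Ann i b. j i m = c \<odot>\<^bsub>N i\<^esub> x}" for i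
    have "submod R (res_scalars \<iota> M) (V i)" for i
    proof (rule submodI)
      interpret N: left_module B "N i" by (rule lN)
      have bc: "z \<in> carrier B" if "z \<in> b" for z using that b(2) ac by auto
      have "\<zero>\<^bsub>N i\<^esub> \<in> Ann i b" using bc by (auto simp: Ann_def)
      then show "\<zero>\<^bsub>res_scalars \<iota> M\<^esub> \<in> V i"
        using hom_zero[OF jh lM lN] cc unfolding V_def by (auto intro!: bexI[of _ "\<zero>\<^bsub>N i\<^esub>"])
      fix m m' assume "m \<in> V i" "m' \<in> V i"
      then obtain x x' where x: "m \<in> carrier M" "m' \<in> carrier M" "x \<in> Ann i b" "x' \<in> Ann i b"
        "j i m = c \<odot>\<^bsub>N i\<^esub> x" "j i m' = c \<odot>\<^bsub>N i\<^esub> x'" by (auto simp: V_def)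
      have "x \<oplus>\<^bsub>N i\<^esub> x' \<in> Ann i b" using x(3,4) bc by (auto simp: Ann_def N.smult_r_distr)
      moreover have "j i (m \<oplus>\<^bsub>M\<^esub> m') = c \<odot>\<^bsub>N i\<^esub> (x \<oplus>\<^bsub>N i\<^esub> x')"
        using x cc Annc by (simp add: hom_add[OF jh] N.smult_r_distr)
      ultimately show "m \<oplus>\<^bsub>res_scalars \<iota> M\<^esub> m' \<in> V i" using x(1,2) unfolding V_def by auto
    next
      interpret N: left_module B "N i" by (rule lN)
      have bc: "z \<in> carrier B" if "z \<in> b" for z using that b(2) ac by auto
      fix r m assume r: "r \<in> carrier R" and "m \<in> V i"
      then obtain x where x: "m \<in> carrier M" "x \<in> Ann i b" "j i m = c \<odot>\<^bsub>N i\<^esub> x" by (auto simp: V_def)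
      have rc: "\<iota> r \<in> carrier B" using ring_hom_closed[OF hom r] .
      have swap: "z \<odot>\<^bsub>N i\<^esub> (\<iota> r \<odot>\<^bsub>N i\<^esub> x) = \<iota> r \<odot>\<^bsub>N i\<^esub> (z \<odot>\<^bsub>N i\<^esub> x)" if "z \<in> carrier B" for z
        using that rc Annc[OF x(2)] central[OF r that] by (simp add: N.smult_assoc[symmetric])
      have "\<iota> r \<odot>\<^bsub>N i\<^esub> x \<in> Ann i b"
        using x(2) rc bc swap unfolding Ann_def by (auto simp: N.smult_closed)
      moreover have "j i (\<iota> r \<odot>\<^bsub>M\<^esub> m) = c \<odot>\<^bsub>N i\<^esub> (\<iota> r \<odot>\<^bsub>N i\<^esub> x)"
        using x(1,3) rc swap[OF cc] by (simp add: hom_smult[OF jh])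
      ultimately show "r \<odot>\<^bsub>res_scalars \<iota> M\<^esub> m \<in> V i" using x(1) rc M.smult_closed unfolding V_def by auto
    qed (auto simp: V_def)
    moreover have "V i \<subseteq> V (Suc i)" for i
    proof
      fix m assume "m \<in> V i"
      then obtain x where x: "m \<in> carrier M" "x \<in> Ann i b" "j i m = c \<odot>\<^bsub>N i\<^esub> x" by (auto simp: V_def)
      have "e i x \<in> Ann (Suc i) b"
        unfolding Ann_def using x(2) b(2) ac hom_closed[OF eh] hom_zero[OF eh lN lN] hom_smult[OF eh, symmetric]
        by (auto simp: Ann_def)
      moreover have "j (Suc i) m = c \<odot>\<^bsub>N (Suc i)\<^esub> e i x"
        using ej[OF x(1), of i] x(3) hom_smult[OF eh cc Annc[OF x(2)]] by simp
      ultimately show "m \<in> V (Suc i)" using x(1) by (auto simp: V_def)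
    qed
    ultimately obtain m1 where m1: "\<And>i. i \<ge> m1 \<Longrightarrow> V i = V m1"
      using accD[OF fg_acc[OF fg_modsD[OF M]], of V] by auto
    obtain m2 where m2: "\<And>i y. i \<ge> m2 \<Longrightarrow> y \<in> Ann (Suc i) a \<Longrightarrow> \<exists>x\<in>carrier (N i). y = e i x"
      using a(2) unfolding St_def by auto
    have "St b" unfolding St_def
    proof (intro exI[of _ "max m1 m2"] allI impI ballI)
      fix i y assume i: "max m1 m2 \<le> i" and y: "y \<in> Ann (Suc i) b"
      interpret N: left_module B "N i" by (rule lN)
      interpret N': left_module B "N (Suc i)" by (rule lN)
      obtain m where m: "m \<in> carrier M" "j (Suc i) m = c \<odot>\<^bsub>N (Suc i)\<^esub> y" using into[OF y] by blast
      then have "m \<in> V (Suc i)" using y by (auto simp: V_def)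
      then have "m \<in> V i" using m1[of i] m1[of "Suc i"] i by simp
      then obtain x where x: "x \<in> Ann i b" "j i m = c \<odot>\<^bsub>N i\<^esub> x" by (auto simp: V_def)
      have xc: "x \<in> carrier (N i)" "e i x \<in> carrier (N (Suc i))" "y \<in> carrier (N (Suc i))"
        using Annc[OF x(1)] hom_closed[OF eh] Annc[OF y] by auto
      \<comment> \<open>\<open>y\<close> is compared with an element of the preceding stage that has
        the same value under \<open>c\<close>. The difference is killed by \<open>b\<close> and
        \<open>c\<close>, hence by \<open>a\<close>, where stabilisation is known.\<close>
      let ?z = "y \<ominus>\<^bsub>N (Suc i)\<^esub> e i x"
      have zc: "?z \<in> carrier (N (Suc i))" using xc by simp
      have sm: "d \<odot>\<^bsub>N (Suc i)\<^esub> ?z = d \<odot>\<^bsub>N (Suc i)\<^esub> y \<ominus>\<^bsub>N (Suc i)\<^esub> e i (d \<odot>\<^bsub>N i\<^esub> x)" if "d \<in> carrier B" for d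
        using that xc by (simp add: a_minus_def N'.smult_r_distr N'.smult_r_minus hom_smult[OF eh])
      have cz: "c \<odot>\<^bsub>N (Suc i)\<^esub> ?z = \<zero>\<^bsub>N (Suc i)\<^esub>"
        using sm[OF cc] m(2) x(2) ej[OF m(1), of i] hom_closed[OF jh m(1)] N'.diff_zero_iff by metis
      have bz: "d \<odot>\<^bsub>N (Suc i)\<^esub> ?z = \<zero>\<^bsub>N (Suc i)\<^esub>" if "d \<in> b" for d
      proof -
        have "d \<in> carrier B" using that b(2) ac by blast
        then show ?thesis using sm[of d] AnnD[OF x(1) that] AnnD[OF y that] hom_zero[OF eh lN lN, of i]
          N'.diff_zero_iff[OF N'.zero_closed N'.zero_closed] by simp
      qed
      have "d \<odot>\<^bsub>N (Suc i)\<^esub> ?z = \<zero>\<^bsub>N (Suc i)\<^esub>" if d: "d \<in> a" for d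
      proof -
        obtain z r where zr: "z \<in> b" "r \<in> carrier B" "d = z \<oplus>\<^bsub>B\<^esub> r \<otimes>\<^bsub>B\<^esub> c" using cover[OF c d] by blast
        then have "z \<in> carrier B" using b(2) ac by auto
        then show ?thesis using zr cc zc cz bz[OF zr(1)]
          by (simp add: N'.smult_l_distr N'.smult_assoc)
      qed
      then have "?z \<in> Ann (Suc i) a" using zc by (auto simp: Ann_def)
      then obtain w where w: "w \<in> carrier (N i)" "?z = e i w" using m2[of i] i by auto
      have "y = ?z \<oplus>\<^bsub>N (Suc i)\<^esub> e i x" using xc by (simp add: a_minus_def N'.a_assoc N'.l_neg)
      then have "y = e i (w \<oplus>\<^bsub>N i\<^esub> x)" using w xc by (simp add: hom_add[OF eh])
      then show "\<exists>x\<in>carrier (N i). y = e i x" using w xc by (intro bexI[of _ "w \<oplus>\<^bsub>N i\<^esub> x"]) auto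
    qed
    then show ?thesis using mina[OF b(1)] b(2) by blast
  qed
qed

text \<open>Otherwise proper essential extensions can be chosen again and again, starting from the
  identity of \<open>M\<close>, in contradiction to \<open>essential_chain_stops\<close>.\<close>

lemma maximal_essential:
  assumes M: "M \<in> fg_mods B"
  shows "\<exists>J j. essential M J j \<and> (\<forall>N j' e. essential M N j' \<and> mod_mono B J N e \<and> (\<forall>x\<in>carrier M. e (j x) = j' x) \<longrightarrow>
     e ` carrier J = carrier N)"
proof (rule ccontr)
  assume n: "\<not> ?thesis"
  define Q :: "'b fgmod \<times> ((nat \<Rightarrow> 'b) set \<Rightarrow> (nat \<Rightarrow> 'b) set) \<Rightarrow> 'b fgmod \<times> ((nat \<Rightarrow> 'b) set \<Rightarrow> (nat \<Rightarrow> 'b) set) \<Rightarrow>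
      ((nat \<Rightarrow> 'b) set \<Rightarrow> (nat \<Rightarrow> 'b) set) \<Rightarrow> bool" where "Q p r e \<longleftrightarrow> essential M (fst r) (snd r) \<and> mod_mono B (fst p) (fst r) e \<and>
      (\<forall>x\<in>carrier M. e (snd p x) = snd r x) \<and> e ` carrier (fst p) \<noteq> carrier (fst r)" for p r e
  define nx where "nx p = (SOME r. \<exists>e. Q p r e)" for p
  have n': "\<exists>N j' e. essential M N j' \<and> mod_mono B J N e \<and> (\<forall>x\<in>carrier M. e (j x) = j' x) \<and> e ` carrier J \<noteq> carrier N"
    if J: "essential M J j" for J j
  proof (rule ccontr)
    assume c: "\<not> ?thesis"
    have "\<forall>N j' e. essential M N j' \<and> mod_mono B J N e \<and> (\<forall>x\<in>carrier M. e (j x) = j' x) \<longrightarrow>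
      e ` carrier J = carrier N"
    proof (intro allI impI)
      fix N j' e assume *: "essential M N j' \<and> mod_mono B J N e \<and> (\<forall>x\<in>carrier M. e (j x) = j' x)"
      show "e ` carrier J = carrier N"
      proof (rule ccontr)
        assume "e ` carrier J \<noteq> carrier N"
        with * have "\<exists>N j' e. essential M N j' \<and> mod_mono B J N e \<and> (\<forall>x\<in>carrier M. e (j x) = j' x) \<and>
          e ` carrier J \<noteq> carrier N" by (intro exI[of _ N] exI[of _ j'] exI[of _ e]) simp
        with c show False ..
      qed
    qed
    with J have "\<exists>J j. essential M J j \<and> (\<forall>N j' e. essential M N j' \<and> mod_mono B J N e \<and>
      (\<forall>x\<in>carrier M. e (j x) = j' x) \<longrightarrow> e ` carrier J = carrier N)"
      by (intro exI[of _ J] exI[of _ j]) simp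
    with n show False ..
  qed
  have nx: "\<exists>e. Q p (nx p) e" if p: "essential M (fst p) (snd p)" for p
  proof -
    obtain N j' e where "essential M N j'" "mod_mono B (fst p) N e" "\<forall>x\<in>carrier M. e (snd p x) = j' x"
      "e ` carrier (fst p) \<noteq> carrier N" using n'[OF p] by (elim exE conjE)
    then have "\<exists>r e. Q p r e" unfolding Q_def by (intro exI[of _ "(N, j')"] exI[of _ e]) auto
    then show ?thesis unfolding nx_def by (rule someI_ex)
  qed
  define s where "s k = (nx ^^ k) (M, \<lambda>x. x)" for k
  have ess0: "essential M M (\<lambda>x. x)"
  proof -
    have lM: "left_module B M" using M by auto
    have "\<exists>x\<in>carrier M. x \<in> W \<and> x \<noteq> \<zero>\<^bsub>M\<^esub>" if "submod B M W" "W \<noteq> {\<zero>\<^bsub>M\<^esub>}" for W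
      using that submodD(1,2)[OF that(1)] by auto
    then show ?thesis using M hom_id unfolding essential_def mod_mono_def by auto
  qed
  have es: "essential M (fst (s k)) (snd (s k))" for k
  proof (induction k)
    case 0 then show ?case using ess0 by (simp add: s_def)
  next
    case (Suc k) then show ?case using nx[OF Suc] by (auto simp: s_def Q_def)
  qed
  have "\<exists>e. Q (s k) (s (Suc k)) e" for k using nx[OF es[of k]] by (simp add: s_def)
  then obtain e where e: "\<And>k. Q (s k) (s (Suc k)) (e k)" by metis
  have "\<exists>i. e i ` carrier (fst (s i)) = carrier (fst (s (Suc i)))"
    using e by (intro essential_chain_stops[OF M es]) (auto simp: Q_def)
  then show False using e by (auto simp: Q_def)
qed

text \<open>To extend \<open>g\<close> along \<open>i\<close>, divide the sum of \<open>J\<close>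
  and \<open>V\<close> by a submodule \<open>W\<close> that contains the antidiagonal image of
  \<open>U\<close> and is maximal with zero intersection with \<open>J\<close>. Every nonzero
  submodule of the quotient then meets \<open>J\<close>, hence \<open>M\<close>. So \<open>M\<close>
  is essential in the quotient, maximality makes \<open>J\<close> isomorphic to it, and
  \<open>V\<close> maps to \<open>J\<close> through it.\<close>

lemma maximal_essential_inj:
  assumes M: "M \<in> fg_mods B" and J: "essential M J j"
    and mx: "\<And>N j' e. essential M N j' \<Longrightarrow> mod_mono B J N e \<Longrightarrow> (\<And>x. x \<in> carrier M \<Longrightarrow> e (j x) = j' x) \<Longrightarrow>
      e ` carrier J = carrier N"
  shows "inj_mod B J"
proof -
  have fJ: "J \<in> fg_mods B" using J by (simp add: essential_def)
  have "\<exists>h\<in>mod_hom B V J. \<forall>x\<in>carrier U. h (i x) = g x"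
    if U: "U \<in> fg_mods B" and V: "V \<in> fg_mods B" and i: "mod_mono B U V i" and g: "g \<in> mod_hom B U J" for U V i g
  proof -  have lM: "left_module B M" and lJ: "left_module B J" and lU: "left_module B U" and lV: "left_module B V"
    using M fJ U V by auto
  interpret J: left_module B J by (rule lJ)
  interpret U: left_module B U by (rule lU)
  interpret V: left_module B V by (rule lV)
  let ?P = "mod_sum J V"
  have fP: "fg_left_module B ?P" using fg_mod_sum fJ V by auto
  have lP: "left_module B ?P" using fP by auto
  interpret P: left_module B ?P by (rule lP)
  note ih = mod_monoD(1)[OF i]
  have nh: "(\<lambda>u. \<ominus>\<^bsub>V\<^esub> i u) \<in> mod_hom B U V"
    using hom_closed[OF ih] by (intro mod_homI)
      (auto simp: hom_add[OF ih] hom_smult[OF ih] V.minus_add V.smult_r_minus)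
  have Gh: "(\<lambda>u. (g u, \<ominus>\<^bsub>V\<^esub> i u)) \<in> mod_hom B U ?P"
    by (rule mod_homI) (use hom_closed[OF g] hom_closed[OF nh] hom_add[OF g] hom_add[OF nh] hom_smult[OF g] hom_smult[OF nh] in auto)
  let ?G = "(\<lambda>u. (g u, \<ominus>\<^bsub>V\<^esub> i u)) ` carrier U"
  have G: "submod B ?P ?G" using submod_image[OF Gh lU lP submod_carrier[OF lU]] .
  let ?C = "{W. submod B ?P W \<and> ?G \<subseteq> W \<and> (\<forall>y. (y, \<zero>\<^bsub>V\<^esub>) \<in> W \<longrightarrow> y = \<zero>\<^bsub>J\<^esub>)}"
  have "\<exists>W\<in>?C. \<forall>W'\<in>?C. W \<subseteq> W' \<longrightarrow> W' = W"
  proof (rule submod_acc_maximal[OF fP])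
    have "y = \<zero>\<^bsub>J\<^esub>" if y: "(y, \<zero>\<^bsub>V\<^esub>) \<in> ?G" for y
    proof -
      obtain u where u: "u \<in> carrier U" "y = g u" "\<ominus>\<^bsub>V\<^esub> i u = \<zero>\<^bsub>V\<^esub>" using y by auto
      then have "i u = \<zero>\<^bsub>V\<^esub>" using hom_closed[OF ih u(1)] V.r_neg[of "i u"] by simp
      then have "u = \<zero>\<^bsub>U\<^esub>" using mod_monoD(2)[OF i] hom_inj_iff[OF ih lU lV] u(1) by blast
      then show ?thesis using u(2) hom_zero[OF g lU lJ] by simp
    qed
    then have "?G \<in> ?C" using G by blast
    then show "?C \<noteq> {}" by blast
  qed blast
  then obtain W where "W \<in> ?C" and mW: "\<forall>W'\<in>?C. W \<subseteq> W' \<longrightarrow> W' = W" by (rule bexE)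
  then have W: "submod B ?P W" "?G \<subseteq> W" "\<And>y. (y, \<zero>\<^bsub>V\<^esub>) \<in> W \<Longrightarrow> y = \<zero>\<^bsub>J\<^esub>" by auto
  obtain Q q where Q: "Q \<in> fg_mods B" "mod_epi B ?P Q q" "\<And>x. x \<in> carrier ?P \<Longrightarrow> q x = \<zero>\<^bsub>Q\<^esub> \<longleftrightarrow> x \<in> W"
    using quot_exists[OF fP W(1)] by metis
  have lQ: "left_module B Q" using Q(1) by auto
  interpret Q: left_module B Q by (rule lQ)
  note qh = mod_epiD(1)[OF Q(2)]
  have inl: "(\<lambda>y. (y, \<zero>\<^bsub>V\<^esub>)) \<in> mod_hom B J ?P" and inr: "(\<lambda>v. (\<zero>\<^bsub>J\<^esub>, v)) \<in> mod_hom B V ?P"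
    by (auto intro!: mod_homI)
  define e where "e y = q (y, \<zero>\<^bsub>V\<^esub>)" for y
  have eh: "e \<in> mod_hom B J Q" unfolding e_def using hom_comp[OF inl qh] .
  have em: "mod_mono B J Q e"
    using Q(3) W(3) by (intro mod_monoI eh lJ lQ) (auto simp: e_def)
  have jm: "mod_mono B M J j" using J by (simp add: essential_def)
  have eq: "e ` carrier J = carrier Q"
  proof (rule mx[OF _ em])
    show "essential M Q (\<lambda>x. e (j x))"
      unfolding essential_def
    proof (intro conjI allI impI)
      show "mod_mono B M Q (\<lambda>x. e (j x))"
        using hom_comp[OF mod_monoD(1)[OF jm] eh] mod_monoD(2)[OF jm] mod_monoD(2)[OF em]
          hom_closed[OF mod_monoD(1)[OF jm]] unfolding mod_mono_def by (auto simp: inj_on_def)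
      fix X assume "submod B Q X \<and> X \<noteq> {\<zero>\<^bsub>Q\<^esub>}"
      then have X: "submod B Q X" "X \<noteq> {\<zero>\<^bsub>Q\<^esub>}" by auto
      let ?W = "{p \<in> carrier ?P. q p \<in> X}"
      have W': "submod B ?P ?W" using submod_vimage[OF qh lP lQ X(1)] .
      have WW: "W \<subseteq> ?W"
      proof
        fix p assume p: "p \<in> W"
        then have pc: "p \<in> carrier ?P" using submodD(1)[OF W(1)] by blast
        then have "q p = \<zero>\<^bsub>Q\<^esub>" using Q(3)[OF pc] p by simp
        then show "p \<in> ?W" using pc submodD(2)[OF X(1)] by simp
      qed
      obtain x where x: "x \<in> X" "x \<noteq> \<zero>\<^bsub>Q\<^esub>" using X submodD(2)[OF X(1)] by auto
      obtain p where p: "p \<in> carrier ?P" "q p = x" using mod_epi_surj[OF Q(2) submodD(1)[OF X(1) x(1)]] by metis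
      have "?W \<noteq> W" using p x Q(3)[OF p(1)] by blast
      \<comment> \<open>By maximality of \<open>W\<close> the strictly larger preimage must contain
        a nonzero element of \<open>J\<close>.\<close>
      then have "?W \<notin> ?C" using mW WW by blast
      then obtain y where y: "(y, \<zero>\<^bsub>V\<^esub>) \<in> ?W" "y \<noteq> \<zero>\<^bsub>J\<^esub>" using W' W(2) WW by blast
      let ?X = "{y \<in> carrier J. e y \<in> X}"
      have X': "submod B J ?X" using submod_vimage[OF eh lJ lQ X(1)] .
      have "y \<in> ?X" using y(1) by (auto simp: e_def)
      then have "?X \<noteq> {\<zero>\<^bsub>J\<^esub>}" using y(2) by blast
      then show "\<exists>x\<in>carrier M. e (j x) \<in> X \<and> x \<noteq> \<zero>\<^bsub>M\<^esub>" using J X' unfolding essential_def by blast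
    qed (rule Q(1))
  qed simp
  have "mod_iso B J Q e" using mod_isoI[OF eh mod_monoD(2)[OF em]] eq by simp
  then obtain e' where e': "mod_iso B Q J e'" "\<And>x. x \<in> carrier J \<Longrightarrow> e' (e x) = x" using mod_iso_inv[OF _ lJ] by metis
  have h: "(\<lambda>v. e' (q (\<zero>\<^bsub>J\<^esub>, v))) \<in> mod_hom B V J" using hom_comp[OF hom_comp[OF inr qh] mod_isoD(1)[OF e'(1)]] .
  have "e' (q (\<zero>\<^bsub>J\<^esub>, i u)) = g u" if u: "u \<in> carrier U" for u
  proof -
    have c: "g u \<in> carrier J" "i u \<in> carrier V" using hom_closed[OF g u] hom_closed[OF ih u] by auto
    have "q (g u, \<ominus>\<^bsub>V\<^esub> i u) = \<zero>\<^bsub>Q\<^esub>" using Q(3)[of "(g u, \<ominus>\<^bsub>V\<^esub> i u)"] W(2) u c by auto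
    moreover have "q (g u, \<zero>\<^bsub>V\<^esub>) = q (g u, \<ominus>\<^bsub>V\<^esub> i u) \<oplus>\<^bsub>Q\<^esub> q (\<zero>\<^bsub>J\<^esub>, i u)"
      using c hom_add[OF qh, of "(g u, \<ominus>\<^bsub>V\<^esub> i u)" "(\<zero>\<^bsub>J\<^esub>, i u)"] by (simp add: V.l_neg)
    ultimately have "q (\<zero>\<^bsub>J\<^esub>, i u) = e (g u)"
      using c hom_closed[OF qh, of "(\<zero>\<^bsub>J\<^esub>, i u)"] by (simp add: e_def)
    then show ?thesis using e'(2)[OF c(1)] by simp
  qed
  then show ?thesis by (intro bexI[OF _ h]) auto
  qed
  then show ?thesis using fJ unfolding inj_mod_def by simp
qed

lemma enough_injectives:
  assumes M: "fg_left_module B M"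
  shows "\<exists>J e. inj_mod B J \<and> mod_mono B M J e"
proof -
  obtain M' m where M': "M' \<in> fg_mods B" "mod_iso B M M' m" using fg_rep[OF M] by blast
  obtain J j where J: "essential M' J j" "\<forall>N j' e. essential M' N j' \<and> mod_mono B J N e \<and> (\<forall>x\<in>carrier M'. e (j x) = j' x) \<longrightarrow>
     e ` carrier J = carrier N" using maximal_essential[OF M'(1)] by metis
  have "inj_mod B J" using maximal_essential_inj[OF M'(1) J(1)] J(2) by metis
  moreover have j: "mod_mono B M' J j" using J(1) by (simp add: essential_def)
  have "mod_mono B M J (\<lambda>x. j (m x))"
    using hom_comp[OF mod_isoD(1)[OF M'(2)] mod_monoD(1)[OF j]] mod_monoD(2)[OF j] mod_isoD(2)[OF M'(2)]
      hom_closed[OF mod_isoD(1)[OF M'(2)]] unfolding mod_mono_def by (auto simp: inj_on_def)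
  ultimately show ?thesis by metis
qed

section \<open>Enough projectives\<close>

text \<open>Direct sums have the wrong carrier type for \<open>projective\<close>; their lifting
  property is proved first and then carried over to a representative.\<close>

lemma projective_iso:
  assumes lP: "left_module B P" and fP': "P' \<in> fg_mods B" and r: "mod_iso B P P' r"
    and lift: "\<And>M N g h. M \<in> fg_mods B \<Longrightarrow> N \<in> fg_mods B \<Longrightarrow> mod_epi B M N g \<Longrightarrow> h \<in> mod_hom B P N \<Longrightarrow>
      \<exists>h'\<in>mod_hom B P M. \<forall>x\<in>carrier P. g (h' x) = h x"
  shows "projective B P'"
  unfolding projective_def
proof (intro conjI fP' ballI allI impI, elim conjE)
  fix M N g h assume MN: "M \<in> fg_mods B" "N \<in> fg_mods B" "mod_epi B M N g" and h: "h \<in> mod_hom B P' N"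
  obtain r' where r': "mod_iso B P' P r'" "\<And>x. x \<in> carrier P' \<Longrightarrow> r (r' x) = x" using mod_iso_inv[OF r lP] by metis
  obtain k where k: "k \<in> mod_hom B P M" "\<And>x. x \<in> carrier P \<Longrightarrow> g (k x) = h (r x)"
    using lift[OF MN hom_comp[OF mod_isoD(1)[OF r] h]] by auto
  have "g (k (r' x)) = h x" if "x \<in> carrier P'" for x
    using k(2)[OF hom_closed[OF mod_isoD(1)[OF r'(1)] that]] r'(2)[OF that] by simp
  then show "\<exists>h'\<in>mod_hom B P' M. \<forall>x\<in>carrier P'. g (h' x) = h x"
    by (intro bexI[OF _ hom_comp[OF mod_isoD(1)[OF r'(1)] k(1)]]) auto
qed

lemma projective_zero:
  assumes "P \<in> fg_mods B" "carrier P = {\<zero>\<^bsub>P\<^esub>}"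
  shows "projective B P"
proof (rule projective_iso[of P P "\<lambda>x. x"])
  show lP: "left_module B P" using assms(1) by auto
  show "mod_iso B P P (\<lambda>x. x)" using hom_id by (auto simp: mod_iso_def bij_betw_def)
  fix M N g h assume MN: "M \<in> fg_mods B" "N \<in> fg_mods B" "mod_epi B M N g" and h: "h \<in> mod_hom B P N"
  then have lm: "left_module B M" "left_module B N" by auto
  show "\<exists>h'\<in>mod_hom B P M. \<forall>x\<in>carrier P. g (h' x) = h x"
    using hom_zero[OF mod_epiD(1)[OF MN(3)] lm] hom_zero[OF h lP lm(2)] assms(2)
    by (intro bexI[OF _ zero_hom[OF lm(1)]]) auto
qed (rule assms)

text \<open>A free module, grown by one copy of the regular module per generator from the zero
  module. A lift on the new copy is given by a preimage \<open>t\<close> of the image of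
  one.\<close>

lemma enough_projectives:
  assumes M: "fg_left_module B M"
  shows "\<exists>P p. projective B P \<and> mod_epi B P M p"
proof -
  have lM: "left_module B M" using M by auto
  interpret M: left_module B M by (rule lM)
  obtain S where S: "finite S" "S \<subseteq> carrier M" "\<And>U. submod B M U \<Longrightarrow> S \<subseteq> U \<Longrightarrow> U = carrier M"
    using M unfolding fg_iff by auto
  have "\<exists>P p. projective B P \<and> p \<in> mod_hom B P M \<and> T \<subseteq> p ` carrier P" if "finite T" "T \<subseteq> carrier M" for T
    using that
  proof induction
    case empty
    have "fg_left_module B (sub_module M {\<zero>\<^bsub>M\<^esub>})" using fg_sub[OF M submod_zero[OF lM]] .
    then obtain P f where P: "P \<in> fg_mods B" "mod_iso B (sub_module M {\<zero>\<^bsub>M\<^esub>}) P f" using fg_rep by blast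
    have lP: "left_module B P" using P by auto
    have "carrier P = {\<zero>\<^bsub>P\<^esub>}"
      using mod_isoD(3)[OF P(2)] abelian_monoid.zero_closed[of P] lP
      by (auto simp: left_module_def abelian_group_def)
    then have "projective B P" using projective_zero P(1) by blast
    then show ?case using zero_hom[OF lM] by blast
  next
    case (insert s T)
    then obtain P p where P: "projective B P" "p \<in> mod_hom B P M" "T \<subseteq> p ` carrier P" by auto
    have fP: "P \<in> fg_mods B" using P(1) by (simp add: projective_def)
    have lP: "left_module B P" using fP by auto
    interpret P: left_module B P by (rule lP)
    have s: "s \<in> carrier M" using insert by auto
    let ?S = "mod_sum P (reg_module B)"
    have lS: "left_module B ?S" using left_module_mod_sum[OF lP reg_left_module[OF B.ring_axioms]] .
    have fS: "fg_left_module B ?S" using fg_mod_sum[OF _ fg_reg] fP by auto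
    have plus: "(\<lambda>(x, b). k x \<oplus>\<^bsub>N\<^esub> b \<odot>\<^bsub>N\<^esub> t) \<in> mod_hom B ?S N"
      if N: "left_module B N" and k: "k \<in> mod_hom B P N" and t: "t \<in> carrier N"
      for N :: "('b, 'x) module" and k t
    proof -
      interpret N: left_module B N by (rule N)
      note kc = hom_closed[OF k]
      show ?thesis
        by (rule mod_homI) (auto simp: kc t N.smult_closed hom_add[OF k] hom_smult[OF k] N.smult_l_distr
          N.smult_r_distr N.smult_assoc N.a_ac)
    qed
    obtain P' r where P': "P' \<in> fg_mods B" "mod_iso B ?S P' r" using fg_rep[OF fS] by blast
    obtain r' where r': "mod_iso B P' ?S r'" "\<And>x. x \<in> carrier ?S \<Longrightarrow> r' (r x) = x"
      using mod_iso_inv[OF P'(2) lS] by metis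
    have "projective B P'"
    proof (rule projective_iso[OF lS P'])
      fix X N g h assume XN: "X \<in> fg_mods B" "N \<in> fg_mods B" "mod_epi B X N g" and h: "h \<in> mod_hom B ?S N"
      have lX: "left_module B X" and lN: "left_module B N" using XN by auto
      interpret X: left_module B X by (rule lX)
      interpret N: left_module B N by (rule lN)
      have inl: "(\<lambda>y. (y, \<zero>\<^bsub>B\<^esub>)) \<in> mod_hom B P ?S" by (auto intro!: mod_homI)
      have h1: "(\<lambda>y. h (y, \<zero>\<^bsub>B\<^esub>)) \<in> mod_hom B P N" using hom_comp[OF inl h] .
      obtain k where k: "k \<in> mod_hom B P X" "\<forall>x\<in>carrier P. g (k x) = h (x, \<zero>\<^bsub>B\<^esub>)"
        using proj_lift[OF P(1) XN(3) _ _ h1] XN by auto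
      obtain t where t: "t \<in> carrier X" "g t = h (\<zero>\<^bsub>P\<^esub>, \<one>\<^bsub>B\<^esub>)"
        using mod_epi_surj[OF XN(3) hom_closed[OF h]] by force
      note gh = mod_epiD(1)[OF XN(3)]
      have "g (k x \<oplus>\<^bsub>X\<^esub> b \<odot>\<^bsub>X\<^esub> t) = h (x, b)" if "x \<in> carrier P" "b \<in> carrier B" for x b
      proof -
        have "g (k x \<oplus>\<^bsub>X\<^esub> b \<odot>\<^bsub>X\<^esub> t) = h (x, \<zero>\<^bsub>B\<^esub>) \<oplus>\<^bsub>N\<^esub> b \<odot>\<^bsub>N\<^esub> h (\<zero>\<^bsub>P\<^esub>, \<one>\<^bsub>B\<^esub>)"
          using that k t hom_closed[OF k(1)] by (simp add: hom_add[OF gh] hom_smult[OF gh] X.smult_closed)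
        also have "\<dots> = h ((x, \<zero>\<^bsub>B\<^esub>) \<oplus>\<^bsub>?S\<^esub> b \<odot>\<^bsub>?S\<^esub> (\<zero>\<^bsub>P\<^esub>, \<one>\<^bsub>B\<^esub>))"
          using that hom_add[OF h, of "(x, \<zero>\<^bsub>B\<^esub>)" "b \<odot>\<^bsub>?S\<^esub> (\<zero>\<^bsub>P\<^esub>, \<one>\<^bsub>B\<^esub>)"] hom_smult[OF h, of b "(\<zero>\<^bsub>P\<^esub>, \<one>\<^bsub>B\<^esub>)"] by simp
        finally show ?thesis using that by simp
      qed
      then show "\<exists>h'\<in>mod_hom B ?S X. \<forall>x\<in>carrier ?S. g (h' x) = h x"
        by (intro bexI[OF _ plus[OF lX k(1) t(1)]]) auto
    qed
    moreover have ph: "(\<lambda>(x, b). p x \<oplus>\<^bsub>M\<^esub> b \<odot>\<^bsub>M\<^esub> s) \<in> mod_hom B ?S M" (is "?p \<in> _") using plus[OF lM P(2) s] .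
    have "(\<lambda>x. ?p (r' x)) \<in> mod_hom B P' M" using hom_comp[OF mod_isoD(1)[OF r'(1)] ph] .
    moreover have "insert s T \<subseteq> (\<lambda>x. ?p (r' x)) ` carrier P'"
    proof -
      have im: "?p z \<in> (\<lambda>x. ?p (r' x)) ` carrier P'" if "z \<in> carrier ?S" for z
        using r'(2)[OF that] hom_closed[OF mod_isoD(1)[OF P'(2)] that] by (intro image_eqI[of _ _ "r z"]) auto
      have "s = ?p (\<zero>\<^bsub>P\<^esub>, \<one>\<^bsub>B\<^esub>)" using s hom_zero[OF P(2) lP lM] by (simp add: M.smult_one)
      moreover have "p x = ?p (x, \<zero>\<^bsub>B\<^esub>)" if "x \<in> carrier P" for x using s hom_closed[OF P(2) that] by simp
      ultimately have sp: "s = ?p (\<zero>\<^bsub>P\<^esub>, \<one>\<^bsub>B\<^esub>)" "\<And>x. x \<in> carrier P \<Longrightarrow> p x = ?p (x, \<zero>\<^bsub>B\<^esub>)" by blast+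
      have "s \<in> (\<lambda>x. ?p (r' x)) ` carrier P'" by (subst sp(1)) (rule im, simp)
      moreover have "p x \<in> (\<lambda>x. ?p (r' x)) ` carrier P'" if "x \<in> carrier P" for x
        by (subst sp(2)[OF that]) (rule im, simp add: that)
      ultimately show ?thesis using P(3) by blast
    qed
    ultimately show ?case by blast
  qed
  from this[OF S(1,2)] obtain P p where P: "projective B P" "p \<in> mod_hom B P M" "S \<subseteq> p ` carrier P" by blast
  have lP: "left_module B P" using P(1) by (auto simp: projective_def)
  have "p ` carrier P = carrier M" using S(3)[OF submod_image[OF P(2) lP lM submod_carrier[OF lP]] P(3)] .
  then show ?thesis using P by (auto simp: mod_epi_def)
qed

text \<open>A projective mapping onto \<open>M\<close> belongs to the resolving subcategory, so its
  map to \<open>M\<close> factors through \<open>f\<close>.\<close>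

lemma approx_epi:
  assumes Y\<Y>: "resolving B \<Y>" and a: "right_approximation B \<Y> Y M f" and M: "M \<in> fg_mods B"
  shows "mod_epi B Y M f"
proof -
  obtain P p where P: "projective B P" "mod_epi B P M p" using enough_projectives[of M] M by auto
  have Pin: "P \<in> \<Y>" using Y\<Y> P(1) by (simp add: resolving_def)
  obtain k where k: "k \<in> mod_hom B P Y" "\<forall>x\<in>carrier P. f (k x) = p x"
    using approx_lift[OF resolving_full[OF Y\<Y>] a in_cat_self[OF resolving_full[OF Y\<Y>] Pin] mod_epiD(1)[OF P(2)]] by blast
  show ?thesis
  proof (rule mod_epiI)
    show "f \<in> mod_hom B Y M" using a by (simp add: right_approximation_def)
    fix y assume "y \<in> carrier M"
    then obtain x where "x \<in> carrier P" "p x = y" using mod_epi_surj[OF P(2)] by metis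
    then show "\<exists>x\<in>carrier Y. y = f x" using k hom_closed[OF k(1)] by (intro bexI[of _ "k x"]) auto
  qed
qed

lemma resolving_zero:
  assumes Y\<Y>: "resolving B \<Y>" and M: "left_module B M" "carrier M = {\<zero>\<^bsub>M\<^esub>}"
  shows "in_cat B \<Y> M"
proof -
  have "fg_left_module B M" unfolding fg_iff using M submodD(1,2)[of B M]
    by (intro conjI exI[of _ "{}"]) (auto simp: submod_def)
  then obtain P f where P: "P \<in> fg_mods B" "mod_iso B M P f" using fg_rep by blast
  have lP: "left_module B P" using P by auto
  have "carrier P = {\<zero>\<^bsub>P\<^esub>}"
    using mod_isoD(3)[OF P(2)] M(2) hom_zero[OF mod_isoD(1)[OF P(2)] M(1) lP] by auto
  then have "P \<in> \<Y>" using projective_zero P(1) Y\<Y> by (auto simp: resolving_def)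
  then show ?thesis using in_cat_iso'[OF in_cat_self[OF resolving_full[OF Y\<Y>]] P(2) M(1)] by blast
qed

end

section \<open>Modules of bounded resolution dimension\<close>

text \<open>Resolution dimension at most \<open>d\<close>, unfolded one kernel at a time for the
  sake of induction; \<open>resolution_hat_iff\<close> connects it with long exact
  sequences.\<close>

primrec dimcat :: "('b, 'c) ring_scheme \<Rightarrow> 'b fgmod set \<Rightarrow> nat \<Rightarrow> 'b fgmod set" where
  "dimcat B \<Y> 0 = \<Y>"
| "dimcat B \<Y> (Suc d) = {M \<in> fg_mods B. \<exists>Y\<in>\<Y>. \<exists>K\<in>dimcat B \<Y> d. \<exists>f g. short_exact B K Y M f g}"

lemma dimcat_SucI:
  assumes "M \<in> fg_mods B" "Y \<in> \<Y>" "K \<in> dimcat B \<Y> d" "short_exact B K Y M f g"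
  shows "M \<in> dimcat B \<Y> (Suc d)"
  unfolding dimcat.simps
  by (intro CollectI conjI bexI[OF _ assms(2)] bexI[OF _ assms(3)] exI) (rule assms(1), rule assms(4))

lemma dimcat_full: "full_subcategory B \<Y> \<Longrightarrow> full_subcategory B (dimcat B \<Y> d)"
proof (induction d)
  case (Suc d)
  then have full: "full_subcategory B (dimcat B \<Y> d)" by simp
  show ?case unfolding full_subcategory_def
  proof (intro conjI ballI impI)
    fix M N assume M: "M \<in> dimcat B \<Y> (Suc d)" and N: "N \<in> fg_mods B" and i: "isomorphic_mods B M N"
    obtain Y K f g where *: "Y \<in> \<Y>" "K \<in> dimcat B \<Y> d" "short_exact B K Y M f g" using M by auto
    obtain m where m: "mod_iso B M N m" using i by (auto simp: isomorphic_mods_def)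
    have "K \<in> fg_mods B" "Y \<in> fg_mods B" "M \<in> fg_mods B"
      using *(1,2) M Suc.prems full by (auto simp: full_subcategory_def)
    then have lm: "left_module B K" "left_module B Y" "left_module B M" "left_module B N" using N by auto
    have id: "mod_iso B L L (\<lambda>x. x)" for L :: "'a fgmod" using hom_id by (auto simp: mod_iso_def bij_betw_def)
    obtain f' g' where "short_exact B K Y N f' g'" using short_exact_transport[OF *(3) id id m lm] by blast
    then show "N \<in> dimcat B \<Y> (Suc d)" by (rule dimcat_SucI[OF N *(1,2)])
  qed auto
qed simp

lemma dimcat_sub: "full_subcategory B \<Y> \<Longrightarrow> dimcat B \<Y> d \<subseteq> fg_mods B"
  using dimcat_full by (auto simp: full_subcategory_def)

lemma in_dimcat_SucI:
  assumes full: "full_subcategory B \<Y>" and e: "short_exact B K Y M f g" and M: "fg_left_module B M"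
    and K: "in_cat B (dimcat B \<Y> d) K" and Y: "in_cat B \<Y> Y"
  shows "in_cat B (dimcat B \<Y> (Suc d)) M"
proof -
  obtain K' k where K': "K' \<in> dimcat B \<Y> d" "left_module B K'" "mod_iso B K K' k"
    using in_cat_rep[OF dimcat_full[OF full] K] by blast
  obtain Y' y where Y': "Y' \<in> \<Y>" "left_module B Y'" "mod_iso B Y Y' y" using in_cat_rep[OF full Y] by blast
  obtain M' m where M': "M' \<in> fg_mods B" "mod_iso B M M' m" using fg_rep[OF M] by blast
  have lm: "left_module B K" "left_module B Y" "left_module B M" "left_module B M'"
    using K Y M M'(1) by (auto simp: in_cat_def)
  obtain f' g' where fg: "short_exact B K' Y' M' f' g'"
    using short_exact_transport[OF e K'(3) Y'(3) M'(2) lm] by blast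
  have "M' \<in> dimcat B \<Y> (Suc d)" using fg K'(1) Y'(1) M'(1) by auto
  then show ?thesis
    using in_cat_iso'[OF in_cat_self[OF dimcat_full[OF full]] M'(2) lm(3)] by blast
qed

section \<open>Dimension shifting and comparison with long resolutions\<close>

context fin_alg begin

text \<open>A form of Schanuel's lemma. A projective \<open>P\<close> covering the pullback of
  \<open>X\<close> and \<open>Y\<close> over \<open>M\<close> maps onto both with kernels in the
  subcategory. The kernel over \<open>Y\<close> maps onto the kernel of \<open>X\<close> over
  \<open>M\<close>, the kernel over \<open>X\<close> maps onto the kernel of \<open>Y\<close> over
  \<open>M\<close>, and both maps have the same kernel, which the induction hypothesis
  bounds.\<close>

lemma dim_shift_aux:
  assumes Y\<Y>: "resolving B \<Y>"
  shows "M \<in> dimcat B \<Y> d \<Longrightarrow> Y \<in> \<Y> \<Longrightarrow> mod_epi B Y M g \<Longrightarrow>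
    in_cat B (dimcat B \<Y> (d - 1)) (sub_module Y {x \<in> carrier Y. g x = \<zero>\<^bsub>M\<^esub>})"
proof (induction d arbitrary: M Y g)
  case 0
  note full = resolving_full[OF Y\<Y>]
  have "fg_left_module B Y" "left_module B Y" "left_module B M"
    using 0 full by (auto simp: full_subcategory_def)
  then show ?case
    using resolving_ker[OF Y\<Y> kernel_short_exact[OF 0(3)] fg_sub[OF _ submod_kernel[OF mod_epiD(1)[OF 0(3)]]]]
      in_cat_self[OF full] 0(1,2) by auto
next
  case (Suc d)
  note full = resolving_full[OF Y\<Y>]
  have fY: "Y \<in> fg_mods B" and fM: "M \<in> fg_mods B" using Suc.prems full by (auto simp: full_subcategory_def)
  have lY: "left_module B Y" and lM: "left_module B M" using fY fM by auto
  obtain X K a b where X: "X \<in> \<Y>" "K \<in> dimcat B \<Y> d" "short_exact B K X M a b" using Suc.prems(1) by auto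
  have fX: "X \<in> fg_mods B" and fK: "K \<in> fg_mods B" using X full dimcat_sub[OF full] by (auto simp: full_subcategory_def)
  have lX: "left_module B X" and lK: "left_module B K" using fX fK by auto
  note ab = short_exactD[OF X(3)]
  note gh = mod_epiD(1)[OF Suc.prems(3)]
  let ?K = "sub_module X {x \<in> carrier X. b x = \<zero>\<^bsub>M\<^esub>}" and ?K' = "sub_module Y {x \<in> carrier Y. g x = \<zero>\<^bsub>M\<^esub>}"
  have sK: "submod B X {x \<in> carrier X. b x = \<zero>\<^bsub>M\<^esub>}" using submod_kernel[OF ab(4) lX lM] .
  have sK': "submod B Y {x \<in> carrier Y. g x = \<zero>\<^bsub>M\<^esub>}" using submod_kernel[OF gh lY lM] .
  have lK0: "left_module B ?K" "left_module B ?K'" using left_module_sub[OF sK lX] left_module_sub[OF sK' lY] by auto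
  have fK0: "fg_left_module B ?K" "fg_left_module B ?K'" using fg_sub[OF _ sK] fg_sub[OF _ sK'] fX fY by auto
  have "mod_iso B K ?K a"
  proof (rule mod_isoI)
    show "a \<in> mod_hom B K ?K" using ab(3,6) by (auto simp: mod_hom_def)
    show "inj_on a (carrier K)" using mod_monoD(2)[OF ab(1)] .
    show "carrier ?K \<subseteq> a ` carrier K" using ab(5) by auto
  qed
  then have K0: "in_cat B (dimcat B \<Y> d) ?K" using in_cat_iso[OF in_cat_self[OF dimcat_full[OF full] X(2)] _ lK0(1)] by blast
  let ?S = "mod_sum X Y"
  let ?E = "{p \<in> carrier ?S. b (fst p) = g (snd p)}"
  have lS: "left_module B ?S" using left_module_mod_sum[OF lX lY] .
  have fS: "fg_left_module B ?S" using fg_mod_sum fX fY by auto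
  interpret S: left_module B ?S by (rule lS)
  have sE: "submod B ?S ?E"
    by (rule submodI) (auto simp: hom_zero[OF ab(4) lX lM] hom_zero[OF gh lY lM] hom_add[OF ab(4)] hom_add[OF gh]
      hom_smult[OF ab(4)] hom_smult[OF gh] left_module.smult_closed[OF lX] left_module.smult_closed[OF lY]
      abelian_monoid.a_closed[OF abelian_group.axioms(1)[OF left_module.axioms(2)[OF lX]]]
      abelian_monoid.a_closed[OF abelian_group.axioms(1)[OF left_module.axioms(2)[OF lY]]]
      abelian_monoid.zero_closed[OF abelian_group.axioms(1)[OF left_module.axioms(2)[OF lX]]]
      abelian_monoid.zero_closed[OF abelian_group.axioms(1)[OF left_module.axioms(2)[OF lY]]])
  let ?EM = "sub_module ?S ?E"
  have fE: "fg_left_module B ?EM" using fg_sub[OF fS sE] .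
  have lE: "left_module B ?EM" using fE by auto
  obtain P p where P: "projective B P" "mod_epi B P ?EM p" using enough_projectives[OF fE] by blast
  have Pin: "P \<in> \<Y>" using Y\<Y> P(1) by (simp add: resolving_def)
  have fP: "P \<in> fg_mods B" using P(1) by (simp add: projective_def)
  have lP: "left_module B P" using fP by auto
  interpret P: left_module B P by (rule lP)
  define \<alpha> where "\<alpha> z = fst (p z)" for z
  define \<beta> where "\<beta> z = snd (p z)" for z
  have incl: "(\<lambda>x. x) \<in> mod_hom B ?EM ?S" by (rule sub_incl) auto
  have ah: "\<alpha> \<in> mod_hom B P X" and bh: "\<beta> \<in> mod_hom B P Y"
    unfolding \<alpha>_def \<beta>_def
    using hom_comp[OF hom_comp[OF mod_epiD(1)[OF P(2)] incl] fst_hom] hom_comp[OF hom_comp[OF mod_epiD(1)[OF P(2)] incl] snd_hom]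
    by auto
  have comm: "b (\<alpha> z) = g (\<beta> z)" if "z \<in> carrier P" for z
    using hom_closed[OF mod_epiD(1)[OF P(2)] that] by (simp add: \<alpha>_def \<beta>_def)
  have ex: "\<exists>z\<in>carrier P. \<alpha> z = x \<and> \<beta> z = y" if "x \<in> carrier X" "y \<in> carrier Y" "b x = g y" for x y
  proof -
    have "(x, y) \<in> carrier ?EM" using that by simp
    from mod_epi_surj[OF P(2) this] obtain z where "z \<in> carrier P" "p z = (x, y)" by blast
    then show ?thesis by (intro bexI[of _ z]) (simp_all add: \<alpha>_def \<beta>_def)
  qed
  have ae: "mod_epi B P X \<alpha>"
  proof (rule mod_epiI[OF ah])
    fix x assume x: "x \<in> carrier X"
    obtain y where "y \<in> carrier Y" "g y = b x" using mod_epi_surj[OF Suc.prems(3) hom_closed[OF ab(4) x]] by metis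
    then show "\<exists>z\<in>carrier P. x = \<alpha> z" using ex[OF x] by metis
  qed
  have be: "mod_epi B P Y \<beta>"
  proof (rule mod_epiI[OF bh])
    fix y assume y: "y \<in> carrier Y"
    obtain x where "x \<in> carrier X" "b x = g y" using mod_epi_surj[OF ab(2) hom_closed[OF gh y]] by metis
    then show "\<exists>z\<in>carrier P. y = \<beta> z" using ex[OF _ y] by metis
  qed
  let ?Z = "sub_module P {z \<in> carrier P. \<beta> z = \<zero>\<^bsub>Y\<^esub>}" and ?Z' = "sub_module P {z \<in> carrier P. \<alpha> z = \<zero>\<^bsub>X\<^esub>}"
  have sZ: "submod B P {z \<in> carrier P. \<beta> z = \<zero>\<^bsub>Y\<^esub>}" using submod_kernel[OF bh lP lY] .
  have sZ': "submod B P {z \<in> carrier P. \<alpha> z = \<zero>\<^bsub>X\<^esub>}" using submod_kernel[OF ah lP lX] .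
  have fZ: "fg_left_module B ?Z" "fg_left_module B ?Z'" using fg_sub[OF _ sZ] fg_sub[OF _ sZ'] fP by auto
  have lZ: "left_module B ?Z" "left_module B ?Z'" using fZ by auto
  note iP = in_cat_self[OF full Pin] and iX = in_cat_self[OF full X(1)] and iY = in_cat_self[OF full Suc.prems(2)]
  have Z: "in_cat B \<Y> ?Z" using resolving_ker[OF Y\<Y> kernel_short_exact[OF be lP lY] fZ(1) iP iY] .
  have Z': "in_cat B \<Y> ?Z'" using resolving_ker[OF Y\<Y> kernel_short_exact[OF ae lP lX] fZ(2) iP iX] .
  have Zm: "?Z \<in> \<Y>" using Z fZ in_cat_mem[OF full] by (auto simp: fg_mods_def)
  have aZ: "mod_epi B ?Z ?K \<alpha>"
  proof (rule mod_epiI)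
    show "\<alpha> \<in> mod_hom B ?Z ?K" using ah comm hom_zero[OF gh lY lM] by (auto simp: mod_hom_def)
    fix x assume "x \<in> carrier ?K"
    then have "x \<in> carrier X" "b x = g \<zero>\<^bsub>Y\<^esub>" using hom_zero[OF gh lY lM] by auto
    then show "\<exists>z\<in>carrier ?Z. x = \<alpha> z"
      using ex[of x "\<zero>\<^bsub>Y\<^esub>"] abelian_monoid.zero_closed[OF abelian_group.axioms(1)[OF left_module.axioms(2)[OF lY]]] by auto
  qed
  have bZ': "mod_epi B ?Z' ?K' \<beta>"
  proof (rule mod_epiI)
    show "\<beta> \<in> mod_hom B ?Z' ?K'" using bh comm[symmetric] hom_zero[OF ab(4) lX lM] by (auto simp: mod_hom_def)
    fix y assume "y \<in> carrier ?K'"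
    then have "y \<in> carrier Y" "b \<zero>\<^bsub>X\<^esub> = g y" using hom_zero[OF ab(4) lX lM] by auto
    then show "\<exists>z\<in>carrier ?Z'. y = \<beta> z"
      using ex[of "\<zero>\<^bsub>X\<^esub>" y] abelian_monoid.zero_closed[OF abelian_group.axioms(1)[OF left_module.axioms(2)[OF lX]]] by auto
  qed
  obtain K1 k1 where K1: "K1 \<in> dimcat B \<Y> d" "left_module B K1" "mod_iso B ?K K1 k1"
    using in_cat_rep[OF dimcat_full[OF full] K0] by blast
  have L1: "in_cat B (dimcat B \<Y> (d - 1)) (sub_module ?Z {x \<in> carrier ?Z. k1 (\<alpha> x) = \<zero>\<^bsub>K1\<^esub>})"
    using Suc.IH[OF K1(1) Zm mod_epi_comp[OF aZ mod_iso_epi[OF K1(3)]]] .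
  have "k1 x = \<zero>\<^bsub>K1\<^esub> \<longleftrightarrow> x = \<zero>\<^bsub>X\<^esub>" if "x \<in> carrier ?K" for x
    using that hom_inj_iff[OF mod_isoD(1)[OF K1(3)] lK0(1) K1(2)] mod_isoD(2)[OF K1(3)]
      hom_zero[OF mod_isoD(1)[OF K1(3)] lK0(1) K1(2)] by auto
  then have "{x \<in> carrier ?Z. k1 (\<alpha> x) = \<zero>\<^bsub>K1\<^esub>} = {z \<in> carrier P. \<alpha> z = \<zero>\<^bsub>X\<^esub> \<and> \<beta> z = \<zero>\<^bsub>Y\<^esub>}"
    using hom_closed[OF mod_epiD(1)[OF aZ]] by auto
  with L1 have L: "in_cat B (dimcat B \<Y> (d - 1)) (sub_module P {z \<in> carrier P. \<alpha> z = \<zero>\<^bsub>X\<^esub> \<and> \<beta> z = \<zero>\<^bsub>Y\<^esub>})" by simp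
  show ?case
  \<comment> \<open>For \<open>d = 0\<close> the truncated subtraction gives nothing smaller. Then
    the pullback itself lies in the subcategory, as an extension of \<open>Y\<close> by the kernel
    over \<open>X\<close>, and the wanted kernel is the kernel of its projection onto
    \<open>X\<close>.\<close>
  proof (cases d)
    case 0
    have i0: "in_cat B \<Y> ?K" using K0 0 by simp
    have "short_exact B ?K ?EM Y (\<lambda>x. (x, \<zero>\<^bsub>Y\<^esub>)) snd"
    proof (rule short_exactI)
      have zY: "\<zero>\<^bsub>Y\<^esub> \<in> carrier Y" using lY by (simp add: left_module_def abelian_group_def abelian_monoid.zero_closed)
      have "(\<lambda>x. (x, \<zero>\<^bsub>Y\<^esub>)) \<in> mod_hom B ?K ?EM"
        using zY lY hom_zero[OF gh lY lM] by (intro mod_homI)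
          (auto simp: left_module.smult_r_null abelian_monoid.l_zero left_module_def abelian_group_def)
      then show "mod_mono B ?K ?EM (\<lambda>x. (x, \<zero>\<^bsub>Y\<^esub>))" by (auto simp: mod_mono_def inj_on_def)
      show "mod_epi B ?EM Y snd"
      proof (rule mod_epiI)
        show "snd \<in> mod_hom B ?EM Y" using hom_comp[OF incl snd_hom] .
        fix y assume y: "y \<in> carrier Y"
        obtain x where "x \<in> carrier X" "b x = g y" using mod_epi_surj[OF ab(2) hom_closed[OF gh y]] by metis
        then show "\<exists>x\<in>carrier ?EM. y = snd x" using y by force
      qed
    qed (auto simp: hom_zero[OF gh lY lM])
    then have iE: "in_cat B \<Y> ?EM" using resolving_ext[OF Y\<Y> _ fE i0 iY] by blast
    have "short_exact B ?K' ?EM X (\<lambda>y. (\<zero>\<^bsub>X\<^esub>, y)) fst"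
    proof (rule short_exactI)
      have zX: "\<zero>\<^bsub>X\<^esub> \<in> carrier X" using lX by (simp add: left_module_def abelian_group_def abelian_monoid.zero_closed)
      have "(\<lambda>y. (\<zero>\<^bsub>X\<^esub>, y)) \<in> mod_hom B ?K' ?EM"
        using zX lX hom_zero[OF ab(4) lX lM] by (intro mod_homI)
          (auto simp: left_module.smult_r_null abelian_monoid.l_zero left_module_def abelian_group_def)
      then show "mod_mono B ?K' ?EM (\<lambda>y. (\<zero>\<^bsub>X\<^esub>, y))" by (auto simp: mod_mono_def inj_on_def)
      show "mod_epi B ?EM X fst"
      proof (rule mod_epiI)
        show "fst \<in> mod_hom B ?EM X" using hom_comp[OF incl fst_hom] .
        fix x assume x: "x \<in> carrier X"
        obtain y where "y \<in> carrier Y" "g y = b x" using mod_epi_surj[OF Suc.prems(3) hom_closed[OF ab(4) x]] by metis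
        then show "\<exists>z\<in>carrier ?EM. x = fst z" using x by force
      qed
    qed (auto simp: hom_zero[OF ab(4) lX lM])
    then have "in_cat B \<Y> ?K'" using resolving_ker[OF Y\<Y> _ fK0(2) iE iX] by blast
    then show ?thesis using 0 by simp
  next
    case (Suc d')
    have e: "sub_module ?Z' {x \<in> carrier ?Z'. \<beta> x = \<zero>\<^bsub>?K'\<^esub>} = sub_module P {z \<in> carrier P. \<alpha> z = \<zero>\<^bsub>X\<^esub> \<and> \<beta> z = \<zero>\<^bsub>Y\<^esub>}"
      by (simp add: conj_assoc)
    show ?thesis
      using in_dimcat_SucI[OF full kernel_short_exact[OF bZ' lZ(2) lK0(2)] fK0(2) _ Z', unfolded e, OF L] Suc by simp
  qed
qed

lemma dim_shift:
  assumes Y\<Y>: "resolving B \<Y>" and M: "in_cat B (dimcat B \<Y> d) M" and Y: "in_cat B \<Y> Y"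
    and e: "short_exact B K Y M f g" and K: "left_module B K"
  shows "in_cat B (dimcat B \<Y> (d - 1)) K"
proof -
  note full = resolving_full[OF Y\<Y>]
  note fg = short_exactD[OF e]
  obtain Y' y where Y': "Y' \<in> \<Y>" "left_module B Y'" "mod_iso B Y Y' y" using in_cat_rep[OF full Y] by blast
  obtain M' m where M': "M' \<in> dimcat B \<Y> d" "left_module B M'" "mod_iso B M M' m"
    using in_cat_rep[OF dimcat_full[OF full] M] by blast
  have lY: "left_module B Y" and lM: "left_module B M" using Y M by (auto simp: in_cat_def)
  obtain y' where y': "mod_iso B Y' Y y'" "\<And>x. x \<in> carrier Y \<Longrightarrow> y' (y x) = x" "\<And>x. x \<in> carrier Y' \<Longrightarrow> y (y' x) = x"
    using mod_iso_inv[OF Y'(3) lY] by metis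
  have mz: "m x = \<zero>\<^bsub>M'\<^esub> \<longleftrightarrow> x = \<zero>\<^bsub>M\<^esub>" if "x \<in> carrier M" for x
    using that hom_inj_iff[OF mod_isoD(1)[OF M'(3)] lM M'(2)] mod_isoD(2)[OF M'(3)]
      hom_zero[OF mod_isoD(1)[OF M'(3)] lM M'(2)] by auto
  let ?g = "\<lambda>x. m (g (y' x))"
  let ?K = "sub_module Y' {x \<in> carrier Y'. ?g x = \<zero>\<^bsub>M'\<^esub>}"
  have "in_cat B (dimcat B \<Y> (d - 1)) ?K"
    using dim_shift_aux[OF Y\<Y> M'(1) Y'(1) mod_epi_comp[OF mod_epi_comp[OF mod_iso_epi[OF y'(1)] fg(2)] mod_iso_epi[OF M'(3)]]] .
  moreover have "mod_iso B K ?K (\<lambda>x. y (f x))"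
  proof (rule mod_isoI)
    note yh = mod_isoD(1)[OF Y'(3)]
    show "(\<lambda>x. y (f x)) \<in> mod_hom B K ?K"
      using hom_comp[OF fg(3) yh] fg(6) y'(2) hom_closed[OF fg(3)] hom_zero[OF mod_isoD(1)[OF M'(3)] lM M'(2)]
      by (auto simp: mod_hom_def)
    show "inj_on (\<lambda>x. y (f x)) (carrier K)"
      using mod_monoD(2)[OF fg(1)] mod_isoD(2)[OF Y'(3)] hom_closed[OF fg(3)] by (auto simp: inj_on_def)
    show "carrier ?K \<subseteq> (\<lambda>x. y (f x)) ` carrier K"
    proof
      fix z assume "z \<in> carrier ?K"
      then have z: "z \<in> carrier Y'" "m (g (y' z)) = \<zero>\<^bsub>M'\<^esub>" by auto
      have c: "y' z \<in> carrier Y" using hom_closed[OF mod_isoD(1)[OF y'(1)] z(1)] .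
      then have "g (y' z) = \<zero>\<^bsub>M\<^esub>" using z(2) mz[OF hom_closed[OF fg(4) c]] by simp
      then obtain x where "x \<in> carrier K" "y' z = f x" using fg(5)[OF c] by auto
      then show "z \<in> (\<lambda>x. y (f x)) ` carrier K" using y'(3)[OF z(1)] by (metis imageI)
    qed
  qed
  ultimately show ?thesis using in_cat_iso' K by blast
qed

text \<open>An object of the subcategory resolves itself with zero kernel, and the zero module is
  there as a projective; higher bounds follow by induction on the kernel.\<close>

lemma dimcat_Suc_mono:
  assumes Y\<Y>: "resolving B \<Y>" shows "dimcat B \<Y> d \<subseteq> dimcat B \<Y> (Suc d)"
proof (induction d)
  case 0
  note full = resolving_full[OF Y\<Y>]
  show ?case
  proof
    fix M assume "M \<in> dimcat B \<Y> 0"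
    then have M: "M \<in> \<Y>" and fM: "M \<in> fg_mods B" using full by (auto simp: full_subcategory_def)
    have lM: "left_module B M" using fM by auto
    let ?Z = "sub_module M {x \<in> carrier M. x = \<zero>\<^bsub>M\<^esub>}"
    have i: "mod_epi B M M (\<lambda>x. x)" using hom_id by (auto simp: mod_epi_def)
    note e = kernel_short_exact[OF i lM lM]
    have lZ: "left_module B ?Z" using left_module_sub[OF submod_kernel[OF hom_id lM lM] lM] .
    have "in_cat B \<Y> ?Z" using lM by (intro resolving_zero[OF Y\<Y> lZ])
      (auto simp: left_module_def abelian_group_def abelian_monoid.zero_closed)
    then have "in_cat B (dimcat B \<Y> (Suc 0)) M"
      using in_dimcat_SucI[OF full e _ _ in_cat_self[OF full M], of 0] fM by auto
    then show "M \<in> dimcat B \<Y> (Suc 0)" using in_cat_mem[OF dimcat_full[OF full] fM] by blast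
  qed
next
  case (Suc d)
  show ?case
  proof
    fix M assume "M \<in> dimcat B \<Y> (Suc d)"
    then obtain Y K f g where *: "M \<in> fg_mods B" "Y \<in> \<Y>" "K \<in> dimcat B \<Y> d" "short_exact B K Y M f g" by auto
    then have "K \<in> dimcat B \<Y> (Suc d)" using Suc by blast
    then show "M \<in> dimcat B \<Y> (Suc (Suc d))" using * unfolding dimcat.simps(2)[of B \<Y> "Suc d"] by blast
  qed
qed

lemma dimcat_mono: "resolving B \<Y> \<Longrightarrow> d \<le> d' \<Longrightarrow> dimcat B \<Y> d \<subseteq> dimcat B \<Y> d'"
  using lift_Suc_mono_le[of "dimcat B \<Y>" d d'] dimcat_Suc_mono by blast

text \<open>Cut off the first term: by exactness the image of \<open>d (Suc 0)\<close> is the kernel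
  of \<open>d 0\<close>, and the remaining maps resolve it.\<close>

lemma hat_to_dim:
  assumes full: "full_subcategory B \<Y>"
  shows "M \<in> fg_mods B \<Longrightarrow> (\<forall>i\<le>m. Y i \<in> \<Y>) \<Longrightarrow> mod_epi B (Y 0) M (d 0) \<Longrightarrow>
     (\<forall>i<m. d (Suc i) \<in> mod_hom B (Y (Suc i)) (Y i)) \<Longrightarrow>
     (\<forall>i<m. d (Suc i) ` carrier (Y (Suc i)) = a_kernel (Y i) (case i of 0 \<Rightarrow> M | Suc j \<Rightarrow> Y j) (d i)) \<Longrightarrow>
     inj_on (d m) (carrier (Y m)) \<Longrightarrow> M \<in> dimcat B \<Y> m"
proof (induction m arbitrary: M Y d)
  case 0
  have "mod_iso B (Y 0) M (d 0)" using 0 by (auto simp: mod_iso_def mod_epi_def bij_betw_def)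
  then show ?case using 0 full unfolding full_subcategory_def isomorphic_mods_def by auto
next
  case (Suc m)
  have fY: "Y i \<in> fg_mods B" if "i \<le> Suc m" for i using that Suc.prems(2) full by (auto simp: full_subcategory_def)
  have lY: "left_module B (Y 0)" and lM: "left_module B M" using fY[of 0] Suc.prems(1) by auto
  let ?K = "sub_module (Y 0) {x \<in> carrier (Y 0). d 0 x = \<zero>\<^bsub>M\<^esub>}"
  have d0: "d 0 \<in> mod_hom B (Y 0) M" using mod_epiD(1)[OF Suc.prems(3)] .
  have sK: "submod B (Y 0) {x \<in> carrier (Y 0). d 0 x = \<zero>\<^bsub>M\<^esub>}" using submod_kernel[OF d0 lY lM] .
  have fK: "?K \<in> fg_mods B" using fg_sub[OF _ sK] fY[of 0] by (auto simp: fg_mods_def)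
  have im: "d (Suc 0) ` carrier (Y (Suc 0)) = {x \<in> carrier (Y 0). d 0 x = \<zero>\<^bsub>M\<^esub>}"
    using Suc.prems(5)[rule_format, of 0] by (simp add: a_kernel_eq)
  have "?K \<in> dimcat B \<Y> m"
  proof (rule Suc.IH[of ?K "\<lambda>i. Y (Suc i)" "\<lambda>i. d (Suc i)"])
    have "d (Suc 0) \<in> mod_hom B (Y (Suc 0)) (Y 0)" using Suc.prems(4) by simp
    then have "d (Suc 0) \<in> mod_hom B (Y (Suc 0)) ?K" using im unfolding mod_hom_def by auto
    then show "mod_epi B (Y (Suc 0)) ?K (d (Suc 0))" using im by (simp add: mod_epi_def)
    show "\<forall>i<m. d (Suc (Suc i)) ` carrier (Y (Suc (Suc i))) =
      a_kernel (Y (Suc i)) (case i of 0 \<Rightarrow> ?K | Suc j \<Rightarrow> Y (Suc j)) (d (Suc i))"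
    proof (intro allI impI)
      fix i assume "i < m"
      then show "d (Suc (Suc i)) ` carrier (Y (Suc (Suc i))) =
        a_kernel (Y (Suc i)) (case i of 0 \<Rightarrow> ?K | Suc j \<Rightarrow> Y (Suc j)) (d (Suc i))"
        using Suc.prems(5)[rule_format, of "Suc i"] by (cases i) (auto simp: a_kernel_eq)
    qed
  qed (use fK Suc.prems in auto)
  then show ?case using kernel_short_exact[OF Suc.prems(3) lY lM] Suc.prems(1,2) by auto
qed

lemma resolution_hat_iff:
  assumes full: "full_subcategory B \<Y>"
  shows "M \<in> resolution_hat B \<Y> \<longleftrightarrow> (\<exists>d. M \<in> dimcat B \<Y> d)"
proof
  assume "M \<in> resolution_hat B \<Y>"
  then obtain m Y d where "M \<in> fg_mods B" "\<forall>i\<le>m. Y i \<in> \<Y>" "mod_epi B (Y 0) M (d 0)"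
     "\<forall>i<m. d (Suc i) \<in> mod_hom B (Y (Suc i)) (Y i)"
     "\<forall>i<m. d (Suc i) ` carrier (Y (Suc i)) = a_kernel (Y i) (case i of 0 \<Rightarrow> M | Suc j \<Rightarrow> Y j) (d i)"
     "inj_on (d m) (carrier (Y m))" unfolding resolution_hat_def by (elim CollectE conjE exE)
  then have "M \<in> dimcat B \<Y> m" by (rule hat_to_dim[OF full])
  then show "\<exists>d. M \<in> dimcat B \<Y> d" ..
next
  have "M \<in> dimcat B \<Y> d \<Longrightarrow> M \<in> resolution_hat B \<Y>" for d
  proof (induction d arbitrary: M)
    case 0
    have "M \<in> fg_mods B" using 0 full by (auto simp: full_subcategory_def)
    moreover have "mod_epi B M M (\<lambda>x. x)" using hom_id by (auto simp: mod_epi_def)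
    ultimately show ?case unfolding resolution_hat_def using 0
      by (intro CollectI conjI exI[of _ 0] exI[of _ "\<lambda>_. M"] exI[of _ "\<lambda>_ x. x"]) auto
  next
    case (Suc d)
    obtain Y0 K f g where M: "M \<in> fg_mods B" "Y0 \<in> \<Y>" "K \<in> dimcat B \<Y> d" "short_exact B K Y0 M f g"
      using Suc.prems by auto
    note fg = short_exactD[OF M(4)]
    have "K \<in> resolution_hat B \<Y>" using Suc.IH[OF M(3)] .
    then obtain m Y \<delta> where K: "\<forall>i\<le>m. Y i \<in> \<Y>" "mod_epi B (Y 0) K (\<delta> 0)"
     "\<forall>i<m. \<delta> (Suc i) \<in> mod_hom B (Y (Suc i)) (Y i)"
     "\<forall>i<m. \<delta> (Suc i) ` carrier (Y (Suc i)) = a_kernel (Y i) (case i of 0 \<Rightarrow> K | Suc j \<Rightarrow> Y j) (\<delta> i)"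
     "inj_on (\<delta> m) (carrier (Y m))" unfolding resolution_hat_def by (elim CollectE conjE exE)
    have "K \<in> fg_mods B" "Y0 \<in> fg_mods B"
      using M(2,3) dimcat_sub[OF full, of d] full by (auto simp: full_subcategory_def)
    then have lm: "left_module B K" "left_module B Y0" "left_module B M" using M(1) by auto
    have fz: "f x = \<zero>\<^bsub>Y0\<^esub> \<longleftrightarrow> x = \<zero>\<^bsub>K\<^esub>" if "x \<in> carrier K" for x
      using that hom_inj_iff[OF fg(3) lm(1,2)] mod_monoD(2)[OF fg(1)] hom_zero[OF fg(3) lm(1,2)] by auto
    define Y' where "Y' i = (case i of 0 \<Rightarrow> Y0 | Suc j \<Rightarrow> Y j)" for i
    \<comment> \<open>Splicing: the resolution of \<open>K\<close> is shifted by one, and its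
      augmentation followed by \<open>f\<close> becomes the map at index 1.\<close>
    define D where "D i = (case i of 0 \<Rightarrow> g | Suc 0 \<Rightarrow> (\<lambda>x. f (\<delta> 0 x)) | Suc (Suc j) \<Rightarrow> \<delta> (Suc j))" for i
    have im0: "\<delta> 0 ` carrier (Y 0) = carrier K" using mod_epiD(2)[OF K(2)] .
    show ?case unfolding resolution_hat_def
    proof (intro CollectI conjI exI[of _ "Suc m"] exI[of _ Y'] exI[of _ D] M(1))
      show "\<forall>i\<le>Suc m. Y' i \<in> \<Y>" using K(1) M(2) by (auto simp: Y'_def split: nat.split)
      show "mod_epi B (Y' 0) M (D 0)" using fg(2) by (simp add: Y'_def D_def)
      have 0: "(\<lambda>x. f (\<delta> 0 x)) \<in> mod_hom B (Y 0) Y0" using hom_comp[OF mod_epiD(1)[OF K(2)] fg(3)] .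
      show "\<forall>i<Suc m. D (Suc i) \<in> mod_hom B (Y' (Suc i)) (Y' i)"
        using K(3) 0 by (auto simp: Y'_def D_def split: nat.split)
      show "\<forall>i<Suc m. D (Suc i) ` carrier (Y' (Suc i)) = a_kernel (Y' i) (case i of 0 \<Rightarrow> M | Suc j \<Rightarrow> Y' j) (D i)"
      proof (intro allI impI)
        fix i assume i: "i < Suc m"
        show "D (Suc i) ` carrier (Y' (Suc i)) = a_kernel (Y' i) (case i of 0 \<Rightarrow> M | Suc j \<Rightarrow> Y' j) (D i)"
        proof (cases i)
          case 0
          have "(\<lambda>x. f (\<delta> 0 x)) ` carrier (Y 0) = f ` carrier K" unfolding im0[symmetric] by auto
          also have "\<dots> = a_kernel Y0 M g" using M(4) by (simp add: short_exact_def)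
          finally show ?thesis using 0 by (simp add: Y'_def D_def)
        next
          case (Suc j)
          have e: "\<delta> (Suc j) ` carrier (Y (Suc j)) = a_kernel (Y j) (case j of 0 \<Rightarrow> K | Suc j \<Rightarrow> Y j) (\<delta> j)"
            using K(4) i Suc by simp
          show ?thesis
          proof (cases j)
            case 0
            have "f (\<delta> 0 x) = \<zero>\<^bsub>Y0\<^esub> \<longleftrightarrow> \<delta> 0 x = \<zero>\<^bsub>K\<^esub>" if "x \<in> carrier (Y 0)" for x
              using fz hom_closed[OF mod_epiD(1)[OF K(2)] that] by blast
            then have "a_kernel (Y 0) Y0 (\<lambda>x. f (\<delta> 0 x)) = a_kernel (Y 0) K (\<delta> 0)"
              unfolding a_kernel_eq by blast
            then show ?thesis using e Suc 0 by (simp add: Y'_def D_def)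
          next
            case (Suc j')
            then show ?thesis using e \<open>i = Suc j\<close> by (simp add: Y'_def D_def)
          qed
        qed
      qed
      show "inj_on (D (Suc m)) (carrier (Y' (Suc m)))"
      proof (cases m)
        case 0
        have "inj_on (\<lambda>x. f (\<delta> 0 x)) (carrier (Y 0))"
          using K(5) 0 mod_monoD(2)[OF fg(1)] hom_closed[OF mod_epiD(1)[OF K(2)]] by (auto simp: inj_on_def)
        then show ?thesis using 0 by (simp add: Y'_def D_def)
      next
        case (Suc m')
        then show ?thesis using K(5) by (simp add: Y'_def D_def)
      qed
    qed
  qed
  then show "\<exists>d. M \<in> dimcat B \<Y> d \<Longrightarrow> M \<in> resolution_hat B \<Y>" by blast
qed

end

section \<open>Modules over upper triangular matrices\<close>

locale tri = fin_alg R A \<iota> for R :: "('r, 'c) ring_scheme" and A :: "('a, 'd) ring_scheme" and \<iota> +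
  fixes n :: nat
  assumes n2: "2 \<le> n"
begin

section \<open>The triangular ring as an algebra over \<open>R\<close>\<close>

abbreviation T :: "(nat \<Rightarrow> nat \<Rightarrow> 'a) ring" where "T \<equiv> upper_tri n A"

abbreviation valid :: "nat \<Rightarrow> nat \<Rightarrow> bool" where "valid i j \<equiv> 1 \<le> i \<and> i \<le> j \<and> j \<le> n"

text \<open>Outside the triangle (in particular for \<open>j = n + 1\<close>) these matrix units are zero.\<close>

definition E :: "nat \<Rightarrow> nat \<Rightarrow> 'a \<Rightarrow> nat \<Rightarrow> nat \<Rightarrow> 'a" where
  "E i j a = (\<lambda>p q. if p = i \<and> q = j \<and> valid i j then a else \<zero>\<^bsub>A\<^esub>)"

abbreviation u :: "nat \<Rightarrow> nat \<Rightarrow> nat \<Rightarrow> nat \<Rightarrow> 'a" where "u i j \<equiv> E i j \<one>\<^bsub>A\<^esub>"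

text \<open>Scalar matrices; those coming from \<open>R\<close> are central and give the structure
  map \<open>\<iota>T\<close>.\<close>

definition dg :: "'a \<Rightarrow> nat \<Rightarrow> nat \<Rightarrow> 'a" where
  "dg a = (\<lambda>p q. if p = q \<and> 1 \<le> p \<and> p \<le> n then a else \<zero>\<^bsub>A\<^esub>)"

lemma T_carrier: "t \<in> carrier T \<longleftrightarrow> (\<forall>i j. t i j \<in> carrier A) \<and> (\<forall>i j. \<not> valid i j \<longrightarrow> t i j = \<zero>\<^bsub>A\<^esub>)"
  by (simp add: upper_tri_def)

lemma T_entry: "t \<in> carrier T \<Longrightarrow> t i j \<in> carrier A"
  and T_out: "t \<in> carrier T \<Longrightarrow> \<not> valid i j \<Longrightarrow> t i j = \<zero>\<^bsub>A\<^esub>"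
  using T_carrier by blast+

lemma T_add: "(s \<oplus>\<^bsub>T\<^esub> t) i j = s i j \<oplus>\<^bsub>A\<^esub> t i j"
  and T_mult: "(s \<otimes>\<^bsub>T\<^esub> t) i j = (\<Oplus>\<^bsub>A\<^esub>k\<in>{1..n}. s i k \<otimes>\<^bsub>A\<^esub> t k j)"
  and T_zero: "\<zero>\<^bsub>T\<^esub> = (\<lambda>i j. \<zero>\<^bsub>A\<^esub>)"
  and T_one: "\<one>\<^bsub>T\<^esub> = dg \<one>\<^bsub>A\<^esub>"
  by (auto simp: upper_tri_def dg_def fun_eq_iff)

lemma E_carrier [simp]: "a \<in> carrier A \<Longrightarrow> E i j a \<in> carrier T"
  by (auto simp: T_carrier E_def)

lemma dg_carrier [simp]: "a \<in> carrier A \<Longrightarrow> dg a \<in> carrier T"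
  by (auto simp: T_carrier dg_def)

lemma E_invalid: "\<not> valid i j \<Longrightarrow> E i j a = \<zero>\<^bsub>T\<^esub>"
  by (auto simp: E_def T_zero)

lemma T_abelian: "abelian_group T"
proof (rule abelian_groupI)
  fix t assume t: "t \<in> carrier T"
  have "(\<lambda>i j. \<ominus>\<^bsub>A\<^esub> t i j) \<in> carrier T" using t by (auto simp: T_carrier)
  moreover have "(\<lambda>i j. \<ominus>\<^bsub>A\<^esub> t i j) \<oplus>\<^bsub>T\<^esub> t = \<zero>\<^bsub>T\<^esub>" using t by (auto simp: fun_eq_iff T_add T_zero T_entry B.l_neg)
  ultimately show "\<exists>s\<in>carrier T. s \<oplus>\<^bsub>T\<^esub> t = \<zero>\<^bsub>T\<^esub>" by blast
qed (auto simp: T_carrier fun_eq_iff T_add T_zero B.a_ac)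

lemma T_mult_closed: "s \<in> carrier T \<Longrightarrow> t \<in> carrier T \<Longrightarrow> s \<otimes>\<^bsub>T\<^esub> t \<in> carrier T"
  unfolding T_carrier[of "s \<otimes>\<^bsub>T\<^esub> t"]
proof (intro conjI allI impI)
  assume s: "s \<in> carrier T" and t: "t \<in> carrier T"
  show "(s \<otimes>\<^bsub>T\<^esub> t) i j \<in> carrier A" for i j
    unfolding T_mult using s t by (intro B.finsum_closed) (auto simp: T_entry)
  fix i j assume ij: "\<not> valid i j"
  have "s i k \<otimes>\<^bsub>A\<^esub> t k j = \<zero>\<^bsub>A\<^esub>" for k
  proof (cases "valid i k")
    case True
    then have "\<not> valid k j" using ij by linarith
    then show ?thesis using T_out[OF t] T_entry[OF s] by simp
  next
    case False
    then show ?thesis using T_out[OF s] T_entry[OF t] by simp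
  qed
  then show "(s \<otimes>\<^bsub>T\<^esub> t) i j = \<zero>\<^bsub>A\<^esub>" unfolding T_mult by (simp add: B.add.finprod_one_eqI)
qed

lemma T_l_distr:
  assumes "s \<in> carrier T" "s' \<in> carrier T" "t \<in> carrier T"
  shows "(s \<oplus>\<^bsub>T\<^esub> s') \<otimes>\<^bsub>T\<^esub> t = s \<otimes>\<^bsub>T\<^esub> t \<oplus>\<^bsub>T\<^esub> s' \<otimes>\<^bsub>T\<^esub> t"
proof (intro ext)
  fix i j
  have "(\<Oplus>\<^bsub>A\<^esub>k\<in>{1..n}. (s i k \<oplus>\<^bsub>A\<^esub> s' i k) \<otimes>\<^bsub>A\<^esub> t k j) =
    (\<Oplus>\<^bsub>A\<^esub>k\<in>{1..n}. s i k \<otimes>\<^bsub>A\<^esub> t k j \<oplus>\<^bsub>A\<^esub> s' i k \<otimes>\<^bsub>A\<^esub> t k j)"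
    using assms by (intro B.finsum_cong') (auto simp: T_entry B.l_distr)
  also have "\<dots> = (\<Oplus>\<^bsub>A\<^esub>k\<in>{1..n}. s i k \<otimes>\<^bsub>A\<^esub> t k j) \<oplus>\<^bsub>A\<^esub> (\<Oplus>\<^bsub>A\<^esub>k\<in>{1..n}. s' i k \<otimes>\<^bsub>A\<^esub> t k j)"
    using assms by (intro B.finsum_addf) (auto simp: T_entry)
  finally show "((s \<oplus>\<^bsub>T\<^esub> s') \<otimes>\<^bsub>T\<^esub> t) i j = (s \<otimes>\<^bsub>T\<^esub> t \<oplus>\<^bsub>T\<^esub> s' \<otimes>\<^bsub>T\<^esub> t) i j" by (simp add: T_mult T_add)
qed

lemma T_r_distr:
  assumes "s \<in> carrier T" "s' \<in> carrier T" "t \<in> carrier T"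
  shows "t \<otimes>\<^bsub>T\<^esub> (s \<oplus>\<^bsub>T\<^esub> s') = t \<otimes>\<^bsub>T\<^esub> s \<oplus>\<^bsub>T\<^esub> t \<otimes>\<^bsub>T\<^esub> s'"
proof (intro ext)
  fix i j
  have "(\<Oplus>\<^bsub>A\<^esub>k\<in>{1..n}. t i k \<otimes>\<^bsub>A\<^esub> (s k j \<oplus>\<^bsub>A\<^esub> s' k j)) =
    (\<Oplus>\<^bsub>A\<^esub>k\<in>{1..n}. t i k \<otimes>\<^bsub>A\<^esub> s k j \<oplus>\<^bsub>A\<^esub> t i k \<otimes>\<^bsub>A\<^esub> s' k j)"
    using assms by (intro B.finsum_cong') (auto simp: T_entry B.r_distr)
  also have "\<dots> = (\<Oplus>\<^bsub>A\<^esub>k\<in>{1..n}. t i k \<otimes>\<^bsub>A\<^esub> s k j) \<oplus>\<^bsub>A\<^esub> (\<Oplus>\<^bsub>A\<^esub>k\<in>{1..n}. t i k \<otimes>\<^bsub>A\<^esub> s' k j)"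
    using assms by (intro B.finsum_addf) (auto simp: T_entry)
  finally show "(t \<otimes>\<^bsub>T\<^esub> (s \<oplus>\<^bsub>T\<^esub> s')) i j = (t \<otimes>\<^bsub>T\<^esub> s \<oplus>\<^bsub>T\<^esub> t \<otimes>\<^bsub>T\<^esub> s') i j" by (simp add: T_mult T_add)
qed

text \<open>A triangular matrix is a finite sum of matrix units, by induction on a finite set
  containing its support. Every statement additive in a matrix is reduced to matrix units in this
  way.\<close>

lemma T_induct [consumes 1, case_names zero unit add]:
  assumes t: "t \<in> carrier T" and z: "P \<zero>\<^bsub>T\<^esub>" and E: "\<And>i j a. valid i j \<Longrightarrow> a \<in> carrier A \<Longrightarrow> P (E i j a)"
    and add: "\<And>s t. s \<in> carrier T \<Longrightarrow> t \<in> carrier T \<Longrightarrow> P s \<Longrightarrow> P t \<Longrightarrow> P (s \<oplus>\<^bsub>T\<^esub> t)"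
  shows "P t"
proof -
  have main: "P t" if "finite D" "t \<in> carrier T" "\<And>p q. (p, q) \<notin> D \<Longrightarrow> t p q = \<zero>\<^bsub>A\<^esub>" for D t
    using that
  proof (induction D arbitrary: t)
    case empty
    then have "t = \<zero>\<^bsub>T\<^esub>" by (auto simp: T_zero fun_eq_iff)
    then show ?case using z by simp
  next
    case (insert x D)
    obtain i j where x: "x = (i, j)" by (cases x)
    define s where "s = (\<lambda>p q. if p = i \<and> q = j then \<zero>\<^bsub>A\<^esub> else t p q)"
    have s: "s \<in> carrier T" using insert.prems(1) by (auto simp: T_carrier s_def)
    have "P s" using insert.prems(2) x by (intro insert.IH[OF s]) (auto simp: s_def)
    show ?case
    proof (cases "valid i j")
      case True
      have "E i j (t i j) \<oplus>\<^bsub>T\<^esub> s = t" using insert.prems(1) True by (auto simp: fun_eq_iff T_add E_def s_def T_entry)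
      then show ?thesis using add[OF E_carrier s E[OF True] \<open>P s\<close>] T_entry[OF insert.prems(1)] by metis
    next
      case False
      then have "s = t" using T_out[OF insert.prems(1)] by (auto simp: fun_eq_iff s_def)
      then show ?thesis using \<open>P s\<close> by simp
    qed
  qed
  show ?thesis
  proof (rule main[OF _ t])
    show "t p q = \<zero>\<^bsub>A\<^esub>" if "(p, q) \<notin> {1..n} \<times> {1..n}" for p q
      using that by (intro T_out[OF t]) auto
  qed simp
qed

lemma E_mult:
  assumes "valid i j" "valid k l" "a \<in> carrier A" "b \<in> carrier A"
  shows "E i j a \<otimes>\<^bsub>T\<^esub> E k l b = (if j = k then E i l (a \<otimes>\<^bsub>A\<^esub> b) else \<zero>\<^bsub>T\<^esub>)"
proof (intro ext)
  fix p q
  have "(\<Oplus>\<^bsub>A\<^esub>m\<in>{1..n}. E i j a p m \<otimes>\<^bsub>A\<^esub> E k l b m q) =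
    (\<Oplus>\<^bsub>A\<^esub>m\<in>{1..n}. if j = m then E i j a p m \<otimes>\<^bsub>A\<^esub> E k l b m q else \<zero>\<^bsub>A\<^esub>)"
    using assms by (intro B.finsum_cong') (auto simp: E_def)
  also have "\<dots> = E i j a p j \<otimes>\<^bsub>A\<^esub> E k l b j q"
    using assms by (intro B.finsum_singleton) (auto simp: E_def)
  also have "\<dots> = (if j = k then E i l (a \<otimes>\<^bsub>A\<^esub> b) else \<zero>\<^bsub>T\<^esub>) p q"
    using assms by (auto simp: E_def T_zero)
  finally show "(E i j a \<otimes>\<^bsub>T\<^esub> E k l b) p q = (if j = k then E i l (a \<otimes>\<^bsub>A\<^esub> b) else \<zero>\<^bsub>T\<^esub>) p q" by (simp add: T_mult)
qed

lemma dg_mult_left: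
  assumes "a \<in> carrier A" "t \<in> carrier T"
  shows "(dg a \<otimes>\<^bsub>T\<^esub> t) p q = a \<otimes>\<^bsub>A\<^esub> t p q"
proof (cases "valid p q")
  case True
  have "(\<Oplus>\<^bsub>A\<^esub>m\<in>{1..n}. dg a p m \<otimes>\<^bsub>A\<^esub> t m q) = (\<Oplus>\<^bsub>A\<^esub>m\<in>{1..n}. if p = m then a \<otimes>\<^bsub>A\<^esub> t m q else \<zero>\<^bsub>A\<^esub>)"
    using assms by (intro B.finsum_cong') (auto simp: dg_def T_entry)
  also have "\<dots> = a \<otimes>\<^bsub>A\<^esub> t p q" using assms True by (intro B.finsum_singleton) (auto simp: T_entry)
  finally show ?thesis by (simp add: T_mult)
qed (use assms in \<open>simp add: T_out T_mult_closed\<close>)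

lemma dg_mult_right:
  assumes "a \<in> carrier A" "t \<in> carrier T"
  shows "(t \<otimes>\<^bsub>T\<^esub> dg a) p q = t p q \<otimes>\<^bsub>A\<^esub> a"
proof (cases "valid p q")
  case True
  have "(\<Oplus>\<^bsub>A\<^esub>m\<in>{1..n}. t p m \<otimes>\<^bsub>A\<^esub> dg a m q) = (\<Oplus>\<^bsub>A\<^esub>m\<in>{1..n}. if q = m then t p m \<otimes>\<^bsub>A\<^esub> a else \<zero>\<^bsub>A\<^esub>)"
    using assms by (intro B.finsum_cong') (auto simp: dg_def T_entry)
  also have "\<dots> = t p q \<otimes>\<^bsub>A\<^esub> a" using assms True by (intro B.finsum_singleton) (auto simp: T_entry)
  finally show ?thesis by (simp add: T_mult)
qed (use assms in \<open>simp add: T_out T_mult_closed\<close>)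

text \<open>Associativity holds for three matrix units and is extended additively to one factor
  after the other, from left to right, so that no double sum has to be interchanged.\<close>

lemma T_ring: "ring T"
proof -
  interpret TG: abelian_group T by (rule T_abelian)
  have assoc_EE: "(s \<otimes>\<^bsub>T\<^esub> E k l b) \<otimes>\<^bsub>T\<^esub> E p q c = s \<otimes>\<^bsub>T\<^esub> (E k l b \<otimes>\<^bsub>T\<^esub> E p q c)"
    if s: "s \<in> carrier T" and v: "valid k l" "valid p q" "b \<in> carrier A" "c \<in> carrier A" for s k l b p q c
    using s
  proof (induction s rule: T_induct)
    case zero
    have z: "\<zero>\<^bsub>T\<^esub> \<otimes>\<^bsub>T\<^esub> t = \<zero>\<^bsub>T\<^esub>" if "t \<in> carrier T" for t
      using that by (auto simp: fun_eq_iff T_mult T_zero T_entry)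
    show ?case using v by (simp add: z T_mult_closed)
  next
    case (unit i j a)
    have z: "\<zero>\<^bsub>T\<^esub> \<otimes>\<^bsub>T\<^esub> t = \<zero>\<^bsub>T\<^esub>" "t \<otimes>\<^bsub>T\<^esub> \<zero>\<^bsub>T\<^esub> = \<zero>\<^bsub>T\<^esub>" if "t \<in> carrier T" for t
      using that by (auto simp: fun_eq_iff T_mult T_zero T_entry)
    have "valid i l" "valid k q" if "j = k" "l = p" using that unit v by auto
    then show ?case using unit v by (auto simp: E_mult z B.m_assoc)
  next
    case (add s t)
    then show ?case using v by (simp add: T_l_distr T_mult_closed)
  qed
  have assoc_E: "(s \<otimes>\<^bsub>T\<^esub> t) \<otimes>\<^bsub>T\<^esub> E p q c = s \<otimes>\<^bsub>T\<^esub> (t \<otimes>\<^bsub>T\<^esub> E p q c)"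
    if s: "s \<in> carrier T" and t: "t \<in> carrier T" and v: "valid p q" "c \<in> carrier A" for s t p q c
    using t
  proof (induction t rule: T_induct)
    case zero
    have z: "\<zero>\<^bsub>T\<^esub> \<otimes>\<^bsub>T\<^esub> t = \<zero>\<^bsub>T\<^esub>" "t \<otimes>\<^bsub>T\<^esub> \<zero>\<^bsub>T\<^esub> = \<zero>\<^bsub>T\<^esub>" if "t \<in> carrier T" for t
      using that by (auto simp: fun_eq_iff T_mult T_zero T_entry)
    show ?case using s v by (simp add: z)
  next
    case (unit k l b)
    then show ?case using assoc_EE[OF s] v by simp
  next
    case (add t t')
    then show ?case using s v by (simp add: T_l_distr T_r_distr T_mult_closed)
  qed
  have assoc: "(s \<otimes>\<^bsub>T\<^esub> t) \<otimes>\<^bsub>T\<^esub> r = s \<otimes>\<^bsub>T\<^esub> (t \<otimes>\<^bsub>T\<^esub> r)"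
    if s: "s \<in> carrier T" and t: "t \<in> carrier T" and r: "r \<in> carrier T" for s t r
    using r
  proof (induction r rule: T_induct)
    case zero
    have z: "t \<otimes>\<^bsub>T\<^esub> \<zero>\<^bsub>T\<^esub> = \<zero>\<^bsub>T\<^esub>" if "t \<in> carrier T" for t
      using that by (auto simp: fun_eq_iff T_mult T_zero T_entry)
    show ?case using s t by (simp add: z T_mult_closed)
  next
    case (unit k l b)
    then show ?case using assoc_E[OF s t] by simp
  next
    case (add r r')
    then show ?case using s t by (simp add: T_r_distr T_mult_closed)
  qed
  have "monoid T"
  proof (rule monoidI)
    show "\<one>\<^bsub>T\<^esub> \<in> carrier T" by (simp add: T_one)
    show "\<one>\<^bsub>T\<^esub> \<otimes>\<^bsub>T\<^esub> t = t" "t \<otimes>\<^bsub>T\<^esub> \<one>\<^bsub>T\<^esub> = t" if "t \<in> carrier T" for t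
      using that by (auto simp: fun_eq_iff T_one dg_mult_left dg_mult_right T_entry)
  qed (use T_mult_closed assoc in auto)
  then show ?thesis using T_l_distr T_r_distr by (intro ringI T_abelian) auto
qed

definition \<iota>T :: "'r \<Rightarrow> nat \<Rightarrow> nat \<Rightarrow> 'a" where "\<iota>T r = dg (\<iota> r)"

lemma iota_closed: "r \<in> carrier R \<Longrightarrow> \<iota> r \<in> carrier A"
  using ring_hom_closed[OF hom] .

text \<open>The matrix entries are jointly injective \<open>R\<close>-linear maps to
  \<open>A\<close>, so \<open>dcc_joint\<close> transfers the chain condition. All results for
  \<open>fin_alg\<close> become available for \<open>T\<close>.\<close>

lemma fin_alg_T: "fin_alg R T \<iota>T"
proof -
  interpret TR: ring T by (rule T_ring)
  have h: "\<iota>T \<in> ring_hom R T"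
  proof (rule ring_hom_memI)
    show "\<iota>T (r \<otimes>\<^bsub>R\<^esub> s) = \<iota>T r \<otimes>\<^bsub>T\<^esub> \<iota>T s" if "r \<in> carrier R" "s \<in> carrier R" for r s
      using that iota_closed ring_hom_mult[OF hom]
      by (auto simp: fun_eq_iff \<iota>T_def dg_mult_left) (auto simp: dg_def)
    show "\<iota>T (r \<oplus>\<^bsub>R\<^esub> s) = \<iota>T r \<oplus>\<^bsub>T\<^esub> \<iota>T s" if "r \<in> carrier R" "s \<in> carrier R" for r s
      using that ring_hom_add[OF hom] by (auto simp: fun_eq_iff \<iota>T_def T_add dg_def)
  qed (auto simp: \<iota>T_def iota_closed T_one ring_hom_one[OF hom])
  have d: "dcc R (res_scalars \<iota>T (reg_module T))"
  proof (rule dcc_joint[of "{1..n} \<times> {1..n}" R _ "\<lambda>_. res_scalars \<iota> (reg_module A)" "\<lambda>(i, j) t. t i j"])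
    show "left_module R (res_scalars \<iota>T (reg_module T))"
      using res_left_module[OF R.ring_axioms h reg_left_module[OF T_ring]] .
    show "left_module R (res_scalars \<iota> (reg_module A)) \<and> dcc R (res_scalars \<iota> (reg_module A)) \<and>
       (case x of (i, j) \<Rightarrow> \<lambda>t. t i j) \<in> mod_hom R (res_scalars \<iota>T (reg_module T)) (res_scalars \<iota> (reg_module A))"
      if "x \<in> {1..n} \<times> {1..n}" for x
      using res_lm[OF reg_left_module[OF B.ring_axioms]] dcc_reg
      by (auto split: prod.split intro!: mod_homI simp: T_entry T_add \<iota>T_def dg_mult_left iota_closed)
    show "t = \<zero>\<^bsub>res_scalars \<iota>T (reg_module T)\<^esub>"
      if t: "t \<in> carrier (res_scalars \<iota>T (reg_module T))"
        and z: "\<And>x. x \<in> {1..n} \<times> {1..n} \<Longrightarrow> (case x of (i, j) \<Rightarrow> \<lambda>t. t i j) t = \<zero>\<^bsub>res_scalars \<iota> (reg_module A)\<^esub>" for t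
    proof -
      have "t i j = \<zero>\<^bsub>A\<^esub>" for i j
      proof (cases "valid i j")
        case True
        then show ?thesis using z[of "(i, j)"] by auto
      next
        case False
        then show ?thesis using t T_out by auto
      qed
      then show ?thesis by (auto simp: fun_eq_iff T_zero)
    qed
  qed simp
  show ?thesis
    by (intro fin_alg.intro fin_alg_axioms.intro R.is_cring T_ring artinian h d)
      (auto simp: fun_eq_iff \<iota>T_def dg_mult_left dg_mult_right iota_closed T_entry central)
qed

sublocale T: fin_alg R T \<iota>T by (rule fin_alg_T)

lemma E_act:
  assumes M: "left_module T M" and v: "valid i j" "valid k l" and ab: "a \<in> carrier A" "b \<in> carrier A" and x: "x \<in> carrier M"
  shows "E i j a \<odot>\<^bsub>M\<^esub> (E k l b \<odot>\<^bsub>M\<^esub> x) = (if j = k then E i l (a \<otimes>\<^bsub>A\<^esub> b) \<odot>\<^bsub>M\<^esub> x else \<zero>\<^bsub>M\<^esub>)"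
proof -
  interpret M: left_module T M by fact
  show ?thesis using E_mult[OF v ab] ab x M.smult_assoc[of "E i j a" "E k l b" x] by (auto split: if_splits)
qed

text \<open>Both sides of the linearity condition are additive in the matrix, so matrix units
  suffice.\<close>

lemma T_homI:
  assumes M: "left_module T M" and N: "left_module T N"
    and c: "\<And>x. x \<in> carrier M \<Longrightarrow> f x \<in> carrier N"
    and a: "\<And>x y. x \<in> carrier M \<Longrightarrow> y \<in> carrier M \<Longrightarrow> f (x \<oplus>\<^bsub>M\<^esub> y) = f x \<oplus>\<^bsub>N\<^esub> f y"
    and s: "\<And>i j b x. valid i j \<Longrightarrow> b \<in> carrier A \<Longrightarrow> x \<in> carrier M \<Longrightarrow> f (E i j b \<odot>\<^bsub>M\<^esub> x) = E i j b \<odot>\<^bsub>N\<^esub> f x"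
  shows "f \<in> mod_hom T M N"
proof (rule mod_homI[OF c a])
  interpret M: left_module T M by fact
  interpret N: left_module T N by fact
  fix t x assume t: "t \<in> carrier T" and x: "x \<in> carrier M"
  have z: "f \<zero>\<^bsub>M\<^esub> = \<zero>\<^bsub>N\<^esub>"
    using a[of "\<zero>\<^bsub>M\<^esub>" "\<zero>\<^bsub>M\<^esub>"] c[of "\<zero>\<^bsub>M\<^esub>"] by (metis M.l_zero M.zero_closed N.add.r_cancel_one')
  show "f (t \<odot>\<^bsub>M\<^esub> x) = t \<odot>\<^bsub>N\<^esub> f x"
    using t by (induction t rule: T_induct)
      (use x z c s in \<open>auto simp: M.smult_l_distr N.smult_l_distr a M.smult_closed\<close>)
qed

lemma T_submodI:
  assumes M: "left_module T M"
    and U: "\<And>x. x \<in> U \<Longrightarrow> x \<in> carrier M" "\<zero>\<^bsub>M\<^esub> \<in> U" "\<And>x y. x \<in> U \<Longrightarrow> y \<in> U \<Longrightarrow> x \<oplus>\<^bsub>M\<^esub> y \<in> U"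
    and s: "\<And>i j a x. valid i j \<Longrightarrow> a \<in> carrier A \<Longrightarrow> x \<in> U \<Longrightarrow> E i j a \<odot>\<^bsub>M\<^esub> x \<in> U"
  shows "submod T M U"
proof (rule submodI[OF U])
  interpret M: left_module T M by fact
  fix t x assume t: "t \<in> carrier T" and x: "x \<in> U"
  show "t \<odot>\<^bsub>M\<^esub> x \<in> U"
    using t by (induction t rule: T_induct) (use x U s in \<open>auto simp: M.smult_l_distr\<close>)
qed

subsection \<open>Components\<close>

text \<open>The Peirce piece of the idempotent \<open>u i i\<close>, that is, the
  \<open>i\<close>-th module of the representation. As a subset of \<open>M\<close> it lets
  \<open>T\<close>-homomorphisms restrict to components as the same functions.\<close>

definition comp :: "nat \<Rightarrow> (nat \<Rightarrow> nat \<Rightarrow> 'a, 'm) module \<Rightarrow> ('a, 'm) module" where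
  "comp i M = \<lparr>carrier = {x \<in> carrier M. u i i \<odot>\<^bsub>M\<^esub> x = x}, mult = undefined, one = undefined,
     zero = zero M, add = add M, smult = (\<lambda>a x. E i i a \<odot>\<^bsub>M\<^esub> x)\<rparr>"

lemma comp_simps [simp]: "x \<in> carrier (comp i M) \<longleftrightarrow> x \<in> carrier M \<and> u i i \<odot>\<^bsub>M\<^esub> x = x"
  "zero (comp i M) = zero M" "add (comp i M) = add M" "smult (comp i M) a x = E i i a \<odot>\<^bsub>M\<^esub> x"
  by (auto simp: comp_def)

lemma E_add: "a \<in> carrier A \<Longrightarrow> b \<in> carrier A \<Longrightarrow> E i j (a \<oplus>\<^bsub>A\<^esub> b) = E i j a \<oplus>\<^bsub>T\<^esub> E i j b"
  by (auto simp: E_def T_add fun_eq_iff)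

lemma E_in_comp:
  assumes M: "left_module T M" and v: "valid i j" and a: "a \<in> carrier A" and x: "x \<in> carrier M"
  shows "E i j a \<odot>\<^bsub>M\<^esub> x \<in> carrier (comp i M)"
proof -
  interpret M: left_module T M by fact
  show ?thesis using E_act[OF M _ v _ a x, of i i] v a x by (simp add: M.smult_closed)
qed

lemma comp_left_module:
  assumes M: "left_module T M" and i: "1 \<le> i" "i \<le> n"
  shows "left_module A (comp i M)"
proof -
  interpret M: left_module T M by fact
  have v: "valid i i" using i by simp
  note ea = E_act[OF M v v]
  have "abelian_group (comp i M)"
  proof (rule abelian_groupI)
    fix x assume "x \<in> carrier (comp i M)"
    then show "\<exists>y\<in>carrier (comp i M). y \<oplus>\<^bsub>comp i M\<^esub> x = \<zero>\<^bsub>comp i M\<^esub>"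
      by (intro bexI[of _ "\<ominus>\<^bsub>M\<^esub> x"]) (auto simp: M.l_neg M.smult_r_minus)
  qed (auto simp: M.a_ac M.smult_r_distr)
  then show ?thesis
    by (rule left_moduleI[OF B.ring_axioms])
      (auto simp: M.smult_r_distr M.smult_l_distr M.smult_closed E_add ea)
qed

lemma comp_hom:
  "f \<in> mod_hom T M N \<Longrightarrow> f \<in> mod_hom A (comp i M) (comp i N)"
  by (rule mod_homI) (auto simp: hom_closed hom_add hom_smult[symmetric])

lemma comp_dg:
  assumes M: "left_module T M" and i: "1 \<le> i" "i \<le> n" and a: "a \<in> carrier A" and x: "x \<in> carrier (comp i M)"
  shows "dg a \<odot>\<^bsub>M\<^esub> x = E i i a \<odot>\<^bsub>M\<^esub> x"
proof -
  interpret M: left_module T M by fact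
  have "dg a \<otimes>\<^bsub>T\<^esub> u i i = E i i a" using a i by (auto simp: fun_eq_iff dg_mult_left) (auto simp: E_def)
  then show ?thesis using M.smult_assoc[of "dg a" "u i i" x] a x by auto
qed

text \<open>Over \<open>R\<close> the component is a submodule of \<open>M\<close>, because the
  scalar matrix of an element of \<open>R\<close> acts on it like a diagonal matrix unit; and finite
  generation is tested over \<open>R\<close>.\<close>

lemma comp_fg:
  assumes M: "fg_left_module T M" and i: "1 \<le> i" "i \<le> n"
  shows "fg_left_module A (comp i M)"
proof -
  have lM: "left_module T M" using M by auto
  note lc = comp_left_module[OF lM i]
  have "mod_mono R (res_scalars \<iota> (comp i M)) (res_scalars \<iota>T M) (\<lambda>x. x)"
    unfolding mod_mono_def
  proof
    show "(\<lambda>x. x) \<in> mod_hom R (res_scalars \<iota> (comp i M)) (res_scalars \<iota>T M)"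
      using comp_dg[OF lM i iota_closed] by (intro mod_homI) (auto simp: \<iota>T_def)
  qed simp
  then have "dcc R (res_scalars \<iota> (comp i M))"
    using dcc_mono[OF _ res_lm[OF lc] T.res_lm[OF lM]] M T.fg_iff_dcc by blast
  then show ?thesis using fg_iff_dcc lc by blast
qed

lemma u_hom:
  assumes M: "left_module T M" and v: "valid i j"
  shows "(\<lambda>x. u i j \<odot>\<^bsub>M\<^esub> x) \<in> mod_hom A (comp j M) (comp i M)"
proof -
  interpret M: left_module T M by fact
  show ?thesis
    by (rule mod_homI) (use v in \<open>auto simp: M.smult_closed M.smult_r_distr E_act[OF M]\<close>)
qed

text \<open>An arbitrary preimage is cut down to the component by the idempotent.\<close>

lemma comp_epi:
  assumes f: "mod_epi T M N f" and M: "left_module T M" and N: "left_module T N" and i: "1 \<le> i" "i \<le> n"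
  shows "mod_epi A (comp i M) (comp i N) f"
proof (rule mod_epiI[OF comp_hom[OF mod_epiD(1)[OF f]]])
  interpret M: left_module T M by fact
  fix y assume y: "y \<in> carrier (comp i N)"
  then obtain x where x: "x \<in> carrier M" "f x = y" using mod_epi_surj[OF f] by auto
  have "u i i \<odot>\<^bsub>M\<^esub> x \<in> carrier (comp i M)" using E_in_comp[OF M _ B.one_closed x(1), of i i] i by blast
  moreover have "f (u i i \<odot>\<^bsub>M\<^esub> x) = y" using x y by (simp add: hom_smult[OF mod_epiD(1)[OF f]])
  ultimately show "\<exists>x\<in>carrier (comp i M). y = f x" by metis
qed

lemma comp_iso:
  assumes f: "mod_iso T M N f" and M: "left_module T M" and N: "left_module T N" and i: "1 \<le> i" "i \<le> n"
  shows "mod_iso A (comp i M) (comp i N) f"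
  using comp_epi[OF mod_iso_epi[OF f] M N i] mod_isoD(2)[OF f]
  unfolding mod_iso_def mod_epi_def bij_betw_def by (auto intro: inj_on_subset simp: inj_on_def)

lemma comp_short_exact:
  assumes e: "short_exact T K L M f g" and K: "left_module T K" and L: "left_module T L" and M: "left_module T M"
    and i: "1 \<le> i" "i \<le> n"
  shows "short_exact A (comp i K) (comp i L) (comp i M) f g"
proof (rule short_exactI)
  note fg = short_exactD[OF e]
  interpret K: left_module T K by fact
  show "mod_mono A (comp i K) (comp i L) f"
    using comp_hom[OF fg(3)] mod_monoD(2)[OF fg(1)] unfolding mod_mono_def by (auto simp: inj_on_def)
  show "mod_epi A (comp i L) (comp i M) g" using comp_epi[OF fg(2) L M i] .
  fix y assume y: "y \<in> carrier (comp i L)" "g y = \<zero>\<^bsub>comp i M\<^esub>"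
  then obtain x where x: "x \<in> carrier K" "y = f x" using fg(5)[of y] by auto
  have "u i i \<odot>\<^bsub>K\<^esub> x \<in> carrier (comp i K)" using E_in_comp[OF K _ B.one_closed x(1), of i i] i by blast
  moreover have "f (u i i \<odot>\<^bsub>K\<^esub> x) = y" using x y by (simp add: hom_smult[OF fg(3)])
  ultimately show "\<exists>x\<in>carrier (comp i K). y = f x" by metis
next
  show "g (f x) = \<zero>\<^bsub>comp i M\<^esub>" if "x \<in> carrier (comp i K)" for x using short_exactD(6)[OF e] that by simp
qed

subsection \<open>Column modules\<close>

text \<open>The representation with \<open>Y\<close> in every place and identities as structure
  maps. Since matrices are upper triangular, the columns that vanish beyond row \<open>k\<close> are
  stable under the action. Entries outside the rows are fixed as zero, which makes equality of
  columns pointwise.\<close>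

definition col :: "('a, 'm) module \<Rightarrow> (nat \<Rightarrow> nat \<Rightarrow> 'a, nat \<Rightarrow> 'm) module" where
  "col Y = \<lparr>carrier = {y. (\<forall>i. y i \<in> carrier Y) \<and> (\<forall>i. i \<notin> {1..n} \<longrightarrow> y i = \<zero>\<^bsub>Y\<^esub>)},
     mult = undefined, one = undefined, zero = (\<lambda>i. \<zero>\<^bsub>Y\<^esub>), add = (\<lambda>x y i. x i \<oplus>\<^bsub>Y\<^esub> y i),
     smult = (\<lambda>t y i. \<Oplus>\<^bsub>Y\<^esub>j\<in>{1..n}. t i j \<odot>\<^bsub>Y\<^esub> y j)\<rparr>"

lemma col_simps [simp]: "y \<in> carrier (col Y) \<longleftrightarrow> (\<forall>i. y i \<in> carrier Y) \<and> (\<forall>i. i \<notin> {1..n} \<longrightarrow> y i = \<zero>\<^bsub>Y\<^esub>)"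
  "zero (col Y) = (\<lambda>i. \<zero>\<^bsub>Y\<^esub>)" "add (col Y) x y = (\<lambda>i. x i \<oplus>\<^bsub>Y\<^esub> y i)"
  by (auto simp: col_def)

lemma col_smult: "(t \<odot>\<^bsub>col Y\<^esub> y) i = (\<Oplus>\<^bsub>Y\<^esub>j\<in>{1..n}. t i j \<odot>\<^bsub>Y\<^esub> y j)"
  by (simp add: col_def)

lemma col_E:
  assumes Y: "left_module A Y" and v: "valid p q" and a: "a \<in> carrier A" and y: "y \<in> carrier (col Y)"
  shows "E p q a \<odot>\<^bsub>col Y\<^esub> y = (\<lambda>i. if i = p then a \<odot>\<^bsub>Y\<^esub> y q else \<zero>\<^bsub>Y\<^esub>)"
proof (intro ext)
  interpret Y: left_module A Y by fact
  fix i
  have "(\<Oplus>\<^bsub>Y\<^esub>j\<in>{1..n}. E p q a i j \<odot>\<^bsub>Y\<^esub> y j) = (\<Oplus>\<^bsub>Y\<^esub>j\<in>{1..n}. if q = j then E p q a i j \<odot>\<^bsub>Y\<^esub> y j else \<zero>\<^bsub>Y\<^esub>)"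
    using y a by (intro Y.finsum_cong') (auto simp: E_def Y.smult_closed)
  also have "\<dots> = E p q a i q \<odot>\<^bsub>Y\<^esub> y q"
    using v y a by (intro Y.finsum_singleton) (auto simp: E_def Y.smult_closed)
  finally show "(E p q a \<odot>\<^bsub>col Y\<^esub> y) i = (if i = p then a \<odot>\<^bsub>Y\<^esub> y q else \<zero>\<^bsub>Y\<^esub>)"
    using v y by (auto simp: col_smult E_def)
qed

lemma col_left_module:
  assumes Y: "left_module A Y"
  shows "left_module T (col Y)"
proof -
  interpret Y: left_module A Y by fact
  have ag: "abelian_group (col Y)"
  proof (rule abelian_groupI)
    fix y assume y: "y \<in> carrier (col Y)"
    then have "(\<lambda>i. \<ominus>\<^bsub>Y\<^esub> y i) \<in> carrier (col Y)" "(\<lambda>i. \<ominus>\<^bsub>Y\<^esub> y i) \<oplus>\<^bsub>col Y\<^esub> y = \<zero>\<^bsub>col Y\<^esub>"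
      by (auto simp: fun_eq_iff Y.l_neg)
    then show "\<exists>z\<in>carrier (col Y). z \<oplus>\<^bsub>col Y\<^esub> y = \<zero>\<^bsub>col Y\<^esub>" by blast
  qed (auto simp: fun_eq_iff Y.a_ac)
  have cl: "t \<odot>\<^bsub>col Y\<^esub> y \<in> carrier (col Y)" if t: "t \<in> carrier T" and y: "y \<in> carrier (col Y)" for t y
  proof -
    have "(t \<odot>\<^bsub>col Y\<^esub> y) i \<in> carrier Y" for i
      unfolding col_smult using t y by (intro Y.finsum_closed) (auto simp: T_entry Y.smult_closed)
    moreover have "(t \<odot>\<^bsub>col Y\<^esub> y) i = \<zero>\<^bsub>Y\<^esub>" if i: "i \<notin> {1..n}" for i
    proof -
      have "t i j \<odot>\<^bsub>Y\<^esub> y j = \<zero>\<^bsub>Y\<^esub>" for j using i T_out[OF t, of i j] y by auto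
      then show ?thesis unfolding col_smult by (intro Y.add.finprod_one_eqI) auto
    qed
    ultimately show ?thesis unfolding col_simps by blast
  qed
  have ld: "(s \<oplus>\<^bsub>T\<^esub> t) \<odot>\<^bsub>col Y\<^esub> y = s \<odot>\<^bsub>col Y\<^esub> y \<oplus>\<^bsub>col Y\<^esub> t \<odot>\<^bsub>col Y\<^esub> y"
    if st: "s \<in> carrier T" "t \<in> carrier T" "y \<in> carrier (col Y)" for s t y
  proof (intro ext)
    fix i
    have "(\<Oplus>\<^bsub>Y\<^esub>j\<in>{1..n}. (s i j \<oplus>\<^bsub>A\<^esub> t i j) \<odot>\<^bsub>Y\<^esub> y j) = (\<Oplus>\<^bsub>Y\<^esub>j\<in>{1..n}. s i j \<odot>\<^bsub>Y\<^esub> y j \<oplus>\<^bsub>Y\<^esub> t i j \<odot>\<^bsub>Y\<^esub> y j)"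
      using st by (intro Y.finsum_cong') (auto simp: T_entry Y.smult_l_distr Y.smult_closed)
    also have "\<dots> = (\<Oplus>\<^bsub>Y\<^esub>j\<in>{1..n}. s i j \<odot>\<^bsub>Y\<^esub> y j) \<oplus>\<^bsub>Y\<^esub> (\<Oplus>\<^bsub>Y\<^esub>j\<in>{1..n}. t i j \<odot>\<^bsub>Y\<^esub> y j)"
      using st by (intro Y.finsum_addf) (auto simp: T_entry Y.smult_closed)
    finally show "((s \<oplus>\<^bsub>T\<^esub> t) \<odot>\<^bsub>col Y\<^esub> y) i = (s \<odot>\<^bsub>col Y\<^esub> y \<oplus>\<^bsub>col Y\<^esub> t \<odot>\<^bsub>col Y\<^esub> y) i" by (simp add: col_smult T_add)
  qed
  have rd: "t \<odot>\<^bsub>col Y\<^esub> (x \<oplus>\<^bsub>col Y\<^esub> y) = t \<odot>\<^bsub>col Y\<^esub> x \<oplus>\<^bsub>col Y\<^esub> t \<odot>\<^bsub>col Y\<^esub> y"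
    if st: "t \<in> carrier T" "x \<in> carrier (col Y)" "y \<in> carrier (col Y)" for t x y
  proof (intro ext)
    fix i
    have "(\<Oplus>\<^bsub>Y\<^esub>j\<in>{1..n}. t i j \<odot>\<^bsub>Y\<^esub> (x j \<oplus>\<^bsub>Y\<^esub> y j)) = (\<Oplus>\<^bsub>Y\<^esub>j\<in>{1..n}. t i j \<odot>\<^bsub>Y\<^esub> x j \<oplus>\<^bsub>Y\<^esub> t i j \<odot>\<^bsub>Y\<^esub> y j)"
      using st by (intro Y.finsum_cong') (auto simp: T_entry Y.smult_r_distr Y.smult_closed)
    also have "\<dots> = (\<Oplus>\<^bsub>Y\<^esub>j\<in>{1..n}. t i j \<odot>\<^bsub>Y\<^esub> x j) \<oplus>\<^bsub>Y\<^esub> (\<Oplus>\<^bsub>Y\<^esub>j\<in>{1..n}. t i j \<odot>\<^bsub>Y\<^esub> y j)"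
      using st by (intro Y.finsum_addf) (auto simp: T_entry Y.smult_closed)
    finally show "(t \<odot>\<^bsub>col Y\<^esub> (x \<oplus>\<^bsub>col Y\<^esub> y)) i = (t \<odot>\<^bsub>col Y\<^esub> x \<oplus>\<^bsub>col Y\<^esub> t \<odot>\<^bsub>col Y\<^esub> y) i" by (simp add: col_smult)
  qed
  have z1: "\<zero>\<^bsub>T\<^esub> \<odot>\<^bsub>col Y\<^esub> y = \<zero>\<^bsub>col Y\<^esub>" if "y \<in> carrier (col Y)" for y
    using that by (auto simp: fun_eq_iff col_smult T_zero intro!: Y.add.finprod_one_eqI)
  have z2: "t \<odot>\<^bsub>col Y\<^esub> \<zero>\<^bsub>col Y\<^esub> = \<zero>\<^bsub>col Y\<^esub>" if "t \<in> carrier T" for t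
    using that by (auto simp: fun_eq_iff col_smult T_entry intro!: Y.add.finprod_one_eqI)
  have aE: "(E p q a \<otimes>\<^bsub>T\<^esub> t) \<odot>\<^bsub>col Y\<^esub> y = E p q a \<odot>\<^bsub>col Y\<^esub> (t \<odot>\<^bsub>col Y\<^esub> y)"
    if v: "valid p q" "a \<in> carrier A" and t: "t \<in> carrier T" and y: "y \<in> carrier (col Y)" for p q a t y
    using t
  proof (induction t rule: T_induct)
    case zero
    then show ?case using v y z1 z2 by simp
  next
    case (unit k l b)
    have y': "y i \<in> carrier Y" for i using y by auto
    have "E k l b \<odot>\<^bsub>col Y\<^esub> y \<in> carrier (col Y)" using cl unit y by simp
    then show ?case using unit v y y' z1[OF y]
      by (auto simp: E_mult col_E[OF Y] Y.smult_assoc fun_eq_iff simp del: col_simps(1))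
  next
    case (add s t)
    then show ?case using v y by (simp only: T.B.r_distr E_carrier ld rd cl T.B.m_closed)
  qed
  have as: "(s \<otimes>\<^bsub>T\<^esub> t) \<odot>\<^bsub>col Y\<^esub> y = s \<odot>\<^bsub>col Y\<^esub> (t \<odot>\<^bsub>col Y\<^esub> y)"
    if s: "s \<in> carrier T" and t: "t \<in> carrier T" and y: "y \<in> carrier (col Y)" for s t y
    using s
  proof (induction s rule: T_induct)
    case zero
    then show ?case using t y z1 cl by (simp del: col_simps(1))
  next
    case (unit k l b)
    then show ?case using aE t y by blast
  next
    case (add s s')
    then show ?case using t y by (simp only: T.B.l_distr ld rd cl T.B.m_closed)
  qed
  have on: "\<one>\<^bsub>T\<^esub> \<odot>\<^bsub>col Y\<^esub> y = y" if y: "y \<in> carrier (col Y)" for y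
  proof (intro ext)
    fix i
    show "(\<one>\<^bsub>T\<^esub> \<odot>\<^bsub>col Y\<^esub> y) i = y i"
    proof (cases "i \<in> {1..n}")
      case True
      have "(\<Oplus>\<^bsub>Y\<^esub>j\<in>{1..n}. \<one>\<^bsub>T\<^esub> i j \<odot>\<^bsub>Y\<^esub> y j) = (\<Oplus>\<^bsub>Y\<^esub>j\<in>{1..n}. if i = j then y j else \<zero>\<^bsub>Y\<^esub>)"
        using y by (intro Y.finsum_cong') (auto simp: T_one dg_def Y.smult_one)
      also have "\<dots> = y i" using y True by (intro Y.finsum_singleton) auto
      finally show ?thesis by (simp add: col_smult)
    next
      case False
      then show ?thesis using y cl[OF T.B.one_closed y] by auto
    qed
  qed
  show ?thesis by (rule left_moduleI[OF T_ring ag]) (fact cl ld rd as on)+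
qed

lemma col_fg:
  assumes Y: "fg_left_module A Y" shows "fg_left_module T (col Y)"
proof -
  have lY: "left_module A Y" using Y by auto
  interpret Y: left_module A Y by (rule lY)
  have lc: "left_module T (col Y)" using col_left_module[OF lY] .
  have dg_col: "(dg a \<odot>\<^bsub>col Y\<^esub> y) i = a \<odot>\<^bsub>Y\<^esub> y i" if a: "a \<in> carrier A" and y: "y \<in> carrier (col Y)" and i: "i \<in> {1..n}" for a y i
  proof -
    have "(\<Oplus>\<^bsub>Y\<^esub>j\<in>{1..n}. dg a i j \<odot>\<^bsub>Y\<^esub> y j) = (\<Oplus>\<^bsub>Y\<^esub>j\<in>{1..n}. if i = j then a \<odot>\<^bsub>Y\<^esub> y j else \<zero>\<^bsub>Y\<^esub>)"
      using y a by (intro Y.finsum_cong') (auto simp: dg_def Y.smult_closed)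
    also have "\<dots> = a \<odot>\<^bsub>Y\<^esub> y i" using y a i by (intro Y.finsum_singleton) (auto simp: Y.smult_closed)
    finally show ?thesis by (simp add: col_smult)
  qed
  have "dcc R (res_scalars \<iota>T (col Y))"
  proof (rule dcc_joint[of "{1..n}" R _ "\<lambda>_. res_scalars \<iota> Y" "\<lambda>i y. y i"])
    show "left_module R (res_scalars \<iota>T (col Y))" using T.res_lm[OF lc] .
    show "left_module R (res_scalars \<iota> Y) \<and> dcc R (res_scalars \<iota> Y) \<and>
       (\<lambda>y. y i) \<in> mod_hom R (res_scalars \<iota>T (col Y)) (res_scalars \<iota> Y)" if "i \<in> {1..n}" for i
      using res_lm[OF lY] Y fg_iff_dcc dg_col[OF iota_closed _ that] by (auto intro!: mod_homI simp: \<iota>T_def)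
    show "y = \<zero>\<^bsub>res_scalars \<iota>T (col Y)\<^esub>"
      if "y \<in> carrier (res_scalars \<iota>T (col Y))" "\<And>i. i \<in> {1..n} \<Longrightarrow> y i = \<zero>\<^bsub>res_scalars \<iota> Y\<^esub>" for y
      using that unfolding res_simps col_simps by (intro ext) metis
  qed simp
  then show ?thesis using T.fg_iff_dcc lc by blast
qed

subsection \<open>Modules concentrated in the first component\<close>

text \<open>The corner entry is multiplicative because the matrices are upper triangular, see
  \<open>corner_mult\<close>; \<open>M\<close> is pulled back along it.\<close>

definition F :: "('a, 'm) module \<Rightarrow> (nat \<Rightarrow> nat \<Rightarrow> 'a, 'm) module" where
  "F M = \<lparr>carrier = carrier M, mult = undefined, one = undefined, zero = zero M, add = add M,
     smult = (\<lambda>t x. t 1 1 \<odot>\<^bsub>M\<^esub> x)\<rparr>"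

lemma F_simps [simp]: "carrier (F M) = carrier M" "zero (F M) = zero M" "add (F M) = add M"
  "smult (F M) t x = t 1 1 \<odot>\<^bsub>M\<^esub> x"
  by (auto simp: F_def)

lemma corner_mult:
  assumes "s \<in> carrier T" "t \<in> carrier T" shows "(s \<otimes>\<^bsub>T\<^esub> t) 1 1 = s 1 1 \<otimes>\<^bsub>A\<^esub> t 1 1"
proof -
  have "(\<Oplus>\<^bsub>A\<^esub>k\<in>{1..n}. s 1 k \<otimes>\<^bsub>A\<^esub> t k 1) = (\<Oplus>\<^bsub>A\<^esub>k\<in>{1..n}. if 1 = k then s 1 k \<otimes>\<^bsub>A\<^esub> t k 1 else \<zero>\<^bsub>A\<^esub>)"
  proof (rule B.finsum_cong'[OF refl])
    fix k assume k: "k \<in> {1..n}"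
    show "s 1 k \<otimes>\<^bsub>A\<^esub> t k 1 = (if 1 = k then s 1 k \<otimes>\<^bsub>A\<^esub> t k 1 else \<zero>\<^bsub>A\<^esub>)"
      using assms k T_out[OF assms(2), of k 1] by (cases "k = 1") (auto simp: T_entry)
  qed (use assms in \<open>auto simp: T_entry\<close>)
  also have "\<dots> = s 1 1 \<otimes>\<^bsub>A\<^esub> t 1 1" using assms n2 by (intro B.finsum_singleton) (auto simp: T_entry)
  finally show ?thesis by (simp add: T_mult)
qed

lemma F_left_module:
  assumes M: "left_module A M" shows "left_module T (F M)"
proof -
  interpret M: left_module A M by fact
  have "abelian_group (F M)" by (rule abelian_groupI) (auto simp: M.a_ac intro: M.l_neg)
  then show ?thesis
    by (rule left_moduleI[OF T_ring])
      (auto simp: M.smult_closed T_entry T_add M.smult_l_distr M.smult_r_distr corner_mult[simplified] M.smult_assoc,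
       use n2 in \<open>simp add: T_one dg_def M.smult_one\<close>)
qed

lemma F_fg:
  assumes M: "fg_left_module A M" shows "fg_left_module T (F M)"
proof -
  have lM: "left_module A M" using M by auto
  have "dcc R (res_scalars \<iota>T (F M))"
  proof (rule dcc_mono)
    show "mod_mono R (res_scalars \<iota>T (F M)) (res_scalars \<iota> M) (\<lambda>x. x)"
      using n2 by (auto simp: mod_mono_def \<iota>T_def dg_def intro!: mod_homI)
    show "left_module R (res_scalars \<iota>T (F M))" using T.res_lm[OF F_left_module[OF lM]] .
    show "left_module R (res_scalars \<iota> M)" using res_lm[OF lM] .
    show "dcc R (res_scalars \<iota> M)" using M fg_iff_dcc by blast
  qed
  then show ?thesis using T.fg_iff_dcc F_left_module[OF lM] by blast
qed

lemma F_E: "left_module A M \<Longrightarrow> valid i j \<Longrightarrow> x \<in> carrier M \<Longrightarrow>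
   E i j a \<odot>\<^bsub>F M\<^esub> x = (if j = 1 then a \<odot>\<^bsub>M\<^esub> x else \<zero>\<^bsub>M\<^esub>)"
  using left_module.smult_l_null[of A M x] by (auto simp: E_def)

lemma F_hom: "f \<in> mod_hom A M N \<Longrightarrow> f \<in> mod_hom T (F M) (F N)"
  by (rule mod_homI) (auto simp: hom_closed hom_add hom_smult T_entry)

end

section \<open>Monic representations as modules\<close>

context tri begin

lemma act_closed: "left_module T M \<Longrightarrow> a \<in> carrier A \<Longrightarrow> x \<in> carrier M \<Longrightarrow> E i j a \<odot>\<^bsub>M\<^esub> x \<in> carrier M"
  using left_module.smult_closed E_carrier by metis

lemma act_invalid: "left_module T M \<Longrightarrow> x \<in> carrier M \<Longrightarrow> \<not> valid i j \<Longrightarrow> E i j a \<odot>\<^bsub>M\<^esub> x = \<zero>\<^bsub>M\<^esub>"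
  using left_module.smult_l_null E_invalid by metis

lemma u_u: "left_module T M \<Longrightarrow> x \<in> carrier M \<Longrightarrow> valid i j \<Longrightarrow> j \<le> k \<Longrightarrow>
    u i j \<odot>\<^bsub>M\<^esub> (u j k \<odot>\<^bsub>M\<^esub> x) = u i k \<odot>\<^bsub>M\<^esub> x"
proof -
  assume M: "left_module T M" and x: "x \<in> carrier M" and v: "valid i j" and jk: "j \<le> k"
  interpret M: left_module T M by fact
  show ?thesis
  proof (cases "k \<le> n")
    case True
    then show ?thesis using E_act[OF M v _ B.one_closed B.one_closed x, of j k] v jk by simp
  next
    case False
    then show ?thesis using act_invalid[OF M x, of i k] act_invalid[OF M x, of j k] by simp
  qed
qed

lemma E_u: "left_module T M \<Longrightarrow> x \<in> carrier M \<Longrightarrow> valid i j \<Longrightarrow> a \<in> carrier A \<Longrightarrow>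
    E i j a \<odot>\<^bsub>M\<^esub> x = E i i a \<odot>\<^bsub>M\<^esub> (u i j \<odot>\<^bsub>M\<^esub> x)"
  and E_u': "left_module T M \<Longrightarrow> x \<in> carrier M \<Longrightarrow> valid i j \<Longrightarrow> a \<in> carrier A \<Longrightarrow>
    E i j a \<odot>\<^bsub>M\<^esub> x = E i j a \<odot>\<^bsub>M\<^esub> (u j j \<odot>\<^bsub>M\<^esub> x)"
  using E_act[of M i i i j a "\<one>\<^bsub>A\<^esub>" x] E_act[of M i j j j a "\<one>\<^bsub>A\<^esub>" x] by auto

text \<open>Each matrix unit factors through some diagonal idempotent, so every matrix kills
  \<open>x\<close>, the identity included.\<close>

lemma components_zero:
  assumes M: "left_module T M" and x: "x \<in> carrier M" and z: "\<And>i. i \<in> {1..n} \<Longrightarrow> u i i \<odot>\<^bsub>M\<^esub> x = \<zero>\<^bsub>M\<^esub>"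
  shows "x = \<zero>\<^bsub>M\<^esub>"
proof -
  interpret M: left_module T M by fact
  have "t \<odot>\<^bsub>M\<^esub> x = \<zero>\<^bsub>M\<^esub>" if "t \<in> carrier T" for t
    using that
  proof (induction t rule: T_induct)
    case (unit i j a)
    then show ?case using E_u'[OF M x, of i j a] z[of j] by simp
  qed (use x in \<open>auto simp: M.smult_l_distr\<close>)
  then show ?thesis using M.smult_one[OF x] T.B.one_closed by metis
qed

text \<open>The sum of the \<open>z i\<close>: each is fixed by its own idempotent and killed by the
  others.\<close>

lemma assemble:
  assumes M: "left_module T M" and z: "\<And>i. i \<in> {1..n} \<Longrightarrow> z i \<in> carrier (comp i M)"
  shows "\<exists>x\<in>carrier M. \<forall>i\<in>{1..n}. u i i \<odot>\<^bsub>M\<^esub> x = z i"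
proof -
  interpret M: left_module T M by fact
  have "\<exists>x\<in>carrier M. \<forall>i\<in>{1..n}. u i i \<odot>\<^bsub>M\<^esub> x = (if i \<le> m then z i else \<zero>\<^bsub>M\<^esub>)" if "m \<le> n" for m
    using that
  proof (induction m)
    case 0
    then show ?case by (intro bexI[of _ "\<zero>\<^bsub>M\<^esub>"]) auto
  next
    case (Suc m)
    then obtain x where x: "x \<in> carrier M" "\<forall>i\<in>{1..n}. u i i \<odot>\<^bsub>M\<^esub> x = (if i \<le> m then z i else \<zero>\<^bsub>M\<^esub>)" by auto
    have zc: "z i \<in> carrier M" "u i i \<odot>\<^bsub>M\<^esub> z i = z i" if "i \<in> {1..n}" for i using z[OF that] by auto
    have m: "Suc m \<in> {1..n}" using Suc.prems by auto
    have "u i i \<odot>\<^bsub>M\<^esub> z (Suc m) = (if i = Suc m then z i else \<zero>\<^bsub>M\<^esub>)" if "i \<in> {1..n}" for i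
      using E_act[OF M _ _ B.one_closed B.one_closed zc(1)[OF m], of i i "Suc m" "Suc m"] zc[OF m] that m by auto
    then have "u i i \<odot>\<^bsub>M\<^esub> (x \<oplus>\<^bsub>M\<^esub> z (Suc m)) = (if i \<le> Suc m then z i else \<zero>\<^bsub>M\<^esub>)" if "i \<in> {1..n}" for i
      using x that zc[OF m] zc[OF that] by (auto simp: M.smult_r_distr)
    then show ?case using x(1) zc(1)[OF m] by (intro bexI[of _ "x \<oplus>\<^bsub>M\<^esub> z (Suc m)"]) auto
  qed
  from this[of n] show ?thesis by auto
qed

lemma tri_simps [simp]: "carrier (tri_module n X \<phi>) = (\<Pi>\<^sub>E i\<in>{1..n}. carrier (X i))"
  "x \<oplus>\<^bsub>tri_module n X \<phi>\<^esub> y = (\<lambda>i\<in>{1..n}. x i \<oplus>\<^bsub>X i\<^esub> y i)"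
  by (auto simp: tri_module_def)

lemma foldr_closed:
  assumes X: "(X, \<phi>) \<in> Mor_objects n A" and i: "1 \<le> i" "i \<le> j" "j \<le> n" and y: "y \<in> carrier (X j)"
  shows "foldr \<phi> [i..<j] y \<in> carrier (X i)"
  using i(2,1)
proof (induction i rule: inc_induct)
  case (step m)
  then have "\<phi> m \<in> mod_hom A (X (Suc m)) (X m)" using X i by (auto simp: Mor_objects_def)
  then show ?case using step by (simp add: upt_conv_Cons hom_closed)
qed (use y in simp)

text \<open>For a matrix unit either the diagonal term or one term of the sum survives. The two
  cases merge because the empty composite, for \<open>p = q\<close>, is the identity.\<close>

lemma tri_E:
  assumes X: "(X, \<phi>) \<in> Mor_objects n A" and v: "valid p q" and a: "a \<in> carrier A"
    and y: "y \<in> carrier (tri_module n X \<phi>)" and i: "i \<in> {1..n}"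
  shows "(E p q a \<odot>\<^bsub>tri_module n X \<phi>\<^esub> y) i = (if i = p then a \<odot>\<^bsub>X p\<^esub> foldr \<phi> [p..<q] (y q) else \<zero>\<^bsub>X i\<^esub>)"
proof -
  have "left_module A (X i)" using X i by (intro fg_mods_left_module) (simp add: Mor_objects_def)
  then interpret Xi: left_module A "X i" .
  have yc: "y j \<in> carrier (X j)" if "j \<in> {1..n}" for j using y that by auto
  have fc: "foldr \<phi> [i..<j] (y j) \<in> carrier (X i)" if "j \<in> {i<..n}" for j
    using foldr_closed[OF X _ _ _ yc[of j]] that i by auto
  have Ec: "E p q a i j \<in> carrier A" for j using T_entry[OF E_carrier[OF a]] .
  have cl: "E p q a i j \<odot>\<^bsub>X i\<^esub> foldr \<phi> [i..<j] (y j) \<in> carrier (X i)" if "j \<in> {i<..n}" for j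
    using Xi.smult_closed[OF Ec fc[OF that]] .
  have sum: "(\<Oplus>\<^bsub>X i\<^esub>j\<in>{i<..n}. E p q a i j \<odot>\<^bsub>X i\<^esub> foldr \<phi> [i..<j] (y j)) =
    (if i = p \<and> p \<noteq> q then a \<odot>\<^bsub>X i\<^esub> foldr \<phi> [p..<q] (y q) else \<zero>\<^bsub>X i\<^esub>)" (is "?s = ?r")
  proof (cases "i = p \<and> p \<noteq> q")
    case True
    have "?s = (\<Oplus>\<^bsub>X i\<^esub>j\<in>{i<..n}. if q = j then E p q a i j \<odot>\<^bsub>X i\<^esub> foldr \<phi> [i..<j] (y j) else \<zero>\<^bsub>X i\<^esub>)"
      using fc a by (intro Xi.finsum_cong') (auto simp: E_def Xi.smult_closed)
    also have "\<dots> = E p q a i q \<odot>\<^bsub>X i\<^esub> foldr \<phi> [i..<q] (y q)"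
      using cl True v by (intro Xi.finsum_singleton) auto
    finally show ?thesis using True v by (simp add: E_def)
  next
    case False
    then have "E p q a i j = \<zero>\<^bsub>A\<^esub>" if "j \<in> {i<..n}" for j using that by (auto simp: E_def)
    then have "E p q a i j \<odot>\<^bsub>X i\<^esub> foldr \<phi> [i..<j] (y j) = \<zero>\<^bsub>X i\<^esub>" if "j \<in> {i<..n}" for j
      using that Xi.smult_l_null[OF fc[OF that]] by simp
    then have "?s = \<zero>\<^bsub>X i\<^esub>" by (intro Xi.add.finprod_one_eqI) auto
    then show ?thesis using False by (simp only: if_False)
  qed
  have "(E p q a \<odot>\<^bsub>tri_module n X \<phi>\<^esub> y) i = E p q a i i \<odot>\<^bsub>X i\<^esub> y i \<oplus>\<^bsub>X i\<^esub> ?s"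
    using i by (simp add: tri_module_def)
  also have "\<dots> = (if i = p then a \<odot>\<^bsub>X p\<^esub> foldr \<phi> [p..<q] (y q) else \<zero>\<^bsub>X i\<^esub>)"
  proof (cases "i = p")
    case True
    then have p: "p = i" by simp
    show ?thesis unfolding sum using yc[OF i] fc[of q] a v unfolding p
      by (cases "q = i") (simp_all add: E_def Xi.smult_closed)
  next
    case False
    then show ?thesis unfolding sum using yc[OF i] by (simp add: E_def)
  qed
  finally show ?thesis .
qed

section \<open>Monic representations described by the action of matrix units\<close>

text \<open>The conditions on a sequence, read off from a \<open>T\<close>-module:
  \<open>u i (Suc i)\<close> is the structure map, and a cokernel is an epimorphism with the
  prescribed kernel. \<open>in_S_iff\<close> confirms that this is membership in S_n.\<close>

definition mono_rep :: "'a fgmod set \<Rightarrow> (nat \<Rightarrow> nat \<Rightarrow> 'a, 'm) module \<Rightarrow> bool" where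
  "mono_rep \<X> M \<longleftrightarrow>
     (\<forall>i\<in>{1..<n}. \<forall>x\<in>carrier (comp (Suc i) M). u i (Suc i) \<odot>\<^bsub>M\<^esub> x = \<zero>\<^bsub>M\<^esub> \<longrightarrow> x = \<zero>\<^bsub>M\<^esub>) \<and>
     (\<forall>i\<in>{1..n}. in_cat A \<X> (comp i M)) \<and>
     (\<forall>i\<in>{1..<n}. \<exists>C\<in>\<X>. \<exists>q. mod_epi A (comp i M) C q \<and>
       (\<forall>x\<in>carrier (comp i M). q x = \<zero>\<^bsub>C\<^esub> \<longleftrightarrow> (\<exists>y\<in>carrier (comp (Suc i) M). x = u i (Suc i) \<odot>\<^bsub>M\<^esub> y)))"

lemma in_S_iff_tri:
  assumes M: "fg_left_module T M"
  shows "in_cat T (mono_rep_cat n A \<X>) M \<longleftrightarrow>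
    (\<exists>X \<phi>. (X, \<phi>) \<in> mono_rep_objects n A \<X> \<and> isomorphic_mods T M (tri_module n X \<phi>))"
proof
  have lM: "left_module T M" using M by auto
  assume "in_cat T (mono_rep_cat n A \<X>) M"
  then obtain N where N: "N \<in> mono_rep_cat n A \<X>" "isomorphic_mods T N M" by (auto simp: in_cat_def)
  then obtain X \<phi> where X: "(X, \<phi>) \<in> mono_rep_objects n A \<X>" "isomorphic_mods T N (tri_module n X \<phi>)" "N \<in> fg_mods T"
    by (auto simp: mono_rep_cat_def)
  have "isomorphic_mods T M N" using isomorphic_mods_sym[OF N(2)] X(3) by auto
  then show "\<exists>X \<phi>. (X, \<phi>) \<in> mono_rep_objects n A \<X> \<and> isomorphic_mods T M (tri_module n X \<phi>)"
    using isomorphic_mods_trans X(1,2) by blast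
next
  have lM: "left_module T M" using M by auto
  assume "\<exists>X \<phi>. (X, \<phi>) \<in> mono_rep_objects n A \<X> \<and> isomorphic_mods T M (tri_module n X \<phi>)"
  then obtain X \<phi> where X: "(X, \<phi>) \<in> mono_rep_objects n A \<X>" "isomorphic_mods T M (tri_module n X \<phi>)" by blast
  obtain N f where N: "N \<in> fg_mods T" "mod_iso T M N f" using fg_rep[OF M] by blast
  have NM: "isomorphic_mods T N M" using isomorphic_mods_sym[OF _ lM] N(2) by (auto simp: isomorphic_mods_def)
  then have "N \<in> mono_rep_cat n A \<X>"
    using isomorphic_mods_trans[OF NM X(2)] X(1) N(1) by (auto simp: mono_rep_cat_def)
  then show "in_cat T (mono_rep_cat n A \<X>) M" using NM lM by (auto simp: in_cat_def)
qed

text \<open>The \<open>i\<close>-th coordinate of an isomorphism with a sequence identifies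
  \<open>comp i M\<close> with \<open>X i\<close> and the action of \<open>u i (Suc i)\<close> with
  the structure map; injectivity and cokernels are carried back.\<close>

lemma in_S_imp_mono_rep:
  assumes full: "full_subcategory A \<X>" and M: "fg_left_module T M" and S: "in_cat T (mono_rep_cat n A \<X>) M"
  shows "mono_rep \<X> M"
proof -
  have lM: "left_module T M" using M by auto
  interpret M: left_module T M by (rule lM)
  obtain X \<phi> f where X: "(X, \<phi>) \<in> mono_rep_objects n A \<X>" and f: "mod_iso T M (tri_module n X \<phi>) f"
    using S in_S_iff_tri[OF M] by (auto simp: isomorphic_mods_def)
  have Xo: "(X, \<phi>) \<in> Mor_objects n A" and XX: "\<And>i. i \<in> {1..n} \<Longrightarrow> X i \<in> \<X>"
    and mono: "\<And>i. i \<in> {1..<n} \<Longrightarrow> mod_mono A (X (Suc i)) (X i) (\<phi> i)"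
    and cok: "\<And>i. i \<in> {1..<n} \<Longrightarrow> \<exists>C\<in>\<X>. isomorphic_mods A C (coker_module (X (Suc i)) (X i) (\<phi> i))"
    using X by (auto simp: mono_rep_objects_def)
  have lX: "left_module A (X i)" if "i \<in> {1..n}" for i
    using Xo that by (intro fg_mods_left_module) (simp add: Mor_objects_def)
  note fh = mod_isoD(1)[OF f]
  have fc: "f x i \<in> carrier (X i)" if "x \<in> carrier M" "i \<in> {1..n}" for x i using hom_closed[OF fh that(1)] that(2) by auto
  have fE: "f (E p q a \<odot>\<^bsub>M\<^esub> x) i = (if i = p then a \<odot>\<^bsub>X p\<^esub> foldr \<phi> [p..<q] (f x q) else \<zero>\<^bsub>X i\<^esub>)"
    if "valid p q" "a \<in> carrier A" "x \<in> carrier M" "i \<in> {1..n}" for p q a x i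
    using tri_E[OF Xo that(1,2) hom_closed[OF fh that(3)] that(4)] hom_smult[OF fh E_carrier[OF that(2)] that(3)] by simp
  have h: "mod_iso A (comp i M) (X i) (\<lambda>x. f x i)" if i: "i \<in> {1..n}" for i
  proof (rule mod_isoI)
    have v: "valid i i" using i by simp
    show "(\<lambda>x. f x i) \<in> mod_hom A (comp i M) (X i)"
      using i by (intro mod_homI) (auto simp: fc hom_add[OF fh] fE)
    show "inj_on (\<lambda>x. f x i) (carrier (comp i M))"
    proof (rule inj_onI)
      fix x y assume x: "x \<in> carrier (comp i M)" and y: "y \<in> carrier (comp i M)" and e: "f x i = f y i"
      have "f x j = f y j" for j
      proof (cases "j \<in> {1..n}")
        case True
        then show ?thesis using fE[OF v B.one_closed _ True, of x] fE[OF v B.one_closed _ True, of y] x y e by auto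
      next
        case False
        then show ?thesis using hom_closed[OF fh, of x] hom_closed[OF fh, of y] x y by (auto simp: PiE_def extensional_def)
      qed
      then have "f x = f y" by blast
      then show "x = y" using mod_isoD(2)[OF f] x y by (auto simp: inj_on_def)
    qed
    show "carrier (X i) \<subseteq> (\<lambda>x. f x i) ` carrier (comp i M)"
    proof
      fix z assume z: "z \<in> carrier (X i)"
      interpret Xi: left_module A "X i" using lX[OF i] .
      have "(\<lambda>j\<in>{1..n}. if j = i then z else \<zero>\<^bsub>X j\<^esub>) \<in> carrier (tri_module n X \<phi>)"
        using z abelian_monoid.zero_closed[OF abelian_group.axioms(1)[OF left_module.axioms(2)[OF lX]]] by auto
      then obtain x where x: "x \<in> carrier M" "f x = (\<lambda>j\<in>{1..n}. if j = i then z else \<zero>\<^bsub>X j\<^esub>)"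
        using mod_isoD(3)[OF f] by (metis (no_types, lifting) imageE)
      have "f (u i i \<odot>\<^bsub>M\<^esub> x) i = z" using fE[OF v B.one_closed x(1) i] x(2) i z by (simp add: Xi.smult_one)
      then show "z \<in> (\<lambda>x. f x i) ` carrier (comp i M)"
        using E_in_comp[OF lM v B.one_closed x(1)] by (metis imageI)
    qed
  qed
  have comm: "f (u i (Suc i) \<odot>\<^bsub>M\<^esub> x) i = \<phi> i (f x (Suc i))" if i: "i \<in> {1..<n}" and x: "x \<in> carrier (comp (Suc i) M)" for i x
  proof -
    interpret Xi: left_module A "X i" using lX i by auto
    have "\<phi> i (f x (Suc i)) \<in> carrier (X i)" using fc[of x "Suc i"] hom_closed[OF mod_monoD(1)[OF mono[OF i]]] i x by auto
    then show ?thesis using fE[of i "Suc i" "\<one>\<^bsub>A\<^esub>" x i] i x by (simp add: Xi.smult_one)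
  qed
  note uh = u_hom[OF lM]
  show ?thesis unfolding mono_rep_def
  proof (intro conjI ballI impI)
    fix i x assume i: "i \<in> {1..<n}" and x: "x \<in> carrier (comp (Suc i) M)" and z: "u i (Suc i) \<odot>\<^bsub>M\<^esub> x = \<zero>\<^bsub>M\<^esub>"
    have i': "i \<in> {1..n}" "Suc i \<in> {1..n}" using i by auto
    have lc: "left_module A (comp i M)" "left_module A (comp (Suc i) M)" using comp_left_module[OF lM] i' by auto
    have "\<phi> i (f x (Suc i)) = \<zero>\<^bsub>X i\<^esub>"
      using comm[OF i x] z hom_zero[OF mod_isoD(1)[OF h[OF i'(1)]] lc(1) lX[OF i'(1)]] by simp
    moreover have "f x (Suc i) \<in> carrier (X (Suc i))" using fc i'(2) x by simp
    ultimately have "f x (Suc i) = \<zero>\<^bsub>X (Suc i)\<^esub>"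
      using hom_inj_iff[OF mod_monoD(1)[OF mono[OF i]] lX[OF i'(2)] lX[OF i'(1)]] mod_monoD(2)[OF mono[OF i]] by blast
    then show "x = \<zero>\<^bsub>M\<^esub>"
      using hom_inj_iff[OF mod_isoD(1)[OF h[OF i'(2)]] lc(2) lX[OF i'(2)]] mod_isoD(2)[OF h[OF i'(2)]] x by simp
  next
    fix i assume i: "i \<in> {1..n}"
    then show "in_cat A \<X> (comp i M)"
      using in_cat_iso'[OF in_cat_self[OF full XX[OF i]] h[OF i]] comp_left_module[OF lM] by auto
  next
    fix i assume i: "i \<in> {1..<n}"
    have i': "i \<in> {1..n}" "Suc i \<in> {1..n}" using i by auto
    obtain C where C: "C \<in> \<X>" "isomorphic_mods A C (coker_module (X (Suc i)) (X i) (\<phi> i))" using cok[OF i] by blast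
    have lC: "left_module A C" using C(1) full by (auto simp: full_subcategory_def)
    obtain q where q: "mod_epi A (X i) C q" "\<And>x. x \<in> carrier (X i) \<Longrightarrow> q x = \<zero>\<^bsub>C\<^esub> \<longleftrightarrow> x \<in> \<phi> i ` carrier (X (Suc i))"
      using C(2) isomorphic_coker_iff[OF lX[OF i'(2)] lX[OF i'(1)] lC mod_monoD(1)[OF mono[OF i]]] by auto
    have "mod_epi A (comp i M) C (\<lambda>x. q (f x i))" using mod_epi_comp[OF mod_iso_epi[OF h[OF i'(1)]] q(1)] .
    moreover have "q (f x i) = \<zero>\<^bsub>C\<^esub> \<longleftrightarrow> (\<exists>y\<in>carrier (comp (Suc i) M). x = u i (Suc i) \<odot>\<^bsub>M\<^esub> y)"
      if x: "x \<in> carrier (comp i M)" for x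
    proof -
      have "q (f x i) = \<zero>\<^bsub>C\<^esub> \<longleftrightarrow> f x i \<in> \<phi> i ` carrier (X (Suc i))" using q(2)[of "f x i"] fc i' x by simp
      also have "\<dots> \<longleftrightarrow> (\<exists>y\<in>carrier (comp (Suc i) M). f x i = \<phi> i (f y (Suc i)))"
        unfolding mod_isoD(3)[OF h[OF i'(2)], symmetric] by blast
      also have "\<dots> \<longleftrightarrow> (\<exists>y\<in>carrier (comp (Suc i) M). f x i = f (u i (Suc i) \<odot>\<^bsub>M\<^esub> y) i)"
        using comm[OF i] by simp
      also have "\<dots> \<longleftrightarrow> (\<exists>y\<in>carrier (comp (Suc i) M). x = u i (Suc i) \<odot>\<^bsub>M\<^esub> y)"
      proof (rule bex_cong[OF refl])
        fix y assume "y \<in> carrier (comp (Suc i) M)"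
        then have "u i (Suc i) \<odot>\<^bsub>M\<^esub> y \<in> carrier (comp i M)" using E_in_comp[OF lM _ B.one_closed, of i "Suc i" y] i by simp
        then show "(f x i = f (u i (Suc i) \<odot>\<^bsub>M\<^esub> y) i) = (x = u i (Suc i) \<odot>\<^bsub>M\<^esub> y)"
          using mod_isoD(2)[OF h[OF i'(1)]] x unfolding inj_on_def by blast
      qed
      finally show ?thesis .
    qed
    ultimately show "\<exists>C\<in>\<X>. \<exists>q. mod_epi A (comp i M) C q \<and>
       (\<forall>x\<in>carrier (comp i M). q x = \<zero>\<^bsub>C\<^esub> \<longleftrightarrow> (\<exists>y\<in>carrier (comp (Suc i) M). x = u i (Suc i) \<odot>\<^bsub>M\<^esub> y))"
      by (intro bexI[OF _ C(1)] exI[of _ "\<lambda>x. q (f x i)"]) simp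
  qed
qed

text \<open>Representatives of the components, with the matrix units conjugated to maps between
  them, form the sequence; an element of \<open>M\<close> goes to the tuple of its
  components.\<close>

lemma mono_rep_imp_in_S:
  assumes full: "full_subcategory A \<X>" and M: "fg_left_module T M" and mr: "mono_rep \<X> M"
  shows "in_cat T (mono_rep_cat n A \<X>) M"
proof -
  have lM: "left_module T M" using M by auto
  interpret M: left_module T M by (rule lM)
  have "\<forall>i\<in>{1..n}. \<exists>N. \<exists>h. N \<in> \<X> \<and> left_module A N \<and> mod_iso A (comp i M) N h"
    using in_cat_rep[OF full] mr unfolding mono_rep_def by metis
  from bchoice[OF this] obtain X where "\<forall>i\<in>{1..n}. \<exists>h. X i \<in> \<X> \<and> left_module A (X i) \<and> mod_iso A (comp i M) (X i) h" by blast
  from bchoice[OF this] obtain h where h': "\<forall>i\<in>{1..n}. X i \<in> \<X> \<and> left_module A (X i) \<and> mod_iso A (comp i M) (X i) (h i)" by blast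
  then have XX: "X i \<in> \<X>" and lX: "left_module A (X i)" and h: "mod_iso A (comp i M) (X i) (h i)" if "i \<in> {1..n}" for i
    using that by auto
  have lc: "left_module A (comp i M)" if "i \<in> {1..n}" for i using comp_left_module[OF lM] that by auto
  have "\<forall>i\<in>{1..n}. \<exists>k. mod_iso A (X i) (comp i M) k \<and> (\<forall>x\<in>carrier (comp i M). k (h i x) = x) \<and> (\<forall>y\<in>carrier (X i). h i (k y) = y)"
    using mod_iso_inv[OF h lc] by blast
  from bchoice[OF this] obtain k where k': "\<forall>i\<in>{1..n}. mod_iso A (X i) (comp i M) (k i) \<and>
    (\<forall>x\<in>carrier (comp i M). k i (h i x) = x) \<and> (\<forall>y\<in>carrier (X i). h i (k i y) = y)" by blast
  have k: "mod_iso A (X i) (comp i M) (k i)" and kh: "\<And>x. x \<in> carrier (comp i M) \<Longrightarrow> k i (h i x) = x"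
    and hk: "\<And>y. y \<in> carrier (X i) \<Longrightarrow> h i (k i y) = y" if "i \<in> {1..n}" for i
    using k' that by auto
  note hc = hom_closed[OF mod_isoD(1)[OF h]] and kc = hom_closed[OF mod_isoD(1)[OF k]]
  define \<phi> where "\<phi> i y = h i (u i (Suc i) \<odot>\<^bsub>M\<^esub> k (Suc i) y)" for i y
  have uh: "(\<lambda>x. u i (Suc i) \<odot>\<^bsub>M\<^esub> x) \<in> mod_hom A (comp (Suc i) M) (comp i M)" if "i \<in> {1..<n}" for i
    using u_hom[OF lM, of i "Suc i"] that by simp
  have \<phi>h: "\<phi> i \<in> mod_hom A (X (Suc i)) (X i)" if "i \<in> {1..<n}" for i
  proof -
    have "Suc i \<in> {1..n}" "i \<in> {1..n}" using that by auto
    then show ?thesis unfolding \<phi>_def using hom_comp[OF hom_comp[OF mod_isoD(1)[OF k] uh[OF that]] mod_isoD(1)[OF h]] by blast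
  qed
  have comm: "\<phi> i (h (Suc i) x) = h i (u i (Suc i) \<odot>\<^bsub>M\<^esub> x)" if "i \<in> {1..<n}" "x \<in> carrier (comp (Suc i) M)" for i x
    using kh[of "Suc i" x] that by (simp add: \<phi>_def)
  have fX: "X i \<in> fg_mods A" if "i \<in> {1..n}" for i using XX[OF that] full by (auto simp: full_subcategory_def)
  have Xo: "(X, \<phi>) \<in> Mor_objects n A" using fX \<phi>h by (auto simp: Mor_objects_def)
  have inj: "x = \<zero>\<^bsub>M\<^esub>" if "i \<in> {1..<n}" "x \<in> carrier (comp (Suc i) M)" "u i (Suc i) \<odot>\<^bsub>M\<^esub> x = \<zero>\<^bsub>M\<^esub>" for i x
    using mr that unfolding mono_rep_def by blast
  have "(X, \<phi>) \<in> mono_rep_objects n A \<X>"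
    unfolding mono_rep_objects_def
  proof (intro CollectI case_prodI conjI ballI Xo XX)
    fix i assume i: "i \<in> {1..<n}"
    then have i': "i \<in> {1..n}" "Suc i \<in> {1..n}" by auto
    show "mod_mono A (X (Suc i)) (X i) (\<phi> i)"
    proof (rule mod_monoI[OF \<phi>h[OF i] lX[OF i'(2)] lX[OF i'(1)]])
      fix y assume y: "y \<in> carrier (X (Suc i))" "\<phi> i y = \<zero>\<^bsub>X i\<^esub>"
      have c: "k (Suc i) y \<in> carrier (comp (Suc i) M)" using kc[OF i'(2) y(1)] .
      then have "u i (Suc i) \<odot>\<^bsub>M\<^esub> k (Suc i) y = \<zero>\<^bsub>comp i M\<^esub>"
        using y(2) hom_inj_iff[OF mod_isoD(1)[OF h[OF i'(1)]] lc[OF i'(1)] lX[OF i'(1)]] mod_isoD(2)[OF h[OF i'(1)]]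
          hom_closed[OF uh[OF i] c] unfolding \<phi>_def by blast
      then have "k (Suc i) y = \<zero>\<^bsub>comp (Suc i) M\<^esub>" using inj[OF i c] by simp
      then show "y = \<zero>\<^bsub>X (Suc i)\<^esub>"
        using y(1) hom_inj_iff[OF mod_isoD(1)[OF k[OF i'(2)]] lX[OF i'(2)] lc[OF i'(2)]] mod_isoD(2)[OF k[OF i'(2)]] by blast
    qed
    obtain C q where C: "C \<in> \<X>" "mod_epi A (comp i M) C q"
      "\<forall>x\<in>carrier (comp i M). q x = \<zero>\<^bsub>C\<^esub> \<longleftrightarrow> (\<exists>y\<in>carrier (comp (Suc i) M). x = u i (Suc i) \<odot>\<^bsub>M\<^esub> y)"
    proof -
      have "\<exists>C\<in>\<X>. \<exists>q. mod_epi A (comp i M) C q \<and>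
        (\<forall>x\<in>carrier (comp i M). q x = \<zero>\<^bsub>C\<^esub> \<longleftrightarrow> (\<exists>y\<in>carrier (comp (Suc i) M). x = u i (Suc i) \<odot>\<^bsub>M\<^esub> y))"
        using mr i unfolding mono_rep_def by (elim conjE) (rule bspec)
      then show thesis by (elim bexE exE conjE) (rule that)
    qed
    have lC: "left_module A C" using C(1) full by (auto simp: full_subcategory_def)
    have "q (k i z) = \<zero>\<^bsub>C\<^esub> \<longleftrightarrow> z \<in> \<phi> i ` carrier (X (Suc i))" if z: "z \<in> carrier (X i)" for z
    proof -
      have "q (k i z) = \<zero>\<^bsub>C\<^esub> \<longleftrightarrow> (\<exists>y\<in>carrier (comp (Suc i) M). k i z = u i (Suc i) \<odot>\<^bsub>M\<^esub> y)"
        using C(3) kc[OF i'(1) z] by blast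
      also have "\<dots> \<longleftrightarrow> (\<exists>y\<in>carrier (X (Suc i)). k i z = u i (Suc i) \<odot>\<^bsub>M\<^esub> k (Suc i) y)"
        unfolding mod_isoD(3)[OF k[OF i'(2)], symmetric] by blast
      also have "\<dots> \<longleftrightarrow> (\<exists>y\<in>carrier (X (Suc i)). z = \<phi> i y)"
      proof (rule bex_cong[OF refl])
        fix y assume "y \<in> carrier (X (Suc i))"
        then have c: "u i (Suc i) \<odot>\<^bsub>M\<^esub> k (Suc i) y \<in> carrier (comp i M)" using hom_closed[OF uh[OF i] kc[OF i'(2)]] by blast
        show "(k i z = u i (Suc i) \<odot>\<^bsub>M\<^esub> k (Suc i) y) = (z = \<phi> i y)"
          unfolding \<phi>_def using hk[OF i'(1) z] kh[OF i'(1) c] by metis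
      qed
      finally show ?thesis by blast
    qed
    then have "\<exists>q. mod_epi A (X i) C q \<and> (\<forall>x\<in>carrier (X i). q x = \<zero>\<^bsub>C\<^esub> \<longleftrightarrow> x \<in> \<phi> i ` carrier (X (Suc i)))"
      using mod_epi_comp[OF mod_iso_epi[OF k[OF i'(1)]] C(2)] by (intro exI[of _ "\<lambda>z. q (k i z)"]) simp
    then have "isomorphic_mods A C (coker_module (X (Suc i)) (X i) (\<phi> i))"
      by (subst isomorphic_coker_iff[OF lX[OF i'(2)] lX[OF i'(1)] lC \<phi>h[OF i]])
    then show "\<exists>C\<in>\<X>. isomorphic_mods A C (coker_module (X (Suc i)) (X i) (\<phi> i))"
      using C(1) by (rule bexI)
  qed
  moreover have "isomorphic_mods T M (tri_module n X \<phi>)"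
  proof -
    let ?N = "tri_module n X \<phi>"
    define f where "f x = (\<lambda>i\<in>{1..n}. h i (u i i \<odot>\<^bsub>M\<^esub> x))" for x
    have uc: "u i i \<odot>\<^bsub>M\<^esub> x \<in> carrier (comp i M)" if "i \<in> {1..n}" "x \<in> carrier M" for i x
      using E_in_comp[OF lM _ B.one_closed that(2), of i i] that(1) by simp
    have fc: "f x \<in> carrier ?N" if "x \<in> carrier M" for x using hc uc that by (auto simp: f_def)
    have fo: "foldr \<phi> [p..<q] (h q x) = h p (u p q \<odot>\<^bsub>M\<^esub> x)" if p: "1 \<le> p" "p \<le> q" "q \<le> n" and x: "x \<in> carrier (comp q M)" for p q x
      using p(2,1)
    proof (induction p rule: inc_induct)
      case base then show ?case using x by simp
    next
      case (step m)
      have m: "m \<in> {1..<n}" using step p by auto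
      have "u (Suc m) q \<odot>\<^bsub>M\<^esub> x \<in> carrier (comp (Suc m) M)"
        using E_in_comp[OF lM _ B.one_closed, of "Suc m" q x] step p x by simp
      then have "foldr \<phi> [m..<q] (h q x) = h m (u m (Suc m) \<odot>\<^bsub>M\<^esub> (u (Suc m) q \<odot>\<^bsub>M\<^esub> x))"
        using step comm[OF m] by (simp add: upt_conv_Cons)
      also have "\<dots> = h m (u m q \<odot>\<^bsub>M\<^esub> x)" using u_u[OF lM, of x m "Suc m" q] x step m by simp
      finally show ?case .
    qed
    have fadd: "f (x \<oplus>\<^bsub>M\<^esub> y) = f x \<oplus>\<^bsub>?N\<^esub> f y" if "x \<in> carrier M" "y \<in> carrier M" for x y
      using that hom_add[OF mod_isoD(1)[OF h] uc uc] by (auto simp: f_def M.smult_r_distr intro!: restrict_ext)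
    \<comment> \<open>The matrix action on \<open>tri_module n X \<phi>\<close> has not been shown
      to satisfy the module axioms, so its additivity in the matrix, on which the reduction to
      matrix units rests, is computed from the definition.\<close>
    have Nadd: "(s \<oplus>\<^bsub>T\<^esub> t) \<odot>\<^bsub>?N\<^esub> y = s \<odot>\<^bsub>?N\<^esub> y \<oplus>\<^bsub>?N\<^esub> t \<odot>\<^bsub>?N\<^esub> y"
      if s: "s \<in> carrier T" and t: "t \<in> carrier T" and y: "y \<in> carrier ?N" for s t y
    proof -
      have "(s \<oplus>\<^bsub>T\<^esub> t) i i \<odot>\<^bsub>X i\<^esub> y i \<oplus>\<^bsub>X i\<^esub> (\<Oplus>\<^bsub>X i\<^esub>j\<in>{i<..n}. (s \<oplus>\<^bsub>T\<^esub> t) i j \<odot>\<^bsub>X i\<^esub> foldr \<phi> [i..<j] (y j)) =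
        (s i i \<odot>\<^bsub>X i\<^esub> y i \<oplus>\<^bsub>X i\<^esub> (\<Oplus>\<^bsub>X i\<^esub>j\<in>{i<..n}. s i j \<odot>\<^bsub>X i\<^esub> foldr \<phi> [i..<j] (y j))) \<oplus>\<^bsub>X i\<^esub>
        (t i i \<odot>\<^bsub>X i\<^esub> y i \<oplus>\<^bsub>X i\<^esub> (\<Oplus>\<^bsub>X i\<^esub>j\<in>{i<..n}. t i j \<odot>\<^bsub>X i\<^esub> foldr \<phi> [i..<j] (y j)))" (is "?l = ?r")
        if i: "i \<in> {1..n}" for i
      proof -
        interpret Xi: left_module A "X i" using lX[OF i] .
        have yc: "y i \<in> carrier (X i)" using y i by auto
        have g: "foldr \<phi> [i..<j] (y j) \<in> carrier (X i)" if "j \<in> {i<..n}" for j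
        proof -
          have "y j \<in> carrier (X j)" using y that i by auto
          then show ?thesis using foldr_closed[OF Xo, of i j "y j"] that i by simp
        qed
        have "(\<Oplus>\<^bsub>X i\<^esub>j\<in>{i<..n}. (s \<oplus>\<^bsub>T\<^esub> t) i j \<odot>\<^bsub>X i\<^esub> foldr \<phi> [i..<j] (y j)) =
          (\<Oplus>\<^bsub>X i\<^esub>j\<in>{i<..n}. s i j \<odot>\<^bsub>X i\<^esub> foldr \<phi> [i..<j] (y j) \<oplus>\<^bsub>X i\<^esub> t i j \<odot>\<^bsub>X i\<^esub> foldr \<phi> [i..<j] (y j))"
          using g s t by (intro Xi.finsum_cong') (auto simp: T_entry T_add Xi.smult_l_distr Xi.smult_closed)
        also have "\<dots> = (\<Oplus>\<^bsub>X i\<^esub>j\<in>{i<..n}. s i j \<odot>\<^bsub>X i\<^esub> foldr \<phi> [i..<j] (y j)) \<oplus>\<^bsub>X i\<^esub>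
          (\<Oplus>\<^bsub>X i\<^esub>j\<in>{i<..n}. t i j \<odot>\<^bsub>X i\<^esub> foldr \<phi> [i..<j] (y j))"
          using g s t by (intro Xi.finsum_addf) (auto simp: T_entry Xi.smult_closed)
        finally have e: "(\<Oplus>\<^bsub>X i\<^esub>j\<in>{i<..n}. (s \<oplus>\<^bsub>T\<^esub> t) i j \<odot>\<^bsub>X i\<^esub> foldr \<phi> [i..<j] (y j)) = \<dots>" .
        have "(\<Oplus>\<^bsub>X i\<^esub>j\<in>{i<..n}. s i j \<odot>\<^bsub>X i\<^esub> foldr \<phi> [i..<j] (y j)) \<in> carrier (X i)"
          "(\<Oplus>\<^bsub>X i\<^esub>j\<in>{i<..n}. t i j \<odot>\<^bsub>X i\<^esub> foldr \<phi> [i..<j] (y j)) \<in> carrier (X i)"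
          using g s t by (auto intro!: Xi.finsum_closed simp: T_entry Xi.smult_closed)
        then show ?thesis unfolding e using s t yc
          by (simp add: T_add Xi.smult_l_distr T_entry Xi.smult_closed Xi.a_ac)
      qed
      then show ?thesis by (auto simp: tri_module_def intro!: restrict_ext)
    qed
    have fs: "f (t \<odot>\<^bsub>M\<^esub> x) = t \<odot>\<^bsub>?N\<^esub> f x" if t: "t \<in> carrier T" and x: "x \<in> carrier M" for t x
      using t
    proof (induction t rule: T_induct)
      case zero
      show ?case
      proof
        fix i
        show "f (\<zero>\<^bsub>T\<^esub> \<odot>\<^bsub>M\<^esub> x) i = (\<zero>\<^bsub>T\<^esub> \<odot>\<^bsub>?N\<^esub> f x) i"
        proof (cases "i \<in> {1..n}")
          case True
          have "h i \<zero>\<^bsub>comp i M\<^esub> = \<zero>\<^bsub>X i\<^esub>" using hom_zero[OF mod_isoD(1)[OF h[OF True]] lc[OF True] lX[OF True]] .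
          moreover have "E i i \<zero>\<^bsub>A\<^esub> = \<zero>\<^bsub>T\<^esub>" by (auto simp: E_def T_zero)
          then have "(\<zero>\<^bsub>T\<^esub> \<odot>\<^bsub>?N\<^esub> f x) i = \<zero>\<^bsub>A\<^esub> \<odot>\<^bsub>X i\<^esub> f x i"
            using tri_E[OF Xo _ B.zero_closed fc[OF x] True, of i i] True by simp
          moreover have "f x i \<in> carrier (X i)" using fc[OF x] True by auto
          ultimately show ?thesis using x True left_module.smult_l_null[OF lX[OF True]] by (simp add: f_def)
        qed (auto simp: f_def tri_module_def)
      qed
    next
      case (unit p q a)
      have p: "p \<in> {1..n}" "q \<in> {1..n}" using unit by auto
      show ?case
      proof
        fix i
        show "f (E p q a \<odot>\<^bsub>M\<^esub> x) i = (E p q a \<odot>\<^bsub>?N\<^esub> f x) i"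
        proof (cases "i \<in> {1..n}")
          case True
          have "f (E p q a \<odot>\<^bsub>M\<^esub> x) i = (if i = p then h p (E p q a \<odot>\<^bsub>M\<^esub> x) else h i \<zero>\<^bsub>M\<^esub>)"
            using E_act[OF lM _ unit(1) B.one_closed unit(2) x, of i i] True unit by (auto simp: f_def)
          also have "\<dots> = (if i = p then h p (E p p a \<odot>\<^bsub>M\<^esub> (u p q \<odot>\<^bsub>M\<^esub> (u q q \<odot>\<^bsub>M\<^esub> x))) else \<zero>\<^bsub>X i\<^esub>)"
            using E_u[OF lM x unit] hom_zero[OF mod_isoD(1)[OF h[OF True]] lc[OF True] lX[OF True]] u_u[OF lM x unit(1), of q] by simp
          also have "h p (E p p a \<odot>\<^bsub>M\<^esub> (u p q \<odot>\<^bsub>M\<^esub> (u q q \<odot>\<^bsub>M\<^esub> x))) = a \<odot>\<^bsub>X p\<^esub> h p (u p q \<odot>\<^bsub>M\<^esub> (u q q \<odot>\<^bsub>M\<^esub> x))"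
            using hom_smult[OF mod_isoD(1)[OF h[OF p(1)]] unit(2) E_in_comp[OF lM unit(1) B.one_closed, of "u q q \<odot>\<^bsub>M\<^esub> x"]]
              act_closed[OF lM B.one_closed x] by simp
          also have "h p (u p q \<odot>\<^bsub>M\<^esub> (u q q \<odot>\<^bsub>M\<^esub> x)) = foldr \<phi> [p..<q] (f x q)"
            using fo[OF _ _ _ uc[OF p(2) x], of p] unit(1) p by (simp add: f_def)
          finally show ?thesis using tri_E[OF Xo unit fc[OF x] True] by simp
        qed (auto simp: f_def tri_module_def)
      qed
    next
      case (add s t)
      then show ?case using x fadd Nadd[OF _ _ fc[OF x]] by (simp add: M.smult_l_distr M.smult_closed)
    qed
    have "mod_iso T M ?N f"
    proof (rule mod_isoI)
      show "f \<in> mod_hom T M ?N" by (rule mod_homI) (fact fc fadd fs)+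
      show "inj_on f (carrier M)"
      proof (rule inj_onI)
        fix x y assume x: "x \<in> carrier M" and y: "y \<in> carrier M" and e: "f x = f y"
        have "u i i \<odot>\<^bsub>M\<^esub> (x \<ominus>\<^bsub>M\<^esub> y) = \<zero>\<^bsub>M\<^esub>" if i: "i \<in> {1..n}" for i
        proof -
          have "h i (u i i \<odot>\<^bsub>M\<^esub> x) = h i (u i i \<odot>\<^bsub>M\<^esub> y)" using fun_cong[OF e, of i] i by (simp add: f_def)
          then have "u i i \<odot>\<^bsub>M\<^esub> x = u i i \<odot>\<^bsub>M\<^esub> y" using mod_isoD(2)[OF h[OF i]] uc[OF i x] uc[OF i y] by (auto simp: inj_on_def)
          then show ?thesis using x y act_closed[OF lM B.one_closed y, of i i] by (simp add: a_minus_def M.smult_r_distr M.smult_r_minus M.r_neg)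
        qed
        then have "x \<ominus>\<^bsub>M\<^esub> y = \<zero>\<^bsub>M\<^esub>" using components_zero[OF lM M.minus_closed[OF x y]] by blast
        then show "x = y" using M.diff_zero_iff x y by blast
      qed
      show "carrier ?N \<subseteq> f ` carrier M"
      proof
        fix y assume y: "y \<in> carrier ?N"
        have "k i (y i) \<in> carrier (comp i M)" if "i \<in> {1..n}" for i
        proof -
          have "y i \<in> carrier (X i)" using y that by auto
          then show ?thesis by (rule kc[OF that])
        qed
        from assemble[OF lM this] obtain x where x: "x \<in> carrier M" "\<forall>i\<in>{1..n}. u i i \<odot>\<^bsub>M\<^esub> x = k i (y i)" by blast
        have "f x = y"
        proof
          fix i show "f x i = y i"
          proof (cases "i \<in> {1..n}")
            case True
            then have "y i \<in> carrier (X i)" using y by auto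
            then show ?thesis using x(2) hk[OF True] True by (simp add: f_def)
          next
            case False
            then show ?thesis using y by (auto simp: f_def PiE_def extensional_def)
          qed
        qed
        then show "y \<in> f ` carrier M" using x(1) by blast
      qed
    qed
    then show ?thesis by (auto simp: isomorphic_mods_def)
  qed
  ultimately show ?thesis using in_S_iff_tri[OF M] by blast
qed

lemma in_S_iff:
  "full_subcategory A \<X> \<Longrightarrow> fg_left_module T M \<Longrightarrow> in_cat T (mono_rep_cat n A \<X>) M \<longleftrightarrow> mono_rep \<X> M"
  using in_S_imp_mono_rep mono_rep_imp_in_S by blast

lemma S_full: "full_subcategory T (mono_rep_cat n A \<X>)"
  unfolding full_subcategory_def
proof (intro conjI ballI impI)
  fix M N assume M: "M \<in> mono_rep_cat n A \<X>" and N: "N \<in> fg_mods T" and i: "isomorphic_mods T M N"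
  have "isomorphic_mods T N M" using isomorphic_mods_sym[OF i] M by (auto simp: mono_rep_cat_def)
  then show "N \<in> mono_rep_cat n A \<X>" using M N isomorphic_mods_trans unfolding mono_rep_cat_def by blast
qed (auto simp: mono_rep_cat_def)

end

section \<open>The cokernel functors\<close>

context tri begin

text \<open>Injectivity of the composite from the \<open>i\<close>-th component to the first. It is
  phrased on all of \<open>M\<close>, since \<open>u 1 i\<close> factors through the projection
  \<open>u i i\<close>.\<close>

definition monic_at :: "nat \<Rightarrow> (nat \<Rightarrow> nat \<Rightarrow> 'a, 'm) module \<Rightarrow> bool" where
  "monic_at i M \<longleftrightarrow> (\<forall>x\<in>carrier M. u 1 i \<odot>\<^bsub>M\<^esub> x = \<zero>\<^bsub>M\<^esub> \<longrightarrow> u i i \<odot>\<^bsub>M\<^esub> x = \<zero>\<^bsub>M\<^esub>)"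

text \<open>\<open>q\<close> is a cokernel of the composite \<open>X (k + 1) \<rightarrow> X 1\<close> of structure maps, where \<open>X (n + 1) = 0\<close>.\<close>

definition cok :: "nat \<Rightarrow> (nat \<Rightarrow> nat \<Rightarrow> 'a, 'm) module \<Rightarrow> ('a, 'k) module \<Rightarrow> ('m \<Rightarrow> 'k) \<Rightarrow> bool" where
  "cok k M N q \<longleftrightarrow> mod_epi A (comp 1 M) N q \<and>
     (\<forall>x\<in>carrier (comp 1 M). q x = \<zero>\<^bsub>N\<^esub> \<longleftrightarrow> (\<exists>y\<in>carrier M. x = u 1 (Suc k) \<odot>\<^bsub>M\<^esub> y))"

definition cin :: "'a fgmod set \<Rightarrow> nat \<Rightarrow> (nat \<Rightarrow> nat \<Rightarrow> 'a, 'm) module \<Rightarrow> bool" where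
  "cin \<Y> k M \<longleftrightarrow> (\<exists>N q. N \<in> \<Y> \<and> cok k M N q)"

lemma cokD: "cok k M N q \<Longrightarrow> mod_epi A (comp 1 M) N q"
  "cok k M N q \<Longrightarrow> q \<in> mod_hom A (comp 1 M) N"
  "cok k M N q \<Longrightarrow> x \<in> carrier (comp 1 M) \<Longrightarrow> q x = \<zero>\<^bsub>N\<^esub> \<Longrightarrow> \<exists>y\<in>carrier M. x = u 1 (Suc k) \<odot>\<^bsub>M\<^esub> y"
  by (auto simp: cok_def mod_epi_def)

lemma u1_comp: "left_module T M \<Longrightarrow> y \<in> carrier M \<Longrightarrow> u 1 i \<odot>\<^bsub>M\<^esub> y \<in> carrier (comp 1 M)"
proof -
  assume M: "left_module T M" and y: "y \<in> carrier M"
  interpret M: left_module T M by fact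
  show ?thesis
  proof (cases "valid 1 i")
    case True then show ?thesis using E_in_comp[OF M _ B.one_closed y] by blast
  next
    case False then show ?thesis using act_invalid[OF M y] by simp
  qed
qed

lemma cok_zero: "cok k M N q \<Longrightarrow> left_module T M \<Longrightarrow> y \<in> carrier M \<Longrightarrow> q (u 1 (Suc k) \<odot>\<^bsub>M\<^esub> y) = \<zero>\<^bsub>N\<^esub>"
  using u1_comp[of M y "Suc k"] unfolding cok_def by blast

lemma comp1_lm: "left_module T M \<Longrightarrow> left_module A (comp 1 M)"
  using comp_left_module[of M 1] n2 by simp

lemma comp1_fg: "fg_left_module T M \<Longrightarrow> fg_left_module A (comp 1 M)"
  using comp_fg[of M 1] n2 by simp

lemma u_hom_zero: "f \<in> mod_hom T M N \<Longrightarrow> x \<in> carrier M \<Longrightarrow> f (u i j \<odot>\<^bsub>M\<^esub> x) = u i j \<odot>\<^bsub>N\<^esub> f x"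
  using hom_smult[of f T M N "u i j" x] E_carrier[OF B.one_closed] by blast

text \<open>The image of the composite is an \<open>A\<close>-submodule of the first component
  because scalars can be moved across the matrix unit.\<close>

lemma cok_exists:
  assumes M: "fg_left_module T M"
  shows "\<exists>N q. N \<in> fg_mods A \<and> cok k M N q"
proof -
  have lM: "left_module T M" using M by auto
  interpret M: left_module T M by (rule lM)
  let ?U = "{x. \<exists>y\<in>carrier M. x = u 1 (Suc k) \<odot>\<^bsub>M\<^esub> y}"
  have "submod A (comp 1 M) ?U"
  proof (rule submodI)
    show "x \<in> carrier (comp 1 M)" if "x \<in> ?U" for x using that u1_comp[OF lM] by blast
    have "\<zero>\<^bsub>M\<^esub> = u 1 (Suc k) \<odot>\<^bsub>M\<^esub> \<zero>\<^bsub>M\<^esub>" by simp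
    then show "\<zero>\<^bsub>comp 1 M\<^esub> \<in> ?U" using M.zero_closed unfolding comp_simps by blast
    fix x y assume "x \<in> ?U" "y \<in> ?U"
    then obtain a b where ab: "a \<in> carrier M" "b \<in> carrier M" "x = u 1 (Suc k) \<odot>\<^bsub>M\<^esub> a" "y = u 1 (Suc k) \<odot>\<^bsub>M\<^esub> b" by blast
    then have "x \<oplus>\<^bsub>M\<^esub> y = u 1 (Suc k) \<odot>\<^bsub>M\<^esub> (a \<oplus>\<^bsub>M\<^esub> b)" by (simp add: M.smult_r_distr)
    then show "x \<oplus>\<^bsub>comp 1 M\<^esub> y \<in> ?U" using ab by auto
  next
    fix a x assume a: "a \<in> carrier A" and "x \<in> ?U"
    then obtain y where y: "y \<in> carrier M" "x = u 1 (Suc k) \<odot>\<^bsub>M\<^esub> y" by blast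
    show "a \<odot>\<^bsub>comp 1 M\<^esub> x \<in> ?U"
    proof (cases "Suc k \<le> n")
      case True
      have "E 1 1 a \<odot>\<^bsub>M\<^esub> x = u 1 (Suc k) \<odot>\<^bsub>M\<^esub> (E (Suc k) (Suc k) a \<odot>\<^bsub>M\<^esub> y)"
        unfolding y(2) using True y(1) a n2 E_act[OF lM _ _ _ _ y(1)] by simp
      then show ?thesis using act_closed[OF lM a y(1)] by auto
    next
      \<comment> \<open>The matrix unit lies outside the triangle and acts as zero, so the cokernel
        is the first component itself.\<close>
      case False
      then have "x = \<zero>\<^bsub>M\<^esub>" using y act_invalid[OF lM y(1)] by simp
      then have "E 1 1 a \<odot>\<^bsub>M\<^esub> x = u 1 (Suc k) \<odot>\<^bsub>M\<^esub> y" using False act_invalid[OF lM y(1), of 1 "Suc k"] a by simp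
      then show ?thesis using y(1) by auto
    qed
  qed
  from quot_exists[OF comp1_fg[OF M] this] show ?thesis unfolding cok_def by simp
qed

section \<open>Exactness of the cokernel functors\<close>

lemma monic_at_mono:
  assumes f: "mod_mono T K L f" and K: "left_module T K" and L: "left_module T L" and m: "monic_at i L"
  shows "monic_at i K"
  unfolding monic_at_def
proof (intro ballI impI)
  fix x assume x: "x \<in> carrier K" "u 1 i \<odot>\<^bsub>K\<^esub> x = \<zero>\<^bsub>K\<^esub>"
  note fh = mod_monoD(1)[OF f]
  have "u 1 i \<odot>\<^bsub>L\<^esub> f x = \<zero>\<^bsub>L\<^esub>" using u_hom_zero[OF fh x(1), of 1 i] x(2) hom_zero[OF fh K L] by simp
  then have "u i i \<odot>\<^bsub>L\<^esub> f x = \<zero>\<^bsub>L\<^esub>" using m hom_closed[OF fh x(1)] unfolding monic_at_def by blast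
  then have "f (u i i \<odot>\<^bsub>K\<^esub> x) = \<zero>\<^bsub>L\<^esub>" using u_hom_zero[OF fh x(1), of i i] by simp
  then show "u i i \<odot>\<^bsub>K\<^esub> x = \<zero>\<^bsub>K\<^esub>"
    using hom_inj_iff[OF fh K L] mod_monoD(2)[OF f] act_closed[OF K B.one_closed x(1)] by blast
qed

text \<open>If the component of \<open>l\<close> vanishes in the first place, so does its image in
  \<open>M\<close>; hence it comes from \<open>K\<close>, where injectivity applies again.\<close>

lemma monic_at_ext:
  assumes e: "short_exact T K L M f g" and K: "left_module T K" and L: "left_module T L" and M: "left_module T M"
    and i: "i \<in> {1..n}" and mK: "monic_at i K" and mM: "monic_at i M"
  shows "monic_at i L"
  unfolding monic_at_def
proof (intro ballI impI)
  fix l assume l: "l \<in> carrier L" "u 1 i \<odot>\<^bsub>L\<^esub> l = \<zero>\<^bsub>L\<^esub>"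
  note fg = short_exactD[OF e]
  have vi: "valid i i" "valid 1 i" using i by auto
  have gl: "g l \<in> carrier M" using hom_closed[OF fg(4) l(1)] .
  have "u 1 i \<odot>\<^bsub>M\<^esub> g l = \<zero>\<^bsub>M\<^esub>" using u_hom_zero[OF fg(4) l(1), of 1 i] l(2) hom_zero[OF fg(4) L M] by simp
  then have "u i i \<odot>\<^bsub>M\<^esub> g l = \<zero>\<^bsub>M\<^esub>" using mM gl unfolding monic_at_def by blast
  then have "g (u i i \<odot>\<^bsub>L\<^esub> l) = \<zero>\<^bsub>M\<^esub>" using u_hom_zero[OF fg(4) l(1), of i i] by simp
  then obtain z where z: "z \<in> carrier K" "u i i \<odot>\<^bsub>L\<^esub> l = f z" using fg(5)[OF act_closed[OF L B.one_closed l(1)]] by blast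
  have "f (u 1 i \<odot>\<^bsub>K\<^esub> z) = u 1 i \<odot>\<^bsub>L\<^esub> (u i i \<odot>\<^bsub>L\<^esub> l)" using u_hom_zero[OF fg(3) z(1), of 1 i] z(2) by simp
  also have "\<dots> = \<zero>\<^bsub>L\<^esub>" using u_u[OF L l(1) vi(2), of i] l(2) by simp
  finally have "u 1 i \<odot>\<^bsub>K\<^esub> z = \<zero>\<^bsub>K\<^esub>"
    using hom_inj_iff[OF fg(3) K L] mod_monoD(2)[OF fg(1)] act_closed[OF K B.one_closed z(1)] by blast
  then have uz: "u i i \<odot>\<^bsub>K\<^esub> z = \<zero>\<^bsub>K\<^esub>" using mK z(1) unfolding monic_at_def by blast
  have "u i i \<odot>\<^bsub>L\<^esub> l = u i i \<odot>\<^bsub>L\<^esub> (u i i \<odot>\<^bsub>L\<^esub> l)" using u_u[OF L l(1) vi(1), of i] by simp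
  also have "\<dots> = f (u i i \<odot>\<^bsub>K\<^esub> z)" using z u_hom_zero[OF fg(3) z(1), of i i] by simp
  also have "\<dots> = \<zero>\<^bsub>L\<^esub>" using uz hom_zero[OF fg(3) K L] by simp
  finally show "u i i \<odot>\<^bsub>L\<^esub> l = \<zero>\<^bsub>L\<^esub>" .
qed

lemma cok_map:
  assumes f: "f \<in> mod_hom T M M'" and M: "left_module T M" and M': "left_module T M'"
    and c: "cok k M N q" and c': "cok k M' N' q'" and N: "left_module A N" and N': "left_module A N'"
  shows "\<exists>f'\<in>mod_hom A N N'. \<forall>x\<in>carrier (comp 1 M). f' (q x) = q' (f x)"
proof (rule epi_factor[OF cokD(1)[OF c] hom_comp[OF comp_hom[OF f] cokD(2)[OF c']] comp1_lm[OF M] N N'])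
  fix x assume "x \<in> carrier (comp 1 M)" "q x = \<zero>\<^bsub>N\<^esub>"
  then obtain y where y: "y \<in> carrier M" "x = u 1 (Suc k) \<odot>\<^bsub>M\<^esub> y" using cokD(3)[OF c] by blast
  then show "q' (f x) = \<zero>\<^bsub>N'\<^esub>"
    using cok_zero[OF c' M' hom_closed[OF f y(1)]] u_hom_zero[OF f y(1), of 1 "Suc k"] by simp
qed

text \<open>Snake lemma: the only obstruction to injectivity of the left map is the kernel of the
  composite from component \<open>k + 1\<close> to the first in \<open>M\<close>, which vanishes by
  assumption. If \<open>k + 1\<close> exceeds \<open>n\<close>, the cokernel is the first component,
  which is exact anyway.\<close>

lemma cok_exact:
  assumes e: "short_exact T K L M f g" and K: "left_module T K" and L: "left_module T L" and M: "left_module T M"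
    and mM: "Suc k \<le> n \<Longrightarrow> monic_at (Suc k) M"
    and cK: "cok k K NK qK" and cL: "cok k L NL qL" and cM: "cok k M NM qM"
    and lN: "left_module A NK" "left_module A NL" "left_module A NM"
  shows "\<exists>f' g'. short_exact A NK NL NM f' g'"
proof -
  note fg = short_exactD[OF e]
  interpret K: left_module T K by fact
  interpret L: left_module T L by fact
  interpret NL: left_module A NL by fact
  let ?k = "Suc k"
  obtain f' where f': "f' \<in> mod_hom A NK NL" "\<forall>x\<in>carrier (comp 1 K). f' (qK x) = qL (f x)"
    using cok_map[OF fg(3) K L cK cL lN(1,2)] by (rule bexE)
  obtain g' where g': "g' \<in> mod_hom A NL NM" "\<forall>x\<in>carrier (comp 1 L). g' (qL x) = qM (g x)"
    using cok_map[OF fg(4) L M cL cM lN(2,3)] by (rule bexE)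
  have fc: "f x \<in> carrier (comp 1 L)" if "x \<in> carrier (comp 1 K)" for x using hom_closed[OF comp_hom[OF fg(3)] that] .
  have "short_exact A NK NL NM f' g'"
  proof (rule short_exactI)
    show "mod_mono A NK NL f'"
    proof (rule mod_monoI[OF f'(1) lN(1,2)])
      fix w assume w: "w \<in> carrier NK" "f' w = \<zero>\<^bsub>NL\<^esub>"
      obtain x where x: "x \<in> carrier (comp 1 K)" "qK x = w" using mod_epi_surj[OF cokD(1)[OF cK] w(1)] by metis
      have "qL (f x) = \<zero>\<^bsub>NL\<^esub>" using f'(2) x w(2) by auto
      then obtain l where l: "l \<in> carrier L" "f x = u 1 ?k \<odot>\<^bsub>L\<^esub> l" using cokD(3)[OF cL fc[OF x(1)]] by blast
      have xK: "x \<in> carrier K" using x(1) by simp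
      show "w = \<zero>\<^bsub>NK\<^esub>"
      proof (cases "?k \<le> n")
        case True
        have v: "valid 1 ?k" "valid ?k ?k" using True by auto
        have gl: "g l \<in> carrier M" using hom_closed[OF fg(4) l(1)] .
        have "u 1 ?k \<odot>\<^bsub>M\<^esub> g l = \<zero>\<^bsub>M\<^esub>"
          using u_hom_zero[OF fg(4) l(1), of 1 ?k] l(2) fg(6)[OF xK] by simp
        then have "u ?k ?k \<odot>\<^bsub>M\<^esub> g l = \<zero>\<^bsub>M\<^esub>" using mM[OF True] gl unfolding monic_at_def by blast
        then have "g (u ?k ?k \<odot>\<^bsub>L\<^esub> l) = \<zero>\<^bsub>M\<^esub>" using u_hom_zero[OF fg(4) l(1)] by simp
        then obtain y where y: "y \<in> carrier K" "u ?k ?k \<odot>\<^bsub>L\<^esub> l = f y"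
          using fg(5)[OF act_closed[OF L B.one_closed l(1)]] by blast
        have "f x = u 1 ?k \<odot>\<^bsub>L\<^esub> f y" using l(2) u_u[OF L l(1) v(1), of ?k] y(2) by simp
        also have "\<dots> = f (u 1 ?k \<odot>\<^bsub>K\<^esub> y)" using u_hom_zero[OF fg(3) y(1)] by simp
        finally have "x = u 1 ?k \<odot>\<^bsub>K\<^esub> y"
          using mod_monoD(2)[OF fg(1)] xK act_closed[OF K B.one_closed y(1)] unfolding inj_on_def by blast
        then show ?thesis using x(2) cok_zero[OF cK K y(1)] by simp
      next
        case False
        then have "f x = \<zero>\<^bsub>L\<^esub>" using l act_invalid[OF L l(1)] by simp
        then have "x = \<zero>\<^bsub>K\<^esub>" using hom_inj_iff[OF fg(3) K L] mod_monoD(2)[OF fg(1)] xK by blast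
        then show ?thesis using x(2) hom_zero[OF cokD(2)[OF cK] comp1_lm[OF K] lN(1)] by simp
      qed
    qed
    show "mod_epi A NL NM g'"
    proof (rule mod_epiI[OF g'(1)])
      fix w assume "w \<in> carrier NM"
      then obtain m where m: "m \<in> carrier (comp 1 M)" "qM m = w" using mod_epi_surj[OF cokD(1)[OF cM]] by metis
      obtain l where l: "l \<in> carrier (comp 1 L)" "g l = m"
        using mod_epi_surj[OF comp_epi[OF fg(2) L M, of 1] m(1)] n2 by force
      have "g' (qL l) = w" using g'(2) l m(2) by blast
      then show "\<exists>x\<in>carrier NL. w = g' x" using hom_closed[OF cokD(2)[OF cL] l(1)] by blast
    qed
  next
    fix w assume w: "w \<in> carrier NL" "g' w = \<zero>\<^bsub>NM\<^esub>"
    obtain l where l: "l \<in> carrier (comp 1 L)" "qL l = w" using mod_epi_surj[OF cokD(1)[OF cL] w(1)] by metis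
    have lL: "l \<in> carrier L" using l(1) by simp
    have "g l \<in> carrier (comp 1 M)" using hom_closed[OF comp_hom[OF fg(4)] l(1)] .
    moreover have "qM (g l) = \<zero>\<^bsub>NM\<^esub>" using g'(2) l w(2) by auto
    ultimately obtain m where m: "m \<in> carrier M" "g l = u 1 ?k \<odot>\<^bsub>M\<^esub> m" using cokD(3)[OF cM] by blast
    obtain l2 where l2: "l2 \<in> carrier L" "g l2 = m" using mod_epi_surj[OF fg(2) m(1)] by metis
    \<comment> \<open>\<open>l\<close> is corrected by an element of the image to be divided out, so
      that the difference is mapped to zero in \<open>M\<close> and comes from
      \<open>K\<close>.\<close>
    let ?y = "u 1 ?k \<odot>\<^bsub>L\<^esub> l2"
    have yc: "?y \<in> carrier (comp 1 L)" "?y \<in> carrier L" using u1_comp[OF L l2(1)] by auto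
    have "g ?y = g l" using u_hom_zero[OF fg(4) l2(1)] l2(2) m(2) by simp
    then have "g (l \<ominus>\<^bsub>L\<^esub> ?y) = \<zero>\<^bsub>M\<^esub>" using hom_eq_iff_diff[OF fg(4) L M lL yc(2)] by simp
    then obtain z where z: "z \<in> carrier K" "l \<ominus>\<^bsub>L\<^esub> ?y = f z" using fg(5) lL yc(2) by blast
    have ly: "l \<ominus>\<^bsub>L\<^esub> ?y \<in> carrier (comp 1 L)"
      using l(1) yc by (simp add: a_minus_def L.smult_r_distr L.smult_r_minus)
    let ?z = "u 1 1 \<odot>\<^bsub>K\<^esub> z"
    have zc: "?z \<in> carrier (comp 1 K)" using u1_comp[OF K z(1)] .
    have fz: "f ?z = l \<ominus>\<^bsub>L\<^esub> ?y" using u_hom_zero[OF fg(3) z(1), of 1 1] z(2) ly by simp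
    have "l = (l \<ominus>\<^bsub>L\<^esub> ?y) \<oplus>\<^bsub>L\<^esub> ?y" using lL yc(2) by (simp add: a_minus_def L.a_assoc L.l_neg)
    then have "qL l = qL (l \<ominus>\<^bsub>L\<^esub> ?y) \<oplus>\<^bsub>NL\<^esub> qL ?y"
      using hom_add[OF cokD(2)[OF cL] ly yc(1)] by simp
    also have "\<dots> = f' (qK ?z)"
      using cok_zero[OF cL L l2(1)] f'(2) zc fz hom_closed[OF cokD(2)[OF cL] ly] by auto
    finally show "\<exists>x\<in>carrier NK. w = f' x" using l(2) hom_closed[OF cokD(2)[OF cK] zc] by auto
  next
    fix w assume "w \<in> carrier NK"
    then obtain x where x: "x \<in> carrier (comp 1 K)" "qK x = w" using mod_epi_surj[OF cokD(1)[OF cK]] by metis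
    then show "g' (f' w) = \<zero>\<^bsub>NM\<^esub>"
      using f'(2) g'(2) fc[OF x(1)] fg(6)[of x] hom_zero[OF cokD(2)[OF cM] comp1_lm[OF M] lN(3)] by auto
  qed
  then show ?thesis by blast
qed

text \<open>Third isomorphism theorem with components regarded as submodules of X_1: the sequence is
  X_(k+1)/X_(k+2), X_1/X_(k+2), X_1/X_(k+1). Injectivity at \<open>k + 1\<close> makes the left map
  monic.\<close>

lemma cok_step:
  assumes M: "left_module T M" and k: "1 \<le> k" "Suc k \<le> n" and m: "monic_at (Suc k) M"
    and cN: "cok (Suc k) M N q" and cW: "cok k M W w"
    and c: "mod_epi A (comp (Suc k) M) C c"
      "\<And>x. x \<in> carrier (comp (Suc k) M) \<Longrightarrow> c x = \<zero>\<^bsub>C\<^esub> \<longleftrightarrow> (\<exists>y\<in>carrier M. x = u (Suc k) (Suc (Suc k)) \<odot>\<^bsub>M\<^esub> y)"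
    and l: "left_module A N" "left_module A W" "left_module A C"
  shows "\<exists>f g. short_exact A C N W f g"
proof -
  interpret M: left_module T M by fact
  let ?k = "Suc k" and ?k2 = "Suc (Suc k)"
  have v: "valid 1 ?k" "valid ?k ?k" using k by auto
  have lc: "left_module A (comp ?k M)" using comp_left_module[OF M, of ?k] k by simp
  have uu: "u 1 ?k \<odot>\<^bsub>M\<^esub> (u ?k ?k2 \<odot>\<^bsub>M\<^esub> y) = u 1 ?k2 \<odot>\<^bsub>M\<^esub> y" if "y \<in> carrier M" for y
    using u_u[OF M that v(1), of ?k2] by simp
  have uh: "(\<lambda>x. u 1 ?k \<odot>\<^bsub>M\<^esub> x) \<in> mod_hom A (comp ?k M) (comp 1 M)" using u_hom[OF M v(1)] .
  have "\<exists>f\<in>mod_hom A C N. \<forall>x\<in>carrier (comp ?k M). f (c x) = q (u 1 ?k \<odot>\<^bsub>M\<^esub> x)"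
  proof (rule epi_factor[OF c(1) hom_comp[OF uh cokD(2)[OF cN]] lc l(3,1)])
    fix x assume "x \<in> carrier (comp ?k M)" "c x = \<zero>\<^bsub>C\<^esub>"
    then obtain y where "y \<in> carrier M" "x = u ?k ?k2 \<odot>\<^bsub>M\<^esub> y" using c(2) by blast
    then show "q (u 1 ?k \<odot>\<^bsub>M\<^esub> x) = \<zero>\<^bsub>N\<^esub>" using uu cok_zero[OF cN M] by simp
  qed
  then obtain f where f: "f \<in> mod_hom A C N" "\<forall>x\<in>carrier (comp ?k M). f (c x) = q (u 1 ?k \<odot>\<^bsub>M\<^esub> x)" by (rule bexE)
  have "\<exists>g\<in>mod_hom A N W. \<forall>x\<in>carrier (comp 1 M). g (q x) = w x"
  proof (rule epi_factor[OF cokD(1)[OF cN] cokD(2)[OF cW] comp1_lm[OF M] l(1,2)])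
    fix x assume "x \<in> carrier (comp 1 M)" "q x = \<zero>\<^bsub>N\<^esub>"
    then obtain y where y: "y \<in> carrier M" "x = u 1 ?k2 \<odot>\<^bsub>M\<^esub> y" using cokD(3)[OF cN] by blast
    then have "x = u 1 ?k \<odot>\<^bsub>M\<^esub> (u ?k ?k2 \<odot>\<^bsub>M\<^esub> y)" using uu by simp
    then show "w x = \<zero>\<^bsub>W\<^esub>" using cok_zero[OF cW M act_closed[OF M B.one_closed y(1)]] by simp
  qed
  then obtain g where g: "g \<in> mod_hom A N W" "\<forall>x\<in>carrier (comp 1 M). g (q x) = w x" by (rule bexE)
  have "short_exact A C N W f g"
  proof (rule short_exactI)
    show "mod_mono A C N f"
    proof (rule mod_monoI[OF f(1) l(3,1)])
      fix z assume z: "z \<in> carrier C" "f z = \<zero>\<^bsub>N\<^esub>"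
      obtain x where x: "x \<in> carrier (comp ?k M)" "c x = z" using mod_epi_surj[OF c(1) z(1)] by metis
      have xM: "x \<in> carrier M" "u ?k ?k \<odot>\<^bsub>M\<^esub> x = x" using x(1) by auto
      have "q (u 1 ?k \<odot>\<^bsub>M\<^esub> x) = \<zero>\<^bsub>N\<^esub>" using f(2) x z(2) by auto
      then obtain y where y: "y \<in> carrier M" "u 1 ?k \<odot>\<^bsub>M\<^esub> x = u 1 ?k2 \<odot>\<^bsub>M\<^esub> y"
        using cokD(3)[OF cN u1_comp[OF M xM(1)]] by blast
      let ?y = "u ?k ?k2 \<odot>\<^bsub>M\<^esub> y"
      have yc: "?y \<in> carrier M" using act_closed[OF M B.one_closed y(1)] .
      have yy: "u ?k ?k \<odot>\<^bsub>M\<^esub> ?y = ?y" using u_u[OF M y(1) v(2), of ?k2] by simp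
      have "u 1 ?k \<odot>\<^bsub>M\<^esub> (x \<ominus>\<^bsub>M\<^esub> ?y) = \<zero>\<^bsub>M\<^esub>"
        using xM(1) yc y(2) uu[OF y(1)] act_closed[OF M B.one_closed y(1), of 1 ?k2]
        by (simp add: a_minus_def M.smult_r_distr M.smult_r_minus M.r_neg)
      then have "u ?k ?k \<odot>\<^bsub>M\<^esub> (x \<ominus>\<^bsub>M\<^esub> ?y) = \<zero>\<^bsub>M\<^esub>"
        using m M.minus_closed[OF xM(1) yc] unfolding monic_at_def by blast
      then have "x \<ominus>\<^bsub>M\<^esub> ?y = \<zero>\<^bsub>M\<^esub>"
        using xM yc yy by (simp add: a_minus_def M.smult_r_distr M.smult_r_minus)
      then have "x = ?y" using M.diff_zero_iff[OF xM(1) yc] by simp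
      then show "z = \<zero>\<^bsub>C\<^esub>" using c(2)[OF x(1)] x(2) y(1) by blast
    qed
    show "mod_epi A N W g"
    proof (rule mod_epiI[OF g(1)])
      fix z assume "z \<in> carrier W"
      then obtain x where x: "x \<in> carrier (comp 1 M)" "w x = z" using mod_epi_surj[OF cokD(1)[OF cW]] by metis
      have "g (q x) = z" using g(2) x by blast
      then show "\<exists>y\<in>carrier N. z = g y" using hom_closed[OF cokD(2)[OF cN] x(1)] by blast
    qed
  next
    fix z assume z: "z \<in> carrier N" "g z = \<zero>\<^bsub>W\<^esub>"
    obtain x where x: "x \<in> carrier (comp 1 M)" "q x = z" using mod_epi_surj[OF cokD(1)[OF cN] z(1)] by metis
    then have "w x = \<zero>\<^bsub>W\<^esub>" using g(2) z(2) by auto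
    then obtain y where y: "y \<in> carrier M" "x = u 1 ?k \<odot>\<^bsub>M\<^esub> y" using cokD(3)[OF cW x(1)] by blast
    let ?y = "u ?k ?k \<odot>\<^bsub>M\<^esub> y"
    have yc: "?y \<in> carrier (comp ?k M)" using E_in_comp[OF M v(2) B.one_closed y(1)] .
    have "x = u 1 ?k \<odot>\<^bsub>M\<^esub> ?y" using u_u[OF M y(1) v(1), of ?k] y(2) by simp
    then have "z = f (c ?y)" using f(2) yc x(2) by auto
    then show "\<exists>x\<in>carrier C. z = f x" using hom_closed[OF mod_epiD(1)[OF c(1)] yc] by blast
  next
    fix z assume "z \<in> carrier C"
    then obtain x where x: "x \<in> carrier (comp ?k M)" "c x = z" using mod_epi_surj[OF c(1)] by metis
    then have xM: "x \<in> carrier M" by simp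
    show "g (f z) = \<zero>\<^bsub>W\<^esub>" using f(2) g(2) x u1_comp[OF M xM, of ?k] cok_zero[OF cW M xM] by auto
  qed
  then show ?thesis by blast
qed

text \<open>The sequences of \<open>cok_step\<close> link consecutive C_k to the cokernels of single
  structure maps. Closure under extensions builds the C_k up from these; closure under kernels
  recovers these, and the components, from the C_k.\<close>

lemma in_S_cok_iff:
  assumes X: "resolving A \<X>" and M: "fg_left_module T M"
  shows "in_cat T (mono_rep_cat n A \<X>) M \<longleftrightarrow> (\<forall>i\<in>{1..n}. monic_at i M) \<and> (\<forall>k\<in>{1..n}. cin \<X> k M)"
proof -
  note full = resolving_full[OF X]
  have lM: "left_module T M" using M by auto
  interpret M: left_module T M by (rule lM)
  have lX: "left_module A N" if "N \<in> \<X>" for N using that full by (auto simp: full_subcategory_def)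
  have cc: "x \<in> carrier M" "u i i \<odot>\<^bsub>M\<^esub> x = x" if "x \<in> carrier (comp i M)" for x i using that by auto
  have sub: "(\<exists>y\<in>carrier (comp (Suc i) M). x = u i (Suc i) \<odot>\<^bsub>M\<^esub> y) \<longleftrightarrow> (\<exists>y\<in>carrier M. x = u i (Suc i) \<odot>\<^bsub>M\<^esub> y)"
    if "i \<in> {1..<n}" for i x
  proof
    assume "\<exists>y\<in>carrier M. x = u i (Suc i) \<odot>\<^bsub>M\<^esub> y"
    then obtain y where y: "y \<in> carrier M" "x = u i (Suc i) \<odot>\<^bsub>M\<^esub> y" by blast
    then have "x = u i (Suc i) \<odot>\<^bsub>M\<^esub> (u (Suc i) (Suc i) \<odot>\<^bsub>M\<^esub> y)" using u_u[OF lM y(1), of i "Suc i" "Suc i"] that by simp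
    moreover have "u (Suc i) (Suc i) \<odot>\<^bsub>M\<^esub> y \<in> carrier (comp (Suc i) M)"
      using E_in_comp[OF lM _ B.one_closed y(1), of "Suc i" "Suc i"] that by simp
    ultimately show "\<exists>y\<in>carrier (comp (Suc i) M). x = u i (Suc i) \<odot>\<^bsub>M\<^esub> y" by blast
  qed (use cc in blast)
  have fcomp: "fg_left_module A (comp i M)" if "i \<in> {1..n}" for i using comp_fg[OF M, of i] that by simp
  have lcomp: "left_module A (comp i M)" if "i \<in> {1..n}" for i using comp_left_module[OF lM, of i] that by simp
  show ?thesis unfolding in_S_iff[OF full M]
  proof
    assume mr: "mono_rep \<X> M"
    have inj: "x = \<zero>\<^bsub>M\<^esub>" if "i \<in> {1..<n}" "x \<in> carrier (comp (Suc i) M)" "u i (Suc i) \<odot>\<^bsub>M\<^esub> x = \<zero>\<^bsub>M\<^esub>" for i x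
      using mr that unfolding mono_rep_def by blast
    have mon: "monic_at (Suc i) M" if "Suc i \<le> n" for i
      using that
    proof (induction i)
      case 0 then show ?case by (simp add: monic_at_def)
    next
      case (Suc i)
      let ?i = "Suc i" and ?j = "Suc (Suc i)"
      show ?case unfolding monic_at_def
      proof (intro ballI impI)
        fix x assume x: "x \<in> carrier M" "u 1 ?j \<odot>\<^bsub>M\<^esub> x = \<zero>\<^bsub>M\<^esub>"
        have v: "valid 1 ?i" "valid ?i ?i" "valid ?i ?j" using Suc.prems by auto
        have "u 1 ?i \<odot>\<^bsub>M\<^esub> (u ?i ?j \<odot>\<^bsub>M\<^esub> x) = \<zero>\<^bsub>M\<^esub>" using u_u[OF lM x(1) v(1), of ?j] x(2) by simp
        then have "u ?i ?i \<odot>\<^bsub>M\<^esub> (u ?i ?j \<odot>\<^bsub>M\<^esub> x) = \<zero>\<^bsub>M\<^esub>"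
          using Suc act_closed[OF lM B.one_closed x(1)] unfolding monic_at_def by simp
        then have "u ?i ?j \<odot>\<^bsub>M\<^esub> x = \<zero>\<^bsub>M\<^esub>" using u_u[OF lM x(1) v(2), of ?j] by simp
        then have "u ?i ?j \<odot>\<^bsub>M\<^esub> (u ?j ?j \<odot>\<^bsub>M\<^esub> x) = \<zero>\<^bsub>M\<^esub>" using u_u[OF lM x(1) v(3), of ?j] by simp
        then show "u ?j ?j \<odot>\<^bsub>M\<^esub> x = \<zero>\<^bsub>M\<^esub>"
          using inj[of ?i "u ?j ?j \<odot>\<^bsub>M\<^esub> x"] E_in_comp[OF lM _ B.one_closed x(1), of ?j ?j] Suc.prems by simp
      qed
    qed
    have mon': "monic_at i M" if "i \<in> {1..n}" for i using mon[of "i - 1"] that by simp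
    have cin: "cin \<X> (Suc k) M" if "Suc k \<le> n" for k
      using that
    proof (induction k)
      case 0
      obtain C q where C: "C \<in> \<X>" "mod_epi A (comp 1 M) C q"
        "\<forall>x\<in>carrier (comp 1 M). q x = \<zero>\<^bsub>C\<^esub> \<longleftrightarrow> (\<exists>y\<in>carrier (comp (Suc 1) M). x = u 1 (Suc 1) \<odot>\<^bsub>M\<^esub> y)"
      proof -
        have "1 \<in> {1..<n}" using n2 by simp
        then have "\<exists>C\<in>\<X>. \<exists>q. mod_epi A (comp 1 M) C q \<and>
          (\<forall>x\<in>carrier (comp 1 M). q x = \<zero>\<^bsub>C\<^esub> \<longleftrightarrow> (\<exists>y\<in>carrier (comp (Suc 1) M). x = u 1 (Suc 1) \<odot>\<^bsub>M\<^esub> y))"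
          using mr unfolding mono_rep_def by (elim conjE) (rule bspec)
        then show thesis by (elim bexE exE conjE) (rule that)
      qed
      have "cok 1 M C q" unfolding cok_def using C(2,3) sub[of 1] n2 by simp
      then show ?case using C(1) unfolding cin_def by auto
    next
      case (Suc k)
      let ?k = "Suc k" and ?j = "Suc (Suc k)"
      obtain W w where W: "W \<in> \<X>" "cok ?k M W w" using Suc unfolding cin_def by auto
      obtain N q where N: "N \<in> fg_mods A" "cok ?j M N q" using cok_exists[OF M] by metis
      have lN: "left_module A N" using N(1) by auto
      have "\<exists>C c. C \<in> \<X> \<and> mod_epi A (comp ?j M) C c \<and>
        (\<forall>x\<in>carrier (comp ?j M). c x = \<zero>\<^bsub>C\<^esub> \<longleftrightarrow> (\<exists>y\<in>carrier M. x = u ?j (Suc ?j) \<odot>\<^bsub>M\<^esub> y))"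
      \<comment> \<open>At the last index there is no further structure map, and the last component
        itself plays the part of the cokernel.\<close>
      proof (cases "?j < n")
        case True
        then have j: "?j \<in> {1..<n}" by simp
        then have "\<exists>C\<in>\<X>. \<exists>q. mod_epi A (comp ?j M) C q \<and>
          (\<forall>x\<in>carrier (comp ?j M). q x = \<zero>\<^bsub>C\<^esub> \<longleftrightarrow> (\<exists>y\<in>carrier (comp (Suc ?j) M). x = u ?j (Suc ?j) \<odot>\<^bsub>M\<^esub> y))"
          using mr unfolding mono_rep_def by (elim conjE) (rule bspec)
        then show ?thesis unfolding sub[OF j] by blast
      next
        case False
        have j: "?j \<in> {1..n}" using Suc.prems by simp
        then have "in_cat A \<X> (comp ?j M)" using mr unfolding mono_rep_def by blast
        then obtain C c where C: "C \<in> \<X>" "left_module A C" "mod_iso A (comp ?j M) C c" using in_cat_rep[OF full] by blast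
        have "c x = \<zero>\<^bsub>C\<^esub> \<longleftrightarrow> (\<exists>y\<in>carrier M. x = u ?j (Suc ?j) \<odot>\<^bsub>M\<^esub> y)" if x: "x \<in> carrier (comp ?j M)" for x
        proof -
          have "c x = \<zero>\<^bsub>C\<^esub> \<longleftrightarrow> x = \<zero>\<^bsub>M\<^esub>"
            using x hom_inj_iff[OF mod_isoD(1)[OF C(3)] lcomp[OF j] C(2)] mod_isoD(2)[OF C(3)]
              hom_zero[OF mod_isoD(1)[OF C(3)] lcomp[OF j] C(2)] by auto
          also have "\<dots> \<longleftrightarrow> (\<exists>y\<in>carrier M. x = u ?j (Suc ?j) \<odot>\<^bsub>M\<^esub> y)"
            using act_invalid[OF lM, of _ ?j "Suc ?j"] False M.zero_closed by auto
          finally show ?thesis .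
        qed
        then show ?thesis using C(1) mod_iso_epi[OF C(3)] by blast
      qed
      then obtain C c where C: "C \<in> \<X>" "mod_epi A (comp ?j M) C c"
        "\<And>x. x \<in> carrier (comp ?j M) \<Longrightarrow> c x = \<zero>\<^bsub>C\<^esub> \<longleftrightarrow> (\<exists>y\<in>carrier M. x = u ?j (Suc ?j) \<odot>\<^bsub>M\<^esub> y)" by blast
      obtain f g where "short_exact A C N W f g"
        using cok_step[OF lM _ Suc.prems mon'[of ?j] N(2) W(2) C(2,3) lN lX[OF W(1)] lX[OF C(1)]] Suc.prems by auto
      then have "in_cat A \<X> N"
        using resolving_ext[OF X _ _ in_cat_self[OF full C(1)] in_cat_self[OF full W(1)]] N(1) by blast
      then show ?case using N in_cat_mem[OF full N(1)] unfolding cin_def by blast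
    qed
    have "cin \<X> k M" if "k \<in> {1..n}" for k using cin[of "k - 1"] that by simp
    then show "(\<forall>i\<in>{1..n}. monic_at i M) \<and> (\<forall>k\<in>{1..n}. cin \<X> k M)" using mon' by blast
  next
    assume *: "(\<forall>i\<in>{1..n}. monic_at i M) \<and> (\<forall>k\<in>{1..n}. cin \<X> k M)"
    \<comment> \<open>The composite from place \<open>n + 1\<close> is zero, so C_n is isomorphic to
      the first component.\<close>
    obtain Cn qn where Cn: "Cn \<in> \<X>" "cok n M Cn qn" using * n2 unfolding cin_def by force
    have n1: "1 \<in> {1..n}" using n2 by simp
    have c1: "in_cat A \<X> (comp 1 M)"
    proof -
      have "inj_on qn (carrier (comp 1 M))"
        unfolding hom_inj_iff[OF cokD(2)[OF Cn(2)] lcomp[OF n1] lX[OF Cn(1)]]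
        using cokD(3)[OF Cn(2)] act_invalid[OF lM, of _ 1 "Suc n"] by force
      then have "mod_iso A (comp 1 M) Cn qn" using cokD(1)[OF Cn(2)] by (auto simp: mod_iso_def mod_epi_def bij_betw_def)
      then show ?thesis using in_cat_iso'[OF in_cat_self[OF full Cn(1)] _ lcomp[OF n1]] by blast
    qed
    show "mono_rep \<X> M" unfolding mono_rep_def
    proof (intro conjI ballI impI)
      fix i x assume i: "i \<in> {1..<n}" and x: "x \<in> carrier (comp (Suc i) M)" and z: "u i (Suc i) \<odot>\<^bsub>M\<^esub> x = \<zero>\<^bsub>M\<^esub>"
      have "u 1 (Suc i) \<odot>\<^bsub>M\<^esub> x = \<zero>\<^bsub>M\<^esub>" using u_u[OF lM cc(1)[OF x], of 1 i "Suc i"] i z by simp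
      moreover have "Suc i \<in> {1..n}" using i by simp
      ultimately have "u (Suc i) (Suc i) \<odot>\<^bsub>M\<^esub> x = \<zero>\<^bsub>M\<^esub>" using * cc(1)[OF x] unfolding monic_at_def by blast
      then show "x = \<zero>\<^bsub>M\<^esub>" using cc(2)[OF x] by simp
    next
      fix i assume i: "i \<in> {1..n}"
      show "in_cat A \<X> (comp i M)"
      proof (cases "i = 1")
        case False
        define k where "k = i - 1"
        have ik: "i = Suc k" "k \<in> {1..n}" using i False by (auto simp: k_def)
        obtain W w where W: "W \<in> \<X>" "cok k M W w" using * ik(2) unfolding cin_def by blast
        have v: "valid 1 i" "valid i i" using i by auto
        \<comment> \<open>Being embedded in the first component, the \<open>i\<close>-th one is the
          kernel of the map onto C_(i-1).\<close>
        have "short_exact A (comp i M) (comp 1 M) W (\<lambda>x. u 1 i \<odot>\<^bsub>M\<^esub> x) w"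
        proof (rule short_exactI)
          show "mod_mono A (comp i M) (comp 1 M) (\<lambda>x. u 1 i \<odot>\<^bsub>M\<^esub> x)"
          proof (rule mod_monoI[OF u_hom[OF lM v(1)] lcomp[OF i] lcomp[OF n1]])
            fix x assume x: "x \<in> carrier (comp i M)" "u 1 i \<odot>\<^bsub>M\<^esub> x = \<zero>\<^bsub>comp 1 M\<^esub>"
            then have "u i i \<odot>\<^bsub>M\<^esub> x = \<zero>\<^bsub>M\<^esub>" using * i cc(1)[OF x(1)] unfolding monic_at_def by simp
            then show "x = \<zero>\<^bsub>comp i M\<^esub>" using cc(2)[OF x(1)] by simp
          qed
          show "mod_epi A (comp 1 M) W w" using cokD(1)[OF W(2)] .
        next
          fix y assume y: "y \<in> carrier (comp 1 M)" "w y = \<zero>\<^bsub>W\<^esub>"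
          then obtain z where z: "z \<in> carrier M" "y = u 1 i \<odot>\<^bsub>M\<^esub> z" using cokD(3)[OF W(2)] ik by blast
          then have "y = u 1 i \<odot>\<^bsub>M\<^esub> (u i i \<odot>\<^bsub>M\<^esub> z)" using u_u[OF lM z(1) v(1), of i] by simp
          then show "\<exists>x\<in>carrier (comp i M). y = u 1 i \<odot>\<^bsub>M\<^esub> x" using E_in_comp[OF lM v(2) B.one_closed z(1)] by blast
        next
          fix x assume "x \<in> carrier (comp i M)"
          then show "w (u 1 i \<odot>\<^bsub>M\<^esub> x) = \<zero>\<^bsub>W\<^esub>" using cok_zero[OF W(2) lM cc(1)] ik(1) by simp
        qed
        then show ?thesis using resolving_ker[OF X _ fcomp[OF i] c1 in_cat_self[OF full W(1)]] by blast
      qed (use c1 in simp)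
    next
      fix i assume i: "i \<in> {1..<n}"
      have i': "i \<in> {1..n}" using i by simp
      show "\<exists>C\<in>\<X>. \<exists>q. mod_epi A (comp i M) C q \<and>
        (\<forall>x\<in>carrier (comp i M). q x = \<zero>\<^bsub>C\<^esub> \<longleftrightarrow> (\<exists>y\<in>carrier (comp (Suc i) M). x = u i (Suc i) \<odot>\<^bsub>M\<^esub> y))"
        unfolding sub[OF i]
      proof (cases "i = 1")
        case True
        obtain C q where C: "C \<in> \<X>" "cok 1 M C q" using * n1 unfolding cin_def by blast
        show "\<exists>C\<in>\<X>. \<exists>q. mod_epi A (comp i M) C q \<and>
          (\<forall>x\<in>carrier (comp i M). q x = \<zero>\<^bsub>C\<^esub> \<longleftrightarrow> (\<exists>y\<in>carrier M. x = u i (Suc i) \<odot>\<^bsub>M\<^esub> y))"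
          using C(2) unfolding True cok_def by (intro bexI[OF _ C(1)] exI[of _ q])
      next
        case False
        define k where "k = i - 1"
        have ik: "i = Suc k" "k \<in> {1..n}" "1 \<le> k" "Suc k \<le> n" using i False by (auto simp: k_def)
        obtain W w where W: "W \<in> \<X>" "cok k M W w" using * ik(2) unfolding cin_def by blast
        obtain N q where N: "N \<in> \<X>" "cok (Suc k) M N q" using * i' ik(1) unfolding cin_def by blast
        have "submod A (comp i M) {x. \<exists>y\<in>carrier (comp (Suc i) M). x = u i (Suc i) \<odot>\<^bsub>M\<^esub> y}"
        proof -
          have v: "valid i (Suc i)" "Suc i \<in> {1..n}" using i by auto
          have "{x. \<exists>y\<in>carrier (comp (Suc i) M). x = u i (Suc i) \<odot>\<^bsub>M\<^esub> y} = (\<lambda>x. u i (Suc i) \<odot>\<^bsub>M\<^esub> x) ` carrier (comp (Suc i) M)"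
            by blast
          then show ?thesis
            using submod_image[OF u_hom[OF lM v(1)] lcomp[OF v(2)] lcomp[OF i'] submod_carrier[OF lcomp[OF v(2)]]] by simp
        qed
        from quot_exists[OF fcomp[OF i'] this, unfolded mem_Collect_eq sub[OF i]]
        obtain C c where C: "C \<in> fg_mods A" "mod_epi A (comp i M) C c"
          "\<forall>x\<in>carrier (comp i M). c x = \<zero>\<^bsub>C\<^esub> \<longleftrightarrow> (\<exists>y\<in>carrier M. x = u i (Suc i) \<odot>\<^bsub>M\<^esub> y)" by (elim exE conjE)
        have mo: "monic_at (Suc k) M" using * i' ik(1) by blast
        have lC: "left_module A C" using C(1) by auto
        obtain f g where "short_exact A C N W f g"
          using cok_step[OF lM ik(3,4) mo N(2) W(2) C(2)[unfolded ik(1)] C(3)[unfolded ik(1), rule_format] lX[OF N(1)] lX[OF W(1)] lC]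
          by blast
        then have "in_cat A \<X> C"
          using resolving_ker[OF X _ _ in_cat_self[OF full N(1)] in_cat_self[OF full W(1)]] C(1) by blast
        then have "C \<in> \<X>" using in_cat_mem[OF full C(1)] by blast
        then show "\<exists>C\<in>\<X>. \<exists>q. mod_epi A (comp i M) C q \<and>
          (\<forall>x\<in>carrier (comp i M). q x = \<zero>\<^bsub>C\<^esub> \<longleftrightarrow> (\<exists>y\<in>carrier M. x = u i (Suc i) \<odot>\<^bsub>M\<^esub> y))"
          using C(2,3) by (intro bexI[of _ C] exI[of _ c] conjI)
      qed
    qed
  qed
qed

section \<open>Closure under extensions, kernels and retracts\<close>

text \<open>The quotient \<open>M\<close> has monic composites, so \<open>cok_exact\<close> turns
  the sequence into exact sequences of cokernels, to which the closure properties over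
  \<open>A\<close> apply. \<open>S_ker\<close> rests on the same sequences.\<close>

lemma S_ext:
  assumes X: "resolving A \<X>" and e: "short_exact T K L M f g" and L: "fg_left_module T L"
    and K: "in_cat T (mono_rep_cat n A \<X>) K" and M: "in_cat T (mono_rep_cat n A \<X>) M"
  shows "in_cat T (mono_rep_cat n A \<X>) L"
proof -
  note full = resolving_full[OF X]
  have fK: "fg_left_module T K" and fM: "fg_left_module T M" using in_cat_fg[OF S_full] K M by blast+
  have lm: "left_module T K" "left_module T L" "left_module T M" using fK L fM by auto
  have cK: "\<forall>i\<in>{1..n}. monic_at i K" "\<forall>k\<in>{1..n}. cin \<X> k K" using K in_S_cok_iff[OF X fK] by auto
  have cM: "\<forall>i\<in>{1..n}. monic_at i M" "\<forall>k\<in>{1..n}. cin \<X> k M" using M in_S_cok_iff[OF X fM] by auto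
  have "monic_at i L" if "i \<in> {1..n}" for i using monic_at_ext[OF e lm that] cK(1) cM(1) that by blast
  moreover have "cin \<X> k L" if k: "k \<in> {1..n}" for k
  proof -
    obtain NK qK where NK: "NK \<in> \<X>" "cok k K NK qK" using cK(2) k unfolding cin_def by blast
    obtain NM qM where NM: "NM \<in> \<X>" "cok k M NM qM" using cM(2) k unfolding cin_def by blast
    obtain NL qL where NL: "NL \<in> fg_mods A" "cok k L NL qL" using cok_exists[OF L] by metis
    have lN: "left_module A NK" "left_module A NL" "left_module A NM"
      using NK(1) NM(1) NL(1) full by (auto simp: full_subcategory_def)
    have mo: "monic_at (Suc k) M" if "Suc k \<le> n" using cM(1) that by simp
    obtain f' g' where "short_exact A NK NL NM f' g'" using cok_exact[OF e lm mo NK(2) NL(2) NM(2) lN] by blast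
    then have "in_cat A \<X> NL"
      using resolving_ext[OF X _ _ in_cat_self[OF full NK(1)] in_cat_self[OF full NM(1)]] NL(1) by blast
    then show ?thesis using NL in_cat_mem[OF full NL(1)] unfolding cin_def by blast
  qed
  ultimately show ?thesis using in_S_cok_iff[OF X L] by blast
qed

lemma S_ker:
  assumes X: "resolving A \<X>" and e: "short_exact T K L M f g" and K: "fg_left_module T K"
    and L: "in_cat T (mono_rep_cat n A \<X>) L" and M: "in_cat T (mono_rep_cat n A \<X>) M"
  shows "in_cat T (mono_rep_cat n A \<X>) K"
proof -
  note full = resolving_full[OF X]
  have fL: "fg_left_module T L" and fM: "fg_left_module T M" using in_cat_fg[OF S_full] L M by blast+
  have lm: "left_module T K" "left_module T L" "left_module T M" using K fL fM by auto
  have cL: "\<forall>i\<in>{1..n}. monic_at i L" "\<forall>k\<in>{1..n}. cin \<X> k L" using L in_S_cok_iff[OF X fL] by auto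
  have cM: "\<forall>i\<in>{1..n}. monic_at i M" "\<forall>k\<in>{1..n}. cin \<X> k M" using M in_S_cok_iff[OF X fM] by auto
  have "monic_at i K" if "i \<in> {1..n}" for i
    using monic_at_mono[OF short_exactD(1)[OF e] lm(1,2)] cL(1) that by blast
  moreover have "cin \<X> k K" if k: "k \<in> {1..n}" for k
  proof -
    obtain NL qL where NL: "NL \<in> \<X>" "cok k L NL qL" using cL(2) k unfolding cin_def by blast
    obtain NM qM where NM: "NM \<in> \<X>" "cok k M NM qM" using cM(2) k unfolding cin_def by blast
    obtain NK qK where NK: "NK \<in> fg_mods A" "cok k K NK qK" using cok_exists[OF K] by metis
    have lN: "left_module A NK" "left_module A NL" "left_module A NM"
      using NK(1) NM(1) NL(1) full by (auto simp: full_subcategory_def)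
    have mo: "monic_at (Suc k) M" if "Suc k \<le> n" using cM(1) that by simp
    obtain f' g' where "short_exact A NK NL NM f' g'" using cok_exact[OF e lm mo NK(2) NL(2) NM(2) lN] by blast
    then have "in_cat A \<X> NK"
      using resolving_ker[OF X _ _ in_cat_self[OF full NL(1)] in_cat_self[OF full NM(1)]] NK(1) by blast
    then show ?thesis using NK in_cat_mem[OF full NK(1)] unfolding cin_def by blast
  qed
  ultimately show ?thesis using in_S_cok_iff[OF X K] by blast
qed

text \<open>Cokernels are functorial (\<open>cok_map\<close>), so those of a retract are retracts of
  cokernels, and injectivity passes to submodules.\<close>

lemma S_retract:
  assumes X: "resolving A \<X>" and L: "in_cat T (mono_rep_cat n A \<X>) L" and K: "fg_left_module T K"
    and i: "i \<in> mod_hom T K L" and p: "p \<in> mod_hom T L K" and pi: "\<And>x. x \<in> carrier K \<Longrightarrow> p (i x) = x"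
  shows "in_cat T (mono_rep_cat n A \<X>) K"
proof -
  note full = resolving_full[OF X]
  have fL: "fg_left_module T L" using in_cat_fg[OF S_full] L by blast
  have lm: "left_module T K" "left_module T L" using K fL by auto
  have cL: "\<forall>i\<in>{1..n}. monic_at i L" "\<forall>k\<in>{1..n}. cin \<X> k L" using L in_S_cok_iff[OF X fL] by auto
  have "mod_mono T K L i" using i pi by (auto simp: mod_mono_def intro: inj_on_inverseI)
  then have "monic_at j K" if "j \<in> {1..n}" for j using monic_at_mono[OF _ lm] cL(1) that by blast
  moreover have "cin \<X> k K" if k: "k \<in> {1..n}" for k
  proof -
    obtain NL qL where NL: "NL \<in> \<X>" "cok k L NL qL" using cL(2) k unfolding cin_def by blast
    obtain NK qK where NK: "NK \<in> fg_mods A" "cok k K NK qK" using cok_exists[OF K] by metis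
    have lN: "left_module A NK" "left_module A NL" using NK(1) NL(1) full by (auto simp: full_subcategory_def)
    obtain i' where i': "i' \<in> mod_hom A NK NL" "\<forall>x\<in>carrier (comp 1 K). i' (qK x) = qL (i x)"
      using cok_map[OF i lm NK(2) NL(2) lN] by (rule bexE)
    obtain p' where p': "p' \<in> mod_hom A NL NK" "\<forall>x\<in>carrier (comp 1 L). p' (qL x) = qK (p x)"
      using cok_map[OF p lm(2,1) NL(2) NK(2) lN(2,1)] by (rule bexE)
    have "p' (i' w) = w" if w: "w \<in> carrier NK" for w
    proof -
      obtain x where x: "x \<in> carrier (comp 1 K)" "qK x = w" using mod_epi_surj[OF cokD(1)[OF NK(2)] w] by metis
      then show ?thesis using i'(2) p'(2) hom_closed[OF comp_hom[OF i] x(1)] pi by auto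
    qed
    then have "in_cat A \<X> NK" using resolving_retract[OF X in_cat_self[OF full NL(1)] lN(1) i'(1) p'(1)] by blast
    then show ?thesis using NK in_cat_mem[OF full NK(1)] unfolding cin_def by blast
  qed
  ultimately show ?thesis using in_S_cok_iff[OF X K] by blast
qed

end

section \<open>Approximations by monic representations\<close>

context tri begin

text \<open>\<open>M'\<close> maps onto \<open>M\<close>, and no map from an object of the family to
  \<open>M\<close> is lost. The relation composes, so an approximation can be reached by improving
  \<open>M\<close> in stages; it is complete once \<open>M'\<close> belongs to the family.\<close>

definition lifts :: "(nat \<Rightarrow> nat \<Rightarrow> 'a) fgmod set \<Rightarrow> (nat \<Rightarrow> nat \<Rightarrow> 'a, 'm) module \<Rightarrow>
    (nat \<Rightarrow> nat \<Rightarrow> 'a, 'k) module \<Rightarrow> ('k \<Rightarrow> 'm) \<Rightarrow> bool" where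
  "lifts \<S> M M' \<pi> \<longleftrightarrow> mod_epi T M' M \<pi> \<and>
     (\<forall>U\<in>\<S>. \<forall>f\<in>mod_hom T U M. \<exists>f'\<in>mod_hom T U M'. \<forall>x\<in>carrier U. \<pi> (f' x) = f x)"

lemma lifts_comp:
  assumes 1: "lifts \<S> M M' \<pi>" and 2: "lifts \<S> M' M'' \<rho>"
  shows "lifts \<S> M M'' (\<lambda>x. \<pi> (\<rho> x))"
  unfolding lifts_def
proof (intro conjI ballI)
  show "mod_epi T M'' M (\<lambda>x. \<pi> (\<rho> x))" using mod_epi_comp 1 2 unfolding lifts_def by blast
  fix U f assume U: "U \<in> \<S>" and f: "f \<in> mod_hom T U M"
  obtain f' where f': "f' \<in> mod_hom T U M'" "\<forall>x\<in>carrier U. \<pi> (f' x) = f x"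
    using 1 U f unfolding lifts_def by metis
  obtain f'' where f'': "f'' \<in> mod_hom T U M''" "\<forall>x\<in>carrier U. \<rho> (f'' x) = f' x"
    using 2 U f'(1) unfolding lifts_def by metis
  show "\<exists>f'\<in>mod_hom T U M''. \<forall>x\<in>carrier U. \<pi> (\<rho> (f' x)) = f x"
    using f'(2) f''(2) by (intro bexI[OF _ f''(1)]) simp
qed

lemma lifts_id: "lifts \<S> M M (\<lambda>x. x)"
  unfolding lifts_def mod_epi_def using hom_id by (auto intro: bexI)

lemma lifts_rep:
  assumes l: "lifts \<S> M M' \<pi>" and r: "mod_iso T N M' r" and N: "left_module T N" and M': "left_module T M'"
  shows "lifts \<S> M N (\<lambda>x. \<pi> (r x))"
proof -
  obtain r' where r': "mod_iso T M' N r'" "\<And>y. y \<in> carrier M' \<Longrightarrow> r (r' y) = y" using mod_iso_inv[OF r N] by metis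
  have "lifts \<S> M' N r" unfolding lifts_def
  proof (intro conjI ballI mod_iso_epi[OF r])
    fix U f assume f: "f \<in> mod_hom T U M'"
    show "\<exists>f'\<in>mod_hom T U N. \<forall>x\<in>carrier U. r (f' x) = f x"
      using r'(2) hom_closed[OF f] by (intro bexI[OF _ hom_comp[OF f mod_isoD(1)[OF r'(1)]]]) simp
  qed
  then show ?thesis using lifts_comp[OF l] by blast
qed

lemma cok_iso:
  assumes r: "mod_iso T N M r" and N: "left_module T N" and M: "left_module T M" and c: "cok k M Y q"
  shows "cok k N Y (\<lambda>x. q (r x))"
  unfolding cok_def
proof (intro conjI ballI)
  note ci = comp_iso[OF r N M, of 1]
  have n1: "1 \<le> n" using n2 by simp
  show "mod_epi A (comp 1 N) Y (\<lambda>x. q (r x))" using mod_epi_comp[OF mod_iso_epi[OF ci[OF order_refl n1]] cokD(1)[OF c]] .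
  fix x assume x: "x \<in> carrier (comp 1 N)"
  then have xN: "x \<in> carrier N" by simp
  have "q (r x) = \<zero>\<^bsub>Y\<^esub> \<longleftrightarrow> (\<exists>y\<in>carrier M. r x = u 1 (Suc k) \<odot>\<^bsub>M\<^esub> y)"
    using c hom_closed[OF comp_hom[OF mod_isoD(1)[OF r]] x] unfolding cok_def by blast
  also have "\<dots> \<longleftrightarrow> (\<exists>y\<in>carrier N. r x = u 1 (Suc k) \<odot>\<^bsub>M\<^esub> r y)"
    unfolding mod_isoD(3)[OF r, symmetric] by blast
  also have "\<dots> \<longleftrightarrow> (\<exists>y\<in>carrier N. x = u 1 (Suc k) \<odot>\<^bsub>N\<^esub> y)"
  proof (rule bex_cong[OF refl])
    fix y assume y: "y \<in> carrier N"
    show "(r x = u 1 (Suc k) \<odot>\<^bsub>M\<^esub> r y) = (x = u 1 (Suc k) \<odot>\<^bsub>N\<^esub> y)"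
      using u_hom_zero[OF mod_isoD(1)[OF r] y, of 1 "Suc k"] mod_isoD(2)[OF r] xN act_closed[OF N B.one_closed y]
      unfolding inj_on_def by metis
  qed
  finally show "q (r x) = \<zero>\<^bsub>Y\<^esub> \<longleftrightarrow> (\<exists>y\<in>carrier N. x = u 1 (Suc k) \<odot>\<^bsub>N\<^esub> y)" .
qed

lemma cin_iso:
  "mod_iso T N M r \<Longrightarrow> left_module T N \<Longrightarrow> left_module T M \<Longrightarrow> cin \<Y> k M \<Longrightarrow> cin \<Y> k N"
  unfolding cin_def using cok_iso by blast

lemma sum_E:
  assumes Y: "left_module A Y" and v: "valid i j" and a: "a \<in> carrier A" and y: "y \<in> carrier (col Y)"
  shows "E i j a \<odot>\<^bsub>mod_sum M (col Y)\<^esub> (m, y) = (E i j a \<odot>\<^bsub>M\<^esub> m, \<lambda>p. if p = i then a \<odot>\<^bsub>Y\<^esub> y j else \<zero>\<^bsub>Y\<^esub>)"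
  using col_E[OF Y v a y] by simp

text \<open>\<open>col Y\<close> truncated to its first \<open>k\<close> rows is right adjoint to the \<open>k\<close>-th cokernel functor.\<close>

lemma col_hom:
  assumes U: "left_module T U" and Y: "left_module A Y" and g: "g \<in> mod_hom A (comp 1 U) Y" and k: "k \<le> n"
    and z: "\<And>x. x \<in> carrier U \<Longrightarrow> g (u 1 (Suc k) \<odot>\<^bsub>U\<^esub> x) = \<zero>\<^bsub>Y\<^esub>"
  shows "(\<lambda>x i. if i \<in> {1..k} then g (u 1 i \<odot>\<^bsub>U\<^esub> x) else \<zero>\<^bsub>Y\<^esub>) \<in> mod_hom T U (col Y)" (is "?h \<in> _")
proof -
  interpret U: left_module T U by fact
  interpret Y: left_module A Y by fact
  have gc: "g (u 1 i \<odot>\<^bsub>U\<^esub> x) \<in> carrier Y" if "x \<in> carrier U" for i x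
    using hom_closed[OF g u1_comp[OF U that]] .
  have hc: "?h x \<in> carrier (col Y)" if "x \<in> carrier U" for x using gc[OF that] k by auto
  \<comment> \<open>The composite from any place beyond \<open>k\<close> factors through place
    \<open>k + 1\<close>, where \<open>g\<close> vanishes; this makes the truncation after row
    \<open>k\<close> compatible with the matrices.\<close>
  have big: "g (u 1 j \<odot>\<^bsub>U\<^esub> x) = \<zero>\<^bsub>Y\<^esub>" if j: "k < j" "j \<le> n" and x: "x \<in> carrier U" for j x
  proof -
    have "u 1 j \<odot>\<^bsub>U\<^esub> x = u 1 (Suc k) \<odot>\<^bsub>U\<^esub> (u (Suc k) j \<odot>\<^bsub>U\<^esub> x)" using u_u[OF U x, of 1 "Suc k" j] j by simp
    then show ?thesis using z[OF act_closed[OF U B.one_closed x]] by simp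
  qed
  show ?thesis
  proof (rule T_homI[OF U col_left_module[OF Y] hc])
    fix x y assume x: "x \<in> carrier U" and y: "y \<in> carrier U"
    have "g (u 1 i \<odot>\<^bsub>U\<^esub> (x \<oplus>\<^bsub>U\<^esub> y)) = g (u 1 i \<odot>\<^bsub>U\<^esub> x) \<oplus>\<^bsub>Y\<^esub> g (u 1 i \<odot>\<^bsub>U\<^esub> y)" for i
      using hom_add[OF g u1_comp[OF U x] u1_comp[OF U y], of i i] x y by (simp add: U.smult_r_distr)
    then show "?h (x \<oplus>\<^bsub>U\<^esub> y) = ?h x \<oplus>\<^bsub>col Y\<^esub> ?h y" by (auto simp: fun_eq_iff)
  next
    fix i j a x assume v: "valid i j" and a: "a \<in> carrier A" and x: "x \<in> carrier U"
    show "?h (E i j a \<odot>\<^bsub>U\<^esub> x) = E i j a \<odot>\<^bsub>col Y\<^esub> ?h x"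
    proof
      fix p
      have e: "u 1 p \<odot>\<^bsub>U\<^esub> (E i j a \<odot>\<^bsub>U\<^esub> x) = (if p = i then E 1 1 a \<odot>\<^bsub>U\<^esub> (u 1 j \<odot>\<^bsub>U\<^esub> x) else \<zero>\<^bsub>U\<^esub>)" if p: "p \<in> {1..k}"
      proof -
        have "u 1 p \<odot>\<^bsub>U\<^esub> (E i j a \<odot>\<^bsub>U\<^esub> x) = (if p = i then E 1 j a \<odot>\<^bsub>U\<^esub> x else \<zero>\<^bsub>U\<^esub>)"
          using E_act[OF U _ v B.one_closed a x, of 1 p] p k a by simp
        moreover have "E 1 j a \<odot>\<^bsub>U\<^esub> x = E 1 1 a \<odot>\<^bsub>U\<^esub> (u 1 j \<odot>\<^bsub>U\<^esub> x)" using E_u[OF U x, of 1 j a] v a by simp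
        ultimately show ?thesis by simp
      qed
      have g1: "g (E 1 1 a \<odot>\<^bsub>U\<^esub> (u 1 j \<odot>\<^bsub>U\<^esub> x)) = a \<odot>\<^bsub>Y\<^esub> g (u 1 j \<odot>\<^bsub>U\<^esub> x)"
        using hom_smult[OF g a u1_comp[OF U x]] by simp
      have g0: "g \<zero>\<^bsub>U\<^esub> = \<zero>\<^bsub>Y\<^esub>" using hom_zero[OF g comp1_lm[OF U] Y] by simp
      have "?h (E i j a \<odot>\<^bsub>U\<^esub> x) p = (if p = i then a \<odot>\<^bsub>Y\<^esub> ?h x j else \<zero>\<^bsub>Y\<^esub>)"
      proof (cases "p \<in> {1..k}")
        case True
        show ?thesis
        proof (cases "p = i")
          case pi: True
          have "a \<odot>\<^bsub>Y\<^esub> ?h x j = a \<odot>\<^bsub>Y\<^esub> g (u 1 j \<odot>\<^bsub>U\<^esub> x)"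
            using big[of j x] v x True pi by auto
          then show ?thesis using e[OF True] g1 True pi by simp
        next
          case False
          then show ?thesis using e[OF True] g0 True by simp
        qed
      next
        case False
        then show ?thesis using v a by auto
      qed
      then show "?h (E i j a \<odot>\<^bsub>U\<^esub> x) p = (E i j a \<odot>\<^bsub>col Y\<^esub> ?h x) p" unfolding col_E[OF Y v a hc[OF x]] .
    qed
  qed
qed

lemma pair_hom:
  assumes "f \<in> mod_hom T U M" "h \<in> mod_hom T U N" "\<And>x. x \<in> carrier U \<Longrightarrow> (f x, h x) \<in> W"
  shows "(\<lambda>x. (f x, h x)) \<in> mod_hom T U (sub_module (mod_sum M N) W)"
  by (rule mod_homI) (use assms in \<open>simp_all add: hom_add hom_smult\<close>)

text \<open>The module \<open>W\<close> is the pullback of \<open>M \<rightarrow> D \<leftarrow> col J\<close>, where \<open>D\<close> is the quotient of \<open>col J\<close> that keeps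
  the rows from \<open>i\<close> on; it makes the map from the \<open>i\<close>-th component monic.\<close>

lemma make_monic_step:
  assumes M: "M \<in> fg_mods T" and i: "i \<in> {1..n}" and S: "\<And>U. U \<in> \<S> \<Longrightarrow> U \<in> fg_mods T \<and> monic_at i U"
  shows "\<exists>M' \<pi>. M' \<in> fg_mods T \<and> lifts \<S> M M' \<pi> \<and> monic_at i M' \<and> (\<forall>j\<in>{1..n}. monic_at j M \<longrightarrow> monic_at j M')"
proof -
  have fM: "fg_left_module T M" and lM: "left_module T M" using M by auto
  interpret M: left_module T M by (rule lM)
  have vi: "valid i i" "valid 1 i" using i by auto
  have fc: "fg_left_module A (comp i M)" and lc: "left_module A (comp i M)" using comp_fg[OF fM, of i] comp_left_module[OF lM, of i] i by auto
  obtain J e where J: "inj_mod A J" and e: "mod_mono A (comp i M) J e" using enough_injectives[OF fc] by metis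
  have fJ: "J \<in> fg_mods A" using J by (simp add: inj_mod_def)
  then have lJ: "left_module A J" by auto
  interpret J: left_module A J by (rule lJ)
  note eh = mod_monoD(1)[OF e]
  have e0: "e \<zero>\<^bsub>M\<^esub> = \<zero>\<^bsub>J\<^esub>" using hom_zero[OF eh lc lJ] by simp
  have uc: "u i p \<odot>\<^bsub>M\<^esub> m \<in> carrier (comp i M)" if "m \<in> carrier M" "p \<in> {i..n}" for p m
    using E_in_comp[OF lM _ B.one_closed that(1), of i p] that(2) i by simp
  have lC: "left_module T (col J)" using col_left_module[OF lJ] .
  let ?P = "mod_sum M (col J)"
  have lP: "left_module T ?P" using left_module_mod_sum[OF lM lC] .
  have fP: "fg_left_module T ?P" using fg_mod_sum[OF fM col_fg] fJ by auto
  interpret P: left_module T ?P by (rule lP)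
  \<comment> \<open>From row \<open>i\<close> on the column is prescribed by \<open>m\<close>
    through the embedding \<open>e\<close>, while the rows before \<open>i\<close> are free. These
    free rows leave room for the images in the first component that separate elements.\<close>
  define W where "W = {(m, y). m \<in> carrier M \<and> y \<in> carrier (col J) \<and> (\<forall>p\<in>{i..n}. y p = e (u i p \<odot>\<^bsub>M\<^esub> m))}"
  have W: "submod T ?P W"
  proof (rule T_submodI[OF lP])
    show "x \<in> carrier ?P" if "x \<in> W" for x using that unfolding W_def by auto
    show "\<zero>\<^bsub>?P\<^esub> \<in> W" using e0 by (auto simp: W_def)
  next
    fix x x' assume "x \<in> W" "x' \<in> W"
    then obtain m y m' y' where x: "x = (m, y)" "x' = (m', y')" "m \<in> carrier M" "m' \<in> carrier M"
      "y \<in> carrier (col J)" "y' \<in> carrier (col J)"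
      "\<forall>p\<in>{i..n}. y p = e (u i p \<odot>\<^bsub>M\<^esub> m)" "\<forall>p\<in>{i..n}. y' p = e (u i p \<odot>\<^bsub>M\<^esub> m')" unfolding W_def by auto
    have "e (u i p \<odot>\<^bsub>M\<^esub> (m \<oplus>\<^bsub>M\<^esub> m')) = y p \<oplus>\<^bsub>J\<^esub> y' p" if "p \<in> {i..n}" for p
      using hom_add[OF eh uc[OF x(3) that] uc[OF x(4) that]] x(3,4,7,8) that by (simp add: M.smult_r_distr)
    then show "x \<oplus>\<^bsub>?P\<^esub> x' \<in> W" using x(1-6) by (auto simp: W_def)
  next
    fix p q a x assume v: "valid p q" and a: "a \<in> carrier A" and "x \<in> W"
    then obtain m y where x: "x = (m, y)" "m \<in> carrier M" "y \<in> carrier (col J)" "\<forall>p\<in>{i..n}. y p = e (u i p \<odot>\<^bsub>M\<^esub> m)"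
      unfolding W_def by auto
    have "(if r = p then a \<odot>\<^bsub>J\<^esub> y q else \<zero>\<^bsub>J\<^esub>) = e (u i r \<odot>\<^bsub>M\<^esub> (E p q a \<odot>\<^bsub>M\<^esub> m))" if r: "r \<in> {i..n}" for r
    proof (cases "r = p")
      case True
      have q: "q \<in> {i..n}" using True r v by auto
      have "u i r \<odot>\<^bsub>M\<^esub> (E p q a \<odot>\<^bsub>M\<^esub> m) = E i i a \<odot>\<^bsub>M\<^esub> (u i q \<odot>\<^bsub>M\<^esub> m)"
        using E_act[OF lM _ v B.one_closed a x(2), of i r] E_u[OF lM x(2), of i q a] True r q i a by simp
      then show ?thesis using hom_smult[OF eh a uc[OF x(2) q]] x(4) q True by simp
    next
      case False
      then have "u i r \<odot>\<^bsub>M\<^esub> (E p q a \<odot>\<^bsub>M\<^esub> m) = \<zero>\<^bsub>M\<^esub>"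
        using E_act[OF lM _ v B.one_closed a x(2), of i r] r i by simp
      then show ?thesis using e0 False by simp
    qed
    moreover have "(\<lambda>r. if r = p then a \<odot>\<^bsub>J\<^esub> y q else \<zero>\<^bsub>J\<^esub>) \<in> carrier (col J)"
      using v a x(3) J.smult_closed by auto
    ultimately show "E p q a \<odot>\<^bsub>?P\<^esub> x \<in> W"
      unfolding x(1) sum_E[OF lJ v a x(3)] using act_closed[OF lM a x(2)] by (simp add: W_def)
  qed
  let ?W = "sub_module ?P W"
  have fW: "fg_left_module T ?W" using T.fg_sub[OF fP W] .
  have lW: "left_module T ?W" using fW by auto
  have WD: "m \<in> carrier M" "y \<in> carrier (col J)" "\<And>p. p \<in> {i..n} \<Longrightarrow> y p = e (u i p \<odot>\<^bsub>M\<^esub> m)" if "(m, y) \<in> W" for m y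
    using that unfolding W_def by auto
  have uW: "u p q \<odot>\<^bsub>?W\<^esub> (m, y) = (u p q \<odot>\<^bsub>M\<^esub> m, \<lambda>r. if r = p then y q else \<zero>\<^bsub>J\<^esub>)" if "(m, y) \<in> W" "valid p q" for p q m y
  proof -
    have "y q \<in> carrier J" using WD(2)[OF that(1)] by simp
    then show ?thesis using sum_E[OF lJ that(2) B.one_closed WD(2)[OF that(1)], of M m] by (auto simp: fun_eq_iff J.smult_one)
  qed
  have fst: "fst \<in> mod_hom T ?W M" using hom_comp[OF sub_incl fst_hom] W by (auto simp: submod_def)
  have l: "lifts \<S> M ?W fst" unfolding lifts_def
  proof (intro conjI ballI)
    show "mod_epi T ?W M fst"
    proof (rule mod_epiI[OF fst])
      fix m assume m: "m \<in> carrier M"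
      have "(m, \<lambda>p. if p \<in> {i..n} then e (u i p \<odot>\<^bsub>M\<^esub> m) else \<zero>\<^bsub>J\<^esub>) \<in> W"
        using m i hom_closed[OF eh uc[OF m]] by (auto simp: W_def)
      then show "\<exists>x\<in>carrier ?W. m = fst x" by force
    qed
    fix U f assume U: "U \<in> \<S>" and f: "f \<in> mod_hom T U M"
    have fU: "fg_left_module T U" and mU: "monic_at i U" using S[OF U] by auto
    then have lU: "left_module T U" by auto
    have lcU: "left_module A (comp i U)" "left_module A (comp 1 U)" using comp_left_module[OF lU, of i] comp1_lm[OF lU] i by auto
    have "mod_mono A (comp i U) (comp 1 U) (\<lambda>x. u 1 i \<odot>\<^bsub>U\<^esub> x)"
    proof (rule mod_monoI[OF u_hom[OF lU vi(2)] lcU])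
      fix x assume x: "x \<in> carrier (comp i U)" "u 1 i \<odot>\<^bsub>U\<^esub> x = \<zero>\<^bsub>comp 1 U\<^esub>"
      then show "x = \<zero>\<^bsub>comp i U\<^esub>" using mU unfolding monic_at_def by auto
    qed
    \<comment> \<open>In \<open>U\<close> the \<open>i\<close>-th component embeds into the first,
      so injectivity of \<open>J\<close> extends the map \<open>e f\<close> to the first component;
      \<open>col_hom\<close> makes a column out of the extension.\<close>
    from inj_ext[OF J this _ comp1_fg[OF fU] hom_comp[OF comp_hom[OF f] eh]] comp_fg[OF fU, of i] i
    obtain g where g: "g \<in> mod_hom A (comp 1 U) J" "\<forall>x\<in>carrier (comp i U). g (u 1 i \<odot>\<^bsub>U\<^esub> x) = e (f x)" by auto
    let ?h = "\<lambda>x i. if i \<in> {1..n} then g (u 1 i \<odot>\<^bsub>U\<^esub> x) else \<zero>\<^bsub>J\<^esub>"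
    have h: "?h \<in> mod_hom T U (col J)"
    proof (rule col_hom[OF lU lJ g(1) order_refl])
      fix x assume "x \<in> carrier U"
      then show "g (u 1 (Suc n) \<odot>\<^bsub>U\<^esub> x) = \<zero>\<^bsub>J\<^esub>" using act_invalid[OF lU, of x 1 "Suc n"] hom_zero[OF g(1) lcU(2) lJ] by simp
    qed
    have in_W: "(f x, ?h x) \<in> W" if x: "x \<in> carrier U" for x
    proof -
      have "?h x p = e (u i p \<odot>\<^bsub>M\<^esub> f x)" if p: "p \<in> {i..n}" for p
      proof -
        have "u i p \<odot>\<^bsub>U\<^esub> x \<in> carrier (comp i U)" using E_in_comp[OF lU _ B.one_closed x, of i p] p i by simp
        then have "g (u 1 i \<odot>\<^bsub>U\<^esub> (u i p \<odot>\<^bsub>U\<^esub> x)) = e (f (u i p \<odot>\<^bsub>U\<^esub> x))" using g(2) by blast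
        then show ?thesis using u_u[OF lU x vi(2), of p] u_hom_zero[OF f x] p i by simp
      qed
      then show ?thesis using hom_closed[OF f x] hom_closed[OF h x] unfolding W_def by blast
    qed
    show "\<exists>f'\<in>mod_hom T U ?W. \<forall>x\<in>carrier U. fst (f' x) = f x"
    proof (intro bexI[of _ "\<lambda>x. (f x, ?h x)"] ballI)
      show "(\<lambda>x. (f x, ?h x)) \<in> mod_hom T U ?W"
        by (rule pair_hom[OF f h in_W])
    qed simp
  qed
  \<comment> \<open>\<open>u 1 i\<close> moves the entry \<open>y i\<close> to row 1, and this entry
    is the image under the embedding \<open>e\<close> of the \<open>i\<close>-th component of
    \<open>m\<close>.\<close>
  have mono_i: "monic_at i ?W"
    unfolding monic_at_def
  proof (intro ballI impI)
    fix x assume x: "x \<in> carrier ?W" "u 1 i \<odot>\<^bsub>?W\<^esub> x = \<zero>\<^bsub>?W\<^esub>"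
    obtain m y where my: "x = (m, y)" by (cases x)
    have xW: "(m, y) \<in> W" using x(1) my by simp
    have "snd (u 1 i \<odot>\<^bsub>?W\<^esub> x) 1 = y i" using uW[OF xW vi(2)] my by simp
    then have yi: "y i = \<zero>\<^bsub>J\<^esub>" using x(2) by simp
    then have "e (u i i \<odot>\<^bsub>M\<^esub> m) = \<zero>\<^bsub>J\<^esub>" using WD(3)[OF xW, of i] i by simp
    then have "u i i \<odot>\<^bsub>M\<^esub> m = \<zero>\<^bsub>M\<^esub>"
      using hom_inj_iff[OF eh lc lJ] mod_monoD(2)[OF e] uc[OF WD(1)[OF xW], of i] i by simp
    then show "u i i \<odot>\<^bsub>?W\<^esub> x = \<zero>\<^bsub>?W\<^esub>" using uW[OF xW vi(1)] my yi by (auto simp: fun_eq_iff)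
  qed
  have mono_j: "monic_at j ?W" if j: "j \<in> {1..n}" "monic_at j M" for j
    unfolding monic_at_def
  proof (intro ballI impI)
    fix x assume x: "x \<in> carrier ?W" "u 1 j \<odot>\<^bsub>?W\<^esub> x = \<zero>\<^bsub>?W\<^esub>"
    obtain m y where my: "x = (m, y)" by (cases x)
    have xW: "(m, y) \<in> W" using x(1) my by simp
    have v: "valid 1 j" "valid j j" using j by auto
    have "fst (u 1 j \<odot>\<^bsub>?W\<^esub> x) = u 1 j \<odot>\<^bsub>M\<^esub> m" "snd (u 1 j \<odot>\<^bsub>?W\<^esub> x) 1 = y j"
      using uW[OF xW v(1)] my by simp_all
    then have *: "u 1 j \<odot>\<^bsub>M\<^esub> m = \<zero>\<^bsub>M\<^esub>" "y j = \<zero>\<^bsub>J\<^esub>" using x(2) by simp_all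
    have "u j j \<odot>\<^bsub>M\<^esub> m = \<zero>\<^bsub>M\<^esub>" using *(1) j(2) WD(1)[OF xW] unfolding monic_at_def by blast
    then show "u j j \<odot>\<^bsub>?W\<^esub> x = \<zero>\<^bsub>?W\<^esub>" using uW[OF xW v(2)] my *(2) by (auto simp: fun_eq_iff)
  qed
  obtain M' r where M': "M' \<in> fg_mods T" "mod_iso T ?W M' r" using fg_rep[OF fW] by metis
  have lM': "left_module T M'" using M'(1) by auto
  obtain r' where r': "mod_iso T M' ?W r'" using mod_iso_inv[OF M'(2) lW] by metis
  note tr = monic_at_mono[OF mod_iso_mono[OF r'] lM' lW]
  show ?thesis
    using M'(1) lifts_rep[OF l r' lM' lW] tr mono_i mono_j by (intro exI[of _ M'] exI[of _ "\<lambda>x. fst (r' x)"]) blast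
qed

text \<open>Here \<open>W\<close> is the pullback of \<open>M\<close> and of the first \<open>k\<close> rows of \<open>col Y\<close> over the first \<open>k\<close> rows of \<open>col N\<close>,
  for an approximation \<open>p : Y \<rightarrow> N\<close> of the \<open>k\<close>-th cokernel \<open>N\<close> of \<open>M\<close>; its \<open>k\<close>-th cokernel is \<open>Y\<close>.\<close>

lemma approx_cok_step:
  assumes X: "resolving A \<X>" and cf: "contravariantly_finite A \<X>" and M: "M \<in> fg_mods T" and k: "k \<in> {1..n}"
    and S: "\<And>U. U \<in> \<S> \<Longrightarrow> U \<in> fg_mods T \<and> cin \<X> k U"
  shows "\<exists>M' \<pi>. M' \<in> fg_mods T \<and> lifts \<S> M M' \<pi> \<and> cin \<X> k M' \<and> (\<forall>j\<in>{1..n}. monic_at j M \<longrightarrow> monic_at j M') \<and>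
    (\<forall>j\<in>{1..<k}. cin \<X> j M \<longrightarrow> cin \<X> j M')"
proof -
  note full = resolving_full[OF X]
  have fM: "fg_left_module T M" and lM: "left_module T M" using M by auto
  interpret M: left_module T M by (rule lM)
  obtain N q where N: "N \<in> fg_mods A" "cok k M N q" using cok_exists[OF fM] by metis
  have lN: "left_module A N" using N(1) by auto
  interpret N: left_module A N by (rule lN)
  note qh = cokD(2)[OF N(2)]
  have q0: "q \<zero>\<^bsub>M\<^esub> = \<zero>\<^bsub>N\<^esub>" using hom_zero[OF qh comp1_lm[OF lM] lN] by simp
  obtain Y p where ap: "right_approximation A \<X> Y N p"
    using cf N(1) unfolding contravariantly_finite_def right_minimal_approximation_def by metis
  have pe: "mod_epi A Y N p" using approx_epi[OF X ap N(1)] .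
  note ph = mod_epiD(1)[OF pe]
  have YX: "Y \<in> \<X>" using ap by (simp add: right_approximation_def)
  have fY: "Y \<in> fg_mods A" using YX full by (auto simp: full_subcategory_def)
  have lY: "left_module A Y" using fY by auto
  interpret Y: left_module A Y by (rule lY)
  have p0: "p \<zero>\<^bsub>Y\<^esub> = \<zero>\<^bsub>N\<^esub>" using hom_zero[OF ph lY lN] .
  have v11: "valid 1 1" using n2 by simp
  have qbig: "q (u 1 j \<odot>\<^bsub>M\<^esub> m) = \<zero>\<^bsub>N\<^esub>" if j: "k < j" "j \<le> n" and m: "m \<in> carrier M" for j m
  proof -
    have "u 1 j \<odot>\<^bsub>M\<^esub> m = u 1 (Suc k) \<odot>\<^bsub>M\<^esub> (u (Suc k) j \<odot>\<^bsub>M\<^esub> m)" using u_u[OF lM m, of 1 "Suc k" j] j by simp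
    then show ?thesis using cok_zero[OF N(2) lM act_closed[OF lM B.one_closed m]] by simp
  qed
  have lC: "left_module T (col Y)" using col_left_module[OF lY] .
  let ?P = "mod_sum M (col Y)"
  have lP: "left_module T ?P" using left_module_mod_sum[OF lM lC] .
  have fP: "fg_left_module T ?P" using fg_mod_sum[OF fM col_fg] fY by auto
  interpret P: left_module T ?P by (rule lP)
  define W where "W = {(m, y). m \<in> carrier M \<and> y \<in> carrier (col Y) \<and> (\<forall>i\<in>{1..k}. p (y i) = q (u 1 i \<odot>\<^bsub>M\<^esub> m)) \<and>
    (\<forall>i. i \<notin> {1..k} \<longrightarrow> y i = \<zero>\<^bsub>Y\<^esub>)}"
  have WI: "(m, y) \<in> W" if "m \<in> carrier M" "\<And>i. y i \<in> carrier Y" "\<And>i. i \<in> {1..k} \<Longrightarrow> p (y i) = q (u 1 i \<odot>\<^bsub>M\<^esub> m)"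
    "\<And>i. i \<notin> {1..k} \<Longrightarrow> y i = \<zero>\<^bsub>Y\<^esub>" for m y
    using that k unfolding W_def by auto
  have WD: "m \<in> carrier M" "y \<in> carrier (col Y)" "\<And>i. i \<in> {1..k} \<Longrightarrow> p (y i) = q (u 1 i \<odot>\<^bsub>M\<^esub> m)"
    "\<And>i. i \<notin> {1..k} \<Longrightarrow> y i = \<zero>\<^bsub>Y\<^esub>" "\<And>i. y i \<in> carrier Y" if "(m, y) \<in> W" for m y
    using that unfolding W_def by auto
  have W: "submod T ?P W"
  proof (rule T_submodI[OF lP])
    show "x \<in> carrier ?P" if "x \<in> W" for x using that unfolding W_def by auto
    show "\<zero>\<^bsub>?P\<^esub> \<in> W" using p0 q0 WI[of "\<zero>\<^bsub>M\<^esub>" "\<lambda>i. \<zero>\<^bsub>Y\<^esub>"] by simp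
  next
    fix x x' assume xx: "x \<in> W" "x' \<in> W"
    obtain m y m' y' where x: "x = (m, y)" "x' = (m', y')" by (cases x, cases x') auto
    note d = WD[OF xx(1)[unfolded x(1)]] and d' = WD[OF xx(2)[unfolded x(2)]]
    have "p (y i \<oplus>\<^bsub>Y\<^esub> y' i) = q (u 1 i \<odot>\<^bsub>M\<^esub> (m \<oplus>\<^bsub>M\<^esub> m'))" if "i \<in> {1..k}" for i
      using hom_add[OF ph d(5) d'(5), of i i] hom_add[OF qh u1_comp[OF lM d(1)] u1_comp[OF lM d'(1)], of i i]
        d(1) d'(1) d(3)[OF that] d'(3)[OF that] by (simp add: M.smult_r_distr)
    then show "x \<oplus>\<^bsub>?P\<^esub> x' \<in> W" unfolding x using d(1,4,5) d'(1,4,5) by (auto intro!: WI)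
  next
    fix i j a x assume v: "valid i j" and a: "a \<in> carrier A" and xx: "x \<in> W"
    obtain m y where x: "x = (m, y)" by (cases x)
    note d = WD[OF xx[unfolded x]]
    have "p (if r = i then a \<odot>\<^bsub>Y\<^esub> y j else \<zero>\<^bsub>Y\<^esub>) = q (u 1 r \<odot>\<^bsub>M\<^esub> (E i j a \<odot>\<^bsub>M\<^esub> m))" if r: "r \<in> {1..k}" for r
    proof (cases "r = i")
      case True
      have "u 1 r \<odot>\<^bsub>M\<^esub> (E i j a \<odot>\<^bsub>M\<^esub> m) = E 1 1 a \<odot>\<^bsub>M\<^esub> (u 1 j \<odot>\<^bsub>M\<^esub> m)"
        using E_act[OF lM _ v B.one_closed a d(1), of 1 r] E_u[OF lM d(1), of 1 j a] True r k a v by simp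
      then have 1: "q (u 1 r \<odot>\<^bsub>M\<^esub> (E i j a \<odot>\<^bsub>M\<^esub> m)) = a \<odot>\<^bsub>N\<^esub> q (u 1 j \<odot>\<^bsub>M\<^esub> m)"
        using hom_smult[OF qh a u1_comp[OF lM d(1)], of j] by simp
      have "p (y j) = q (u 1 j \<odot>\<^bsub>M\<^esub> m)"
      proof (cases "j \<le> k")
        case True then show ?thesis using d(3) v by simp
      next
        case False
        then show ?thesis using d(4)[of j] p0 qbig[of j m] v d(1) by simp
      qed
      then show ?thesis using 1 hom_smult[OF ph a d(5), of j] True by simp
    next
      case False
      then have "u 1 r \<odot>\<^bsub>M\<^esub> (E i j a \<odot>\<^bsub>M\<^esub> m) = \<zero>\<^bsub>M\<^esub>"
        using E_act[OF lM _ v B.one_closed a d(1), of 1 r] r k by simp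
      then show ?thesis using q0 p0 False by simp
    qed
    moreover have "(if r = i then a \<odot>\<^bsub>Y\<^esub> y j else \<zero>\<^bsub>Y\<^esub>) = \<zero>\<^bsub>Y\<^esub>" if r: "r \<notin> {1..k}" for r
      using d(4)[of j] a r v by (cases "r = i") auto
    ultimately show "E i j a \<odot>\<^bsub>?P\<^esub> x \<in> W"
      unfolding x(1) sum_E[OF lY v a d(2)] using act_closed[OF lM a d(1)] d(5) a Y.smult_closed
      by (intro WI) auto
  qed
  let ?W = "sub_module ?P W"
  have fW: "fg_left_module T ?W" using T.fg_sub[OF fP W] .
  have lW: "left_module T ?W" using fW by auto
  have uW: "u i j \<odot>\<^bsub>?W\<^esub> (m, y) = (u i j \<odot>\<^bsub>M\<^esub> m, \<lambda>r. if r = i then y j else \<zero>\<^bsub>Y\<^esub>)" if "(m, y) \<in> W" "valid i j" for i j m y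
    using sum_E[OF lY that(2) B.one_closed WD(2)[OF that(1)], of M m] WD(5)[OF that(1)] by (auto simp: fun_eq_iff Y.smult_one)
  have EW: "E 1 1 a \<odot>\<^bsub>?W\<^esub> (m, y) = (E 1 1 a \<odot>\<^bsub>M\<^esub> m, \<lambda>r. if r = 1 then a \<odot>\<^bsub>Y\<^esub> y 1 else \<zero>\<^bsub>Y\<^esub>)"
    if "(m, y) \<in> W" "a \<in> carrier A" for a m y
    using sum_E[OF lY v11 that(2) WD(2)[OF that(1)], of M m] by simp
  have fst: "fst \<in> mod_hom T ?W M" using hom_comp[OF sub_incl fst_hom] W by (auto simp: submod_def)
  \<comment> \<open>The column is concentrated in row 1, so the first component of \<open>W\<close>
    is the pullback of the first component of \<open>M\<close> and \<open>Y\<close> over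
    \<open>N\<close>.\<close>
  have comp1W: "m \<in> carrier (comp 1 M)" "y = (\<lambda>r. if r = 1 then y 1 else \<zero>\<^bsub>Y\<^esub>)" if "(m, y) \<in> carrier (comp 1 ?W)" for m y
    using that uW[of m y 1 1] v11 WD(1)[of m y] by auto
  have comp1WI: "(m, \<lambda>r. if r = 1 then y else \<zero>\<^bsub>Y\<^esub>) \<in> carrier (comp 1 ?W)"
    if "m \<in> carrier (comp 1 M)" "y \<in> carrier Y" "p y = q m" for m y
  proof -
    have "(m, \<lambda>r. if r = 1 then y else \<zero>\<^bsub>Y\<^esub>) \<in> W"
    proof (rule WI)
      fix i assume i: "i \<in> {1..k}"
      have m: "m \<in> carrier M" "u 1 1 \<odot>\<^bsub>M\<^esub> m = m" using that(1) by auto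
      have "u 1 i \<odot>\<^bsub>M\<^esub> m = (if i = 1 then m else \<zero>\<^bsub>M\<^esub>)"
        using E_act[OF lM _ v11 B.one_closed B.one_closed m(1), of 1 i] m(2) i k by auto
      then show "p (if i = 1 then y else \<zero>\<^bsub>Y\<^esub>) = q (u 1 i \<odot>\<^bsub>M\<^esub> m)" using that(3) p0 q0 by simp
    qed (use that k in auto)
    then show ?thesis using uW[of m _ 1 1] v11 that by auto
  qed
  have l: "lifts \<S> M ?W fst" unfolding lifts_def
  proof (intro conjI ballI)
    show "mod_epi T ?W M fst"
    proof (rule mod_epiI[OF fst])
      fix m assume m: "m \<in> carrier M"
      have "\<exists>y. y \<in> carrier Y \<and> p y = q (u 1 i \<odot>\<^bsub>M\<^esub> m)" for i
        using mod_epi_surj[OF pe hom_closed[OF qh u1_comp[OF lM m]]] by metis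
      then obtain y where y: "\<And>i. y i \<in> carrier Y \<and> p (y i) = q (u 1 i \<odot>\<^bsub>M\<^esub> m)" by metis
      have "(m, \<lambda>i. if i \<in> {1..k} then y i else \<zero>\<^bsub>Y\<^esub>) \<in> W" using m y by (intro WI) auto
      then show "\<exists>x\<in>carrier ?W. m = fst x" by force
    qed
    fix U f assume U: "U \<in> \<S>" and f: "f \<in> mod_hom T U M"
    have fU: "fg_left_module T U" and cU: "cin \<X> k U" using S[OF U] by auto
    then have lU: "left_module T U" by auto
    obtain Z z where Z: "Z \<in> \<X>" "cok k U Z z" using cU unfolding cin_def by blast
    have lZ: "left_module A Z" using Z(1) full by (auto simp: full_subcategory_def)
    obtain f' where f': "f' \<in> mod_hom A Z N" "\<forall>x\<in>carrier (comp 1 U). f' (z x) = q (f x)"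
      using cok_map[OF f lU lM Z(2) N(2) lZ lN] by (rule bexE)
    obtain g where g: "g \<in> mod_hom A Z Y" "\<forall>x\<in>carrier Z. p (g x) = f' x"
      using approx_lift[OF full ap in_cat_self[OF full Z(1)] f'(1)] by (rule bexE)
    have gz: "(\<lambda>x. g (z x)) \<in> mod_hom A (comp 1 U) Y" using hom_comp[OF cokD(2)[OF Z(2)] g(1)] .
    let ?h = "\<lambda>x i. if i \<in> {1..k} then g (z (u 1 i \<odot>\<^bsub>U\<^esub> x)) else \<zero>\<^bsub>Y\<^esub>"
    have kn: "k \<le> n" using k by simp
    have h: "?h \<in> mod_hom T U (col Y)"
      by (rule col_hom[OF lU lY gz kn]) (simp add: cok_zero[OF Z(2) lU, simplified] hom_zero[OF g(1) lZ lY])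
    have in_W: "(f x, ?h x) \<in> W" if x: "x \<in> carrier U" for x
    proof (rule WI)
      show "f x \<in> carrier M" using hom_closed[OF f x] .
      show "?h x i \<in> carrier Y" for i using hom_closed[OF gz u1_comp[OF lU x]] by simp
      show "p (?h x i) = q (u 1 i \<odot>\<^bsub>M\<^esub> f x)" if "i \<in> {1..k}" for i
        using that f'(2) g(2) hom_closed[OF cokD(2)[OF Z(2)] u1_comp[OF lU x]] u1_comp[OF lU x] u_hom_zero[OF f x, of 1 i] by simp
    qed auto
    show "\<exists>f'\<in>mod_hom T U ?W. \<forall>x\<in>carrier U. fst (f' x) = f x"
    proof (intro bexI[of _ "\<lambda>x. (f x, ?h x)"] ballI)
      show "(\<lambda>x. (f x, ?h x)) \<in> mod_hom T U ?W"
        by (rule pair_hom[OF f h in_W])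
    qed simp
  qed
  have mono_j: "monic_at j ?W" if j: "j \<in> {1..n}" "monic_at j M" for j
    unfolding monic_at_def
  proof (intro ballI impI)
    fix x assume x: "x \<in> carrier ?W" "u 1 j \<odot>\<^bsub>?W\<^esub> x = \<zero>\<^bsub>?W\<^esub>"
    obtain m y where my: "x = (m, y)" by (cases x)
    have xW: "(m, y) \<in> W" using x(1) my by simp
    have v: "valid 1 j" "valid j j" using j by auto
    have "fst (u 1 j \<odot>\<^bsub>?W\<^esub> x) = u 1 j \<odot>\<^bsub>M\<^esub> m" "snd (u 1 j \<odot>\<^bsub>?W\<^esub> x) 1 = y j"
      using uW[OF xW v(1)] my by simp_all
    then have *: "u 1 j \<odot>\<^bsub>M\<^esub> m = \<zero>\<^bsub>M\<^esub>" "y j = \<zero>\<^bsub>Y\<^esub>" using x(2) by simp_all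
    have "u j j \<odot>\<^bsub>M\<^esub> m = \<zero>\<^bsub>M\<^esub>" using *(1) j(2) WD(1)[OF xW] unfolding monic_at_def by blast
    then show "u j j \<odot>\<^bsub>?W\<^esub> x = \<zero>\<^bsub>?W\<^esub>" using uW[OF xW v(2)] my *(2) by (auto simp: fun_eq_iff)
  qed
  have u_inv: "u 1 (Suc j) \<odot>\<^bsub>?W\<^esub> x = \<zero>\<^bsub>?W\<^esub>" if "x \<in> W" "n < Suc j" for x j using act_invalid[OF lW, of x 1 "Suc j"] that by simp
  \<comment> \<open>The projection of that pullback to \<open>Y\<close> is onto, as \<open>q\<close>
    is. Its kernel is the kernel of \<open>q\<close>, that is, the image from place
    \<open>k + 1\<close> in \<open>M\<close>; this image is the same in \<open>W\<close>, since its
    columns vanish beyond row \<open>k\<close>.\<close>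
  have ck: "cok k ?W Y (\<lambda>x. snd x 1)"
    unfolding cok_def
  proof (intro conjI ballI)
    show "mod_epi A (comp 1 ?W) Y (\<lambda>x. snd x 1)"
    proof (rule mod_epiI)
      show "(\<lambda>x. snd x 1) \<in> mod_hom A (comp 1 ?W) Y"
      proof (rule mod_homI)
        show "snd x 1 \<in> carrier Y" if "x \<in> carrier (comp 1 ?W)" for x using that WD(5)[of "fst x" "snd x" 1] by simp
        show "snd (x \<oplus>\<^bsub>comp 1 ?W\<^esub> x') 1 = snd x 1 \<oplus>\<^bsub>Y\<^esub> snd x' 1" for x x' by (cases x, cases x') simp
        show "snd (a \<odot>\<^bsub>comp 1 ?W\<^esub> x) 1 = a \<odot>\<^bsub>Y\<^esub> snd x 1" if "a \<in> carrier A" "x \<in> carrier (comp 1 ?W)" for a x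
          using that EW[of "fst x" "snd x" a] by simp
      qed
      fix y assume y: "y \<in> carrier Y"
      obtain m where m: "m \<in> carrier (comp 1 M)" "q m = p y" using mod_epi_surj[OF cokD(1)[OF N(2)] hom_closed[OF ph y]] by metis
      show "\<exists>x\<in>carrier (comp 1 ?W). y = snd x 1"
        by (rule bexI[OF _ comp1WI[OF m(1) y m(2)[symmetric]]]) simp
    qed
    fix x assume x: "x \<in> carrier (comp 1 ?W)"
    obtain m y where my: "x = (m, y)" by (cases x)
    have xW: "(m, y) \<in> W" using x my by simp
    note c1 = comp1W[OF x[unfolded my]]
    show "snd x 1 = \<zero>\<^bsub>Y\<^esub> \<longleftrightarrow> (\<exists>y\<in>carrier ?W. x = u 1 (Suc k) \<odot>\<^bsub>?W\<^esub> y)"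
    proof
      assume "snd x 1 = \<zero>\<^bsub>Y\<^esub>"
      then have y1: "y 1 = \<zero>\<^bsub>Y\<^esub>" using my by simp
      then have y0: "y = (\<lambda>r. \<zero>\<^bsub>Y\<^esub>)" using c1(2) by (metis (mono_tags, lifting))
      have "q m = \<zero>\<^bsub>N\<^esub>" using WD(3)[OF xW, of 1] k y1 p0 c1(1) by simp
      then obtain m' where m': "m' \<in> carrier M" "m = u 1 (Suc k) \<odot>\<^bsub>M\<^esub> m'" using cokD(3)[OF N(2) c1(1)] by blast
      show "\<exists>y\<in>carrier ?W. x = u 1 (Suc k) \<odot>\<^bsub>?W\<^esub> y"
      proof (cases "Suc k \<le> n")
        case True
        let ?m = "u (Suc k) (Suc k) \<odot>\<^bsub>M\<^esub> m'"
        have in_W: "(?m, \<lambda>r. \<zero>\<^bsub>Y\<^esub>) \<in> W"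
        proof (rule WI)
          fix i assume i: "i \<in> {1..k}"
          have "u 1 i \<odot>\<^bsub>M\<^esub> ?m = \<zero>\<^bsub>M\<^esub>"
            using E_act[OF lM _ _ B.one_closed B.one_closed m'(1), of 1 i "Suc k" "Suc k"] True i by auto
          then show "p \<zero>\<^bsub>Y\<^esub> = q (u 1 i \<odot>\<^bsub>M\<^esub> ?m)" using p0 q0 by simp
        qed (use act_closed[OF lM B.one_closed m'(1)] in auto)
        have "u 1 (Suc k) \<odot>\<^bsub>?W\<^esub> (?m, \<lambda>r. \<zero>\<^bsub>Y\<^esub>) = x"
          using uW[OF in_W, of 1 "Suc k"] True u_u[OF lM m'(1), of 1 "Suc k" "Suc k"] m'(2) my y0 by simp
        then show ?thesis using in_W by force
      next
        case False
        then have "m = \<zero>\<^bsub>M\<^esub>" using m' act_invalid[OF lM m'(1)] by simp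
        then have "x = \<zero>\<^bsub>?W\<^esub>" using my y0 by simp
        then show ?thesis using u_inv[of x k] xW my False by (intro bexI[of _ x]) auto
      qed
    next
      assume "\<exists>y\<in>carrier ?W. x = u 1 (Suc k) \<odot>\<^bsub>?W\<^esub> y"
      then obtain m' y' where xx: "(m', y') \<in> W" "x = u 1 (Suc k) \<odot>\<^bsub>?W\<^esub> (m', y')" by auto
      show "snd x 1 = \<zero>\<^bsub>Y\<^esub>"
      proof (cases "Suc k \<le> n")
        case True
        then show ?thesis using xx(2) uW[OF xx(1), of 1 "Suc k"] WD(4)[OF xx(1), of "Suc k"] by simp
      next
        case False
        then show ?thesis using xx u_inv[OF xx(1), of k] by simp
      qed
    qed
  qed
  \<comment> \<open>For \<open>j < k\<close> the place \<open>j + 1\<close> of \<open>W\<close> is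
    again a pullback with \<open>Y\<close>, so the same summand from the kernel of \<open>p\<close>
    is added in the places 1 and \<open>j + 1\<close>, and the quotient does not change.\<close>
  have cj: "cin \<X> j ?W" if j: "j \<in> {1..<k}" and c: "cin \<X> j M" for j
  proof -
    obtain V w where V: "V \<in> \<X>" "cok j M V w" using c unfolding cin_def by blast
    have lV: "left_module A V" using V(1) full by (auto simp: full_subcategory_def)
    have sj: "valid 1 (Suc j)" "valid (Suc j) (Suc j)" "Suc j \<in> {1..k}" using j k by auto
    have "cok j ?W V (\<lambda>x. w (fst x))"
      unfolding cok_def
    proof (intro conjI ballI)
      have "mod_epi T ?W M fst" using l by (simp add: lifts_def)
      from mod_epi_comp[OF comp_epi[OF this lW lM, of 1] cokD(1)[OF V(2)]]
      show "mod_epi A (comp 1 ?W) V (\<lambda>x. w (fst x))" using n2 by simp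
      fix x assume x: "x \<in> carrier (comp 1 ?W)"
      obtain m y where my: "x = (m, y)" by (cases x)
      have xW: "(m, y) \<in> W" using x my by simp
      note c1 = comp1W[OF x[unfolded my]]
      show "w (fst x) = \<zero>\<^bsub>V\<^esub> \<longleftrightarrow> (\<exists>y\<in>carrier ?W. x = u 1 (Suc j) \<odot>\<^bsub>?W\<^esub> y)"
      proof
        assume "w (fst x) = \<zero>\<^bsub>V\<^esub>"
        then obtain m' where m': "m' \<in> carrier M" "m = u 1 (Suc j) \<odot>\<^bsub>M\<^esub> m'" using cokD(3)[OF V(2) c1(1)] my by auto
        let ?m = "u (Suc j) (Suc j) \<odot>\<^bsub>M\<^esub> m'" and ?y = "\<lambda>r. if r = Suc j then y 1 else \<zero>\<^bsub>Y\<^esub>"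
        have mm: "u 1 (Suc j) \<odot>\<^bsub>M\<^esub> ?m = m" using u_u[OF lM m'(1) sj(1), of "Suc j"] m'(2) by simp
        have in_W: "(?m, ?y) \<in> W"
        proof (rule WI)
          show "?m \<in> carrier M" using act_closed[OF lM B.one_closed m'(1)] .
          show "?y i \<in> carrier Y" for i using WD(5)[OF xW] by simp
          show "?y i = \<zero>\<^bsub>Y\<^esub>" if "i \<notin> {1..k}" for i using that sj(3) by auto
          fix i assume i: "i \<in> {1..k}"
          show "p (?y i) = q (u 1 i \<odot>\<^bsub>M\<^esub> ?m)"
          proof (cases "i = Suc j")
            case True
            have "p (y 1) = q m" using WD(3)[OF xW, of 1] k c1(1) by simp
            then show ?thesis using mm True by simp
          next
            case False
            then have "u 1 i \<odot>\<^bsub>M\<^esub> ?m = \<zero>\<^bsub>M\<^esub>"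
              using E_act[OF lM _ sj(2) B.one_closed B.one_closed m'(1), of 1 i] i k by simp
            then show ?thesis using False p0 q0 by simp
          qed
        qed
        have "u 1 (Suc j) \<odot>\<^bsub>?W\<^esub> (?m, ?y) = x" using uW[OF in_W sj(1)] mm my c1(2) by simp
        then show "\<exists>y\<in>carrier ?W. x = u 1 (Suc j) \<odot>\<^bsub>?W\<^esub> y" using in_W by force
      next
        assume "\<exists>y\<in>carrier ?W. x = u 1 (Suc j) \<odot>\<^bsub>?W\<^esub> y"
        then obtain m' y' where xx: "(m', y') \<in> W" "x = u 1 (Suc j) \<odot>\<^bsub>?W\<^esub> (m', y')" by auto
        then show "w (fst x) = \<zero>\<^bsub>V\<^esub>" using uW[OF xx(1) sj(1)] cok_zero[OF V(2) lM WD(1)[OF xx(1)]] by simp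
      qed
    qed
    then show ?thesis using V(1) unfolding cin_def by blast
  qed
  obtain M' r where M': "M' \<in> fg_mods T" "mod_iso T ?W M' r" using fg_rep[OF fW] by metis
  have lM': "left_module T M'" using M'(1) by auto
  obtain r' where r': "mod_iso T M' ?W r'" using mod_iso_inv[OF M'(2) lW] by metis
  note tr = monic_at_mono[OF mod_iso_mono[OF r'] lM' lW]
  have "cin \<X> k M'" using cin_iso[OF r' lM' lW] ck YX unfolding cin_def by blast
  moreover have "cin \<X> j M'" if "j \<in> {1..<k}" "cin \<X> j M" for j using cin_iso[OF r' lM' lW cj[OF that]] .
  ultimately show ?thesis
    using M'(1) lifts_rep[OF l r' lM' lW] tr mono_j by (intro exI[of _ M'] exI[of _ "\<lambda>x. fst (r' x)"]) blast
qed

text \<open>Each step keeps what was gained before: injectivity at all places, and the cokernels of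
  smaller index. For a larger index the cokernel is extended by the kernel of the approximation
  \<open>p\<close>, which is why the indices are treated in ascending order.\<close>

lemma S_approx:
  assumes X: "resolving A \<X>" and cf: "contravariantly_finite A \<X>" and M: "M \<in> fg_mods T"
  shows "\<exists>Y \<pi>. Y \<in> mono_rep_cat n A \<X> \<and> lifts (mono_rep_cat n A \<X>) M Y \<pi>"
proof -
  let ?S = "mono_rep_cat n A \<X>"
  have S: "U \<in> fg_mods T \<and> monic_at i U \<and> cin \<X> i U" if "U \<in> ?S" "i \<in> {1..n}" for U i
  proof -
    have U: "U \<in> fg_mods T" using that(1) by (simp add: mono_rep_cat_def)
    then show ?thesis using in_cat_self[OF S_full that(1)] in_S_cok_iff[OF X, of U] that(2) by auto
  qed
  have "\<exists>M' \<pi>. M' \<in> fg_mods T \<and> lifts ?S M M' \<pi> \<and> (\<forall>i\<in>{1..j}. monic_at i M')" if "j \<le> n" for j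
    using that
  proof (induction j)
    case 0
    then show ?case using M lifts_id by (intro exI[of _ M] exI[of _ "\<lambda>x. x"]) simp
  next
    case (Suc j)
    then obtain M1 \<pi>1 where M1: "M1 \<in> fg_mods T" "lifts ?S M M1 \<pi>1" "\<forall>i\<in>{1..j}. monic_at i M1" by auto
    have j: "Suc j \<in> {1..n}" using Suc.prems by simp
    obtain M2 \<pi>2 where M2: "M2 \<in> fg_mods T" "lifts ?S M1 M2 \<pi>2" "monic_at (Suc j) M2"
      "\<forall>i\<in>{1..n}. monic_at i M1 \<longrightarrow> monic_at i M2"
      using make_monic_step[OF M1(1) j, of ?S] S j by metis
    have "monic_at i M2" if "i \<in> {1..Suc j}" for i
      using that M1(3) M2(3,4) Suc.prems by (cases "i = Suc j") auto
    then show ?case using M2(1) lifts_comp[OF M1(2) M2(2)] by blast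
  qed
  then obtain M1 \<pi>1 where M1: "M1 \<in> fg_mods T" "lifts ?S M M1 \<pi>1" "\<forall>i\<in>{1..n}. monic_at i M1" by blast
  have "\<exists>M' \<pi>. M' \<in> fg_mods T \<and> lifts ?S M M' \<pi> \<and> (\<forall>i\<in>{1..n}. monic_at i M') \<and> (\<forall>i\<in>{1..k}. cin \<X> i M')" if "k \<le> n" for k
    using that
  proof (induction k)
    case 0
    then show ?case using M1 by auto
  next
    case (Suc k)
    then obtain M2 \<pi>2 where M2: "M2 \<in> fg_mods T" "lifts ?S M M2 \<pi>2" "\<forall>i\<in>{1..n}. monic_at i M2" "\<forall>i\<in>{1..k}. cin \<X> i M2" by auto
    have k: "Suc k \<in> {1..n}" using Suc.prems by simp
    obtain M3 \<pi>3 where M3: "M3 \<in> fg_mods T" "lifts ?S M2 M3 \<pi>3" "cin \<X> (Suc k) M3"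
      "\<forall>i\<in>{1..n}. monic_at i M2 \<longrightarrow> monic_at i M3" "\<forall>i\<in>{1..<Suc k}. cin \<X> i M2 \<longrightarrow> cin \<X> i M3"
      using approx_cok_step[OF X cf M2(1) k, of ?S] S k by metis
    have "cin \<X> i M3" if "i \<in> {1..Suc k}" for i
      using that M2(4) M3(3,5) by (cases "i = Suc k") auto
    then show ?case using M3(1,4) M2(3) lifts_comp[OF M2(2) M3(2)] by blast
  qed
  then obtain M2 \<pi>2 where M2: "M2 \<in> fg_mods T" "lifts ?S M M2 \<pi>2" "\<forall>i\<in>{1..n}. monic_at i M2" "\<forall>i\<in>{1..n}. cin \<X> i M2" by blast
  have "in_cat T ?S M2" using in_S_cok_iff[OF X, of M2] M2 by auto
  then show ?thesis using in_cat_mem[OF S_full M2(1)] M2(2) by blast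
qed

section \<open>From the subcategory to its monic representations\<close>

lemma S_resolving:
  assumes X: "resolving A \<X>" and cf: "contravariantly_finite A \<X>"
  shows "resolving T (mono_rep_cat n A \<X>)"
  unfolding resolving_def
proof (intro conjI allI ballI impI)
  let ?S = "mono_rep_cat n A \<X>"
  show "full_subcategory T ?S" by (rule S_full)
  have fS: "K \<in> fg_mods T" "in_cat T ?S K" if "K \<in> ?S" for K
    using that in_cat_self[OF S_full that] by (auto simp: mono_rep_cat_def)
  note mem = in_cat_mem[OF S_full]
  \<comment> \<open>The approximation of a projective splits, and its construction did not
    presuppose that projectives belong to S_n.\<close>
  show "P \<in> ?S" if P: "projective T P" for P
  proof -
    have fP: "P \<in> fg_mods T" using P by (simp add: projective_def)
    obtain Y \<pi> where Y: "Y \<in> ?S" "lifts ?S P Y \<pi>" using S_approx[OF X cf fP] by metis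
    have pe: "mod_epi T Y P \<pi>" using Y(2) by (simp add: lifts_def)
    have "\<exists>s\<in>mod_hom T P Y. \<forall>x\<in>carrier P. \<pi> (s x) = x"
      using proj_lift[OF P pe _ _ hom_id] fS(1)[OF Y(1)] fP by blast
    then obtain s where s: "s \<in> mod_hom T P Y" "\<forall>x\<in>carrier P. \<pi> (s x) = x" by (rule bexE)
    have "in_cat T ?S P" using S_retract[OF X fS(2)[OF Y(1)] _ s(1) mod_epiD(1)[OF pe]] s(2) fP by auto
    then show ?thesis using mem[OF fP] by blast
  qed
  show "L \<in> ?S" if "K \<in> ?S" "L \<in> fg_mods T" "M \<in> ?S" "short_exact T K L M f g" for K L M f g
    using S_ext[OF X that(4) _ fS(2)[OF that(1)] fS(2)[OF that(3)]] mem[OF that(2)] that(2) by blast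
  show "K \<in> ?S" if "K \<in> fg_mods T" "L \<in> ?S" "M \<in> ?S" "short_exact T K L M f g" for K L M f g
    using S_ker[OF X that(4) _ fS(2)[OF that(2)] fS(2)[OF that(3)]] mem[OF that(1)] that(1) by blast
  show "K \<in> ?S" if K: "K \<in> fg_mods T" and N: "N \<in> fg_mods T" and L: "L \<in> ?S" and i: "isomorphic_mods T L (mod_sum K N)" for K N L
  proof -
    have lm: "left_module T K" "left_module T N" "left_module T L" using K N fS(1)[OF L] by auto
    interpret N: left_module T N by (rule lm(2))
    obtain h where h: "mod_iso T L (mod_sum K N) h" using i by (auto simp: isomorphic_mods_def)
    obtain h' where h': "mod_iso T (mod_sum K N) L h'" "\<And>y. y \<in> carrier (mod_sum K N) \<Longrightarrow> h (h' y) = y"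
      using mod_iso_inv[OF h lm(3)] by metis
    have inl: "(\<lambda>x. (x, \<zero>\<^bsub>N\<^esub>)) \<in> mod_hom T K (mod_sum K N)" by (auto intro!: mod_homI)
    have "in_cat T ?S K"
    proof (rule S_retract[OF X fS(2)[OF L] fg_modsD[OF K]])
      show "(\<lambda>x. h' (x, \<zero>\<^bsub>N\<^esub>)) \<in> mod_hom T K L" using hom_comp[OF inl mod_isoD(1)[OF h'(1)]] .
      show "(\<lambda>x. fst (h x)) \<in> mod_hom T L K" using hom_comp[OF mod_isoD(1)[OF h] fst_hom] .
      show "fst (h (h' (x, \<zero>\<^bsub>N\<^esub>))) = x" if "x \<in> carrier K" for x using h'(2)[of "(x, \<zero>\<^bsub>N\<^esub>)"] that by simp
    qed
    then show ?thesis using mem[OF K] by blast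
  qed
qed

lemma S_contravariantly_finite:
  assumes X: "resolving A \<X>" and cf: "contravariantly_finite A \<X>"
  shows "contravariantly_finite T (mono_rep_cat n A \<X>)"
  unfolding contravariantly_finite_def
proof
  fix M assume M: "M \<in> fg_mods T"
  obtain Y \<pi> where Y: "Y \<in> mono_rep_cat n A \<X>" "lifts (mono_rep_cat n A \<X>) M Y \<pi>" using S_approx[OF X cf M] by metis
  then have "right_approximation T (mono_rep_cat n A \<X>) Y M \<pi>"
    unfolding right_approximation_def lifts_def mod_epi_def by simp
  then show "\<exists>Y f. right_minimal_approximation T (mono_rep_cat n A \<X>) Y M f"
    by (rule T.minimal_approximation[OF S_resolving[OF X cf] _ M])
qed

text \<open>The kernel of an approximation inherits monic composites. \<open>cok_exact\<close>
  presents each of its cokernels as a kernel of a map from an object of the subcategory, and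
  \<open>dim_shift\<close> lowers all bounds by one.\<close>

lemma S_dim:
  assumes X: "resolving A \<X>" and cf: "contravariantly_finite A \<X>"
  shows "M \<in> fg_mods T \<Longrightarrow> (\<forall>i\<in>{1..n}. monic_at i M) \<Longrightarrow> (\<forall>k\<in>{1..n}. cin (dimcat A \<X> d) k M) \<Longrightarrow>
    M \<in> dimcat T (mono_rep_cat n A \<X>) d"
proof (induction d arbitrary: M)
  case 0
  then have "in_cat T (mono_rep_cat n A \<X>) M" using in_S_cok_iff[OF X, of M] by auto
  then show ?case using in_cat_mem[OF S_full 0(1)] by simp
next
  case (Suc d)
  note full = resolving_full[OF X]
  let ?S = "mono_rep_cat n A \<X>"
  obtain Y \<pi> where Y: "Y \<in> ?S" "lifts ?S M Y \<pi>" using S_approx[OF X cf Suc.prems(1)] by metis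
  have pe: "mod_epi T Y M \<pi>" using Y(2) by (simp add: lifts_def)
  have fY: "Y \<in> fg_mods T" using Y(1) by (simp add: mono_rep_cat_def)
  have cY: "\<forall>i\<in>{1..n}. monic_at i Y" "\<forall>k\<in>{1..n}. cin \<X> k Y"
    using in_cat_self[OF S_full Y(1)] in_S_cok_iff[OF X, of Y] fY by auto
  have lY: "left_module T Y" and lM: "left_module T M" using fY Suc.prems(1) by auto
  let ?K = "sub_module Y {x \<in> carrier Y. \<pi> x = \<zero>\<^bsub>M\<^esub>}"
  note e = kernel_short_exact[OF pe lY lM]
  have fK: "?K \<in> fg_mods T" using T.fg_sub[OF _ submod_kernel[OF mod_epiD(1)[OF pe] lY lM]] fY by (auto simp: fg_mods_def)
  have lK: "left_module T ?K" using fK by (rule fg_mods_left_module)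
  have "?K \<in> dimcat T ?S d"
  proof (rule Suc.IH[OF fK])
    show "\<forall>i\<in>{1..n}. monic_at i ?K" using monic_at_mono[OF short_exactD(1)[OF e] lK lY] cY(1) by blast
    show "\<forall>k\<in>{1..n}. cin (dimcat A \<X> d) k ?K"
    proof
      fix k assume k: "k \<in> {1..n}"
      obtain NY qY where NY: "NY \<in> \<X>" "cok k Y NY qY" using cY(2) k unfolding cin_def by blast
      obtain NM qM where NM: "NM \<in> dimcat A \<X> (Suc d)" "cok k M NM qM" using Suc.prems(3) k unfolding cin_def by blast
      obtain NK qK where NK: "NK \<in> fg_mods A" "cok k ?K NK qK"
        using cok_exists[OF fg_modsD[OF fK], of k] by (elim exE conjE)
      have "NY \<in> fg_mods A" "NM \<in> fg_mods A" using NY(1) NM(1) full by (auto simp: full_subcategory_def)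
      then have lN: "left_module A NK" "left_module A NY" "left_module A NM" using NK(1) by auto
      have mo: "monic_at (Suc k) M" if "Suc k \<le> n" using Suc.prems(2) that by simp
      obtain f' g' where "short_exact A NK NY NM f' g'" using cok_exact[OF e lK lY lM mo NK(2) NY(2) NM(2) lN] by blast
      then have "in_cat A (dimcat A \<X> (Suc d - 1)) NK"
        by (rule dim_shift[OF X in_cat_self[OF dimcat_full[OF full] NM(1)] in_cat_self[OF full NY(1)] _ lN(1)])
      then have "NK \<in> dimcat A \<X> d" using in_cat_mem[OF dimcat_full[OF full] NK(1)] by simp
      then show "cin (dimcat A \<X> d) k ?K" using NK(2) unfolding cin_def by blast
    qed
  qed
  then show ?case using dimcat_SucI[OF Suc.prems(1) Y(1) _ e] by blast
qed

lemma S_hat: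
  assumes X: "resolving A \<X>" and cf: "contravariantly_finite A \<X>" and hat: "resolution_hat A \<X> = fg_mods A"
  shows "resolution_hat T (mono_rep_cat n A \<X>) = fg_mods T"
proof
  show "resolution_hat T (mono_rep_cat n A \<X>) \<subseteq> fg_mods T" by (auto simp: resolution_hat_def)
  show "fg_mods T \<subseteq> resolution_hat T (mono_rep_cat n A \<X>)"
  proof
    fix M assume M: "M \<in> fg_mods T"
    note full = resolving_full[OF X]
    let ?S = "mono_rep_cat n A \<X>"
    obtain Y \<pi> where Y: "Y \<in> ?S" "lifts ?S M Y \<pi>" using S_approx[OF X cf M] by metis
    have pe: "mod_epi T Y M \<pi>" using Y(2) by (simp add: lifts_def)
    have fY: "Y \<in> fg_mods T" using Y(1) by (simp add: mono_rep_cat_def)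
    have cY: "\<forall>i\<in>{1..n}. monic_at i Y"
      using in_cat_self[OF S_full Y(1)] in_S_cok_iff[OF X, of Y] fY by auto
    have lY: "left_module T Y" and lM: "left_module T M" using fY M by auto
    let ?K = "sub_module Y {x \<in> carrier Y. \<pi> x = \<zero>\<^bsub>M\<^esub>}"
    note e = kernel_short_exact[OF pe lY lM]
    have fK: "?K \<in> fg_mods T" using T.fg_sub[OF _ submod_kernel[OF mod_epiD(1)[OF pe] lY lM]] fY by (auto simp: fg_mods_def)
    have lK: "left_module T ?K" using fK by (rule fg_mods_left_module)
    \<comment> \<open>\<open>M\<close> itself may have composites that are not monic; the kernel of
      its approximation embeds in a monic representation, so \<open>S_dim\<close> applies to it at
      the price of one more step.\<close>
    have mK: "\<forall>i\<in>{1..n}. monic_at i ?K" using monic_at_mono[OF short_exactD(1)[OF e] lK lY] cY by blast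
    have "\<exists>d. cin (dimcat A \<X> d) k ?K" for k
    proof -
      obtain N q where N: "N \<in> fg_mods A" "cok k ?K N q"
        using cok_exists[OF fg_modsD[OF fK], of k] by (elim exE conjE)
      then obtain d where "N \<in> dimcat A \<X> d" using hat resolution_hat_iff[OF full, of N] by auto
      then show ?thesis using N(2) unfolding cin_def by blast
    qed
    then have "\<forall>k. \<exists>d. cin (dimcat A \<X> d) k ?K" ..
    from choice[OF this] obtain d where d: "\<forall>k. cin (dimcat A \<X> (d k)) k ?K" ..
    \<comment> \<open>A common bound for the finitely many cokernels; \<open>dimcat_mono\<close>
      allows each individual bound to be raised to it.\<close>
    define D where "D = Max (d ` {1..n})"
    have "cin (dimcat A \<X> D) k ?K" if "k \<in> {1..n}" for k
    proof -
      have "d k \<le> D" using that by (simp add: D_def)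
      then show ?thesis using spec[OF d, of k] dimcat_mono[OF X, of "d k" D] unfolding cin_def by blast
    qed
    then have "?K \<in> dimcat T ?S D" using S_dim[OF X cf fK mK] by blast
    then have "M \<in> dimcat T ?S (Suc D)" using dimcat_SucI[OF M Y(1) _ e] by blast
    then show "M \<in> resolution_hat T ?S" using T.resolution_hat_iff[OF S_full] by blast
  qed
qed

end

section \<open>Recovering the subcategory from its monic representations\<close>

context tri begin

lemma F_corner: "left_module A M \<Longrightarrow> x \<in> carrier M \<Longrightarrow> a \<in> carrier A \<Longrightarrow> E 1 1 a \<odot>\<^bsub>F M\<^esub> x = a \<odot>\<^bsub>M\<^esub> x"
  using F_E[of M 1 1 x a] n2 by simp

lemma F_one: "left_module A M \<Longrightarrow> x \<in> carrier M \<Longrightarrow> u 1 1 \<odot>\<^bsub>F M\<^esub> x = x"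
  using F_corner[of M x "\<one>\<^bsub>A\<^esub>"] left_module.smult_one by (metis B.one_closed)

lemma F_off: "left_module A M \<Longrightarrow> x \<in> carrier M \<Longrightarrow> valid i j \<Longrightarrow> j \<noteq> 1 \<Longrightarrow> E i j a \<odot>\<^bsub>F M\<^esub> x = \<zero>\<^bsub>M\<^esub>"
  using F_E[of M i j x a] by simp

lemma F_comp1:
  assumes M: "left_module A M" shows "mod_iso A M (comp 1 (F M)) (\<lambda>x. x)"
proof (rule mod_isoI)
  show "(\<lambda>x. x) \<in> mod_hom A M (comp 1 (F M))"
  proof (rule mod_homI)
    show "x \<in> carrier (comp 1 (F M))" if "x \<in> carrier M" for x using F_one[OF M that] that unfolding comp_simps by simp
    show "a \<odot>\<^bsub>M\<^esub> x = a \<odot>\<^bsub>comp 1 (F M)\<^esub> x" if "a \<in> carrier A" "x \<in> carrier M" for a x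
      using F_corner[OF M that(2,1)] unfolding comp_simps by simp
  qed simp
qed auto

lemma F_comp_other:
  assumes M: "left_module A M" and i: "i \<in> {1..n}" "i \<noteq> 1" shows "carrier (comp i (F M)) = {\<zero>\<^bsub>M\<^esub>}"
proof -
  interpret M: left_module A M by fact
  have "u i i \<odot>\<^bsub>F M\<^esub> x = \<zero>\<^bsub>M\<^esub>" if "x \<in> carrier M" for x using F_off[OF M that, of i i] i by simp
  then show ?thesis by (auto simp del: F_simps(4))
qed

text \<open>On both sides a matrix unit with second index other than 1 acts as zero on the relevant
  elements, and the only remaining ones are the corner units, which act as scalars of
  \<open>A\<close>.\<close>

lemma F_hom_iff: 
  assumes M: "left_module A M" and N: "left_module T N"
  shows "k \<in> mod_hom T (F M) N \<longleftrightarrow> k \<in> mod_hom A M (comp 1 N)"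
proof
  interpret M: left_module A M by fact
  interpret N: left_module T N by fact
  have v11: "valid 1 1" using n2 by simp
  assume k: "k \<in> mod_hom T (F M) N"
  note kE = hom_smult[OF k E_carrier, unfolded F_simps(1)]
  show "k \<in> mod_hom A M (comp 1 N)"
  proof (rule mod_homI)
    fix x assume x: "x \<in> carrier M"
    have "u 1 1 \<odot>\<^bsub>N\<^esub> k x = k x" using kE[OF B.one_closed x, of 1 1] F_one[OF M x] by simp
    then show "k x \<in> carrier (comp 1 N)" using hom_closed[OF k] x unfolding comp_simps by simp
  next
    show "k (a \<odot>\<^bsub>M\<^esub> x) = a \<odot>\<^bsub>comp 1 N\<^esub> k x" if "a \<in> carrier A" "x \<in> carrier M" for a x
      using kE[OF that, of 1 1] F_corner[OF M that(2,1)] unfolding comp_simps by simp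
  qed (use hom_add[OF k] in simp)
next
  interpret M: left_module A M by fact
  interpret N: left_module T N by fact
  assume k: "k \<in> mod_hom A M (comp 1 N)"
  have kc: "k x \<in> carrier N" "u 1 1 \<odot>\<^bsub>N\<^esub> k x = k x" if "x \<in> carrier M" for x
    using hom_closed[OF k that] unfolding comp_simps by auto
  show "k \<in> mod_hom T (F M) N"
  proof (rule T_homI[OF F_left_module[OF M] N])
    fix i j a x assume v: "valid i j" and a: "a \<in> carrier A" and x': "x \<in> carrier (F M)"
    then have x: "x \<in> carrier M" by simp
    show "k (E i j a \<odot>\<^bsub>F M\<^esub> x) = E i j a \<odot>\<^bsub>N\<^esub> k x"
    proof (cases "j = 1")
      case True
      then have "i = 1" using v by simp
      then show ?thesis using True F_corner[OF M x a] hom_smult[OF k a x] unfolding comp_simps by simp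
    next
      case False
      have "E i j a \<odot>\<^bsub>N\<^esub> (u 1 1 \<odot>\<^bsub>N\<^esub> k x) = \<zero>\<^bsub>N\<^esub>"
        using E_act[OF N v _ a B.one_closed kc(1)[OF x], of 1 1] False n2 by simp
      then show ?thesis
        using kc(2)[OF x] F_off[OF M x v False] hom_zero[OF k M comp1_lm[OF N]] unfolding comp_simps by simp
    qed
  qed (use kc hom_add[OF k] in simp_all)
qed

lemma zero_modules_iso:
  assumes "left_module A Z" "left_module A Z'" "carrier Z = {\<zero>\<^bsub>Z\<^esub>}" "carrier Z' = {\<zero>\<^bsub>Z'\<^esub>}"
  shows "mod_iso A Z Z' (\<lambda>_. \<zero>\<^bsub>Z'\<^esub>)"
  using zero_hom[OF assms(2)] assms(3,4) by (intro mod_isoI) auto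

lemma F_in_S_D:
  assumes full: "full_subcategory A \<X>" and M: "fg_left_module A M" and S: "in_cat T (mono_rep_cat n A \<X>) (F M)"
  shows "in_cat A \<X> M"
proof -
  have lM: "left_module A M" using M by auto
  have "1 \<in> {1..n}" using n2 by simp
  then have "in_cat A \<X> (comp 1 (F M))" using S in_S_iff[OF full F_fg[OF M]] unfolding mono_rep_def by blast
  then show ?thesis using in_cat_iso'[OF _ F_comp1[OF lM] lM] by blast
qed

text \<open>All components of \<open>F M\<close> except the first vanish, hence also all cokernels
  except the first, which is \<open>M\<close>. The zero object \<open>Z\<close> is supplied from
  outside because \<open>\<X>\<close> is not assumed to be resolving here.\<close>

lemma F_in_S_I:
  assumes full: "full_subcategory A \<X>" and Z: "Z \<in> \<X>" "carrier Z = {\<zero>\<^bsub>Z\<^esub>}" and M: "in_cat A \<X> M"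
  shows "in_cat T (mono_rep_cat n A \<X>) (F M)"
proof -
  have fM: "fg_left_module A M" using in_cat_fg[OF full M] .
  have lM: "left_module A M" using fM by auto
  have fF: "fg_left_module T (F M)" using F_fg[OF fM] .
  have lF: "left_module T (F M)" using fF by auto
  interpret F: left_module T "F M" by (rule lF)
  have lZ: "left_module A Z" using Z(1) full by (auto simp: full_subcategory_def)
  have n1: "1 \<in> {1..n}" using n2 by simp
  have lc: "left_module A (comp i (F M))" if "i \<in> {1..n}" for i using comp_left_module[OF lF, of i] that by simp
  have z: "x = \<zero>\<^bsub>M\<^esub>" if "x \<in> carrier (comp i (F M))" "i \<in> {1..n}" "i \<noteq> 1" for i x
    using F_comp_other[OF lM that(2,3)] that(1) by blast
  have zc: "\<zero>\<^bsub>M\<^esub> \<in> carrier (comp i (F M))" if "i \<in> {1..n}" for i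
    using abelian_monoid.zero_closed[OF abelian_group.axioms(1)[OF left_module.axioms(2)[OF lc[OF that]]]] by simp
  have uz: "u i j \<odot>\<^bsub>F M\<^esub> \<zero>\<^bsub>M\<^esub> = \<zero>\<^bsub>M\<^esub>" for i j using F.smult_r_null[of "u i j"] by (metis B.one_closed E_carrier F_simps(2))
  obtain C h where C: "C \<in> \<X>" "left_module A C" "mod_iso A (comp 1 (F M)) C h"
    using in_cat_rep[OF full in_cat_iso[OF M F_comp1[OF lM] lc[OF n1]]] by metis
  have hz: "h x = \<zero>\<^bsub>C\<^esub> \<longleftrightarrow> x = \<zero>\<^bsub>M\<^esub>" if "x \<in> carrier (comp 1 (F M))" for x
    using that hom_inj_iff[OF mod_isoD(1)[OF C(3)] lc[OF n1] C(2)] mod_isoD(2)[OF C(3)]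
      hom_zero[OF mod_isoD(1)[OF C(3)] lc[OF n1] C(2)] by auto
  have "mono_rep \<X> (F M)"
    unfolding mono_rep_def
  proof (intro conjI ballI impI)
    fix i x assume "i \<in> {1..<n}" "x \<in> carrier (comp (Suc i) (F M))"
    then show "x = \<zero>\<^bsub>F M\<^esub>" using z[of x "Suc i"] by simp
  next
    fix i assume i: "i \<in> {1..n}"
    show "in_cat A \<X> (comp i (F M))"
    proof (cases "i = 1")
      case True
      then show ?thesis using in_cat_iso[OF M F_comp1[OF lM]] lc[OF n1] by simp
    next
      case False
      then have "carrier (comp i (F M)) = {\<zero>\<^bsub>comp i (F M)\<^esub>}" using F_comp_other[OF lM i] by simp
      then show ?thesis using in_cat_iso[OF in_cat_self[OF full Z(1)] zero_modules_iso[OF lZ lc[OF i] Z(2)] lc[OF i]] by blast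
    qed
  next
    fix i assume i: "i \<in> {1..<n}"
    have i': "i \<in> {1..n}" "Suc i \<in> {1..n}" "Suc i \<noteq> 1" using i by auto
    have R: "(\<exists>y\<in>carrier (comp (Suc i) (F M)). x = u i (Suc i) \<odot>\<^bsub>F M\<^esub> y) \<longleftrightarrow> x = \<zero>\<^bsub>M\<^esub>" for x
      unfolding F_comp_other[OF lM i'(2,3)] using uz by simp
    show "\<exists>C\<in>\<X>. \<exists>q. mod_epi A (comp i (F M)) C q \<and>
       (\<forall>x\<in>carrier (comp i (F M)). q x = \<zero>\<^bsub>C\<^esub> \<longleftrightarrow> (\<exists>y\<in>carrier (comp (Suc i) (F M)). x = u i (Suc i) \<odot>\<^bsub>F M\<^esub> y))"
      unfolding R
    proof (cases "i = 1")
      case True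
      show "\<exists>C\<in>\<X>. \<exists>q. mod_epi A (comp i (F M)) C q \<and> (\<forall>x\<in>carrier (comp i (F M)). q x = \<zero>\<^bsub>C\<^esub> \<longleftrightarrow> x = \<zero>\<^bsub>M\<^esub>)"
        unfolding True using mod_iso_epi[OF C(3)] hz by (intro bexI[OF _ C(1)] exI[of _ h] conjI ballI)
    next
      case False
      then have "carrier (comp i (F M)) = {\<zero>\<^bsub>comp i (F M)\<^esub>}" using F_comp_other[OF lM i'(1)] by simp
      then have "mod_epi A (comp i (F M)) Z (\<lambda>_. \<zero>\<^bsub>Z\<^esub>)"
        using mod_iso_epi[OF zero_modules_iso[OF lc[OF i'(1)] lZ _ Z(2)]] by blast
      then show "\<exists>C\<in>\<X>. \<exists>q. mod_epi A (comp i (F M)) C q \<and> (\<forall>x\<in>carrier (comp i (F M)). q x = \<zero>\<^bsub>C\<^esub> \<longleftrightarrow> x = \<zero>\<^bsub>M\<^esub>)"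
        using z[OF _ i'(1) False] by (intro bexI[OF _ Z(1)] exI[of _ "\<lambda>_. \<zero>\<^bsub>Z\<^esub>"] conjI ballI) blast+
    qed
  qed
  then show ?thesis using in_S_iff[OF full fF] by blast
qed

text \<open>The right adjoint, taking first components, preserves epimorphisms, so its left adjoint
  \<open>F\<close> preserves projectives.\<close>

lemma F_projective:
  assumes P: "projective A P" and N: "N \<in> fg_mods T" and r: "mod_iso T (F P) N r"
  shows "projective T N"
proof -
  have fP: "P \<in> fg_mods A" using P by (simp add: projective_def)
  have lP: "left_module A P" using fP by auto
  show ?thesis
  proof (rule T.projective_iso[OF F_left_module[OF lP] N r])
    fix M L g h assume MMs: "M \<in> fg_mods T" "L \<in> fg_mods T" "mod_epi T M L g" and h: "h \<in> mod_hom T (F P) L"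
    have lm: "left_module T M" "left_module T L" using MMs by auto
    have h': "h \<in> mod_hom A P (comp 1 L)" using h F_hom_iff[OF lP lm(2)] by blast
    have n1: "1 \<le> n" using n2 by simp
    have "\<exists>k\<in>mod_hom A P (comp 1 M). \<forall>x\<in>carrier P. g (k x) = h x"
      using proj_lift[OF P comp_epi[OF MMs(3) lm order_refl n1] comp1_fg comp1_fg h'] MMs(1,2) by blast
    then show "\<exists>h'\<in>mod_hom T (F P) M. \<forall>x\<in>carrier (F P). g (h' x) = h x"
      using F_hom_iff[OF lP lm(1)] by (metis F_simps(1))
  qed
qed

lemma F_short_exact: "short_exact A K L M f g \<Longrightarrow> short_exact T (F K) (F L) (F M) f g"
  unfolding short_exact_def mod_mono_def mod_epi_def a_kernel_eq by (simp add: F_hom)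

section \<open>From the monic representations back to the subcategory\<close>

context
  fixes \<X> :: "'a fgmod set"
  assumes full: "full_subcategory A \<X>"
    and res: "resolving T (mono_rep_cat n A \<X>)"
begin

text \<open>\<open>F P\<close> is projective, so a representative of it lies in the resolving S_n;
  the first component then gives back \<open>P\<close>.\<close>

lemma projective_in_X:
  assumes P: "projective A P" shows "in_cat T (mono_rep_cat n A \<X>) (F P)" "P \<in> \<X>"
proof -
  have fP: "P \<in> fg_mods A" using P by (simp add: projective_def)
  have fF: "fg_left_module T (F P)" using F_fg fP by auto
  obtain N r where N: "N \<in> fg_mods T" "mod_iso T (F P) N r" using fg_rep[OF fF] by blast
  have "N \<in> mono_rep_cat n A \<X>" using F_projective[OF P N] res by (simp add: resolving_def)
  then show S: "in_cat T (mono_rep_cat n A \<X>) (F P)"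
    using in_cat_iso'[OF in_cat_self[OF S_full] N(2)] fF by blast
  show "P \<in> \<X>" using F_in_S_D[OF full _ S] in_cat_mem[OF full fP] fP by blast
qed

text \<open>A projective \<open>P\<close> exists and \<open>F P\<close> is a monic representation,
  so its second component, which is zero, is isomorphic to an object of \<open>\<X>\<close>. The
  second component exists because \<open>n\<close> is at least 2.\<close>

lemma zero_in_X: "\<exists>Z\<in>\<X>. carrier Z = {\<zero>\<^bsub>Z\<^esub>}"
proof -
  obtain P p where P: "projective A P" "mod_epi A P (reg_module A) p" using enough_projectives[OF fg_reg] by metis
  have fP: "P \<in> fg_mods A" using P(1) by (simp add: projective_def)
  have lP: "left_module A P" using fP by auto
  have t: "2 \<in> {1..n}" "(2::nat) \<noteq> 1" using n2 by auto
  have fF: "fg_left_module T (F P)" using F_fg fP by auto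
  have "in_cat A \<X> (comp 2 (F P))"
    using projective_in_X(1)[OF P(1)] in_S_iff[OF full fF] t(1) unfolding mono_rep_def by blast
  then obtain Z z where Z: "Z \<in> \<X>" "left_module A Z" "mod_iso A (comp 2 (F P)) Z z" using in_cat_rep[OF full] by blast
  have lF: "left_module T (F P)" using fF by auto
  have l2: "left_module A (comp 2 (F P))" using comp_left_module[OF lF, of 2] n2 by simp
  have "carrier Z = {\<zero>\<^bsub>Z\<^esub>}"
    using mod_isoD(3)[OF Z(3)] F_comp_other[OF lP t] hom_zero[OF mod_isoD(1)[OF Z(3)] l2 Z(2)] by simp
  then show ?thesis using Z(1) by blast
qed

lemma F_in_S_iff: "fg_left_module A M \<Longrightarrow> in_cat T (mono_rep_cat n A \<X>) (F M) \<longleftrightarrow> in_cat A \<X> M"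
  using F_in_S_D[OF full] F_in_S_I[OF full] zero_in_X by blast

lemma X_resolving: "resolving A \<X>"
  unfolding resolving_def
proof (intro conjI allI ballI impI full)
  note mem = in_cat_mem[OF full] and self = in_cat_self[OF full]
  have fX: "fg_left_module A M" if "M \<in> \<X>" for M using that full by (auto simp: full_subcategory_def)
  show "P \<in> \<X>" if "projective A P" for P using projective_in_X(2)[OF that] .
  show "L \<in> \<X>" if "K \<in> \<X>" and L: "L \<in> fg_mods A" and "M \<in> \<X>" "short_exact A K L M f g" for K L M f g
    using resolving_ext[OF res F_short_exact[OF that(4)]] F_fg[OF fg_modsD[OF L]] self[OF that(1)] self[OF that(3)]
      F_in_S_iff fX[OF that(1)] fX[OF that(3)] F_in_S_iff[OF fg_modsD[OF L]] mem[OF L] by blast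
  show "K \<in> \<X>" if K: "K \<in> fg_mods A" and "L \<in> \<X>" and "M \<in> \<X>" "short_exact A K L M f g" for K L M f g
    using resolving_ker[OF res F_short_exact[OF that(4)]] F_fg[OF fg_modsD[OF K]] self[OF that(2)] self[OF that(3)]
      F_in_S_iff fX[OF that(2)] fX[OF that(3)] F_in_S_iff[OF fg_modsD[OF K]] mem[OF K] by blast
  show "K \<in> \<X>" if K: "K \<in> fg_mods A" and N: "N \<in> fg_mods A" and L: "L \<in> \<X>" and i: "isomorphic_mods A L (mod_sum K N)" for K N L
  proof -
    have lm: "left_module A K" "left_module A N" "left_module A L" using K N fX[OF L] by auto
    interpret N: left_module A N by (rule lm(2))
    obtain h where h: "mod_iso A L (mod_sum K N) h" using i by (auto simp: isomorphic_mods_def)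
    obtain h' where h': "mod_iso A (mod_sum K N) L h'" "\<And>y. y \<in> carrier (mod_sum K N) \<Longrightarrow> h (h' y) = y"
      using mod_iso_inv[OF h lm(3)] by metis
    have inl: "(\<lambda>x. (x, \<zero>\<^bsub>N\<^esub>)) \<in> mod_hom A K (mod_sum K N)" by (auto intro!: mod_homI)
    have "in_cat T (mono_rep_cat n A \<X>) (F K)"
    proof (rule T.resolving_retract[OF res _ F_left_module[OF lm(1)]])
      show "in_cat T (mono_rep_cat n A \<X>) (F L)" using F_in_S_iff[OF fX[OF L]] self[OF L] by blast
      show "(\<lambda>x. h' (x, \<zero>\<^bsub>N\<^esub>)) \<in> mod_hom T (F K) (F L)" using F_hom[OF hom_comp[OF inl mod_isoD(1)[OF h'(1)]]] .
      show "(\<lambda>x. fst (h x)) \<in> mod_hom T (F L) (F K)" using F_hom[OF hom_comp[OF mod_isoD(1)[OF h] fst_hom]] .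
      show "fst (h (h' (x, \<zero>\<^bsub>N\<^esub>))) = x" if "x \<in> carrier (F K)" for x using h'(2)[of "(x, \<zero>\<^bsub>N\<^esub>)"] that by simp
    qed
    then show ?thesis using F_in_S_iff[OF fg_modsD[OF K]] mem[OF K] by blast
  qed
qed

text \<open>If \<open>Y \<rightarrow> F M\<close> is a right minimal approximation and \<open>C\<close> is the first cokernel of \<open>Y\<close>, then \<open>Y \<rightarrow> F C\<close> is
  an isomorphism, since \<open>F\<close> is right adjoint to the first cokernel functor.\<close>

lemma X_contravariantly_finite:
  assumes cf: "contravariantly_finite T (mono_rep_cat n A \<X>)"
  shows "contravariantly_finite A \<X>"
  unfolding contravariantly_finite_def
proof
  let ?S = "mono_rep_cat n A \<X>"
  fix M assume M: "M \<in> fg_mods A"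
  have lM: "left_module A M" using M by auto
  have lFM: "left_module T (F M)" using F_left_module[OF lM] .
  obtain N r where N: "N \<in> fg_mods T" "mod_iso T (F M) N r" using fg_rep[OF F_fg] M by blast
  obtain r' where r': "mod_iso T N (F M) r'" "\<And>x. x \<in> carrier (F M) \<Longrightarrow> r' (r x) = x" "\<And>x. x \<in> carrier N \<Longrightarrow> r (r' x) = x"
    using mod_iso_inv[OF N(2) lFM] by metis
  obtain Y y where Yy: "right_minimal_approximation T ?S Y N y" using cf N(1) unfolding contravariantly_finite_def by metis
  then have ap: "right_approximation T ?S Y N y" by (simp add: right_minimal_approximation_def)
  have YS: "Y \<in> ?S" and yh: "y \<in> mod_hom T Y N" using ap by (auto simp: right_approximation_def)
  have fY: "Y \<in> fg_mods T" using YS by (simp add: mono_rep_cat_def)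
  have lY: "left_module T Y" using fY by auto
  interpret Y: left_module T Y by (rule lY)
  \<comment> \<open>\<open>F M\<close> has the wrong carrier type for an object of
    \<open>T\<close>-mod. Its representative \<open>N\<close> is approximated instead; lifting and
    minimality are carried back to \<open>F M\<close> in the next steps.\<close>
  define f where "f x = r' (y x)" for x
  have f: "f \<in> mod_hom T Y (F M)" unfolding f_def using hom_comp[OF yh mod_isoD(1)[OF r'(1)]] .
  have lift: "\<exists>k\<in>mod_hom T Z Y. \<forall>x\<in>carrier Z. f (k x) = h x"
    if Z: "in_cat T ?S Z" and h: "h \<in> mod_hom T Z (F M)" for Z :: "(nat \<Rightarrow> nat \<Rightarrow> 'a, (nat \<Rightarrow> 'a) set) module" and h
  proof -
    obtain k where k: "k \<in> mod_hom T Z Y" "\<forall>x\<in>carrier Z. y (k x) = r (h x)"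
      using approx_lift[OF S_full ap Z hom_comp[OF h mod_isoD(1)[OF N(2)]]] by (rule bexE)
    have "f (k x) = h x" if "x \<in> carrier Z" for x using k(2) that r'(2)[OF hom_closed[OF h that]] by (simp add: f_def)
    then show ?thesis using k(1) by (intro bexI[of _ k]) auto
  qed
  have min: "mod_iso T Y Y g" if g: "g \<in> mod_hom T Y Y" and e: "\<And>x. x \<in> carrier Y \<Longrightarrow> f (g x) = f x" for g
  proof -
    have "y (g x) = y x" if x: "x \<in> carrier Y" for x
      using e[OF x] r'(3)[OF hom_closed[OF yh x]] r'(3)[OF hom_closed[OF yh hom_closed[OF g x]]] unfolding f_def by metis
    then show ?thesis using Yy g unfolding right_minimal_approximation_def by blast
  qed
  have inS: "in_cat T ?S Y" using in_cat_self[OF S_full YS] .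
  obtain C q where C: "C \<in> \<X>" "mod_epi A (comp 1 Y) C q"
    "\<forall>x\<in>carrier (comp 1 Y). q x = \<zero>\<^bsub>C\<^esub> \<longleftrightarrow> (\<exists>z\<in>carrier (comp (Suc 1) Y). x = u 1 (Suc 1) \<odot>\<^bsub>Y\<^esub> z)"
  proof -
    have "1 \<in> {1..<n}" using n2 by simp
    then have "\<exists>C\<in>\<X>. \<exists>q. mod_epi A (comp 1 Y) C q \<and>
      (\<forall>x\<in>carrier (comp 1 Y). q x = \<zero>\<^bsub>C\<^esub> \<longleftrightarrow> (\<exists>z\<in>carrier (comp (Suc 1) Y). x = u 1 (Suc 1) \<odot>\<^bsub>Y\<^esub> z))"
      using conjunct2[OF conjunct2[OF inS[unfolded in_S_iff[OF full fg_modsD[OF fY]] mono_rep_def]]] by (rule bspec[rotated])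
    then show thesis by (elim bexE exE conjE) (rule that)
  qed
  have fC: "fg_left_module A C" and lC: "left_module A C" using C(1) full by (auto simp: full_subcategory_def)
  note qh = mod_epiD(1)[OF C(2)]
  have v: "valid 1 1" "valid 1 2" "valid 2 2" using n2 by auto
  have q12: "q (u 1 2 \<odot>\<^bsub>Y\<^esub> z) = \<zero>\<^bsub>C\<^esub>" if z: "z \<in> carrier Y" for z
  proof -
    have "u 1 2 \<odot>\<^bsub>Y\<^esub> z = u 1 (Suc 1) \<odot>\<^bsub>Y\<^esub> (u 2 2 \<odot>\<^bsub>Y\<^esub> z)" using u_u[OF lY z v(2), of 2] by (simp add: numeral_2_eq_2)
    moreover have "u 2 2 \<odot>\<^bsub>Y\<^esub> z \<in> carrier (comp (Suc 1) Y)"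
      using E_in_comp[OF lY v(3) B.one_closed z] by (simp add: numeral_2_eq_2)
    ultimately show ?thesis using C(3) u1_comp[OF lY z, of 2] by blast
  qed
  have fM1: "f \<in> mod_hom A (comp 1 Y) M"
  proof (rule mod_homI)
    show "f x \<in> carrier M" if "x \<in> carrier (comp 1 Y)" for x using hom_closed[OF f, of x] that by simp
    show "f (x \<oplus>\<^bsub>comp 1 Y\<^esub> x') = f x \<oplus>\<^bsub>M\<^esub> f x'" if "x \<in> carrier (comp 1 Y)" "x' \<in> carrier (comp 1 Y)" for x x'
      using hom_add[OF f, of x x'] that by simp
    show "f (a \<odot>\<^bsub>comp 1 Y\<^esub> x) = a \<odot>\<^bsub>M\<^esub> f x" if a: "a \<in> carrier A" and x: "x \<in> carrier (comp 1 Y)" for a x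
    proof -
      have xY: "x \<in> carrier Y" using x by simp
      then have "f x \<in> carrier M" using hom_closed[OF f xY] by simp
      then show ?thesis using hom_smult[OF f E_carrier[OF a] xY, of 1 1] F_corner[OF lM _ a, of "f x"] unfolding comp_simps by simp
    qed
  qed
  \<comment> \<open>The second component of \<open>F M\<close> is zero, so \<open>f\<close> kills
    the image of the second component of \<open>Y\<close> in the first and descends to the cokernel
    \<open>C\<close>.\<close>
  have "\<exists>f'\<in>mod_hom A C M. \<forall>x\<in>carrier (comp 1 Y). f' (q x) = f x"
  proof (rule epi_factor[OF C(2) fM1 comp1_lm[OF lY] lC lM])
    fix x assume "x \<in> carrier (comp 1 Y)" "q x = \<zero>\<^bsub>C\<^esub>"
    then obtain z where z: "z \<in> carrier Y" "x = u 1 (Suc 1) \<odot>\<^bsub>Y\<^esub> z" using C(3) by auto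
    have "f x = u 1 2 \<odot>\<^bsub>F M\<^esub> f z" unfolding z(2) using u_hom_zero[OF f z(1), of 1 2] by (simp add: numeral_2_eq_2)
    then show "f x = \<zero>\<^bsub>M\<^esub>" using F_off[OF lM _ v(2)] hom_closed[OF f z(1)] by simp
  qed
  then obtain f' where f': "f' \<in> mod_hom A C M" "\<forall>x\<in>carrier (comp 1 Y). f' (q x) = f x" by (rule bexE)
  have ap': "right_approximation A \<X> C M f'"
    unfolding right_approximation_def
  proof (intro conjI ballI C(1) f'(1))
    fix Z h assume Z: "Z \<in> \<X>" and h: "h \<in> mod_hom A Z M"
    have fZ: "fg_left_module A Z" and lZ: "left_module A Z" using Z full by (auto simp: full_subcategory_def)
    have "in_cat T ?S (F Z)" using F_in_S_iff[OF fZ] in_cat_self[OF full Z] by blast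
    from lift[OF this F_hom[OF h]] obtain k where k: "k \<in> mod_hom T (F Z) Y" "\<forall>x\<in>carrier (F Z). f (k x) = h x" by (rule bexE)
    have k1: "k \<in> mod_hom A Z (comp 1 Y)" using k(1) F_hom_iff[OF lZ lY] by blast
    have "f' (q (k x)) = h x" if "x \<in> carrier Z" for x using f'(2) k(2) hom_closed[OF k1 that] that by simp
    then show "\<exists>h'\<in>mod_hom A Z C. \<forall>x\<in>carrier Z. f' (h' x) = h x" by (intro bexI[OF _ hom_comp[OF k1 qh]]) auto
  qed
  \<comment> \<open>The unit of the adjunction, from \<open>Y\<close> to \<open>F C\<close>.\<close>
  define p where "p x = q (u 1 1 \<odot>\<^bsub>Y\<^esub> x)" for x
  have lFC: "left_module T (F C)" using F_left_module[OF lC] .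
  interpret C: left_module A C by (rule lC)
  have pc: "p x \<in> carrier C" if "x \<in> carrier Y" for x unfolding p_def using hom_closed[OF qh u1_comp[OF lY that]] .
  have ph: "p \<in> mod_hom T Y (F C)"
  proof (rule T_homI[OF lY lFC])
    show "p x \<in> carrier (F C)" if "x \<in> carrier Y" for x using pc[OF that] by simp
    show "p (x \<oplus>\<^bsub>Y\<^esub> x') = p x \<oplus>\<^bsub>F C\<^esub> p x'" if "x \<in> carrier Y" "x' \<in> carrier Y" for x x'
      using hom_add[OF qh u1_comp[OF lY that(1)] u1_comp[OF lY that(2)], of 1 1] that by (simp add: p_def Y.smult_r_distr)
    fix i j a x assume vij: "valid i j" and a: "a \<in> carrier A" and x: "x \<in> carrier Y"
    show "p (E i j a \<odot>\<^bsub>Y\<^esub> x) = E i j a \<odot>\<^bsub>F C\<^esub> p x"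
    proof (cases "j = 1")
      case True
      then have i: "i = 1" using vij by simp
      have "u 1 1 \<odot>\<^bsub>Y\<^esub> (E 1 1 a \<odot>\<^bsub>Y\<^esub> x) = E 1 1 a \<odot>\<^bsub>Y\<^esub> (u 1 1 \<odot>\<^bsub>Y\<^esub> x)"
        using E_act[OF lY v(1) v(1) B.one_closed a x] E_act[OF lY v(1) v(1) a B.one_closed x] a by simp
      then show ?thesis
        using hom_smult[OF qh a u1_comp[OF lY x], of 1] F_corner[OF lC pc[OF x] a] True i unfolding comp_simps by (simp add: p_def)
    next
      case False
      have "q (u 1 1 \<odot>\<^bsub>Y\<^esub> (E i j a \<odot>\<^bsub>Y\<^esub> x)) = \<zero>\<^bsub>C\<^esub>"
      proof (cases "i = 1")
        case True
        have "u 1 1 \<odot>\<^bsub>Y\<^esub> (E i j a \<odot>\<^bsub>Y\<^esub> x) = u 1 2 \<odot>\<^bsub>Y\<^esub> (E 2 j a \<odot>\<^bsub>Y\<^esub> x)"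
          using E_act[OF lY v(1) vij B.one_closed a x] E_act[OF lY v(2) _ B.one_closed a x, of 2 j] True False vij a by simp
        then show ?thesis using q12[OF act_closed[OF lY a x]] by simp
      next
        case i: False
        then have "u 1 1 \<odot>\<^bsub>Y\<^esub> (E i j a \<odot>\<^bsub>Y\<^esub> x) = \<zero>\<^bsub>Y\<^esub>" using E_act[OF lY v(1) vij B.one_closed a x] by simp
        then show ?thesis using hom_zero[OF qh comp1_lm[OF lY] lC] by simp
      qed
      then show ?thesis using F_off[OF lC pc[OF x] vij False] by (simp add: p_def)
    qed
  qed
  have f'p: "f' (p x) = f x" if x: "x \<in> carrier Y" for x
  proof -
    have fx: "f x \<in> carrier M" using hom_closed[OF f x] by simp
    have "f' (p x) = f (u 1 1 \<odot>\<^bsub>Y\<^esub> x)" using f'(2) u1_comp[OF lY x] by (simp add: p_def)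
    also have "\<dots> = f x" using u_hom_zero[OF f x, of 1 1] F_one[OF lM fx] by simp
    finally show ?thesis .
  qed
  have p_onto: "\<exists>x\<in>carrier Y. p x = c" if c: "c \<in> carrier C" for c
  proof -
    obtain x where "x \<in> carrier (comp 1 Y)" "q x = c" using mod_epi_surj[OF C(2) c] by (rule bexE)
    then show ?thesis by (intro bexI[of _ x]) (auto simp: p_def)
  qed
  have FCS: "in_cat T ?S (F C)" using F_in_S_iff[OF fC] in_cat_self[OF full C(1)] by blast
  \<comment> \<open>\<open>F C\<close> is a monic representation over \<open>F M\<close>, so it
    lifts to \<open>Y\<close>. The composite of \<open>p\<close> and \<open>s\<close> is an
    endomorphism of \<open>Y\<close> over \<open>F M\<close>, hence bijective by minimality, which
    forces \<open>s\<close> to be injective on \<open>C\<close>.\<close>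
  obtain s where s: "s \<in> mod_hom T (F C) Y" "\<forall>x\<in>carrier (F C). f (s x) = f' x" using lift[OF FCS F_hom[OF f'(1)]] by (rule bexE)
  have sc: "s c \<in> carrier Y" if "c \<in> carrier C" for c using hom_closed[OF s(1)] that by simp
  have sp: "mod_iso T Y Y (\<lambda>x. s (p x))"
    using s(2) f'p pc by (intro min hom_comp[OF ph s(1)]) simp
  have s_inj: "c = d" if c: "c \<in> carrier C" and d: "d \<in> carrier C" and e: "s c = s d" for c d
  proof -
    obtain x z where "x \<in> carrier Y" "p x = c" "z \<in> carrier Y" "p z = d" using p_onto[OF c] p_onto[OF d] by blast
    then show ?thesis using mod_isoD(2)[OF sp] e unfolding inj_on_def by blast
  qed
  have "mod_iso A C C g" if g: "g \<in> mod_hom A C C" and e: "\<forall>x\<in>carrier C. f' (g x) = f' x" for g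
  proof -
    have gc: "g c \<in> carrier C" if "c \<in> carrier C" for c using hom_closed[OF g that] .
    \<comment> \<open>An endomorphism of \<open>C\<close> over \<open>M\<close> is inserted between
      \<open>p\<close> and \<open>s\<close>, so that minimality for \<open>Y\<close> can decide
      about it.\<close>
    have sgp: "mod_iso T Y Y (\<lambda>x. s (g (p x)))"
    proof (rule min)
      show "(\<lambda>x. s (g (p x))) \<in> mod_hom T Y Y" using hom_comp[OF hom_comp[OF ph F_hom[OF g]] s(1)] .
      show "f (s (g (p x))) = f x" if "x \<in> carrier Y" for x using s(2) e f'p[OF that] pc[OF that] gc by simp
    qed
    show ?thesis
    proof (rule mod_isoI[OF g])
      show "inj_on g (carrier C)"
      proof (rule inj_onI)
        fix c d assume c: "c \<in> carrier C" and d: "d \<in> carrier C" and e: "g c = g d"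
        obtain x z where xz: "x \<in> carrier Y" "p x = c" "z \<in> carrier Y" "p z = d" using p_onto[OF c] p_onto[OF d] by blast
        then have "x = z" using mod_isoD(2)[OF sgp] e unfolding inj_on_def by simp
        then show "c = d" using xz by simp
      qed
      show "carrier C \<subseteq> g ` carrier C"
      proof
        fix c assume c: "c \<in> carrier C"
        have "s c \<in> (\<lambda>x. s (g (p x))) ` carrier Y" using mod_isoD(3)[OF sgp] sc[OF c] by simp
        then obtain x where x: "x \<in> carrier Y" "s c = s (g (p x))" by blast
        then have "c = g (p x)" using s_inj[OF c gc[OF pc[OF x(1)]]] by simp
        then show "c \<in> g ` carrier C" using pc[OF x(1)] by blast
      qed
    qed
  qed
  then show "\<exists>C f. right_minimal_approximation A \<X> C M f"
    using ap' unfolding right_minimal_approximation_def by (intro exI[of _ C] exI[of _ f']) blast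
qed

text \<open>Taking first components is exact, sends S_n into \<open>\<X>\<close> and recovers
  \<open>M\<close> from \<open>F M\<close>; a resolution of \<open>F M\<close> therefore restricts
  to one of \<open>M\<close> of the same length.\<close>

lemma X_hat:
  assumes hat: "resolution_hat T (mono_rep_cat n A \<X>) = fg_mods T"
  shows "resolution_hat A \<X> = fg_mods A"
proof
  let ?S = "mono_rep_cat n A \<X>"
  have n1: "1 \<in> {1..n}" "1 \<le> n" using n2 by auto
  have comp_S: "in_cat A \<X> (comp 1 N)" if N: "N \<in> ?S" for N
    using in_cat_self[OF S_full N] in_S_iff[OF full, of N] N n1 unfolding mono_rep_def mono_rep_cat_def by blast
  have comp_dim: "N \<in> dimcat T ?S d \<Longrightarrow> in_cat A (dimcat A \<X> d) (comp 1 N)" for N d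
  proof (induction d arbitrary: N)
    case 0 then show ?case using comp_S by simp
  next
    case (Suc d)
    obtain Y K f g where *: "N \<in> fg_mods T" "Y \<in> ?S" "K \<in> dimcat T ?S d" "short_exact T K Y N f g" using Suc.prems by auto
    have "Y \<in> fg_mods T" "K \<in> fg_mods T" using *(2,3) dimcat_sub[OF S_full] by (auto simp: mono_rep_cat_def)
    then have lm: "left_module T K" "left_module T Y" "left_module T N" using *(1) by auto
    show ?case
      by (rule in_dimcat_SucI[OF full comp_short_exact[OF *(4) lm order_refl n1(2)] comp1_fg[OF fg_modsD[OF *(1)]] Suc.IH[OF *(3)] comp_S[OF *(2)]])
  qed
  show "resolution_hat A \<X> \<subseteq> fg_mods A" by (auto simp: resolution_hat_def)
  show "fg_mods A \<subseteq> resolution_hat A \<X>"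
  proof
    fix M assume M: "M \<in> fg_mods A"
    have lM: "left_module A M" and lF: "left_module T (F M)" using M F_left_module by auto
    obtain N r where N: "N \<in> fg_mods T" "mod_iso T (F M) N r" using fg_rep[OF F_fg] M by blast
    have lN: "left_module T N" using N(1) by auto
    obtain d where "N \<in> dimcat T ?S d" using hat N(1) T.resolution_hat_iff[OF S_full, of N] by auto
    then have "in_cat A (dimcat A \<X> d) (comp 1 N)" by (rule comp_dim)
    then have "in_cat A (dimcat A \<X> d) M"
      using in_cat_iso'[OF _ mod_iso_comp[OF F_comp1[OF lM] comp_iso[OF N(2) lF lN order_refl n1(2)]] lM] by blast
    then show "M \<in> resolution_hat A \<X>" using in_cat_mem[OF dimcat_full[OF full] M] resolution_hat_iff[OF full] by blast
  qed
qed

end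

end

theorem theorem3p9:
  fixes R :: "('r, 'c) ring_scheme" and A :: "('a, 'd) ring_scheme" and \<iota> :: "'r \<Rightarrow> 'a"
    and n :: nat and \<X> :: "'a fgmod set"
  assumes "artin_algebra R A \<iota>" and "n \<ge> 2" and "full_subcategory A \<X>"
  shows "(resolving (upper_tri n A) (mono_rep_cat n A \<X>) \<and>
          contravariantly_finite (upper_tri n A) (mono_rep_cat n A \<X>) \<and>
          resolution_hat (upper_tri n A) (mono_rep_cat n A \<X>) = fg_mods (upper_tri n A))
     \<longleftrightarrow> (resolving A \<X> \<and> contravariantly_finite A \<X> \<and> resolution_hat A \<X> = fg_mods A)"
proof -
  interpret tri R A \<iota> n
    using fin_algI[OF assms(1)] assms(2) by (simp add: tri_def tri_axioms_def)
  show ?thesis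
    using X_resolving[OF assms(3)] X_contravariantly_finite[OF assms(3)] X_hat[OF assms(3)]
      S_resolving S_contravariantly_finite S_hat by blast
qed

end
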